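(* Let $\gamma\in[83/87,1)$ and $A>0$. For a real-valued potential $V:\mathbb{T}\times[0,\infty)\to\mathbb{R}$ satisfying $$\|V(\cdot,t)\|_{L^\infty(\mathbb{T})}\le\lambda(1+t)^{-\gamma},\qquad t\ge0,$$ and for $k\in\mathbb{R}$, let $u(x,t,k)$ be the solution of $$iu_t=k\left(\frac{i\partial_x}{t+1}-P_{[t/2]}\frac{\partial_{xx}^2}{(t+1)^2}\right)u+Vu,\qquad u(x,0,k)=1,\qquad x\in\mathbb{T},$$ and let $G(x,t,k)$ be the solution of the transport equation $$iG_t=\frac{ik}{1+t}\,G_x+VG,\qquad G(x,0,k)=1.$$ Then $$\int_{-A}^A\sup_{t>0}\|u(\cdot,t,k)-G(\cdot,t,k)\|_{L^2(\mathbb{T})}\,dk\to0\quad\text{as }\lambda\to0;$$ that is, for every $\varepsilon>0$ there is $\lambda_0>0$ such that the integral is less than $\varepsilon$ for every such $V$ with $0<\lambda\le\lambda_0$.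
   Context: $\mathbb{T}$ is the one-dimensional torus with normalized measure (so $\|1\|_{L^2(\mathbb{T})}=1$). For an integer $N\ge0$, $P_N$ is the Fourier projection onto frequencies $|n|\le N$: $\widehat{P_Nf}(n)=\chi_{|n|\le N}\widehat f(n)$. $[a]$ denotes the integer part of a real number $a$. Solutions are understood in the sense of Duhamel's formula in $L^2(\mathbb{T})$ (mild solutions). *)

theory Defs
  imports "HOL-Probability.Essential_Supremum"
begin

text \<open>The torus is \<open>\<real>/2\<pi>\<int>\<close>. Its functions are represented by functions on the real
  line of which only the values on the fundamental domain, up to null sets, matter: all notions
  below depend on \<open>f\<close> only through its almost-everywhere class with respect to this
  probability measure.\<close>

definition torus :: "real measure" where
  "torus = uniform_measure lborel {0..<2 * pi}"

definition in_L2 :: "(real \<Rightarrow> complex) \<Rightarrow> bool" where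
  "in_L2 f \<longleftrightarrow> f \<in> borel_measurable torus \<and> integrable torus (\<lambda>x. (cmod (f x))\<^sup>2)"

definition L2_norm :: "(real \<Rightarrow> complex) \<Rightarrow> real" where
  "L2_norm f = sqrt (LINT x|torus. (cmod (f x))\<^sup>2)"

definition fourier_coeff :: "(real \<Rightarrow> complex) \<Rightarrow> int \<Rightarrow> complex" where
  "fourier_coeff f n = (LINT x|torus. f x * exp (- (\<i> * of_int n * of_real x)))"

text \<open>Fourier multipliers of \<open>\<partial>\<^sub>x\<close> and of the projection \<open>P\<^sub>N\<close>.\<close>

definition dx_mult :: "int \<Rightarrow> complex" where
  "dx_mult n = \<i> * of_int n"

definition proj_mult :: "int \<Rightarrow> int \<Rightarrow> complex" where
  "proj_mult N n = (if \<bar>n\<bar> \<le> N then 1 else 0)"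

text \<open>Multipliers of the free operators \<open>H(t)\<close> in \<open>i w\<^sub>t = H(t) w + V w\<close>: for \<open>u\<close>,
  \<open>H(t) = k (i \<partial>\<^sub>x / (t+1) - P\<^bsub>[t/2]\<^esub> \<partial>\<^sub>x\<^sub>x / (t+1)\<^sup>2)\<close>, and for \<open>G\<close>, \<open>H(t) = i k \<partial>\<^sub>x / (1+t)\<close>.\<close>

definition schroedinger_mult :: "real \<Rightarrow> real \<Rightarrow> int \<Rightarrow> complex" where
  "schroedinger_mult k t n =
     of_real k * (\<i> * dx_mult n / of_real (t + 1)
       - proj_mult \<lfloor>t / 2\<rfloor> n * (dx_mult n)\<^sup>2 / of_real ((t + 1)\<^sup>2))"

definition transport_mult :: "real \<Rightarrow> real \<Rightarrow> int \<Rightarrow> complex" where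
  "transport_mult k t n = \<i> * of_real k / of_real (1 + t) * dx_mult n"

text \<open>The propagator \<open>U(t,s)\<close> of \<open>i w\<^sub>t = H(t) w\<close> is again a Fourier multiplier.\<close>

definition propagator_mult :: "(real \<Rightarrow> int \<Rightarrow> complex) \<Rightarrow> real \<Rightarrow> real \<Rightarrow> int \<Rightarrow> complex" where
  "propagator_mult h t s n = exp (- \<i> * (LBINT r:{s..t}. h r n))"

text \<open>Mild solutions \<open>w \<in> C([0,\<infinity>); L\<^sup>2)\<close> of \<open>i w\<^sub>t = H(t) w + V w\<close>, \<open>w(0) = f\<close>, where
  \<open>H(t)\<close> has multiplier \<open>h t\<close>: Duhamel's formula
  \<open>w(t) = U(t,0) f - i \<integral>\<^sub>0\<^sup>t U(t,s) V(s) w(s) ds\<close>, as an identity in \<open>L\<^sup>2\<close>, that is, between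
  the Fourier coefficients of both sides. Both \<open>V\<close> and \<open>w\<close> take the time argument first.\<close>

definition mild_solution ::
  "(real \<Rightarrow> int \<Rightarrow> complex) \<Rightarrow> (real \<Rightarrow> real \<Rightarrow> real) \<Rightarrow> (real \<Rightarrow> complex) \<Rightarrow> (real \<Rightarrow> real \<Rightarrow> complex) \<Rightarrow> bool"
where
  "mild_solution h V f w \<longleftrightarrow>
     (\<forall>t\<ge>0. in_L2 (w t)) \<and>
     (\<forall>t\<ge>0. ((\<lambda>s. L2_norm (\<lambda>x. w s x - w t x)) \<longlongrightarrow> 0) (at t within {0..})) \<and>
     (\<forall>t\<ge>0. \<forall>n.
        set_integrable lborel {0..t}
          (\<lambda>s. propagator_mult h t s n * fourier_coeff (\<lambda>x. of_real (V s x) * w s x) n) \<and>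
        fourier_coeff (w t) n =
          propagator_mult h t 0 n * fourier_coeff f n
          - \<i> * (LBINT s:{0..t}. propagator_mult h t s n
                   * fourier_coeff (\<lambda>x. of_real (V s x) * w s x) n))"

definition admissible_potential :: "real \<Rightarrow> real \<Rightarrow> (real \<Rightarrow> real \<Rightarrow> real) \<Rightarrow> bool" where
  "admissible_potential \<gamma> c V \<longleftrightarrow>
     (\<lambda>(t, x). V t x) \<in> borel_measurable (restrict_space borel {0..} \<Otimes>\<^sub>M torus) \<and>
     (\<forall>t\<ge>0. esssup torus (\<lambda>x. ereal \<bar>V t x\<bar>) \<le> ereal (c * (1 + t) powr (- \<gamma>)))"

end

theory Submission
  imports Defs "HOL-Probability.Probability"
begin

text \<open>Truncating \<open>V\<close> to the bound it satisfies almost everywhere changes neither solution, and both flows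
  are unitary, so \<open>\<parallel>u - G\<parallel>\<^sup>2 = 2 - 2 Re \<langle>u, G\<rangle>\<close>: it suffices to control the increments of the overlap
  \<open>\<langle>u, G\<rangle>\<close> along the times \<open>j\<^sup>1\<^sup>0\<close>. On one step, undo the free phases and expand both evolutions to
  first order in \<open>V\<close>. Since \<open>V\<close> is symmetric, the first-order terms cancel up to four errors: the part of
  \<open>G\<close> at frequencies above \<open>N = j\<^sup>3\<close>, the difference of the two free phases at frequencies up to
  \<open>M = j\<^sup>5\<close>, the transfer of mass from frequencies below \<open>N\<close> to frequencies above \<open>M\<close>, and a
  quadratic remainder.

  The phases are affine in \<open>k\<close>, and their differences between frequencies \<open>n\<close> and \<open>m\<close> have a
  derivative comparable to \<open>(n - m) / (1 + t)\<close> when \<open>\<bar>m\<bar>\<close> is small compared with \<open>\<bar>n\<bar>\<close>. Hence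
  averaging over \<open>k\<close> bounds a squared oscillatory integral of \<open>f\<close> by
  \<open>\<integral> \<bar>f\<bar>\<^sup>2 (1 + t) dt / \<bar>n - m\<bar>\<close> (Schur's test with Gaussian weight). This controls the transfer term,
  and also the high frequencies of \<open>G\<close>: in the frame moving with the transport, \<open>G = exp (- \<i> S)\<close>
  with an oscillatory integral \<open>S\<close>, so its seminorm in the Sobolev space of order one half is at most
  that of \<open>S\<close>. The averaged errors of the steps are summable. The tail of the sum is small, and up to any
  fixed time both solutions are within \<open>O(\<lambda>)\<close> of the constant \<open>1\<close>.\<close>

section \<open>Square-integrable functions\<close>

text \<open>Duhamel's formula for \<open>u - G\<close> does not suffice: the free phases differ by
  about \<open>n^2\<close> times an integral of \<open>(1 + t)^-2\<close>, and nothing is known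
  about the high frequencies of \<open>u\<close>. In the overlap the symmetry of V lets all
  frequency cuts fall on \<open>G\<close>. The exponents come from balancing. The step from
  \<open>j^10\<close> to \<open>(j+1)^10\<close> has length about \<open>j^9\<close> and V has size
  about \<open>j^(-10 \<gamma>)\<close>, so one use of V costs
  \<open>e = j^(10(1-\<gamma>)-1)\<close> and quadratic errors cost \<open>e^2\<close>. The phases
  differ at frequency L by \<open>L^2 / j^11\<close>: hence \<open>L = j^3\<close> where this enters
  alone and \<open>L = j^5\<close> where it is multiplied by \<open>e\<close>. The mean squares of
  the high part of \<open>G\<close> and of the transfer term are \<open>j^(20(1-\<gamma>))\<close>
  times \<open>1 / N\<close> and \<open>N / (j M)\<close>, both equal to
  \<open>j^(20(1-\<gamma>)-3)\<close>; their square roots are summable for \<gamma> > 19/20, and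
  83/87 lies above this threshold. No measurability in k is assumed of the solutions, so the
  quantities that are averaged are explicit majorants in V and k alone.\<close>

definition sq_integrable :: "'a measure \<Rightarrow> ('a \<Rightarrow> complex) \<Rightarrow> bool" where
  "sq_integrable M f \<longleftrightarrow> f \<in> borel_measurable M \<and> integrable M (\<lambda>x. (cmod (f x))\<^sup>2)"

definition nrm :: "'a measure \<Rightarrow> ('a \<Rightarrow> complex) \<Rightarrow> real" where
  "nrm M f = sqrt (LINT x|M. (cmod (f x))\<^sup>2)"

definition ip :: "'a measure \<Rightarrow> ('a \<Rightarrow> complex) \<Rightarrow> ('a \<Rightarrow> complex) \<Rightarrow> complex" where
  "ip M f g = (LINT x|M. f x * cnj (g x))"

lemma borel_measurable_cnj [measurable]:
  "f \<in> borel_measurable M \<Longrightarrow> (\<lambda>x. cnj (f x)) \<in> borel_measurable M"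
  by (rule measurable_compose[OF _ borel_measurable_continuous_onI[OF continuous_on_cnj[OF continuous_on_id]]])

lemma sq_integrable_measurable [measurable_dest]:
  "sq_integrable M f \<Longrightarrow> f \<in> borel_measurable M"
  by (simp add: sq_integrable_def)

lemma sq_integrableD: "sq_integrable M f \<Longrightarrow> integrable M (\<lambda>x. (cmod (f x))\<^sup>2)"
  by (simp add: sq_integrable_def)

lemma nrm_nonneg [simp]: "0 \<le> nrm M f"
  by (simp add: nrm_def)

lemma nrm_sq: "(nrm M f)\<^sup>2 = (LINT x|M. (cmod (f x))\<^sup>2)"
  by (simp add: nrm_def)

lemma ennreal_nrm_sq:
  "sq_integrable M f \<Longrightarrow> ennreal ((nrm M f)\<^sup>2) = (\<integral>\<^sup>+x. ennreal ((cmod (f x))\<^sup>2) \<partial>M)"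
  unfolding nrm_sq by (rule nn_integral_eq_integral[symmetric]) (auto simp: sq_integrable_def)

lemma sq_integrableI_nn:
  assumes "f \<in> borel_measurable M" and "(\<integral>\<^sup>+x. ennreal ((cmod (f x))\<^sup>2) \<partial>M) \<le> ennreal B"
  shows "sq_integrable M f"
  using assms unfolding sq_integrable_def
  by (auto intro!: integrableI_nonneg order.strict_trans1[OF assms(2)])

lemma nrm_le_nn:
  assumes "f \<in> borel_measurable M" and "(\<integral>\<^sup>+x. ennreal ((cmod (f x))\<^sup>2) \<partial>M) \<le> ennreal (B\<^sup>2)" "0 \<le> B"
  shows "nrm M f \<le> B"
proof -
  have "ennreal ((nrm M f)\<^sup>2) \<le> ennreal (B\<^sup>2)"
    using ennreal_nrm_sq[OF sq_integrableI_nn[OF assms(1,2)]] assms(2) by simp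
  then show ?thesis using assms(3) by (simp add: power2_le_iff_abs_le)
qed

lemma nrm_cong: "(\<And>x. x \<in> space M \<Longrightarrow> cmod (f x) = cmod (g x)) \<Longrightarrow> nrm M f = nrm M g"
  unfolding nrm_def by (simp cong: Bochner_Integration.integral_cong)

lemma nrm_mono:
  assumes "sq_integrable M g" and "\<And>x. x \<in> space M \<Longrightarrow> cmod (f x) \<le> cmod (g x)"
  shows "nrm M f \<le> nrm M g"
proof (cases "integrable M (\<lambda>x. (cmod (f x))\<^sup>2)")
  case True
  then show ?thesis unfolding nrm_def
    using assms by (auto intro!: integral_mono power_mono simp: sq_integrable_def)
next
  case False
  then show ?thesis by (simp add: nrm_def not_integrable_integral_eq)
qed

lemma sq_integrable_bound:
  assumes "sq_integrable M g" "f \<in> borel_measurable M" "AE x in M. cmod (f x) \<le> C * cmod (g x)"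
  shows "sq_integrable M f"
  unfolding sq_integrable_def
proof (intro conjI)
  show "integrable M (\<lambda>x. (cmod (f x))\<^sup>2)"
  proof (rule Bochner_Integration.integrable_bound[where f="\<lambda>x. C\<^sup>2 * (cmod (g x))\<^sup>2"])
    show "integrable M (\<lambda>x. C\<^sup>2 * (cmod (g x))\<^sup>2)"
      using assms(1) by (intro integrable_mult_right) (auto simp: sq_integrable_def)
    show "AE x in M. norm ((cmod (f x))\<^sup>2) \<le> norm (C\<^sup>2 * (cmod (g x))\<^sup>2)"
      using assms(3)
    proof eventually_elim
      case (elim x)
      then have "(cmod (f x))\<^sup>2 \<le> (C * cmod (g x))\<^sup>2" by (intro power_mono) auto
      then show ?case by (simp add: power_mult_distrib)
    qed
  qed (use assms(2) in measurable)
qed fact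

lemma nrm_bound:
  assumes "sq_integrable M g" "f \<in> borel_measurable M" "AE x in M. cmod (f x) \<le> C * cmod (g x)" "0 \<le> C"
  shows "nrm M f \<le> C * nrm M g"
proof -
  have "(nrm M f)\<^sup>2 \<le> (LINT x|M. C\<^sup>2 * (cmod (g x))\<^sup>2)"
    unfolding nrm_sq
  proof (rule integral_mono_AE)
    show "integrable M (\<lambda>x. (cmod (f x))\<^sup>2)"
      using sq_integrable_bound[OF assms(1-3)] by (rule sq_integrableD)
    show "integrable M (\<lambda>x. C\<^sup>2 * (cmod (g x))\<^sup>2)"
      using assms(1) by (intro integrable_mult_right) (auto simp: sq_integrable_def)
    show "AE x in M. (cmod (f x))\<^sup>2 \<le> C\<^sup>2 * (cmod (g x))\<^sup>2"
      using assms(3)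
    proof eventually_elim
      case (elim x)
      then have "(cmod (f x))\<^sup>2 \<le> (C * cmod (g x))\<^sup>2" by (intro power_mono) auto
      then show ?case by (simp add: power_mult_distrib)
    qed
  qed
  also have "\<dots> = (C * nrm M g)\<^sup>2" by (simp add: power_mult_distrib nrm_sq)
  finally show ?thesis using assms(4) by (simp add: power2_le_iff_abs_le abs_mult)
qed

lemma integrable_ip:
  assumes "sq_integrable M f" "sq_integrable M g"
  shows "integrable M (\<lambda>x. f x * cnj (g x))"
proof (rule Bochner_Integration.integrable_bound[where f="\<lambda>x. (cmod (f x))\<^sup>2 + (cmod (g x))\<^sup>2"])
  show "integrable M (\<lambda>x. (cmod (f x))\<^sup>2 + (cmod (g x))\<^sup>2)"
    using assms by (auto simp: sq_integrable_def)
  show "AE x in M. norm (f x * cnj (g x)) \<le> norm ((cmod (f x))\<^sup>2 + (cmod (g x))\<^sup>2)"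
  proof (rule AE_I2)
    fix x
    have "2 * cmod (f x) * cmod (g x) \<le> (cmod (f x))\<^sup>2 + (cmod (g x))\<^sup>2"
      by (rule sum_squares_bound)
    then show "norm (f x * cnj (g x)) \<le> norm ((cmod (f x))\<^sup>2 + (cmod (g x))\<^sup>2)"
      using mult_nonneg_nonneg[OF norm_ge_zero[of "f x"] norm_ge_zero[of "g x"]]
      unfolding norm_mult complex_mod_cnj real_norm_def by linarith
  qed
qed (use assms in measurable)

lemma integrable_cmod_prod:
  assumes "sq_integrable M f" "sq_integrable M g"
  shows "integrable M (\<lambda>x. cmod (f x) * cmod (g x))"
  using integrable_norm[OF integrable_ip[OF assms]] by (simp add: norm_mult)

lemma sq_integrable_add:
  assumes "sq_integrable M f" "sq_integrable M g"
  shows "sq_integrable M (\<lambda>x. f x + g x)"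
  unfolding sq_integrable_def
proof (intro conjI)
  show "integrable M (\<lambda>x. (cmod (f x + g x))\<^sup>2)"
  proof (rule Bochner_Integration.integrable_bound[where f="\<lambda>x. 2 * (cmod (f x))\<^sup>2 + 2 * (cmod (g x))\<^sup>2"])
    show "integrable M (\<lambda>x. 2 * (cmod (f x))\<^sup>2 + 2 * (cmod (g x))\<^sup>2)"
      using assms by (auto simp: sq_integrable_def)
    show "AE x in M. norm ((cmod (f x + g x))\<^sup>2) \<le> norm (2 * (cmod (f x))\<^sup>2 + 2 * (cmod (g x))\<^sup>2)"
    proof (rule AE_I2)
      fix x
      have "(cmod (f x + g x))\<^sup>2 \<le> (cmod (f x) + cmod (g x))\<^sup>2"
        by (intro power_mono norm_triangle_ineq) auto
      also have "\<dots> \<le> 2 * (cmod (f x))\<^sup>2 + 2 * (cmod (g x))\<^sup>2"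
        using sum_squares_bound[of "cmod (f x)" "cmod (g x)"] by (simp add: power2_sum)
      finally show "norm ((cmod (f x + g x))\<^sup>2) \<le> norm (2 * (cmod (f x))\<^sup>2 + 2 * (cmod (g x))\<^sup>2)"
        by simp
    qed
  qed (use assms in measurable)
qed (use assms in measurable)

lemma sq_integrable_cmult:
  "sq_integrable M f \<Longrightarrow> sq_integrable M (\<lambda>x. c * f x)"
  by (auto simp: sq_integrable_def norm_mult power_mult_distrib)

lemma sq_integrable_uminus:
  "sq_integrable M f \<Longrightarrow> sq_integrable M (\<lambda>x. - f x)"
  by (auto simp: sq_integrable_def)

lemma sq_integrable_diff:
  "sq_integrable M f \<Longrightarrow> sq_integrable M g \<Longrightarrow> sq_integrable M (\<lambda>x. f x - g x)"
  using sq_integrable_add[OF _ sq_integrable_uminus, of M f g] by simp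

lemma sq_integrable_zero [simp]: "sq_integrable M (\<lambda>x. 0)"
  by (simp add: sq_integrable_def)

lemma sq_integrable_sum:
  "(\<And>i. i \<in> S \<Longrightarrow> sq_integrable M (f i)) \<Longrightarrow> sq_integrable M (\<lambda>x. \<Sum>i\<in>S. f i x)"
  by (induction S rule: infinite_finite_induct) (auto intro!: sq_integrable_add)

lemma ip_add_left:
  assumes "sq_integrable M f" "sq_integrable M g" "sq_integrable M h"
  shows "ip M (\<lambda>x. f x + g x) h = ip M f h + ip M g h"
  unfolding ip_def distrib_right by (intro Bochner_Integration.integral_add integrable_ip assms)

lemma ip_add_right:
  assumes "sq_integrable M f" "sq_integrable M g" "sq_integrable M h"
  shows "ip M h (\<lambda>x. f x + g x) = ip M h f + ip M h g"
  unfolding ip_def distrib_left complex_cnj_add by (intro Bochner_Integration.integral_add integrable_ip assms)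

lemma ip_diff_left:
  assumes "sq_integrable M f" "sq_integrable M g" "sq_integrable M h"
  shows "ip M (\<lambda>x. f x - g x) h = ip M f h - ip M g h"
  unfolding ip_def left_diff_distrib by (intro Bochner_Integration.integral_diff integrable_ip assms)

lemma ip_diff_right:
  assumes "sq_integrable M f" "sq_integrable M g" "sq_integrable M h"
  shows "ip M h (\<lambda>x. f x - g x) = ip M h f - ip M h g"
  unfolding ip_def right_diff_distrib complex_cnj_diff by (intro Bochner_Integration.integral_diff integrable_ip assms)

lemma ip_cmult_left: "ip M (\<lambda>x. c * f x) g = c * ip M f g"
  unfolding ip_def by (simp add: mult.assoc)

lemma ip_cmult_right: "ip M f (\<lambda>x. c * g x) = cnj c * ip M f g"
  unfolding ip_def by (simp add: mult.left_commute)

lemma ip_commute: "ip M g f = cnj (ip M f g)"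
  unfolding ip_def by (subst Bochner_Integration.integral_cnj[symmetric]) (simp add: mult.commute)

lemma ip_self: "ip M f f = of_real ((nrm M f)\<^sup>2)"
  unfolding ip_def nrm_sq by (simp add: complex_norm_square[symmetric] del: of_real_power)

text \<open>Integrate \<open>2 s t |f| |g| \<le> t\<^sup>2 |f|\<^sup>2 + s\<^sup>2 |g|\<^sup>2\<close> with \<open>s = \<parallel>f\<parallel>\<close> and \<open>t = \<parallel>g\<parallel>\<close>;
  if \<open>s = 0\<close> the other factor is scaled instead.\<close>

lemma cauchy_schwarz_abs:
  assumes f: "sq_integrable M f" and g: "sq_integrable M g"
  shows "(LINT x|M. cmod (f x) * cmod (g x)) \<le> nrm M f * nrm M g"
proof -
  let ?I = "LINT x|M. cmod (f x) * cmod (g x)"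
  have I: "2 * t * ?I \<le> t\<^sup>2 * (nrm M f)\<^sup>2 + (nrm M g)\<^sup>2" if "t \<ge> 0" for t
  proof -
    have "2 * t * ?I = (LINT x|M. 2 * t * (cmod (f x) * cmod (g x)))" by simp
    also have "\<dots> \<le> (LINT x|M. t\<^sup>2 * (cmod (f x))\<^sup>2 + (cmod (g x))\<^sup>2)"
    proof (rule integral_mono)
      show "integrable M (\<lambda>x. 2 * t * (cmod (f x) * cmod (g x)))"
        using integrable_cmod_prod[OF f g] by (rule integrable_mult_right)
      show "integrable M (\<lambda>x. t\<^sup>2 * (cmod (f x))\<^sup>2 + (cmod (g x))\<^sup>2)"
        using f g by (intro Bochner_Integration.integrable_add integrable_mult_right) (auto simp: sq_integrable_def)
      show "2 * t * (cmod (f x) * cmod (g x)) \<le> t\<^sup>2 * (cmod (f x))\<^sup>2 + (cmod (g x))\<^sup>2" for x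
        using sum_squares_bound[of "t * cmod (f x)" "cmod (g x)"] by (simp add: power_mult_distrib algebra_simps)
    qed
    also have "\<dots> = t\<^sup>2 * (nrm M f)\<^sup>2 + (nrm M g)\<^sup>2"
      unfolding nrm_sq
      using f g by (subst Bochner_Integration.integral_add) (auto simp: sq_integrable_def)
    finally show ?thesis .
  qed
  show ?thesis
  proof (cases "nrm M f = 0")
    case True
    have "?I \<le> 0"
    proof (rule ccontr)
      assume "\<not> ?I \<le> 0"
      then have p: "?I > 0" by simp
      \<comment> \<open>With this scale \<open>I\<close> would give
        \<open>(nrm M g)^2 + 1 <= (nrm M g)^2\<close>.\<close>
      define t where "t = ((nrm M g)\<^sup>2 + 1) / (2 * ?I)"
      have "2 * t * ?I = (nrm M g)\<^sup>2 + 1" using p by (simp add: t_def)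
      moreover have "t \<ge> 0" using p by (simp add: t_def)
      ultimately show False using I[of t] True by simp
    qed
    then show ?thesis using True by simp
  next
    case False
    then have p: "nrm M f > 0" using nrm_nonneg[of M f] by linarith
    define t where "t = nrm M g / nrm M f"
    have "2 * t * ?I \<le> 2 * (nrm M g)\<^sup>2" using I[of t] p by (simp add: t_def power_divide)
    then have *: "nrm M g * ?I \<le> nrm M g * (nrm M f * nrm M g)"
      using p by (simp add: t_def field_simps power2_eq_square)
    show ?thesis
    proof (cases "nrm M g = 0")
      case True
      have "?I \<le> 0"
      proof (rule ccontr)
        assume "\<not> ?I \<le> 0"
        then have q: "?I > 0" by simp
        \<comment> \<open>The minimiser of \<open>t^2 (nrm M f)^2 - 2 t ?I\<close>, which
          \<open>I\<close> bounds below by zero since \<open>nrm M g = 0\<close>.\<close>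
        define t where "t = ?I / (nrm M f)\<^sup>2"
        have "2 * ?I * ?I \<le> ?I * ?I" using I[of t] p q True by (simp add: t_def field_simps power2_eq_square)
        then show False using q by (simp add: mult_le_0_iff)
      qed
      then show ?thesis using True by simp
    next
      case False
      then have "nrm M g > 0" using nrm_nonneg[of M g] by linarith
      then show ?thesis using * by (simp only: mult_le_cancel_left_pos)
    qed
  qed
qed

lemma cauchy_schwarz_ip:
  assumes f: "sq_integrable M f" and g: "sq_integrable M g"
  shows "cmod (ip M f g) \<le> nrm M f * nrm M g"
proof -
  have "cmod (ip M f g) \<le> (LINT x|M. cmod (f x * cnj (g x)))"
    unfolding ip_def by (rule integral_norm_bound)
  also have "\<dots> = (LINT x|M. cmod (f x) * cmod (g x))" by (simp add: norm_mult)
  also have "\<dots> \<le> nrm M f * nrm M g" by (rule cauchy_schwarz_abs[OF f g])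
  finally show ?thesis .
qed

lemma nrm_add_sq:
  assumes f: "sq_integrable M f" and g: "sq_integrable M g"
  shows "(nrm M (\<lambda>x. f x + g x))\<^sup>2 = (nrm M f)\<^sup>2 + 2 * Re (ip M f g) + (nrm M g)\<^sup>2"
proof -
  have "complex_of_real ((nrm M (\<lambda>x. f x + g x))\<^sup>2) = ip M (\<lambda>x. f x + g x) (\<lambda>x. f x + g x)"
    by (rule ip_self[symmetric])
  also have "\<dots> = ip M f f + ip M f g + (ip M g f + ip M g g)"
    using f g by (simp add: ip_add_left ip_add_right sq_integrable_add)
  also have "\<dots> = of_real ((nrm M f)\<^sup>2) + (ip M f g + cnj (ip M f g)) + of_real ((nrm M g)\<^sup>2)"
    using ip_commute[of M g f] by (simp add: ip_self)
  also have "\<dots> = of_real ((nrm M f)\<^sup>2 + 2 * Re (ip M f g) + (nrm M g)\<^sup>2)"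
    by (simp add: complex_add_cnj)
  finally show ?thesis by (simp only: of_real_eq_iff)
qed

lemma nrm_uminus [simp]: "nrm M (\<lambda>x. - f x) = nrm M f"
  by (simp add: nrm_def)

lemma nrm_diff_sq:
  assumes f: "sq_integrable M f" and g: "sq_integrable M g"
  shows "(nrm M (\<lambda>x. f x - g x))\<^sup>2 = (nrm M f)\<^sup>2 - 2 * Re (ip M f g) + (nrm M g)\<^sup>2"
  using nrm_add_sq[OF f sq_integrable_uminus[OF g]] ip_cmult_right[of M f "-1" g] by simp

lemma nrm_triangle:
  assumes f: "sq_integrable M f" and g: "sq_integrable M g"
  shows "nrm M (\<lambda>x. f x + g x) \<le> nrm M f + nrm M g"
proof (rule power2_le_imp_le)
  have "Re (ip M f g) \<le> nrm M f * nrm M g"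
    using cauchy_schwarz_ip[OF f g] complex_Re_le_cmod[of "ip M f g"] by linarith
  then show "(nrm M (\<lambda>x. f x + g x))\<^sup>2 \<le> (nrm M f + nrm M g)\<^sup>2"
    using nrm_add_sq[OF f g] by (simp add: power2_sum)
qed simp

lemma nrm_triangle_diff:
  assumes f: "sq_integrable M f" and g: "sq_integrable M g"
  shows "nrm M (\<lambda>x. f x - g x) \<le> nrm M f + nrm M g"
  using nrm_triangle[OF f sq_integrable_uminus[OF g]] by simp

lemma nrm_cmult: "nrm M (\<lambda>x. c * f x) = cmod c * nrm M f"
  by (simp add: nrm_def norm_mult power_mult_distrib real_sqrt_mult)

lemma nrm_le_const:
  assumes M: "prob_space M" and f: "f \<in> borel_measurable M" and C: "AE x in M. cmod (f x) \<le> C" "0 \<le> C"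
  shows "sq_integrable M f" "nrm M f \<le> C"
proof -
  interpret prob_space M by fact
  have o: "sq_integrable M (\<lambda>x. 1)" "nrm M (\<lambda>x. 1) = 1"
    by (auto simp: sq_integrable_def nrm_def prob_space)
  show "sq_integrable M f" by (rule sq_integrable_bound[OF o(1) f, of C]) (use C in simp)
  show "nrm M f \<le> C" using nrm_bound[OF o(1) f, of C] C o(2) by simp
qed

abbreviation zcount :: "int measure" where "zcount \<equiv> count_space UNIV"

section \<open>Fourier series on the torus\<close>

lemma emeasure_fundamental: "emeasure lborel {0..<2 * pi} = ennreal (2 * pi)"
  by simp

lemma prob_space_torus: "prob_space torus"
  unfolding torus_def by (rule prob_space_uniform_measure) auto

interpretation torus: prob_space torus by (rule prob_space_torus)

lemma sets_torus [simp, measurable_cong]: "sets torus = sets borel"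
  by (simp add: torus_def)

lemma space_torus [simp]: "space torus = UNIV"
  by (simp add: torus_def)

lemma in_L2_sq_integrable: "in_L2 = sq_integrable torus"
  by (simp add: in_L2_def sq_integrable_def fun_eq_iff)

lemma L2_norm_nrm: "L2_norm = nrm torus"
  by (simp add: L2_norm_def nrm_def fun_eq_iff)

lemma nn_integral_torus:
  "f \<in> borel_measurable borel \<Longrightarrow>
    (\<integral>\<^sup>+x. f x \<partial>torus) = (\<integral>\<^sup>+x. f x * indicator {0..<2 * pi} x \<partial>lborel) / ennreal (2 * pi)"
  unfolding torus_def by (subst nn_integral_uniform_measure) auto

lemma AE_torus: "AE x in torus. x \<in> {0..<2 * pi}"
  unfolding torus_def by (rule AE_uniform_measureI) auto

definition ech :: "int \<Rightarrow> real \<Rightarrow> complex" where "ech n x = cis (of_int n * x)"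

lemma ech_measurable [measurable]: "ech n \<in> borel_measurable borel"
  unfolding ech_def[abs_def] cis_conv_exp by measurable

lemma cmod_ech [simp]: "cmod (ech n x) = 1" by (simp add: ech_def)

lemma ech_mult: "ech n x * ech m x = ech (n + m) x"
  by (simp add: ech_def cis_mult distrib_right)

lemma cnj_ech: "cnj (ech n x) = ech (- n) x"
  by (simp add: ech_def cis_cnj)

lemma ech_0 [simp]: "ech 0 x = 1" by (simp add: ech_def)

lemma sq_integrable_torusI:
  assumes [measurable]: "f \<in> borel_measurable borel" and "\<And>x. cmod (f x) \<le> C"
  shows "sq_integrable torus f"
proof (rule nrm_le_const(1)[OF prob_space_torus])
  show "AE x in torus. cmod (f x) \<le> C" using assms(2) by simp
  show "0 \<le> C" using norm_ge_zero[of "f 0"] assms(2)[of 0] by linarith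
qed measurable

lemma sq_integrable_ech [simp]: "sq_integrable torus (ech n)"
  by (rule sq_integrable_torusI[where C=1]) auto

lemma fourier_coeff_ip: "fourier_coeff f n = ip torus f (ech n)"
  unfolding fourier_coeff_def ip_def ech_def cis_cnj
  by (simp add: cis_conv_exp mult.assoc)

lemma integral_torus_ech: "(LINT x|torus. ech n x) = (if n = 0 then 1 else 0)"
proof (cases "n = 0")
  case True
  then show ?thesis using torus.prob_space by simp
next
  case False
  have "(LINT x|torus. ech n x) = (LINT x|density lborel (\<lambda>x. ennreal (indicator {0..<2*pi} x / (2*pi))). ech n x)"
  proof -
    have "torus = density lborel (\<lambda>x. ennreal (indicator {0..<2*pi} x / (2*pi)))"
      unfolding torus_def uniform_measure_def emeasure_fundamental
      by (intro density_cong) (auto split: split_indicator simp: divide_ennreal[symmetric] ennreal_indicator[symmetric])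
    then show ?thesis by simp
  qed
  also have "\<dots> = (LINT x|lborel. (indicator {0..<2*pi} x / (2*pi)) *\<^sub>R ech n x)"
    by (rule integral_density) auto
  also have "\<dots> = (LINT x|lborel. (indicator {0..2*pi} x / (2*pi)) *\<^sub>R ech n x)"
  proof (rule integral_cong_AE)
    have "AE x in lborel. x \<noteq> 2 * pi" by (rule AE_lborel_singleton)
    then show "AE x in lborel. (indicator {0..<2*pi} x / (2*pi)) *\<^sub>R ech n x = (indicator {0..2*pi} x / (2*pi)) *\<^sub>R ech n x"
      by eventually_elim (auto simp: indicator_def)
  qed auto
  also have "\<dots> = (LINT x|lborel. (1/(2*pi)) *\<^sub>R (indicator {0..2*pi} x *\<^sub>R ech n x))"
    by (intro Bochner_Integration.integral_cong refl) (simp add: field_simps)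
  also have "\<dots> = (1/(2*pi)) *\<^sub>R (LINT x|lborel. indicator {0..2*pi} x *\<^sub>R ech n x)"
    by (rule integral_scaleR_right)
  also have "(LINT x|lborel. indicator {0..2*pi} x *\<^sub>R ech n x) = ech n (2*pi) / (\<i> * of_int n) - ech n 0 / (\<i> * of_int n)"
  proof (rule integral_FTC_Icc)
    show "continuous_on {0..2*pi} (ech n)"
      unfolding ech_def[abs_def] by (intro continuous_intros)
    show "((\<lambda>x. ech n x / (\<i> * of_int n)) has_vector_derivative ech n x) (at x within {0..2*pi})" for x
    proof -
      have "((\<lambda>z. exp (\<i> * of_int n * z) / (\<i> * of_int n)) has_field_derivative exp (\<i> * of_int n * of_real x)) (at (of_real x))"
        using False by (auto intro!: derivative_eq_intros)
      then have "((\<lambda>x. exp (\<i> * of_int n * of_real x) / (\<i> * of_int n)) has_vector_derivative exp (\<i> * of_int n * of_real x)) (at x within {0..2*pi})"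
        by (rule has_vector_derivative_real_field)
      then show ?thesis
        by (simp add: ech_def[abs_def] cis_conv_exp mult.assoc)
    qed
  qed simp
  also have "ech n (2*pi) = ech n 0"
    by (simp add: ech_def cis_conv_exp exp_eq_1 mult_ac)
  finally show ?thesis using False by simp
qed

lemma ip_ech: "ip torus (ech n) (ech m) = (if n = m then 1 else 0)"
  unfolding ip_def by (simp add: cnj_ech ech_mult integral_torus_ech)

lemma sq_integrable_trig [simp]: "sq_integrable torus (\<lambda>x. \<Sum>n\<in>S. a n * ech n x)"
  by (intro sq_integrable_sum sq_integrable_cmult sq_integrable_ech)

lemma ip_trig_right:
  assumes "sq_integrable torus f"
  shows "ip torus f (\<lambda>x. \<Sum>n\<in>S. a n * ech n x) = (\<Sum>n\<in>S. cnj (a n) * fourier_coeff f n)"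
proof -
  have "ip torus f (\<lambda>x. \<Sum>n\<in>S. a n * ech n x) = (LINT x|torus. (\<Sum>n\<in>S. f x * cnj (a n * ech n x)))"
    unfolding ip_def by (simp add: sum_distrib_left)
  also have "\<dots> = (\<Sum>n\<in>S. ip torus f (\<lambda>x. a n * ech n x))"
    unfolding ip_def by (rule Bochner_Integration.integral_sum) (intro integrable_ip assms sq_integrable_cmult sq_integrable_ech)
  also have "\<dots> = (\<Sum>n\<in>S. cnj (a n) * fourier_coeff f n)"
    by (simp add: ip_cmult_right fourier_coeff_ip)
  finally show ?thesis .
qed

lemma fourier_coeff_trig:
  assumes "finite S"
  shows "fourier_coeff (\<lambda>x. \<Sum>n\<in>S. a n * ech n x) m = (if m \<in> S then a m else 0)"
proof -
  have "fourier_coeff (\<lambda>x. \<Sum>n\<in>S. a n * ech n x) m = cnj (ip torus (ech m) (\<lambda>x. \<Sum>n\<in>S. a n * ech n x))"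
    unfolding fourier_coeff_ip by (rule ip_commute)
  also have "\<dots> = (\<Sum>n\<in>S. a n * (if n = m then 1 else 0))"
    by (subst ip_trig_right) (auto simp: fourier_coeff_ip ip_ech intro!: sum.cong)
  also have "\<dots> = (if m \<in> S then a m else 0)"
    using assms by (auto simp: if_distrib cong: if_cong)
  finally show ?thesis .
qed

lemma nrm_trig_sq:
  assumes "finite S"
  shows "(nrm torus (\<lambda>x. \<Sum>n\<in>S. a n * ech n x))\<^sup>2 = (\<Sum>n\<in>S. (cmod (a n))\<^sup>2)"
proof -
  have "complex_of_real ((nrm torus (\<lambda>x. \<Sum>n\<in>S. a n * ech n x))\<^sup>2) = complex_of_real (\<Sum>n\<in>S. (cmod (a n))\<^sup>2)"
    unfolding ip_self[symmetric] ip_trig_right[OF sq_integrable_trig] fourier_coeff_trig[OF assms] of_real_sum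
    by (intro sum.cong refl) (simp add: complex_norm_square[symmetric] mult.commute)
  then show ?thesis by (simp only: of_real_eq_iff)
qed

text \<open>Completing the square in the coefficients. The choice \<open>a = fourier_coeff f\<close>
  yields Bessel's inequality, and a good approximation of \<open>f\<close> yields the converse bound
  in Parseval's identity.\<close>

lemma nrm_diff_trig_sq:
  assumes "finite S" "sq_integrable torus f"
  shows "(nrm torus (\<lambda>x. f x - (\<Sum>n\<in>S. a n * ech n x)))\<^sup>2 =
    (nrm torus f)\<^sup>2 - (\<Sum>n\<in>S. (cmod (fourier_coeff f n))\<^sup>2) + (\<Sum>n\<in>S. (cmod (fourier_coeff f n - a n))\<^sup>2)"
proof -
  have *: "(cmod (fourier_coeff f n - a n))\<^sup>2 = (cmod (fourier_coeff f n))\<^sup>2 - 2 * Re (cnj (a n) * fourier_coeff f n) + (cmod (a n))\<^sup>2" for n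
    unfolding cmod_power2 by (simp add: power2_eq_square algebra_simps)
  have "(nrm torus (\<lambda>x. f x - (\<Sum>n\<in>S. a n * ech n x)))\<^sup>2 =
     (nrm torus f)\<^sup>2 - 2 * Re (\<Sum>n\<in>S. cnj (a n) * fourier_coeff f n) + (\<Sum>n\<in>S. (cmod (a n))\<^sup>2)"
    by (simp add: nrm_diff_sq[OF assms(2) sq_integrable_trig] ip_trig_right[OF assms(2)] nrm_trig_sq[OF assms(1)])
  also have "\<dots> = (nrm torus f)\<^sup>2 - (\<Sum>n\<in>S. (cmod (fourier_coeff f n))\<^sup>2) + (\<Sum>n\<in>S. (cmod (fourier_coeff f n - a n))\<^sup>2)"
    unfolding * by (simp add: sum.distrib sum_subtractf sum_distrib_left)
  finally show ?thesis .
qed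

lemma bessel:
  assumes "finite S" "sq_integrable torus f"
  shows "(\<Sum>n\<in>S. (cmod (fourier_coeff f n))\<^sup>2) \<le> (nrm torus f)\<^sup>2"
  using nrm_diff_trig_sq[OF assms, of "fourier_coeff f"]
    zero_le_power2[of "nrm torus (\<lambda>x. f x - (\<Sum>n\<in>S. fourier_coeff f n * ech n x))"] by simp

section \<open>Density of trigonometric polynomials in \<open>L^2\<close> of the torus\<close>

definition trig_polys :: "(real \<Rightarrow> complex) set" where
  "trig_polys = {f. \<exists>S a. finite S \<and> f = (\<lambda>x. \<Sum>n\<in>S. a n * ech n x)}"

lemma trig_polysI: "finite S \<Longrightarrow> (\<lambda>x. \<Sum>n\<in>S. a n * ech n x) \<in> trig_polys"
  by (auto simp: trig_polys_def)

lemma trig_polys_monom: "(\<lambda>x. c * ech n x) \<in> trig_polys"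
  using trig_polysI[of "{n}" "\<lambda>_. c"] by simp

lemma trig_polys_const: "(\<lambda>x. c) \<in> trig_polys"
  using trig_polys_monom[of c 0] by simp

lemma trig_polys_add:
  assumes "f \<in> trig_polys" "g \<in> trig_polys" shows "(\<lambda>x. f x + g x) \<in> trig_polys"
proof -
  obtain S a where S: "finite S" "f = (\<lambda>x. \<Sum>n\<in>S. a n * ech n x)" using assms(1) by (auto simp: trig_polys_def)
  obtain T b where T: "finite T" "g = (\<lambda>x. \<Sum>n\<in>T. b n * ech n x)" using assms(2) by (auto simp: trig_polys_def)
  have 1: "f x = (\<Sum>n\<in>S \<union> T. (if n \<in> S then a n else 0) * ech n x)" for x
    unfolding S(2) using S(1) T(1) by (intro sum.mono_neutral_cong_left) auto
  have 2: "g x = (\<Sum>n\<in>S \<union> T. (if n \<in> T then b n else 0) * ech n x)" for x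
    unfolding T(2) using S(1) T(1) by (intro sum.mono_neutral_cong_left) auto
  have "(\<lambda>x. f x + g x) = (\<lambda>x. \<Sum>n\<in>S \<union> T. ((if n \<in> S then a n else 0) + (if n \<in> T then b n else 0)) * ech n x)"
    unfolding 1 2 by (simp add: sum.distrib distrib_right)
  also have "\<dots> \<in> trig_polys" using S(1) T(1) by (intro trig_polysI) simp
  finally show ?thesis .
qed

lemma trig_polys_sum:
  "(\<And>i. i \<in> I \<Longrightarrow> f i \<in> trig_polys) \<Longrightarrow> (\<lambda>x. \<Sum>i\<in>I. f i x) \<in> trig_polys"
  by (induction I rule: infinite_finite_induct) (auto intro!: trig_polys_add trig_polys_const)

lemma trig_polys_mult:
  assumes "f \<in> trig_polys" "g \<in> trig_polys" shows "(\<lambda>x. f x * g x) \<in> trig_polys"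
proof -
  obtain S a where S: "finite S" "f = (\<lambda>x. \<Sum>n\<in>S. a n * ech n x)" using assms(1) by (auto simp: trig_polys_def)
  obtain T b where T: "finite T" "g = (\<lambda>x. \<Sum>n\<in>T. b n * ech n x)" using assms(2) by (auto simp: trig_polys_def)
  have "(\<lambda>x. f x * g x) = (\<lambda>x. \<Sum>n\<in>S. \<Sum>m\<in>T. (a n * b m) * ech (n + m) x)"
    unfolding S(2) T(2) sum_product by (simp add: ech_mult[symmetric] mult_ac)
  then show ?thesis by (auto intro!: trig_polys_sum trig_polys_monom)
qed

lemma trig_polys_sq_integrable: "f \<in> trig_polys \<Longrightarrow> sq_integrable torus f"
  by (auto simp: trig_polys_def)

text \<open>Connects Stone-Weierstrass on the unit circle with Fourier series. A linear functional
  of \<open>cis x\<close> is a combination of cosine and sine, hence of \<open>ech 1\<close> and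
  \<open>ech (-1)\<close>; products and sums stay trigonometric.\<close>

lemma trig_polys_real_polynomial_function:
  fixes p :: "complex \<Rightarrow> real"
  assumes "real_polynomial_function p"
  shows "(\<lambda>x. of_real (p (cis x))) \<in> trig_polys"
  using assms
proof (induction p rule: real_polynomial_function.induct)
  case (linear f)
  interpret bounded_linear f by fact
  have "complex_of_real (f (cis x)) = (of_real (f 1) / 2 - \<i> * of_real (f \<i>) / 2) * ech 1 x
      + (of_real (f 1) / 2 + \<i> * of_real (f \<i>) / 2) * ech (- 1) x" for x
  proof -
    have "cis x = cos x *\<^sub>R 1 + sin x *\<^sub>R \<i>" by (simp add: complex_eq_iff)
    then have "f (cis x) = cos x * f 1 + sin x * f \<i>" by (metis add scaleR real_scaleR_def)
    then show ?thesis by (simp add: ech_def complex_eq_iff algebra_simps)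
  qed
  then show ?case by (auto intro!: trig_polys_add trig_polys_monom)
next
  case (const c)
  show ?case by (rule trig_polys_const)
next
  case (add f g)
  then show ?case by (auto dest: trig_polys_add)
next
  case (mult f g)
  then show ?case by (auto dest: trig_polys_mult)
qed

lemma Arg2pi_measurable [measurable]: "Arg2pi \<in> borel_measurable borel"
  unfolding borel_measurable_iff_greater
  using open_Arg2pi2pi_gt by auto

lemma Arg2pi_cis: "0 \<le> x \<Longrightarrow> x < 2 * pi \<Longrightarrow> Arg2pi (cis x) = x"
  using Arg2pi_exp[of "\<i> * of_real x"] by (simp add: cis_conv_exp)

text \<open>The set is carried to the unit circle, since continuity there is continuity of a
  periodic function. Regularity of the image measure encloses the set between a compact and an open
  set, Urysohn's function interpolates between them, and Stone-Weierstrass approximates that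
  function uniformly.\<close>

lemma trig_polys_dense_indicator:
  assumes B: "B \<in> sets borel" and e: "e > 0"
  shows "\<exists>p\<in>trig_polys. nrm torus (\<lambda>x. indicator B x - p x) < e"
proof -
  let ?D = "distr torus borel cis"
  have cis_meas [measurable]: "cis \<in> borel_measurable borel"
    by (intro borel_measurable_continuous_onI continuous_intros)
  interpret D: prob_space ?D by (rule torus.prob_space_distr) simp
  \<comment> \<open>\<open>Arg2pi\<close> inverts \<open>cis\<close> on the fundamental domain, so
    membership of \<open>x\<close> in \<open>B\<close> and of \<open>cis x\<close> in
    \<open>B'\<close> agree almost everywhere.\<close>
  define B' where "B' = Arg2pi -` B"
  have B' [measurable]: "B' \<in> sets borel"
    unfolding B'_def using measurable_sets[OF Arg2pi_measurable B] by simp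
  \<comment> \<open>\<open>U - K\<close> has measure below \<open>2 \<delta>\<close>, hence below
    \<open>4 \<delta> = (e/2)^2\<close>; the Urysohn function then costs at most \<open>e/2\<close>
    in norm, which leaves room for the \<open>e/4\<close> of the polynomial.\<close>
  define \<delta> where "\<delta> = e\<^sup>2 / 16"
  have \<delta>: "\<delta> > 0" using e by (simp add: \<delta>_def)
  have fin: "emeasure ?D B' \<noteq> \<infinity>" by simp
  obtain K where K: "K \<subseteq> B'" "compact K" "emeasure ?D B' < emeasure ?D K + ennreal \<delta>"
  \<comment> \<open>Inner regularity is used through a value strictly below the supremum; when the
    supremum is zero there is none, and the empty set serves.\<close>
  proof (cases "emeasure ?D B' = 0")
    case True
    then show ?thesis using that[of "{}"] \<delta> by simp
  next
    case False
    have "emeasure ?D B' - ennreal \<delta> < emeasure ?D B'"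
      using False \<delta> zero_less_measure_iff[of ?D B']
      by (auto simp: D.emeasure_eq_measure ennreal_minus intro!: ennreal_lessI)
    also have "\<dots> = (SUP K\<in>{K. K \<subseteq> B' \<and> compact K}. emeasure ?D K)"
      by (rule inner_regular[OF sets_distr _ B']) simp
    finally have "\<exists>K\<in>{K. K \<subseteq> B' \<and> compact K}. emeasure ?D B' - ennreal \<delta> < emeasure ?D K"
      by (simp only: less_SUP_iff)
    then obtain K where K: "K \<subseteq> B'" "compact K" "emeasure ?D B' - ennreal \<delta> < emeasure ?D K" by blast
    have "emeasure ?D B' < emeasure ?D K + ennreal \<delta>"
    proof -
      have "\<not> measure ?D K \<le> measure ?D B' - \<delta>"
        using K(3) \<delta> ennreal_leI by (auto simp: D.emeasure_eq_measure ennreal_minus not_le[symmetric])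
      then show ?thesis
        using \<delta> by (simp add: D.emeasure_eq_measure ennreal_less_iff ennreal_plus[symmetric] del: ennreal_plus)
    qed
    then show ?thesis using that K(1,2) by blast
  qed
  have "(INF U\<in>{U. B' \<subseteq> U \<and> open U}. emeasure ?D U) = emeasure ?D B'"
    by (rule outer_regular[OF sets_distr _ B', symmetric]) simp
  also have "\<dots> < emeasure ?D B' + ennreal \<delta>"
    using \<delta> by (simp add: D.emeasure_eq_measure ennreal_plus[symmetric] ennreal_less_iff del: ennreal_plus)
  finally have "\<exists>U\<in>{U. B' \<subseteq> U \<and> open U}. emeasure ?D U < emeasure ?D B' + ennreal \<delta>"
    by (simp only: INF_less_iff)
  then obtain U where U: "B' \<subseteq> U" "open U" "emeasure ?D U < emeasure ?D B' + ennreal \<delta>" by blast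
  have [measurable]: "K \<in> sets borel" "U \<in> sets borel" using K U by (auto intro: borel_compact)
  have cl: "closed K" "closed (- U)" using K U by (auto intro: compact_imp_closed)
  have dis: "K \<inter> - U = {}" using K(1) U(1) by blast
  obtain g :: "complex \<Rightarrow> real" where g: "continuous_on UNIV g" "\<And>z. g z \<in> closed_segment 1 0"
    "\<And>z. z \<in> K \<Longrightarrow> g z = 1" "\<And>z. z \<in> - U \<Longrightarrow> g z = 0"
    by (rule Urysohn[OF cl dis, of "1::real" 0]) blast
  have "\<exists>q. polynomial_function q \<and> (\<forall>z\<in>sphere 0 1. norm (g z - q z) < e / 4)"
    using e by (intro Stone_Weierstrass_polynomial_function continuous_on_subset[OF g(1)]) auto
  then obtain q where q: "polynomial_function q" "\<forall>z\<in>sphere 0 1. norm (g z - q z) < e / 4"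
    by (elim exE conjE)
  define p where "p x = complex_of_real (q (cis x))" for x
  have p: "p \<in> trig_polys" unfolding p_def[abs_def]
    by (rule trig_polys_real_polynomial_function) (simp add: real_polynomial_function_eq q(1))
  have [measurable]: "g \<in> borel_measurable borel" using g(1) by (rule borel_measurable_continuous_onI)
  have [measurable]: "p \<in> borel_measurable borel" using sq_integrable_measurable[OF trig_polys_sq_integrable[OF p]] by simp
  define g' where "g' x = complex_of_real (g (cis x))" for x
  have [measurable]: "g' \<in> borel_measurable borel" unfolding g'_def[abs_def] by measurable
  have g01: "0 \<le> g z" "g z \<le> 1" for z using g(2)[of z] by (auto simp: closed_segment_eq_real_ivl)
  have n1: "nrm torus (\<lambda>x. g' x - p x) \<le> e / 4"
  proof (rule nrm_le_const(2)[OF prob_space_torus])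
    have "cmod (g' x - p x) \<le> e / 4" for x
    proof -
      have "cmod (g' x - p x) = norm (g (cis x) - q (cis x))"
        unfolding g'_def p_def of_real_diff[symmetric] norm_of_real by simp
      then show ?thesis using bspec[OF q(2), of "cis x"] by simp
    qed
    then show "AE x in torus. cmod (g' x - p x) \<le> e / 4" by simp
  qed (use e in auto)
  have n2: "nrm torus (\<lambda>x. indicator B x - g' x) \<le> e / 2"
  proof (rule nrm_le_nn)
    show "(\<lambda>x. indicator B x - g' x) \<in> borel_measurable torus" using B by measurable
    have "(\<integral>\<^sup>+x. ennreal ((cmod (indicator B x - g' x))\<^sup>2) \<partial>torus) \<le> (\<integral>\<^sup>+x. indicator (U - K) (cis x) \<partial>torus)"
    proof (rule nn_integral_mono_AE)
      show "AE x in torus. ennreal ((cmod (indicator B x - g' x))\<^sup>2) \<le> indicator (U - K) (cis x)"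
        using AE_torus
      proof eventually_elim
        case (elim x)
        then have x: "x \<in> B \<longleftrightarrow> cis x \<in> B'" by (simp add: B'_def Arg2pi_cis)
        have eq: "cmod (indicator B x - g' x) = \<bar>(if x \<in> B then 1 else 0) - g (cis x)\<bar>"
        proof -
          have "indicator B x - g' x = complex_of_real ((if x \<in> B then 1 else 0) - g (cis x))"
            by (simp add: g'_def indicator_def)
          then show ?thesis by (simp only: norm_of_real)
        qed
        show ?case
        proof (cases "cis x \<in> U - K")
          case True
          have "\<bar>(if x \<in> B then 1 else 0) - g (cis x)\<bar> \<le> 1" using g01[of "cis x"] by auto
          then have "(cmod (indicator B x - g' x))\<^sup>2 \<le> 1" unfolding eq by (intro power_le_one) simp_all
          then show ?thesis using True by simp
        next
          case False
          then have "cmod (indicator B x - g' x) = 0"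
            unfolding eq using x g(3,4)[of "cis x"] K(1) U(1) by auto
          then show ?thesis by simp
        qed
      qed
    qed
    also have "\<dots> = (\<integral>\<^sup>+z. indicator (U - K) z \<partial>?D)"
      by (subst nn_integral_distr) auto
    also have "\<dots> = emeasure ?D (U - K)" by (subst nn_integral_indicator) auto
    also have "\<dots> \<le> ennreal ((e/2)\<^sup>2)"
    proof -
      have KU: "K \<subseteq> U" using K U by auto
      have a: "measure ?D B' < measure ?D K + \<delta>" using K(3) \<delta>
        by (simp add: D.emeasure_eq_measure ennreal_plus[symmetric] ennreal_less_iff del: ennreal_plus)
      have b: "measure ?D U < measure ?D B' + \<delta>" using U(3) \<delta>
        by (simp add: D.emeasure_eq_measure ennreal_plus[symmetric] ennreal_less_iff del: ennreal_plus)
      have "measure ?D (U - K) = measure ?D U - measure ?D K"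
        using KU by (intro D.finite_measure_Diff) auto
      also have "\<dots> \<le> 4 * \<delta>" using a b \<delta> by linarith
      also have "\<dots> = (e/2)\<^sup>2" by (simp add: \<delta>_def power_divide)
      finally show ?thesis by (simp add: D.emeasure_eq_measure ennreal_leI)
    qed
    finally show "(\<integral>\<^sup>+x. ennreal ((cmod (indicator B x - g' x))\<^sup>2) \<partial>torus) \<le> ennreal ((e/2)\<^sup>2)" .
  qed (use e in auto)
  have "nrm torus (\<lambda>x. indicator B x - p x) = nrm torus (\<lambda>x. (indicator B x - g' x) + (g' x - p x))" by simp
  also have "\<dots> \<le> nrm torus (\<lambda>x. indicator B x - g' x) + nrm torus (\<lambda>x. g' x - p x)"
  proof (rule nrm_triangle)
    show "sq_integrable torus (\<lambda>x. indicator B x - g' x)"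
      using B g01 by (intro sq_integrable_diff sq_integrable_torusI[where C=1]) (auto simp: indicator_def g'_def)
    show "sq_integrable torus (\<lambda>x. g' x - p x)"
      using g01 p by (intro sq_integrable_diff sq_integrable_torusI[where C=1] trig_polys_sq_integrable) (auto simp: g'_def)
  qed
  also have "\<dots> < e" using n1 n2 e by simp
  finally show ?thesis using p by auto
qed

lemma trig_polys_dense_add:
  assumes f: "sq_integrable torus f" "\<And>e. e > 0 \<Longrightarrow> \<exists>p\<in>trig_polys. nrm torus (\<lambda>x. f x - p x) < e"
    and g: "sq_integrable torus g" "\<And>e. e > 0 \<Longrightarrow> \<exists>p\<in>trig_polys. nrm torus (\<lambda>x. g x - p x) < e"
    and e: "e > 0"
  shows "\<exists>p\<in>trig_polys. nrm torus (\<lambda>x. (f x + g x) - p x) < e"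
proof -
  obtain p where p: "p \<in> trig_polys" "nrm torus (\<lambda>x. f x - p x) < e/2" using f(2)[of "e/2"] e by auto
  obtain q where q: "q \<in> trig_polys" "nrm torus (\<lambda>x. g x - q x) < e/2" using g(2)[of "e/2"] e by auto
  have "nrm torus (\<lambda>x. (f x + g x) - (p x + q x)) = nrm torus (\<lambda>x. (f x - p x) + (g x - q x))" by (simp add: algebra_simps)
  also have "\<dots> \<le> nrm torus (\<lambda>x. f x - p x) + nrm torus (\<lambda>x. g x - q x)"
    by (intro nrm_triangle sq_integrable_diff f g trig_polys_sq_integrable p q)
  also have "\<dots> < e" using p q by simp
  finally show ?thesis by (intro bexI[OF _ trig_polys_add[OF p(1) q(1)]])
qed

lemma trig_polys_dense_simple:
  fixes c :: "'b \<Rightarrow> complex"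
  assumes "finite S" "\<And>i. i \<in> S \<Longrightarrow> A i \<in> sets borel"
  shows "sq_integrable torus (\<lambda>x. \<Sum>i\<in>S. c i * indicator (A i) x) \<and>
    (\<forall>e>0. \<exists>p\<in>trig_polys. nrm torus (\<lambda>x. (\<Sum>i\<in>S. c i * indicator (A i) x) - p x) < e)"
  using assms
proof (induction S)
  case empty
  have "nrm torus (\<lambda>x. 0) = 0" by (simp add: nrm_def)
  then show ?case using trig_polys_const[of 0] by force
next
  case (insert i S)
  have sq: "sq_integrable torus (\<lambda>x. indicator (A i) x :: complex)"
    using insert.prems by (intro sq_integrable_torusI[where C=1]) (auto simp: indicator_def)
  have "\<exists>p\<in>trig_polys. nrm torus (\<lambda>x. c i * indicator (A i) x - p x) < e" if e: "e > 0" for e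
  proof -
    obtain p where p: "p \<in> trig_polys" "nrm torus (\<lambda>x. indicator (A i) x - p x) < e / (1 + cmod (c i))"
      using trig_polys_dense_indicator[of "A i" "e / (1 + cmod (c i))"] insert.prems e
      by (auto simp: add_pos_nonneg)
    have "nrm torus (\<lambda>x. c i * indicator (A i) x - c i * p x) = cmod (c i) * nrm torus (\<lambda>x. indicator (A i) x - p x)"
      unfolding right_diff_distrib[symmetric] by (rule nrm_cmult)
    also have "\<dots> \<le> cmod (c i) * (e / (1 + cmod (c i)))" using p by (intro mult_left_mono) auto
    also have "\<dots> < e" using e by (simp add: field_simps add_pos_nonneg)
    finally show ?thesis by (intro bexI[OF _ trig_polys_mult[OF trig_polys_const[of "c i"] p(1)]])
  qed
  moreover have sqS: "sq_integrable torus (\<lambda>x. \<Sum>i\<in>S. c i * indicator (A i) x)"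
    "\<And>e. e > 0 \<Longrightarrow> \<exists>p\<in>trig_polys. nrm torus (\<lambda>x. (\<Sum>i\<in>S. c i * indicator (A i) x) - p x) < e"
    using insert.IH insert.prems by blast+
  ultimately have "\<exists>p\<in>trig_polys. nrm torus (\<lambda>x. (c i * indicator (A i) x + (\<Sum>i\<in>S. c i * indicator (A i) x)) - p x) < e"
    if "e > 0" for e
    using that by (intro trig_polys_dense_add sq_integrable_cmult[OF sq])
  then show ?case
    unfolding sum.insert[OF insert.hyps] by (intro conjI allI impI sq_integrable_add sq_integrable_cmult[OF sq] sqS)
qed

lemma trig_polys_dense:
  assumes f: "sq_integrable torus f" and e: "e > 0"
  shows "\<exists>p\<in>trig_polys. nrm torus (\<lambda>x. f x - p x) < e"
proof -
  have fm [measurable]: "f \<in> borel_measurable borel" using sq_integrable_measurable[OF f] by simp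
  obtain F where F: "\<And>i. simple_function torus (F i)" "\<And>x. (\<lambda>i. F i x) \<longlonglongrightarrow> f x"
    "\<And>i x. dist (F i x) 0 \<le> 2 * dist (f x) 0"
    using borel_measurable_implies_sequence_metric[of f torus 0] by auto
  have Fm [measurable]: "F i \<in> borel_measurable borel" for i
    using borel_measurable_simple_function[OF F(1)[of i]] by simp
  have "(\<lambda>i. LINT x|torus. (cmod (f x - F i x))\<^sup>2) \<longlonglongrightarrow> (LINT x|torus. 0)"
  \<comment> \<open>The simple functions satisfy \<open>|F i x| <= 2 |f x|\<close>, so the
    difference is at most \<open>3 |f x|\<close>.\<close>
  proof (rule integral_dominated_convergence[where w="\<lambda>x. 9 * (cmod (f x))\<^sup>2"])
    show "integrable torus (\<lambda>x. 9 * (cmod (f x))\<^sup>2)" using sq_integrableD[OF f] by simp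
    show "AE x in torus. (\<lambda>i. (cmod (f x - F i x))\<^sup>2) \<longlonglongrightarrow> 0"
    proof (rule AE_I2)
      fix x
      have "(\<lambda>i. (cmod (f x - F i x))\<^sup>2) \<longlonglongrightarrow> (cmod (f x - f x))\<^sup>2" by (intro tendsto_intros F)
      then show "(\<lambda>i. (cmod (f x - F i x))\<^sup>2) \<longlonglongrightarrow> 0" by simp
    qed
    show "AE x in torus. norm ((cmod (f x - F i x))\<^sup>2) \<le> 9 * (cmod (f x))\<^sup>2" for i
    proof (rule AE_I2)
      fix x
      have "cmod (f x - F i x) \<le> 3 * cmod (f x)" using F(3)[of i x] norm_triangle_ineq4[of "f x" "F i x"] by simp
      then have "(cmod (f x - F i x))\<^sup>2 \<le> (3 * cmod (f x))\<^sup>2" by (intro power_mono) auto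
      then show "norm ((cmod (f x - F i x))\<^sup>2) \<le> 9 * (cmod (f x))\<^sup>2" by (simp add: power_mult_distrib)
    qed
  qed auto
  then have "(\<lambda>i. nrm torus (\<lambda>x. f x - F i x)) \<longlonglongrightarrow> sqrt 0"
    unfolding nrm_def by (intro tendsto_real_sqrt) simp
  then have "eventually (\<lambda>i. nrm torus (\<lambda>x. f x - F i x) < e/2) sequentially"
    using e by (intro order_tendstoD) auto
  then obtain i where i: "nrm torus (\<lambda>x. f x - F i x) < e/2" by (auto simp: eventually_sequentially)
  define S where "S = range (F i)"
  have finS: "finite S" using F(1)[of i] by (simp add: simple_function_def S_def)
  have Feq: "F i x = (\<Sum>y\<in>S. y * indicator (F i -` {y}) x)" for x
  proof -
    have "(\<Sum>y\<in>S. y * indicator (F i -` {y}) x) = (\<Sum>y\<in>{F i x}. y * indicator (F i -` {y}) x)"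
      using finS by (intro sum.mono_neutral_right) (auto simp: S_def indicator_def)
    then show ?thesis by simp
  qed
  have Am: "F i -` {y} \<in> sets borel" for y using measurable_sets[OF Fm[of i], of "{y}"] by simp
  obtain p where p: "p \<in> trig_polys" "nrm torus (\<lambda>x. F i x - p x) < e/2" and sqF: "sq_integrable torus (F i)"
    using trig_polys_dense_simple[OF finS, of "\<lambda>y. F i -` {y}" "\<lambda>y. y"] Am e
    unfolding Feq[symmetric] by (metis half_gt_zero)
  have "nrm torus (\<lambda>x. f x - p x) = nrm torus (\<lambda>x. (f x - F i x) + (F i x - p x))" by simp
  also have "\<dots> \<le> nrm torus (\<lambda>x. f x - F i x) + nrm torus (\<lambda>x. F i x - p x)"
    by (intro nrm_triangle sq_integrable_diff f sqF trig_polys_sq_integrable p)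
  also have "\<dots> < e" using i p by simp
  finally show ?thesis using p by blast
qed

section \<open>Parseval's identity as an equality of integrals over counting measure\<close>

lemma nn_integral_zcount_le:
  assumes "\<And>S. finite S \<Longrightarrow> (\<Sum>n\<in>S. f n) \<le> B"
  shows "(\<integral>\<^sup>+n. f n \<partial>zcount) \<le> B"
proof -
  have "(\<integral>\<^sup>+n. f n \<partial>zcount) = (\<integral>\<^sup>+i. f (from_nat_into UNIV i) \<partial>count_space (UNIV :: nat set))"
    by (rule nn_integral_bij_count_space[symmetric]) (rule bij_betw_from_nat_into, auto simp: infinite_UNIV_int)
  also have "\<dots> = (\<Sum>i. f (from_nat_into UNIV i))" by (rule nn_integral_count_space_nat)
  also have "\<dots> \<le> B"
  proof (rule suminf_le_const)
    show "(\<Sum>i<n. f (from_nat_into UNIV i)) \<le> B" for n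
    proof -
      have "inj_on (from_nat_into (UNIV::int set)) {..<n}"
        using bij_betw_from_nat_into[of "UNIV::int set"] by (auto simp: bij_betw_def infinite_UNIV_int intro: inj_on_subset)
      then have "(\<Sum>i<n. f (from_nat_into UNIV i)) = (\<Sum>m\<in>from_nat_into UNIV ` {..<n}. f m)"
        by (simp add: sum.reindex)
      then show ?thesis using assms by simp
    qed
  qed simp
  finally show ?thesis .
qed

lemma sum_le_nn_integral_zcount:
  assumes "finite S" shows "(\<Sum>n\<in>S. f n) \<le> (\<integral>\<^sup>+n. f n \<partial>zcount)"
proof -
  have "(\<Sum>n\<in>S. f n) = (\<integral>\<^sup>+n. f n \<partial>count_space S)" using assms by (simp add: nn_integral_count_space_finite)
  also have "\<dots> = (\<integral>\<^sup>+n. f n * indicator S n \<partial>zcount)" by (simp add: nn_integral_count_space_indicator)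
  also have "\<dots> \<le> (\<integral>\<^sup>+n. f n \<partial>zcount)" by (intro nn_integral_mono) (auto simp: indicator_def)
  finally show ?thesis .
qed

text \<open>One direction is Bessel's inequality on finite sets. For the other, if a trigonometric
  polynomial lies within \<open>sqrt e\<close> of \<open>f\<close>, then by
  \<open>nrm_diff_trig_sq\<close> the coefficients of \<open>f\<close> on its frequencies already
  carry the squared norm up to \<open>e\<close>.\<close>

lemma parseval_nn:
  assumes f: "sq_integrable torus f"
  shows "(\<integral>\<^sup>+n. ennreal ((cmod (fourier_coeff f n))\<^sup>2) \<partial>zcount) = ennreal ((nrm torus f)\<^sup>2)"
proof (rule antisym)
  show "(\<integral>\<^sup>+n. ennreal ((cmod (fourier_coeff f n))\<^sup>2) \<partial>zcount) \<le> ennreal ((nrm torus f)\<^sup>2)"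
    by (rule nn_integral_zcount_le) (simp add: bessel f ennreal_leI)
  show "ennreal ((nrm torus f)\<^sup>2) \<le> (\<integral>\<^sup>+n. ennreal ((cmod (fourier_coeff f n))\<^sup>2) \<partial>zcount)"
  proof (rule ennreal_le_epsilon)
    fix e :: real assume e: "e > 0"
    then obtain p where p: "p \<in> trig_polys" "nrm torus (\<lambda>x. f x - p x) < sqrt e"
      using trig_polys_dense[OF f, of "sqrt e"] by auto
    then obtain S a where S: "finite S" "p = (\<lambda>x. \<Sum>n\<in>S. a n * ech n x)" by (auto simp: trig_polys_def)
    have "(nrm torus (\<lambda>x. f x - p x))\<^sup>2 < e"
      using p(2) e by (metis nrm_nonneg real_sqrt_less_iff real_sqrt_abs abs_of_nonneg)
    moreover have "0 \<le> (\<Sum>n\<in>S. (cmod (fourier_coeff f n - a n))\<^sup>2)" by (intro sum_nonneg) auto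
    ultimately have "(nrm torus f)\<^sup>2 \<le> (\<Sum>n\<in>S. (cmod (fourier_coeff f n))\<^sup>2) + e"
      using nrm_diff_trig_sq[OF S(1) f, of a] S(2) by simp
    then have "ennreal ((nrm torus f)\<^sup>2) \<le> ennreal ((\<Sum>n\<in>S. (cmod (fourier_coeff f n))\<^sup>2) + e)"
      by (rule ennreal_leI)
    also have "\<dots> = (\<Sum>n\<in>S. ennreal ((cmod (fourier_coeff f n))\<^sup>2)) + ennreal e"
      using e by (simp add: sum_nonneg)
    also have "\<dots> \<le> (\<integral>\<^sup>+n. ennreal ((cmod (fourier_coeff f n))\<^sup>2) \<partial>zcount) + ennreal e"
      by (intro add_right_mono sum_le_nn_integral_zcount S)
    finally show "ennreal ((nrm torus f)\<^sup>2) \<le> (\<integral>\<^sup>+n. ennreal ((cmod (fourier_coeff f n))\<^sup>2) \<partial>zcount) + ennreal e" .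
  qed
qed

lemma sq_integrable_fourier:
  "sq_integrable torus f \<Longrightarrow> sq_integrable zcount (fourier_coeff f)"
  by (rule sq_integrableI_nn[where B="(nrm torus f)\<^sup>2"]) (simp_all add: parseval_nn)

lemma nrm_fourier: "sq_integrable torus f \<Longrightarrow> nrm zcount (fourier_coeff f) = nrm torus f"
proof -
  assume f: "sq_integrable torus f"
  have "ennreal ((nrm zcount (fourier_coeff f))\<^sup>2) = ennreal ((nrm torus f)\<^sup>2)"
    using ennreal_nrm_sq[OF sq_integrable_fourier[OF f]] parseval_nn[OF f] by simp
  then show ?thesis by simp
qed

lemma fourier_coeff_add:
  "sq_integrable torus f \<Longrightarrow> sq_integrable torus g \<Longrightarrow>
    fourier_coeff (\<lambda>x. f x + g x) n = fourier_coeff f n + fourier_coeff g n"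
  by (simp add: fourier_coeff_ip ip_add_left)

lemma fourier_coeff_diff:
  "sq_integrable torus f \<Longrightarrow> sq_integrable torus g \<Longrightarrow>
    fourier_coeff (\<lambda>x. f x - g x) n = fourier_coeff f n - fourier_coeff g n"
  by (simp add: fourier_coeff_ip ip_diff_left)

lemma fourier_coeff_cmult: "fourier_coeff (\<lambda>x. c * f x) n = c * fourier_coeff f n"
  by (simp add: fourier_coeff_ip ip_cmult_left)

text \<open>Polarization: the real part is read off from the norm of the sum, the imaginary part is
  the real part after multiplying \<open>f\<close> by \<open>-\<i>\<close>.\<close>

lemma parseval_ip:
  assumes f: "sq_integrable torus f" and g: "sq_integrable torus g"
  shows "ip zcount (fourier_coeff f) (fourier_coeff g) = ip torus f g"
proof -
  have re: "Re (ip zcount (fourier_coeff f) (fourier_coeff g)) = Re (ip torus f g)"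
    if f: "sq_integrable torus f" for f
  proof -
    have "nrm zcount (\<lambda>n. fourier_coeff f n + fourier_coeff g n) = nrm torus (\<lambda>x. f x + g x)"
      using nrm_fourier[OF sq_integrable_add[OF f g]] fourier_coeff_add[OF f g] by (simp cong: nrm_cong)
    then show ?thesis
      using nrm_add_sq[OF f g] nrm_add_sq[OF sq_integrable_fourier[OF f] sq_integrable_fourier[OF g]]
        nrm_fourier[OF f] nrm_fourier[OF g] by simp
  qed
  have "Re (ip zcount (fourier_coeff (\<lambda>x. -\<i> * f x)) (fourier_coeff g)) = Re (ip torus (\<lambda>x. -\<i> * f x) g)"
    by (rule re[OF sq_integrable_cmult[OF f]])
  then have "Im (ip zcount (fourier_coeff f) (fourier_coeff g)) = Im (ip torus f g)"
    unfolding fourier_coeff_cmult[abs_def] ip_cmult_left by simp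
  with re[OF f] show ?thesis by (simp add: complex_eq_iff)
qed

section \<open>Oscillatory integrals in the spectral parameter\<close>

lemma cis_borel_measurable [measurable]:
  "f \<in> borel_measurable M \<Longrightarrow> (\<lambda>x. cis (f x)) \<in> borel_measurable M"
  by (rule measurable_compose[OF _ borel_measurable_continuous_onI[OF continuous_on_cis[OF continuous_on_id]]])

lemma cis_eq_iexp: "cis x = iexp x"
  by (simp add: cis_conv_exp)

lemma char_normal_cis: "(LINT k|std_normal_distribution. cis (k * x)) = complex_of_real (exp (- x\<^sup>2 / 2))"
proof -
  have "(LINT k|std_normal_distribution. cis (k * x)) = char std_normal_distribution x"
    unfolding char_def cis_eq_iexp by (simp add: mult.commute)
  then show ?thesis by (simp add: char_std_normal_distribution)
qed

lemma prob_space_std_normal: "prob_space std_normal_distribution"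
  by (rule prob_space_normal_density) simp

text \<open>Averaged against a Gaussian, \<open>|\<integral> f e\<^sup>i\<^sup>k\<^sup>\<psi>|\<^sup>2\<close> becomes a quadratic form with kernel
  \<open>exp (- (\<psi> s - \<psi> s')\<^sup>2 / 2)\<close>, which is bounded by Schur's test with weight \<open>w\<close>.\<close>

lemma gaussian_oscillation:
  fixes f :: "'a \<Rightarrow> complex" and \<psi> w :: "'a \<Rightarrow> real"
  assumes M: "finite_measure M"
    and [measurable]: "f \<in> borel_measurable M" "\<psi> \<in> borel_measurable M" "w \<in> borel_measurable M"
    and fB: "\<And>s. s \<in> space M \<Longrightarrow> cmod (f s) \<le> B"
    and w: "\<And>s. s \<in> space M \<Longrightarrow> 0 < w s"
    and \<kappa>: "\<And>s. s \<in> space M \<Longrightarrow>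
      (\<integral>\<^sup>+s'. ennreal (exp (- (\<psi> s - \<psi> s')\<^sup>2 / 2) / w s') \<partial>M) \<le> \<kappa>"
  shows "(\<integral>\<^sup>+k. ennreal ((cmod (LINT s|M. f s * cis (k * \<psi> s)))\<^sup>2) \<partial>std_normal_distribution)
    \<le> \<kappa> * (\<integral>\<^sup>+s. ennreal ((cmod (f s))\<^sup>2 * w s) \<partial>M)"
\<comment> \<open>On an empty space the bound \<open>fB\<close> says nothing about the sign of
  \<open>B\<close>, and \<open>B\<close> serves below as an integrability bound.\<close>
proof (cases "space M = {}")
  case True
  then have "(LINT s|M. f s * cis (k * \<psi> s)) = 0" for k
    by (simp add: Bochner_Integration.integral_empty)
  then show ?thesis by simp
next
  case False
  interpret M: finite_measure M by fact
  let ?N = std_normal_distribution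
  interpret N: prob_space ?N by (rule prob_space_std_normal)
  interpret MM: pair_sigma_finite M M ..
  let ?P = "M \<Otimes>\<^sub>M M"
  interpret P: finite_measure ?P by (rule finite_measure_pair_measure) fact+
  interpret NP: pair_sigma_finite ?N ?P ..
  interpret NPf: finite_measure "?N \<Otimes>\<^sub>M ?P"
    by (rule finite_measure_pair_measure) unfold_locales
  have B0: "0 \<le> B" using False fB norm_ge_zero order_trans by blast
  define I where "I k = (LINT s|M. f s * cis (k * \<psi> s))" for k
  define h where "h k p = f (fst p) * cnj (f (snd p)) * cis (k * (\<psi> (fst p) - \<psi> (snd p)))" for k p
  have hB: "cmod (h k p) \<le> B * B" if "p \<in> space ?P" for k p
    using that fB B0 by (auto simp: h_def norm_mult space_pair_measure intro!: mult_mono)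
  have [measurable]: "(\<lambda>x. h (fst x) (snd x)) \<in> borel_measurable (?N \<Otimes>\<^sub>M ?P)"
    unfolding h_def by measurable
  have [measurable]: "h k \<in> borel_measurable ?P" for k
    unfolding h_def[abs_def] by measurable
  have intP: "integrable ?P (h k)" for k
    by (rule P.integrable_const_bound[where B="B * B"]) (use hB in auto)
  have intNP: "integrable (?N \<Otimes>\<^sub>M ?P) (case_prod h)"
    by (rule NPf.integrable_const_bound[where B="B * B"])
      (use hB in \<open>auto simp: space_pair_measure case_prod_beta intro!: AE_I2\<close>)
  \<comment> \<open>The square is written as an integral over pairs so that Fubini's theorem can
    bring the Gaussian integral in k inside, where it is the characteristic function of the normal
    law.\<close>
  have sq: "complex_of_real ((cmod (I k))\<^sup>2) = (LINT p|?P. h k p)" for k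
  proof -
    have "(LINT p|?P. h k p) = (LINT s|M. LINT s'|M. h k (s, s'))"
      using MM.integral_fst'[OF intP[of k]] by simp
    also have "\<dots> = (LINT s|M. f s * cis (k * \<psi> s) * cnj (I k))"
    proof (rule Bochner_Integration.integral_cong[OF refl])
      fix s
      have "h k (s, s') = f s * cis (k * \<psi> s) * cnj (f s' * cis (k * \<psi> s'))" for s'
        by (simp add: h_def right_diff_distrib cis_divide[symmetric] cis_cnj[symmetric] cis_inverse divide_inverse)
      then show "(LINT s'|M. h k (s, s')) = f s * cis (k * \<psi> s) * cnj (I k)"
        unfolding I_def by (simp only: integral_mult_right_zero Bochner_Integration.integral_cnj)
    qed
    also have "\<dots> = I k * cnj (I k)" unfolding I_def by (simp only: integral_mult_left_zero)
    also have "\<dots> = complex_of_real ((cmod (I k))\<^sup>2)" by (simp only: complex_norm_square)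
    finally show ?thesis by simp
  qed
  have [measurable]: "(\<lambda>k. (cmod (I k))\<^sup>2) \<in> borel_measurable ?N"
    unfolding I_def by measurable
  have Iint: "integrable ?N (\<lambda>k. (cmod (I k))\<^sup>2)"
  proof -
    have "integrable ?N (\<lambda>k. LINT p|?P. h k p)" using NP.integrable_fst'[OF intNP] by simp
    then have "integrable ?N (\<lambda>k. complex_of_real ((cmod (I k))\<^sup>2))" unfolding sq .
    then have "integrable ?N (\<lambda>k. Re (complex_of_real ((cmod (I k))\<^sup>2)))" by (rule integrable_Re)
    then show ?thesis by simp
  qed
  define E where "E p = exp (- (\<psi> (fst p) - \<psi> (snd p))\<^sup>2 / 2)" for p
  have [measurable]: "E \<in> borel_measurable ?P" unfolding E_def[abs_def] by measurable
  define X where "X s = ennreal ((cmod (f s))\<^sup>2 * w s)" for s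
  define Y where "Y p s = ennreal (E p / w s)" for p s
  have [measurable]: "X \<in> borel_measurable M" unfolding X_def[abs_def] by measurable
  have [measurable]: "(\<lambda>p. Y p (fst p)) \<in> borel_measurable ?P" "(\<lambda>p. Y p (snd p)) \<in> borel_measurable ?P"
    unfolding Y_def by measurable
  have half: "ennreal (1/2 * (x * y)) = ennreal (1/2) * (ennreal x * ennreal y)" if "0 \<le> x" "0 \<le> y" for x y :: real
    by (subst ennreal_mult, simp, simp add: that, subst ennreal_mult) (use that in auto)
  have "complex_of_real (LINT k|?N. (cmod (I k))\<^sup>2) = (LINT k|?N. LINT p|?P. h k p)"
    by (simp only: sq[symmetric] integral_complex_of_real)
  also have "\<dots> = (LINT p|?P. LINT k|?N. h k p)"
    by (rule NP.Fubini_integral[OF intNP, symmetric])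
  also have "\<dots> = (LINT p|?P. f (fst p) * cnj (f (snd p)) * complex_of_real (E p))"
    unfolding h_def E_def by (simp only: integral_mult_right_zero char_normal_cis)
  finally have *: "complex_of_real (LINT k|?N. (cmod (I k))\<^sup>2) = \<dots>" .
  have "(\<integral>\<^sup>+k. ennreal ((cmod (I k))\<^sup>2) \<partial>?N) = ennreal (LINT k|?N. (cmod (I k))\<^sup>2)"
    by (rule nn_integral_eq_integral[OF Iint]) simp
  also have "\<dots> = ennreal (cmod (complex_of_real (LINT k|?N. (cmod (I k))\<^sup>2)))"
    by (simp add: integral_nonneg_AE)
  also have "\<dots> \<le> (\<integral>\<^sup>+p. ennreal (cmod (f (fst p) * cnj (f (snd p)) * complex_of_real (E p))) \<partial>?P)"
    unfolding *
  proof (rule integral_norm_bound_ennreal)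
    show "integrable ?P (\<lambda>p. f (fst p) * cnj (f (snd p)) * complex_of_real (E p))"
    proof (rule P.integrable_const_bound[where B="B * B * 1"])
      show "AE p in ?P. norm (f (fst p) * cnj (f (snd p)) * complex_of_real (E p)) \<le> B * B * 1"
      proof (rule AE_I2)
        fix p assume p: "p \<in> space ?P"
        have "cmod (f (fst p)) * cmod (f (snd p)) * \<bar>E p\<bar> \<le> B * B * 1"
          using p fB B0 by (intro mult_mono) (auto simp: space_pair_measure E_def)
        then show "norm (f (fst p) * cnj (f (snd p)) * complex_of_real (E p)) \<le> B * B * 1"
          by (simp only: norm_mult complex_mod_cnj norm_of_real)
      qed
    qed measurable
  qed
  \<comment> \<open>Weighted arithmetic-geometric mean,
    \<open>2 (a x) (b y) <= (a x)^2 + (b y)^2\<close> divided by \<open>x y\<close>. The two halves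
    have equal integrals because the kernel is symmetric.\<close>
  also have "\<dots> \<le> (\<integral>\<^sup>+p. ennreal (1/2) * (X (fst p) * Y p (snd p)) + ennreal (1/2) * (X (snd p) * Y p (fst p)) \<partial>?P)"
  proof (rule nn_integral_mono)
    fix p assume p: "p \<in> space ?P"
    define a b x y e where "a = cmod (f (fst p))" "b = cmod (f (snd p))" "x = w (fst p)" "y = w (snd p)" "e = E p"
    have pos: "0 < x" "0 < y" "0 \<le> a" "0 \<le> b" "0 \<le> e"
      using p w by (auto simp: a_b_x_y_e_def space_pair_measure E_def)
    have "a * b * e \<le> 1/2 * ((a\<^sup>2 * x) * (e / y)) + 1/2 * ((b\<^sup>2 * y) * (e / x))"
    proof -
      have "2 * (a * x) * (b * y) \<le> (a * x)\<^sup>2 + (b * y)\<^sup>2" by (rule sum_squares_bound)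
      then have "e * (2 * (a * x) * (b * y)) \<le> e * ((a * x)\<^sup>2 + (b * y)\<^sup>2)" using pos by (intro mult_left_mono)
      then show ?thesis using pos by (simp add: field_simps power2_eq_square)
    qed
    then have "ennreal (a * b * e) \<le> ennreal (1/2 * ((a\<^sup>2 * x) * (e / y)) + 1/2 * ((b\<^sup>2 * y) * (e / x)))" by (rule ennreal_leI)
    also have "\<dots> = ennreal (1/2 * ((a\<^sup>2 * x) * (e / y))) + ennreal (1/2 * ((b\<^sup>2 * y) * (e / x)))"
      using pos by (intro ennreal_plus) auto
    also have "\<dots> = ennreal (1/2) * (X (fst p) * Y p (snd p)) + ennreal (1/2) * (X (snd p) * Y p (fst p))"
      using pos by (subst (1 2) half) (auto simp: X_def Y_def a_b_x_y_e_def)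
    finally show "ennreal (cmod (f (fst p) * cnj (f (snd p)) * complex_of_real (E p)))
      \<le> ennreal (1/2) * (X (fst p) * Y p (snd p)) + ennreal (1/2) * (X (snd p) * Y p (fst p))"
      using pos by (simp add: a_b_x_y_e_def norm_mult)
  qed
  also have "\<dots> = ennreal (1/2) * (\<integral>\<^sup>+p. X (fst p) * Y p (snd p) \<partial>?P) + ennreal (1/2) * (\<integral>\<^sup>+p. X (snd p) * Y p (fst p) \<partial>?P)"
    by (subst nn_integral_add) (simp_all add: nn_integral_cmult)
  also have "(\<integral>\<^sup>+p. X (snd p) * Y p (fst p) \<partial>?P) = (\<integral>\<^sup>+p. X (fst p) * Y p (snd p) \<partial>?P)"
  proof -
    have "(\<integral>\<^sup>+p. X (fst p) * Y p (snd p) \<partial>?P) = (\<integral>\<^sup>+p. X (fst p) * Y p (snd p) \<partial>distr ?P ?P (\<lambda>(x, y). (y, x)))"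
      using MM.distr_pair_swap by simp
    also have "\<dots> = (\<integral>\<^sup>+p. X (snd p) * Y (snd p, fst p) (fst p) \<partial>?P)"
      by (subst nn_integral_distr) (auto simp: case_prod_beta)
    also have "\<dots> = (\<integral>\<^sup>+p. X (snd p) * Y p (fst p) \<partial>?P)"
      by (simp add: Y_def E_def power2_commute)
    finally show ?thesis by simp
  qed
  also have "ennreal (1/2) * (\<integral>\<^sup>+p. X (fst p) * Y p (snd p) \<partial>?P) + ennreal (1/2) * (\<integral>\<^sup>+p. X (fst p) * Y p (snd p) \<partial>?P)
     = (\<integral>\<^sup>+p. X (fst p) * Y p (snd p) \<partial>?P)"
    by (subst distrib_right[symmetric], subst ennreal_plus[symmetric]) auto
  also have "\<dots> = (\<integral>\<^sup>+s. \<integral>\<^sup>+s'. X s * Y (s, s') s' \<partial>M \<partial>M)"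
    by (subst M.nn_integral_fst[symmetric]) simp_all
  also have "\<dots> \<le> (\<integral>\<^sup>+s. X s * \<kappa> \<partial>M)"
  proof (rule nn_integral_mono)
    fix s assume s: "s \<in> space M"
    have "(\<integral>\<^sup>+s'. X s * Y (s, s') s' \<partial>M) = X s * (\<integral>\<^sup>+s'. Y (s, s') s' \<partial>M)"
      by (rule nn_integral_cmult) (unfold Y_def E_def fst_conv snd_conv, measurable)
    also have "\<dots> \<le> X s * \<kappa>"
      using \<kappa>[OF s] by (intro mult_left_mono) (auto simp: E_def Y_def)
    finally show "(\<integral>\<^sup>+s'. X s * Y (s, s') s' \<partial>M) \<le> X s * \<kappa>" .
  qed
  also have "\<dots> = (\<integral>\<^sup>+s. X s \<partial>M) * \<kappa>"
    by (rule nn_integral_multc) measurable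
  finally show ?thesis unfolding I_def X_def by (simp add: mult.commute)
qed

section \<open>Time intervals as finite measure spaces\<close>

abbreviation tm :: "real \<Rightarrow> real \<Rightarrow> real measure" where
  "tm a b \<equiv> restrict_space lborel {a..b}"

lemma finite_measure_tm: "finite_measure (tm a b)"
  by (rule finite_measureI) (simp add: emeasure_restrict_space emeasure_lborel_Icc_eq)

lemma space_tm [simp]: "space (tm a b) = {a..b}"
  by (simp add: space_restrict_space)

lemma measure_tm: "a \<le> b \<Longrightarrow> measure (tm a b) (space (tm a b)) = b - a"
  by (simp add: measure_restrict_space)

lemma integral_tm: "(LINT s|tm a b. f s) = (LBINT s:{a..b}. f s)"
  for f :: "real \<Rightarrow> 'b::{banach, second_countable_topology}"
  by (simp add: integral_restrict_space set_lebesgue_integral_def)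

lemma integrable_tm: "integrable (tm a b) f \<longleftrightarrow> set_integrable lborel {a..b} f"
  for f :: "real \<Rightarrow> 'b::{banach, second_countable_topology}"
  by (simp add: integrable_restrict_space set_integrable_def)

lemma nn_integral_tm: "(\<integral>\<^sup>+s. f s \<partial>tm a b) = (\<integral>\<^sup>+s. f s * indicator {a..b} s \<partial>lborel)"
  by (simp add: nn_integral_restrict_space)

lemma measurable_tm [measurable (raw)]:
  "f \<in> borel_measurable borel \<Longrightarrow> f \<in> borel_measurable (tm a b)"
  by (rule measurable_restrict_space1) simp

text \<open>In the variable \<open>ln (1 + s')\<close> the weighted measure becomes Lebesgue measure
  and the phase moves with speed at least \<rho>. From \<open>1 + y <= exp y\<close> the Gaussian is
  dominated by the kernel \<open>2 / (1 + x^2)\<close>, whose primitive is an arctangent; its total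
  mass after scaling is \<open>2 pi / \<rho>\<close>.\<close>

lemma gaussian_kernel_log:
  fixes \<psi> :: "real \<Rightarrow> real"
  assumes a: "0 \<le> a" "a \<le> b" and \<rho>: "0 < \<rho>" and s: "s \<in> {a..b}"
    and \<psi>: "\<And>s'. s' \<in> {a..b} \<Longrightarrow> \<rho> * \<bar>ln (1 + s) - ln (1 + s')\<bar> \<le> \<bar>\<psi> s - \<psi> s'\<bar>"
  shows "(\<integral>\<^sup>+s'. ennreal (exp (- (\<psi> s - \<psi> s')\<^sup>2 / 2) / (1 + s')) \<partial>tm a b) \<le> ennreal (2 * pi / \<rho>)"
proof -
  let ?g = "\<lambda>s'. 2 / (1 + (\<rho> * (ln (1 + s') - ln (1 + s)))\<^sup>2) / (1 + s')"
  let ?F = "\<lambda>s'. 2 / \<rho> * arctan (\<rho> * (ln (1 + s') - ln (1 + s)))"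
  have "(\<integral>\<^sup>+s'. ennreal (exp (- (\<psi> s - \<psi> s')\<^sup>2 / 2) / (1 + s')) \<partial>tm a b) \<le> (\<integral>\<^sup>+s'. ennreal (?g s') \<partial>tm a b)"
  proof (rule nn_integral_mono, rule ennreal_leI, rule divide_right_mono)
    fix s' assume s': "s' \<in> space (tm a b)"
    show "0 \<le> 1 + s'" using s' a by simp
    let ?x = "\<rho> * (ln (1 + s') - ln (1 + s))"
    have "\<bar>?x\<bar> \<le> \<bar>\<psi> s - \<psi> s'\<bar>" using \<psi>[of s'] s' \<rho> by (simp add: abs_mult abs_minus_commute)
    then have x: "?x\<^sup>2 \<le> (\<psi> s - \<psi> s')\<^sup>2" by (simp add: abs_le_square_iff)
    have "(1 + ?x\<^sup>2) / 2 \<le> 1 + (\<psi> s - \<psi> s')\<^sup>2 / 2" using x by simp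
    also have "\<dots> \<le> exp ((\<psi> s - \<psi> s')\<^sup>2 / 2)" by (rule exp_ge_add_one_self)
    finally have "inverse (exp ((\<psi> s - \<psi> s')\<^sup>2 / 2)) \<le> inverse ((1 + ?x\<^sup>2) / 2)"
      by (intro le_imp_inverse_le) (simp_all add: add_pos_nonneg)
    then show "exp (- (\<psi> s - \<psi> s')\<^sup>2 / 2) \<le> 2 / (1 + ?x\<^sup>2)"
      by (simp add: exp_minus[symmetric])
  qed
  also have "\<dots> = (\<integral>\<^sup>+s'. ennreal (?g s') * indicator {a..b} s' \<partial>lborel)" by (rule nn_integral_tm)
  also have "\<dots> = ennreal (?F b - ?F a)"
  proof (rule nn_integral_FTC_Icc)
    fix x assume x: "x \<in> {a..b}"
    let ?u = "\<lambda>x. \<rho> * (ln (1 + x) - ln (1 + s))"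
    have "DERIV ?u x :> \<rho> * (1 / (1 + x))"
      using x a by (auto intro!: derivative_eq_intros)
    then have "DERIV (\<lambda>x. arctan (?u x)) x :> inverse (1 + (?u x)\<^sup>2) * (\<rho> * (1 / (1 + x)))"
      by (rule DERIV_chain2[OF DERIV_arctan])
    then have "DERIV ?F x :> 2 / \<rho> * (inverse (1 + (?u x)\<^sup>2) * (\<rho> * (1 / (1 + x))))"
      by (rule DERIV_cmult)
    then show "DERIV ?F x :> ?g x" by (rule DERIV_cong) (use \<rho> in \<open>simp add: divide_inverse\<close>)
    show "0 \<le> ?g x" using x a by simp
  qed (use a in auto)
  also have "\<dots> \<le> ennreal (2 * pi / \<rho>)"
  proof (rule ennreal_leI)
    have "?F b \<le> 2 / \<rho> * (pi / 2)" using \<rho> arctan_ubound[of "\<rho> * (ln (1 + b) - ln (1 + s))"]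
      by (intro mult_left_mono) auto
    moreover have "2 / \<rho> * (- (pi / 2)) \<le> ?F a" using \<rho> arctan_lbound[of "\<rho> * (ln (1 + a) - ln (1 + s))"]
      by (intro mult_left_mono) auto
    ultimately have "?F b - ?F a \<le> 2 / \<rho> * (pi / 2) - 2 / \<rho> * (- (pi / 2))" by (rule diff_mono)
    also have "\<dots> = 2 * pi / \<rho>" using \<rho> by (simp add: field_simps)
    finally show "?F b - ?F a \<le> 2 * pi / \<rho>" .
  qed
  finally show ?thesis .
qed

text \<open>The first two factors are the reciprocal of the least value of the normal density on
  \<open>{-A..A}\<close>; the last one comes from \<open>gaussian_kernel_log\<close>.\<close>

definition osc_const :: "real \<Rightarrow> real" where
  "osc_const A = sqrt (2 * pi) * exp (A\<^sup>2 / 2) * (2 * pi)"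

lemma osc_const_pos: "0 < osc_const A" by (simp add: osc_const_def)

text \<open>Schur's test with weight \<open>1 + s\<close>. The phase is compared with the logarithm
  because the transport phase at frequency n is a multiple of \<open>n * ln (1 + t)\<close>; the
  gain \<open>1 / \<rho>\<close> is what the averaging over k provides.\<close>

lemma oscillation_bound:
  fixes f :: "real \<Rightarrow> complex" and \<psi> :: "real \<Rightarrow> real"
  assumes a: "0 \<le> a" "a \<le> b" and \<rho>: "0 < \<rho>"
    and f [measurable]: "f \<in> borel_measurable (tm a b)" and fB: "\<And>s. s \<in> {a..b} \<Longrightarrow> cmod (f s) \<le> B"
    and \<psi>m [measurable]: "\<psi> \<in> borel_measurable (tm a b)"
    and \<psi>: "\<And>s s'. s \<in> {a..b} \<Longrightarrow> s' \<in> {a..b} \<Longrightarrow> \<rho> * \<bar>ln (1 + s) - ln (1 + s')\<bar> \<le> \<bar>\<psi> s - \<psi> s'\<bar>"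
  shows "(\<integral>\<^sup>+k\<in>{-A..A}. ennreal ((cmod (LINT s|tm a b. f s * cis (k * \<psi> s)))\<^sup>2) \<partial>lborel)
    \<le> ennreal (osc_const A / \<rho>) * (\<integral>\<^sup>+s. ennreal ((cmod (f s))\<^sup>2 * (1 + s)) \<partial>tm a b)"
proof -
  let ?J = "\<lambda>k. ennreal ((cmod (LINT s|tm a b. f s * cis (k * \<psi> s)))\<^sup>2)"
  interpret finite_measure "tm a b" by (rule finite_measure_tm)
  have [measurable]: "?J \<in> borel_measurable borel" by measurable
  let ?c = "sqrt (2 * pi) * exp (A\<^sup>2 / 2)"
  have "(\<integral>\<^sup>+k\<in>{-A..A}. ?J k \<partial>lborel) \<le> (\<integral>\<^sup>+k. ennreal ?c * (ennreal (std_normal_density k) * ?J k) \<partial>lborel)"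
  proof (rule nn_integral_mono)
    fix k
    show "?J k * indicator {-A..A} k \<le> ennreal ?c * (ennreal (std_normal_density k) * ?J k)"
    proof (cases "k \<in> {-A..A}")
      case True
      then have "\<bar>k\<bar> \<le> \<bar>A\<bar>" by auto
      then have "k\<^sup>2 \<le> A\<^sup>2" by (rule abs_le_square_iff[THEN iffD1])
      then have "1 \<le> exp (A\<^sup>2 / 2 - k\<^sup>2 / 2)" by simp
      also have "\<dots> = exp (A\<^sup>2 / 2) * exp (- k\<^sup>2 / 2)"
        by (simp add: exp_add[symmetric])
      also have "\<dots> = ?c * std_normal_density k"
        by (simp add: std_normal_density_def)
      finally have "1 \<le> ennreal ?c * ennreal (std_normal_density k)"
        by (subst ennreal_mult[symmetric], simp, simp) (simp only: ennreal_1[symmetric] ennreal_leI)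
      then have "1 * ?J k \<le> ennreal ?c * ennreal (std_normal_density k) * ?J k"
        by (intro mult_right_mono) auto
      then show ?thesis using True by (simp add: mult.assoc)
    qed simp
  qed
  also have "\<dots> = ennreal ?c * (\<integral>\<^sup>+k. ?J k \<partial>std_normal_distribution)"
    by (subst nn_integral_cmult) (auto simp: nn_integral_density)
  also have "\<dots> \<le> ennreal ?c * (ennreal (2 * pi / \<rho>) * (\<integral>\<^sup>+s. ennreal ((cmod (f s))\<^sup>2 * (1 + s)) \<partial>tm a b))"
  proof (intro mult_left_mono gaussian_oscillation[where B=B])
    show "(\<integral>\<^sup>+s'. ennreal (exp (- (\<psi> s - \<psi> s')\<^sup>2 / 2) / (1 + s')) \<partial>tm a b) \<le> ennreal (2 * pi / \<rho>)"
      if "s \<in> space (tm a b)" for s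
      using that by (intro gaussian_kernel_log a \<rho> \<psi>) auto
    show "0 < 1 + s" if "s \<in> space (tm a b)" for s using that a by simp
  qed (use fB in \<open>auto simp: finite_measure_tm\<close>)
  also have "\<dots> = ennreal (osc_const A / \<rho>) * (\<integral>\<^sup>+s. ennreal ((cmod (f s))\<^sup>2 * (1 + s)) \<partial>tm a b)"
    using \<rho> by (subst mult.assoc[symmetric], subst ennreal_mult[symmetric]) (auto simp: osc_const_def mult_ac)
  finally show ?thesis .
qed

section \<open>Time integrals of square-summable sequences\<close>

text \<open>Under a bound uniform in time, Minkowski's integral inequality follows from
  Cauchy-Schwarz in time for each frequency and then Tonelli's theorem.\<close>

lemma minkowski_zcount:
  fixes F :: "'a \<Rightarrow> int \<Rightarrow> complex"
  assumes M: "finite_measure M" and m [measurable]: "\<And>n. (\<lambda>s. F s n) \<in> borel_measurable M"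
    and B: "\<And>s. s \<in> space M \<Longrightarrow> (\<integral>\<^sup>+n. ennreal ((cmod (F s n))\<^sup>2) \<partial>zcount) \<le> ennreal (B\<^sup>2)" "0 \<le> B"
  shows "integrable M (\<lambda>s. F s n)"
    and "sq_integrable zcount (\<lambda>n. LINT s|M. F s n)"
    and "nrm zcount (\<lambda>n. LINT s|M. F s n) \<le> measure M (space M) * B"
proof -
  interpret finite_measure M by fact
  let ?\<mu> = "measure M (space M)"
  have FB: "cmod (F s n) \<le> B" if "s \<in> space M" for s n
  proof -
    have "ennreal ((cmod (F s n))\<^sup>2) \<le> (\<integral>\<^sup>+n. ennreal ((cmod (F s n))\<^sup>2) \<partial>zcount)"
      using sum_le_nn_integral_zcount[of "{n}" "\<lambda>n. ennreal ((cmod (F s n))\<^sup>2)"] by simp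
    also have "\<dots> \<le> ennreal (B\<^sup>2)" by (rule B(1)[OF that])
    finally have "ennreal ((cmod (F s n))\<^sup>2) \<le> ennreal (B\<^sup>2)" .
    then show ?thesis using B(2) by (simp add: power2_le_iff_abs_le)
  qed
  show int: "integrable M (\<lambda>s. F s n)" for n
    by (rule integrable_const_bound[where B=B]) (use FB in auto)
  have one: "sq_integrable M (\<lambda>s. 1)" "(nrm M (\<lambda>s. 1))\<^sup>2 = ?\<mu>"
    by (auto simp: sq_integrable_def nrm_sq)
  have sqF: "sq_integrable M (\<lambda>s. F s n)" for n
    by (rule sq_integrable_bound[OF one(1), where C=B]) (use FB in auto)
  have pt: "(cmod (LINT s|M. F s n))\<^sup>2 \<le> ?\<mu> * (nrm M (\<lambda>s. F s n))\<^sup>2" for n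
  proof -
    have "cmod (LINT s|M. F s n) \<le> nrm M (\<lambda>s. F s n) * nrm M (\<lambda>s. 1)"
      using cauchy_schwarz_ip[OF sqF one(1)] by (simp add: ip_def)
    then have "(cmod (LINT s|M. F s n))\<^sup>2 \<le> (nrm M (\<lambda>s. F s n) * nrm M (\<lambda>s. 1))\<^sup>2" by (intro power_mono) auto
    then show ?thesis by (simp add: power_mult_distrib one mult.commute)
  qed
  have "(\<integral>\<^sup>+n. ennreal ((cmod (LINT s|M. F s n))\<^sup>2) \<partial>zcount)
    \<le> (\<integral>\<^sup>+n. ennreal ?\<mu> * (\<integral>\<^sup>+s. ennreal ((cmod (F s n))\<^sup>2) \<partial>M) \<partial>zcount)"
    using pt by (intro nn_integral_mono)
      (auto simp: ennreal_nrm_sq[OF sqF, symmetric] ennreal_mult[symmetric] intro!: ennreal_leI)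
  also have "\<dots> = ennreal ?\<mu> * (\<integral>\<^sup>+n. \<integral>\<^sup>+s. ennreal ((cmod (F s n))\<^sup>2) \<partial>M \<partial>zcount)"
    by (rule nn_integral_cmult) simp
  also have "\<dots> \<le> ennreal ?\<mu> * (ennreal (B\<^sup>2) * ennreal ?\<mu>)"
  proof (rule mult_left_mono)
    have "(\<integral>\<^sup>+n. \<integral>\<^sup>+s. ennreal ((cmod (F s n))\<^sup>2) \<partial>M \<partial>zcount) = (\<integral>\<^sup>+s. \<integral>\<^sup>+n. ennreal ((cmod (F s n))\<^sup>2) \<partial>zcount \<partial>M)"
      by (rule nn_integral_count_space_nn_integral[symmetric]) auto
    also have "\<dots> \<le> (\<integral>\<^sup>+s. ennreal (B\<^sup>2) \<partial>M)" using B by (intro nn_integral_mono)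
    also have "\<dots> = ennreal (B\<^sup>2) * ennreal ?\<mu>" by (simp add: emeasure_eq_measure)
    finally show "(\<integral>\<^sup>+n. \<integral>\<^sup>+s. ennreal ((cmod (F s n))\<^sup>2) \<partial>M \<partial>zcount) \<le> ennreal (B\<^sup>2) * ennreal ?\<mu>" .
  qed simp
  also have "\<dots> = ennreal ((?\<mu> * B)\<^sup>2)"
    using B(2) by (subst ennreal_mult[symmetric], simp, simp, subst ennreal_mult[symmetric]) (simp_all add: power2_eq_square mult_ac)
  finally have fin: "(\<integral>\<^sup>+n. ennreal ((cmod (LINT s|M. F s n))\<^sup>2) \<partial>zcount) \<le> ennreal ((?\<mu> * B)\<^sup>2)" .
  show "sq_integrable zcount (\<lambda>n. LINT s|M. F s n)" by (rule sq_integrableI_nn[OF _ fin]) simp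
  show "nrm zcount (\<lambda>n. LINT s|M. F s n) \<le> ?\<mu> * B" by (rule nrm_le_nn[OF _ fin]) (use B in auto)
qed

text \<open>\<open>Z\<close> is only square-summable, so the integrability over the product that
  Fubini's theorem asks for comes from Cauchy-Schwarz over the frequencies, with a bound independent
  of time.\<close>

lemma ip_zcount_integral:
  fixes F :: "'a \<Rightarrow> int \<Rightarrow> complex"
  assumes M: "finite_measure M" and m [measurable]: "\<And>n. (\<lambda>s. F s n) \<in> borel_measurable M"
    and B: "\<And>s. s \<in> space M \<Longrightarrow> (\<integral>\<^sup>+n. ennreal ((cmod (F s n))\<^sup>2) \<partial>zcount) \<le> ennreal (B\<^sup>2)" "0 \<le> B"
    and Z: "sq_integrable zcount Z"
  shows "integrable M (\<lambda>s. ip zcount Z (F s))"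
    and "ip zcount Z (\<lambda>n. LINT s|M. F s n) = (LINT s|M. ip zcount Z (F s))"
proof -
  interpret finite_measure M by fact
  interpret C: sigma_finite_measure zcount by (rule sigma_finite_measure_count_space)
  interpret pair_sigma_finite zcount M ..
  interpret S: pair_sigma_finite M zcount ..
  have sqF: "sq_integrable zcount (F s)" "nrm zcount (F s) \<le> B" if "s \<in> space M" for s
    using sq_integrableI_nn[OF _ B(1)[OF that]] nrm_le_nn[OF _ B(1)[OF that] B(2)] by auto
  have [measurable]: "(\<lambda>x. Z (snd x) * cnj (F (fst x) (snd x))) \<in> borel_measurable (M \<Otimes>\<^sub>M zcount)"
    by (rule measurable_compose_countable'[where f="\<lambda>n x. Z n * cnj (F (fst x) n)" and g=snd and I=UNIV]) auto
  have int: "integrable (M \<Otimes>\<^sub>M zcount) (case_prod (\<lambda>s n. Z n * cnj (F s n)))"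
    unfolding case_prod_beta
  proof (rule S.Fubini_integrable)
    show "AE s in M. integrable zcount (\<lambda>n. Z (snd (s, n)) * cnj (F (fst (s, n)) (snd (s, n))))"
      using integrable_ip[OF Z sqF(1)] by (auto intro!: AE_I2)
    show "integrable M (\<lambda>s. LINT n|zcount. norm (Z (snd (s, n)) * cnj (F (fst (s, n)) (snd (s, n)))))"
    proof (rule integrable_const_bound[where B="nrm zcount Z * B"])
      show "AE s in M. norm (LINT n|zcount. norm (Z (snd (s, n)) * cnj (F (fst (s, n)) (snd (s, n))))) \<le> nrm zcount Z * B"
      proof (rule AE_I2)
        fix s assume s: "s \<in> space M"
        have "(LINT n|zcount. cmod (Z n) * cmod (F s n)) \<le> nrm zcount Z * B"
          using cauchy_schwarz_abs[OF Z sqF(1)[OF s]] mult_left_mono[OF sqF(2)[OF s] nrm_nonneg[of zcount Z]] by linarith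
        moreover have "0 \<le> (LINT n|zcount. cmod (Z n) * cmod (F s n))" by (rule Bochner_Integration.integral_nonneg) simp
        ultimately show "norm (LINT n|zcount. norm (Z (snd (s, n)) * cnj (F (fst (s, n)) (snd (s, n))))) \<le> nrm zcount Z * B"
          by (simp add: norm_mult)
      qed
    qed measurable
  qed measurable
  show "integrable M (\<lambda>s. ip zcount Z (F s))"
    using S.integrable_fst'[OF int] by (simp add: ip_def)
  have "(LINT s|M. ip zcount Z (F s)) = (LINT n|zcount. LINT s|M. Z n * cnj (F s n))"
    unfolding ip_def by (rule S.Fubini_integral[OF int, symmetric])
  also have "\<dots> = ip zcount Z (\<lambda>n. LINT s|M. F s n)"
    unfolding ip_def by (simp only: integral_mult_right_zero Bochner_Integration.integral_cnj)
  finally show "ip zcount Z (\<lambda>n. LINT s|M. F s n) = (LINT s|M. ip zcount Z (F s))" by simp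
qed

section \<open>Evolution in the interaction picture\<close>

lemma ennreal_nrm_sq_le:
  "sq_integrable M f \<Longrightarrow> nrm M f \<le> B \<Longrightarrow> (\<integral>\<^sup>+x. ennreal ((cmod (f x))\<^sup>2) \<partial>M) \<le> ennreal (B\<^sup>2)"
  by (subst ennreal_nrm_sq[symmetric]) (auto intro!: ennreal_leI power_mono)

lemma sq_integrable_zcountI:
  "sq_integrable zcount g \<Longrightarrow> (\<And>n. cmod (f n) \<le> cmod (g n)) \<Longrightarrow> sq_integrable zcount f"
  by (rule sq_integrable_bound[where C=1]) auto

lemma ip_phase: "ip M (\<lambda>n. cis (p n) * x n) (\<lambda>n. cis (p n) * y n) = ip M x y"
proof -
  have "cis (p n) * x n * cnj (cis (p n) * y n) = x n * cnj (y n)" for n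
  proof -
    have "cis (p n) * x n * cnj (cis (p n) * y n) = (cis (p n) * cnj (cis (p n))) * (x n * cnj (y n))"
      by (simp add: mult_ac)
    also have "cis (p n) * cnj (cis (p n)) = 1" by (simp add: cis_cnj cis_mult)
    finally show ?thesis by simp
  qed
  then show ?thesis unfolding ip_def by (intro Bochner_Integration.integral_cong refl)
qed

text \<open>Quadratic increments force a vanishing derivative. This takes the place of
  differentiating in time: the solutions are known only through integrals whose integrands are
  merely measurable.\<close>

lemma constant_if_quadratic:
  fixes g :: "real \<Rightarrow> real"
  assumes "\<And>s t. a \<le> s \<Longrightarrow> s \<le> t \<Longrightarrow> t \<le> b \<Longrightarrow> \<bar>g t - g s\<bar> \<le> C * (t - s)\<^sup>2"
    and "t \<in> {a..b}"
  shows "g t = g a"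
proof -
  have d: "(g has_field_derivative 0) (at x within {a..b})" if x: "x \<in> {a..b}" for x
    unfolding has_field_derivative_iff
  proof (rule Lim_null_comparison)
    have "norm ((g y - g x) / (y - x)) \<le> C * \<bar>y - x\<bar>" if y: "y \<in> {a..b}" "y \<noteq> x" for y
    proof -
      have "\<bar>g y - g x\<bar> \<le> C * \<bar>y - x\<bar>\<^sup>2"
        using assms(1)[of x y] assms(1)[of y x] x y by (cases "x \<le> y") (auto simp: abs_minus_commute power2_commute)
      then show ?thesis using y by (simp add: abs_divide power2_eq_square divide_simps mult_ac)
    qed
    then show "\<forall>\<^sub>F y in at x within {a..b}. norm ((g y - g x) / (y - x)) \<le> C * \<bar>y - x\<bar>"
      by (auto simp: eventually_at_filter)
    have "((\<lambda>y. C * \<bar>y - x\<bar>) \<longlongrightarrow> C * \<bar>x - x\<bar>) (at x within {a..b})" by (intro tendsto_intros)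
    then show "((\<lambda>y. C * \<bar>y - x\<bar>) \<longlongrightarrow> 0) (at x within {a..b})" by simp
  qed
  obtain c where "\<And>x. x \<in> {a..b} \<Longrightarrow> g x = c"
    using has_field_derivative_zero_constant[OF convex_real_interval(5)[of a b] d] by blast
  then show ?thesis using assms(2) by auto
qed

section \<open>Multiplication by the potential, Duhamel's formula and conservation of the
  norm\<close>

definition Vmul :: "(real \<Rightarrow> real \<Rightarrow> real) \<Rightarrow> real \<Rightarrow> (real \<Rightarrow> complex) \<Rightarrow> real \<Rightarrow> complex" where
  "Vmul V s f = (\<lambda>x. of_real (V s x) * f x)"

definition meas_potential :: "(real \<Rightarrow> real \<Rightarrow> real) \<Rightarrow> bool" where
  "meas_potential V \<longleftrightarrow> (\<lambda>p. V (fst p) (snd p)) \<in> borel_measurable (borel \<Otimes>\<^sub>M borel)"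

lemma meas_potentialD [measurable_dest]:
  "meas_potential V \<Longrightarrow> (\<lambda>p. V (fst p) (snd p)) \<in> borel_measurable (borel \<Otimes>\<^sub>M borel)"
  by (simp add: meas_potential_def)

lemma potential_measurable:
  assumes V: "meas_potential V"
  shows "V s \<in> borel_measurable borel"
  using measurable_compose[OF measurable_Pair1'[of s borel borel] meas_potentialD[OF V]] by simp

lemma fourier_potential_measurable:
  assumes V [measurable]: "meas_potential V"
  shows "(\<lambda>s. fourier_coeff (\<lambda>x. of_real (V s x)) n) \<in> borel_measurable borel"
proof -
  have [measurable]: "(\<lambda>p. V (fst p) (snd p)) \<in> borel_measurable (borel \<Otimes>\<^sub>M torus)"
    using meas_potentialD[OF V] measurable_cong_sets[OF sets_pair_measure_cong[OF refl sets_torus] refl] by blast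
  have "(\<lambda>p. complex_of_real (V (fst p) (snd p)) * cnj (ech n (snd p))) \<in> borel_measurable (borel \<Otimes>\<^sub>M torus)"
    by measurable
  then have "(\<lambda>s. LINT x|torus. complex_of_real (V s x) * cnj (ech n x)) \<in> borel_measurable borel"
    by (intro torus.borel_measurable_lebesgue_integral) (simp add: case_prod_beta)
  then show ?thesis by (simp add: fourier_coeff_ip ip_def)
qed

lemma
  assumes V: "meas_potential V" and v: "\<And>x. \<bar>V s x\<bar> \<le> v" and f: "sq_integrable torus f"
  shows sq_integrable_Vmul: "sq_integrable torus (Vmul V s f)"
    and nrm_Vmul: "nrm torus (Vmul V s f) \<le> v * nrm torus f"
proof -
  have m: "Vmul V s f \<in> borel_measurable torus"
    using potential_measurable[OF V, of s] f unfolding Vmul_def by measurable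
  have b: "AE x in torus. cmod (Vmul V s f x) \<le> v * cmod (f x)"
    using v by (intro AE_I2) (auto simp: Vmul_def norm_mult intro!: mult_right_mono)
  have "0 \<le> v" using v[of 0] by linarith
  then show "sq_integrable torus (Vmul V s f)" "nrm torus (Vmul V s f) \<le> v * nrm torus f"
    using sq_integrable_bound[OF f m b] nrm_bound[OF f m b] by auto
qed

lemma Vmul_symmetric: "ip torus (Vmul V s f) g = ip torus f (Vmul V s g)"
  by (simp add: ip_def Vmul_def mult_ac)

text \<open>Multiplication acts on the Fourier side as convolution. The finite form serves for the
  low-frequency free waves, where it makes measurability in time evident and exhibits the matrix
  entries of the first-order term.\<close>

lemma fourier_Vmul_trig:
  assumes V: "meas_potential V" and v: "\<And>x. \<bar>V s x\<bar> \<le> v"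
  shows "fourier_coeff (Vmul V s (\<lambda>x. \<Sum>m\<in>S. c m * ech m x)) n =
    (\<Sum>m\<in>S. c m * fourier_coeff (\<lambda>x. of_real (V s x)) (n - m))"
proof -
  have sqV: "sq_integrable torus (\<lambda>x. complex_of_real (V s x))"
    using v potential_measurable[OF V, of s] by (intro sq_integrable_torusI[where C=v]) auto
  have "fourier_coeff (Vmul V s (\<lambda>x. \<Sum>m\<in>S. c m * ech m x)) n
    = (LINT x|torus. (\<Sum>m\<in>S. c m * (of_real (V s x) * cnj (ech (n - m) x))))"
  proof -
    have e: "cnj (ech (n - m) x) = ech m x * cnj (ech n x)" for m x
      by (simp add: cnj_ech ech_mult)
    show ?thesis unfolding fourier_coeff_ip ip_def Vmul_def e
      by (simp add: sum_distrib_left sum_distrib_right mult_ac)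
  qed
  also have "\<dots> = (\<Sum>m\<in>S. LINT x|torus. c m * (of_real (V s x) * cnj (ech (n - m) x)))"
    by (rule Bochner_Integration.integral_sum) (intro integrable_mult_right integrable_ip sqV sq_integrable_ech)
  also have "\<dots> = (\<Sum>m\<in>S. c m * fourier_coeff (\<lambda>x. of_real (V s x)) (n - m))"
    by (simp add: fourier_coeff_ip ip_def)
  finally show ?thesis .
qed

text \<open>Duhamel's formula between any two times, in the frame where the free phase \<open>cis (- P t n)\<close> is undone.\<close>

definition evol :: "(real \<Rightarrow> int \<Rightarrow> real) \<Rightarrow> (real \<Rightarrow> real \<Rightarrow> real) \<Rightarrow> (real \<Rightarrow> real \<Rightarrow> complex) \<Rightarrow> real \<Rightarrow> real \<Rightarrow> bool" where
  "evol P V w a b \<longleftrightarrow>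
     (\<forall>t\<in>{a..b}. sq_integrable torus (w t)) \<and>
     (\<forall>n. (\<lambda>s. cis (P s n) * fourier_coeff (Vmul V s (w s)) n) \<in> borel_measurable (tm a b)) \<and>
     (\<forall>n s t. a \<le> s \<longrightarrow> s \<le> t \<longrightarrow> t \<le> b \<longrightarrow>
        cis (P t n) * fourier_coeff (w t) n - cis (P s n) * fourier_coeff (w s) n =
        - \<i> * (LINT r|tm s t. cis (P r n) * fourier_coeff (Vmul V r (w r)) n))"

lemma measurable_tm_subset:
  assumes "f \<in> borel_measurable (tm a b)" "a \<le> c" "d \<le> b"
  shows "f \<in> borel_measurable (tm c d)"
proof -
  have "f \<in> borel_measurable (restrict_space (tm a b) {c..d})" using assms(1) by (rule measurable_restrict_space1)
  also have "restrict_space (tm a b) {c..d} = tm c d"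
    using assms(2,3) by (simp add: restrict_restrict_space inf_absorb2 Int_absorb1)
  finally show ?thesis .
qed

lemma evol_subset:
  assumes "evol P V w a b" "a \<le> c" "d \<le> b" shows "evol P V w c d"
  unfolding evol_def
proof (intro conjI allI impI ballI)
  show "(\<lambda>s. cis (P s n) * fourier_coeff (Vmul V s (w s)) n) \<in> borel_measurable (tm c d)" for n
    by (rule measurable_tm_subset[OF _ assms(2,3)]) (use assms(1) in \<open>simp add: evol_def\<close>)
qed (use assms in \<open>auto simp: evol_def\<close>)

text \<open>A phase constant in time may be removed. Each time step uses this to make the phases
  vanish at its beginning, so that no correction arises there.\<close>

lemma evol_shift:
  assumes "evol P V w a b" shows "evol (\<lambda>t n. P t n - c n) V w a b"
proof -
  have e: "cis (P t n - c n) * z = cis (- c n) * (cis (P t n) * z)" for t n z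
    by (simp add: cis_mult mult.assoc[symmetric])
  show ?thesis
    unfolding evol_def e integral_mult_right_zero
  proof (intro conjI allI impI ballI)
    fix n s t assume st: "a \<le> s" "s \<le> t" "t \<le> b"
    have "cis (P t n) * fourier_coeff (w t) n - cis (P s n) * fourier_coeff (w s) n =
        - \<i> * (LINT r|tm s t. cis (P r n) * fourier_coeff (Vmul V r (w r)) n)"
      using assms st unfolding evol_def by blast
    from arg_cong[OF this, of "\<lambda>z. cis (- c n) * z"]
    show "cis (- c n) * (cis (P t n) * fourier_coeff (w t) n) - cis (- c n) * (cis (P s n) * fourier_coeff (w s) n) =
        - \<i> * (cis (- c n) * (LINT r|tm s t. cis (P r n) * fourier_coeff (Vmul V r (w r)) n))"
      by (simp only: right_diff_distrib mult.left_commute)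
  next
    fix n
    have "(\<lambda>s. cis (P s n) * fourier_coeff (Vmul V s (w s)) n) \<in> borel_measurable (tm a b)"
      using assms unfolding evol_def by blast
    then show "(\<lambda>s. cis (- c n) * (cis (P s n) * fourier_coeff (Vmul V s (w s)) n)) \<in> borel_measurable (tm a b)"
      by measurable
  qed (use assms in \<open>auto simp: evol_def\<close>)
qed

text \<open>The bound is asked at every point instead of almost everywhere; the potential is
  truncated to fit.\<close>

locale bounded_potential =
  fixes V :: "real \<Rightarrow> real \<Rightarrow> real" and a b v :: real
  assumes V [measurable]: "meas_potential V" and vB: "\<And>s x. s \<in> {a..b} \<Longrightarrow> \<bar>V s x\<bar> \<le> v" and v0: "0 \<le> v"
begin

lemma Vmul_L2:
  assumes "sq_integrable torus f" "nrm torus f \<le> B" "s \<in> {a..b}"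
  shows "sq_integrable torus (Vmul V s f)" "nrm torus (Vmul V s f) \<le> v * B"
proof -
  show "sq_integrable torus (Vmul V s f)" by (rule sq_integrable_Vmul[OF V vB[OF assms(3)] assms(1)])
  have "nrm torus (Vmul V s f) \<le> v * nrm torus f" by (rule nrm_Vmul[OF V vB[OF assms(3)] assms(1)])
  also have "\<dots> \<le> v * B" using assms(2) v0 by (rule mult_left_mono)
  finally show "nrm torus (Vmul V s f) \<le> v * B" .
qed

lemma phased_L2:
  assumes "sq_integrable torus f"
  shows "sq_integrable zcount (\<lambda>n. cis (p n) * fourier_coeff f n)"
    "nrm zcount (\<lambda>n. cis (p n) * fourier_coeff f n) = nrm torus f"
proof -
  show "sq_integrable zcount (\<lambda>n. cis (p n) * fourier_coeff f n)"
    by (rule sq_integrable_zcountI[OF sq_integrable_fourier[OF assms]]) (simp add: norm_mult)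
  have "nrm zcount (\<lambda>n. cis (p n) * fourier_coeff f n) = nrm zcount (fourier_coeff f)"
    by (rule nrm_cong) (simp add: norm_mult)
  then show "nrm zcount (\<lambda>n. cis (p n) * fourier_coeff f n) = nrm torus f"
    by (simp add: nrm_fourier[OF assms])
qed

lemma force_bound:
  assumes "sq_integrable torus f" "nrm torus f \<le> B" "s \<in> {a..b}"
  shows "(\<integral>\<^sup>+n. ennreal ((cmod (cis (p n) * fourier_coeff (Vmul V s f) n))\<^sup>2) \<partial>zcount) \<le> ennreal ((v * B)\<^sup>2)"
  by (rule ennreal_nrm_sq_le)
    (simp_all only: phased_L2[OF Vmul_L2(1)[OF assms], of p] Vmul_L2(2)[OF assms])

lemma evol_increment:
  assumes w: "evol P V w a b" and B: "\<And>t. t \<in> {a..b} \<Longrightarrow> nrm torus (w t) \<le> B" "0 \<le> B"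
    and st: "a \<le> s" "s \<le> t" "t \<le> b"
  shows "sq_integrable zcount (\<lambda>n. cis (P t n) * fourier_coeff (w t) n - cis (P s n) * fourier_coeff (w s) n)"
    and "nrm zcount (\<lambda>n. cis (P t n) * fourier_coeff (w t) n - cis (P s n) * fourier_coeff (w s) n) \<le> (t - s) * (v * B)"
proof -
  have L2: "sq_integrable torus (w r)" if "r \<in> {a..b}" for r using w that by (auto simp: evol_def)
  have m: "(\<lambda>r. cis (P r n) * fourier_coeff (Vmul V r (w r)) n) \<in> borel_measurable (tm s t)" for n
    using w st by (auto simp: evol_def intro: measurable_tm_subset)
  have bd: "(\<integral>\<^sup>+n. ennreal ((cmod (cis (P r n) * fourier_coeff (Vmul V r (w r)) n))\<^sup>2) \<partial>zcount) \<le> ennreal ((v * B)\<^sup>2)"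
    if "r \<in> space (tm s t)" for r
    using that st by (intro force_bound L2 B) auto
  have vB0: "0 \<le> v * B" using v0 B by simp
  have mk: "sq_integrable zcount (\<lambda>n. LINT r|tm s t. cis (P r n) * fourier_coeff (Vmul V r (w r)) n)"
    "nrm zcount (\<lambda>n. LINT r|tm s t. cis (P r n) * fourier_coeff (Vmul V r (w r)) n) \<le> measure (tm s t) (space (tm s t)) * (v * B)"
    by (rule minkowski_zcount(2)[OF finite_measure_tm m bd vB0], assumption)
      (rule minkowski_zcount(3)[OF finite_measure_tm m bd vB0])
  have eq: "cis (P t n) * fourier_coeff (w t) n - cis (P s n) * fourier_coeff (w s) n
    = - \<i> * (LINT r|tm s t. cis (P r n) * fourier_coeff (Vmul V r (w r)) n)" for n
    using w st by (auto simp: evol_def)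
  show "sq_integrable zcount (\<lambda>n. cis (P t n) * fourier_coeff (w t) n - cis (P s n) * fourier_coeff (w s) n)"
    unfolding eq by (intro sq_integrable_cmult mk(1))
  show "nrm zcount (\<lambda>n. cis (P t n) * fourier_coeff (w t) n - cis (P s n) * fourier_coeff (w s) n) \<le> (t - s) * (v * B)"
    unfolding eq nrm_cmult using mk(2) measure_tm[of s t] st by simp
qed

text \<open>The first-order change of the squared norm is an imaginary part that vanishes at equal
  times by the symmetry of V. Hence increments are quadratic in the time difference and
  \<open>constant_if_quadratic\<close> applies. The bound \<open>B\<close> only has to exist; it
  does not enter the conclusion.\<close>

lemma evol_norm_conserved:
  assumes w: "evol P V w a b" and B: "\<And>t. t \<in> {a..b} \<Longrightarrow> nrm torus (w t) \<le> B" "0 \<le> B"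
    and t: "t \<in> {a..b}"
  shows "nrm torus (w t) = nrm torus (w a)"
proof -
  define \<zeta> where "\<zeta> r n = cis (P r n) * fourier_coeff (w r) n" for r n
  define F where "F r n = cis (P r n) * fourier_coeff (Vmul V r (w r)) n" for r n
  have L2: "sq_integrable torus (w r)" if "r \<in> {a..b}" for r using w that by (auto simp: evol_def)
  have \<zeta>: "sq_integrable zcount (\<zeta> r)" "nrm zcount (\<zeta> r) = nrm torus (w r)" if "r \<in> {a..b}" for r
    using phased_L2[OF L2[OF that], of "P r"] by (auto simp: \<zeta>_def[abs_def])
  have vB0: "0 \<le> v * B" using v0 B by simp
  have FL: "sq_integrable zcount (F r)" "nrm zcount (F r) \<le> v * B" if "r \<in> {a..b}" for r
    using phased_L2[OF Vmul_L2(1)[OF L2 B(1)], OF that that that, of "P r"] Vmul_L2(2)[OF L2 B(1), OF that that that]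
    by (auto simp: F_def[abs_def])
  have imag: "Im (ip zcount (\<zeta> r) (F r)) = 0" if r: "r \<in> {a..b}" for r
  proof -
    have "ip zcount (\<zeta> r) (F r) = ip zcount (fourier_coeff (w r)) (fourier_coeff (Vmul V r (w r)))"
      unfolding \<zeta>_def F_def by (rule ip_phase)
    also have "\<dots> = ip torus (w r) (Vmul V r (w r))"
      by (rule parseval_ip[OF L2[OF r] Vmul_L2(1)[OF L2[OF r] B(1)[OF r] r]])
    finally have e: "ip zcount (\<zeta> r) (F r) = ip torus (w r) (Vmul V r (w r))" .
    have "cnj (ip torus (w r) (Vmul V r (w r))) = ip torus (Vmul V r (w r)) (w r)" by (rule ip_commute[symmetric])
    also have "\<dots> = ip torus (w r) (Vmul V r (w r))" by (rule Vmul_symmetric)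
    finally have "cnj (ip torus (w r) (Vmul V r (w r))) = ip torus (w r) (Vmul V r (w r))" .
    from arg_cong[OF this, of Im] show ?thesis unfolding e by simp
  qed
  \<comment> \<open>Two of the three come from twice the real part of the first-order term, one from
    the squared norm of the increment.\<close>
  have "\<bar>(nrm torus (w t))\<^sup>2 - (nrm torus (w s))\<^sup>2\<bar> \<le> 3 * (v * B)\<^sup>2 * (t - s)\<^sup>2"
    if st: "a \<le> s" "s \<le> t" "t \<le> b" for s t
  proof -
    have s: "s \<in> {a..b}" and t: "t \<in> {a..b}" using st by auto
    define \<delta> where "\<delta> n = \<zeta> t n - \<zeta> s n" for n
    have \<delta>: "sq_integrable zcount \<delta>" "nrm zcount \<delta> \<le> (t - s) * (v * B)"
      using evol_increment[OF w B st] by (auto simp: \<delta>_def[abs_def] \<zeta>_def[abs_def])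
    have mF: "(\<lambda>r. F r n) \<in> borel_measurable (tm s t)" for n
      using w st by (auto simp: evol_def F_def intro: measurable_tm_subset)
    have bd: "(\<integral>\<^sup>+n. ennreal ((cmod (F r n))\<^sup>2) \<partial>zcount) \<le> ennreal ((v * B)\<^sup>2)" if "r \<in> space (tm s t)" for r
      unfolding F_def using that st by (intro force_bound L2 B) auto
    have ipi: "integrable (tm s t) (\<lambda>r. ip zcount (\<zeta> s) (F r))"
      "ip zcount (\<zeta> s) (\<lambda>n. LINT r|tm s t. F r n) = (LINT r|tm s t. ip zcount (\<zeta> s) (F r))"
      by (rule ip_zcount_integral(1)[OF finite_measure_tm mF bd vB0 \<zeta>(1)[OF s]], assumption)
        (rule ip_zcount_integral(2)[OF finite_measure_tm mF bd vB0 \<zeta>(1)[OF s]])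
    have \<delta>eq: "\<delta> = (\<lambda>n. - \<i> * (LINT r|tm s t. F r n))"
      using w st by (auto simp: evol_def \<delta>_def \<zeta>_def F_def fun_eq_iff)
    have "Re (ip zcount (\<zeta> s) \<delta>) = - Im (LINT r|tm s t. ip zcount (\<zeta> s) (F r))"
      unfolding \<delta>eq ip_cmult_right ipi(2) by simp
    also have "\<dots> = - (LINT r|tm s t. Im (ip zcount (\<zeta> s) (F r)))"
      using ipi(1) by (simp add: integral_Im)
    finally have Re: "Re (ip zcount (\<zeta> s) \<delta>) = \<dots>" .
    have "\<bar>LINT r|tm s t. Im (ip zcount (\<zeta> s) (F r))\<bar> \<le> (LINT r|tm s t. (t - s) * (v * B) * (v * B))"
    proof (rule order_trans[OF integral_abs_bound], rule integral_mono)
      interpret finite_measure "tm s t" by (rule finite_measure_tm)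
      show "integrable (tm s t) (\<lambda>r. \<bar>Im (ip zcount (\<zeta> s) (F r))\<bar>)"
        using ipi(1) by (intro integrable_abs integrable_Im)
      show "integrable (tm s t) (\<lambda>r. (t - s) * (v * B) * (v * B))" by simp
      fix r assume "r \<in> space (tm s t)"
      then have r: "r \<in> {a..b}" "s \<le> r" "r \<le> t" using st by auto
      have d: "sq_integrable zcount (\<lambda>n. \<zeta> r n - \<zeta> s n)" "nrm zcount (\<lambda>n. \<zeta> r n - \<zeta> s n) \<le> (r - s) * (v * B)"
        using evol_increment[OF w B, of s r] st r by (auto simp: \<zeta>_def[abs_def])
      \<comment> \<open>By \<open>imag\<close> the value at equal times drops out, so only the
        increment of \<open>\<zeta>\<close> between s and r remains; it supplies the second factor
        \<open>t - s\<close>.\<close>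
      have "Im (ip zcount (\<zeta> s) (F r)) = - Im (ip zcount (\<lambda>n. \<zeta> r n - \<zeta> s n) (F r))"
        using imag[OF r(1)] by (simp add: ip_diff_left[OF \<zeta>(1)[OF r(1)] \<zeta>(1)[OF s] FL(1)[OF r(1)]])
      then have "\<bar>Im (ip zcount (\<zeta> s) (F r))\<bar> \<le> cmod (ip zcount (\<lambda>n. \<zeta> r n - \<zeta> s n) (F r))"
        using abs_Im_le_cmod by simp
      also have "\<dots> \<le> nrm zcount (\<lambda>n. \<zeta> r n - \<zeta> s n) * nrm zcount (F r)"
        by (rule cauchy_schwarz_ip[OF d(1) FL(1)[OF r(1)]])
      also have "\<dots> \<le> ((t - s) * (v * B)) * (v * B)"
        using d(2) r FL(2)[OF r(1)] vB0 st by (intro mult_mono order_trans[OF d(2)] mult_right_mono) auto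
      finally show "\<bar>Im (ip zcount (\<zeta> s) (F r))\<bar> \<le> (t - s) * (v * B) * (v * B)" .
    qed
    also have "\<dots> = (v * B)\<^sup>2 * (t - s)\<^sup>2"
      using measure_tm[of s t] st by (simp add: power2_eq_square)
    finally have ReB: "\<bar>Re (ip zcount (\<zeta> s) \<delta>)\<bar> \<le> (v * B)\<^sup>2 * (t - s)\<^sup>2" unfolding Re by simp
    have "(nrm zcount \<delta>)\<^sup>2 \<le> ((t - s) * (v * B))\<^sup>2" using \<delta>(2) by (intro power_mono) auto
    then have dB: "(nrm zcount \<delta>)\<^sup>2 \<le> (v * B)\<^sup>2 * (t - s)\<^sup>2" by (simp only: power_mult_distrib mult_ac)
    have "(nrm zcount (\<zeta> t))\<^sup>2 = (nrm zcount (\<lambda>n. \<zeta> s n + \<delta> n))\<^sup>2" by (simp add: \<delta>_def)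
    also have "\<dots> = (nrm zcount (\<zeta> s))\<^sup>2 + 2 * Re (ip zcount (\<zeta> s) \<delta>) + (nrm zcount \<delta>)\<^sup>2"
      by (rule nrm_add_sq[OF \<zeta>(1)[OF s] \<delta>(1)])
    finally have "(nrm torus (w t))\<^sup>2 - (nrm torus (w s))\<^sup>2 = 2 * Re (ip zcount (\<zeta> s) \<delta>) + (nrm zcount \<delta>)\<^sup>2"
      by (simp add: \<zeta>(2)[OF s] \<zeta>(2)[OF t])
    then show ?thesis using ReB dB zero_le_power2[of "nrm zcount \<delta>"] unfolding mult.assoc by linarith
  qed
  then have "(nrm torus (w t))\<^sup>2 = (nrm torus (w a))\<^sup>2"
    by (rule constant_if_quadratic[where g="\<lambda>t. (nrm torus (w t))\<^sup>2"]) (use t in auto)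
  then show ?thesis by (simp add: power2_eq_iff_nonneg)
qed

end

section \<open>One time step\<close>

lemma cmod_cis_diff: "cmod (cis x - cis y) \<le> \<bar>x - y\<bar>"
proof -
  have "cis x - cis y = cis y * (cis (x - y) - 1)" by (simp add: right_diff_distrib cis_mult)
  then have e: "cmod (cis x - cis y) = cmod (cis (x - y) - 1)" by (simp add: norm_mult)
  define h where "h = (x - y) / 2"
  have z: "x - y = 2 * h" by (simp add: h_def)
  have "(cmod (cis (x - y) - 1))\<^sup>2 = (cos (2 * h) - 1)\<^sup>2 + (sin (2 * h))\<^sup>2" by (simp add: z cmod_power2)
  also have "\<dots> = ((cos (2 * h))\<^sup>2 + (sin (2 * h))\<^sup>2) + 1 - 2 * cos (2 * h)" unfolding power2_diff by simp
  also have "\<dots> = 4 * (sin h)\<^sup>2" by (simp only: sin_cos_squared_add2) (simp add: cos_double_sin)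
  also have "\<dots> \<le> 4 * h\<^sup>2"
    using abs_sin_x_le_abs_x[of h] by (simp add: abs_le_square_iff)
  also have "\<dots> = \<bar>x - y\<bar>\<^sup>2" by (simp add: z power_mult_distrib)
  finally show ?thesis unfolding e by (rule power2_le_imp_le) simp
qed

lemma nrm_split:
  assumes f: "sq_integrable zcount f"
  shows "nrm zcount f \<le> nrm zcount (\<lambda>n. if n \<in> S then f n else 0) + nrm zcount (\<lambda>n. if n \<in> S then 0 else f n)"
proof -
  have "nrm zcount f = nrm zcount (\<lambda>n. (if n \<in> S then f n else 0) + (if n \<in> S then 0 else f n))"
    by (rule nrm_cong) simp
  also have "\<dots> \<le> nrm zcount (\<lambda>n. if n \<in> S then f n else 0) + nrm zcount (\<lambda>n. if n \<in> S then 0 else f n)"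
    by (intro nrm_triangle sq_integrable_zcountI[OF f]) auto
  finally show ?thesis .
qed

lemma nrm_zcount_mono:
  "sq_integrable zcount g \<Longrightarrow> (\<And>n. cmod (f n) \<le> C * cmod (g n)) \<Longrightarrow> 0 \<le> C \<Longrightarrow> nrm zcount f \<le> C * nrm zcount g"
  by (rule nrm_bound) auto

text \<open>Turns an overlap seen in two different frames into the plain one. On \<open>S\<close>
  the frames nearly agree; off \<open>S\<close> their difference is at most 2 and only
  \<open>y\<close> has to be small there, so \<open>x\<close> may be rough. In the application
  \<open>y\<close> belongs to the transport equation.\<close>

lemma phase_mismatch:
  assumes x: "sq_integrable zcount x" "nrm zcount x \<le> 1" and y: "sq_integrable zcount y" "nrm zcount y \<le> 1"
    and \<mu>: "\<And>n. n \<in> S \<Longrightarrow> \<bar>P n - Q n\<bar> \<le> \<mu>" "0 \<le> \<mu>"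
  shows "cmod (ip zcount (\<lambda>n. cis (P n) * x n) (\<lambda>n. cis (Q n) * y n) - ip zcount x y)
    \<le> \<mu> + 2 * nrm zcount (\<lambda>n. if n \<in> S then 0 else y n)"
proof -
  define z where "z n = (cis (Q n - P n) - 1) * y n" for n
  have z2: "cmod (z n) \<le> 2 * cmod (y n)" for n
    unfolding z_def norm_mult using norm_triangle_ineq4[of "cis (Q n - P n)" 1] by (intro mult_right_mono) auto
  have zs: "sq_integrable zcount z"
    by (rule sq_integrable_zcountI[OF sq_integrable_cmult[OF y(1), of 2]]) (use z2 in \<open>simp add: norm_mult\<close>)
  have ys: "sq_integrable zcount (\<lambda>n. cis (Q n - P n) * y n)"
    by (rule sq_integrable_zcountI[OF y(1)]) (simp add: norm_mult)
  have "ip zcount (\<lambda>n. cis (P n) * x n) (\<lambda>n. cis (Q n) * y n)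
    = ip zcount (\<lambda>n. cis (P n) * x n) (\<lambda>n. cis (P n) * (cis (Q n - P n) * y n))"
    by (simp add: cis_mult mult.assoc[symmetric])
  also have "\<dots> = ip zcount x (\<lambda>n. cis (Q n - P n) * y n)" by (rule ip_phase)
  finally have "ip zcount (\<lambda>n. cis (P n) * x n) (\<lambda>n. cis (Q n) * y n) - ip zcount x y = ip zcount x z"
    using ip_diff_right[OF ys y(1) x(1)] by (simp add: z_def[abs_def] left_diff_distrib)
  then have "cmod (ip zcount (\<lambda>n. cis (P n) * x n) (\<lambda>n. cis (Q n) * y n) - ip zcount x y) \<le> nrm zcount x * nrm zcount z"
    using cauchy_schwarz_ip[OF x(1) zs] by simp
  also have "\<dots> \<le> 1 * nrm zcount z" using x(2) by (intro mult_right_mono) auto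
  also have "nrm zcount z \<le> nrm zcount (\<lambda>n. if n \<in> S then z n else 0) + nrm zcount (\<lambda>n. if n \<in> S then 0 else z n)"
    by (rule nrm_split[OF zs])
  also have "nrm zcount (\<lambda>n. if n \<in> S then z n else 0) \<le> \<mu> * nrm zcount y"
  proof (rule nrm_zcount_mono[OF y(1) _ \<mu>(2)])
    fix n
    have "cmod (cis (Q n - P n) - cis 0) \<le> \<mu>" if "n \<in> S"
      using cmod_cis_diff[of "Q n - P n" 0] \<mu>(1)[OF that] by linarith
    then show "cmod (if n \<in> S then z n else 0) \<le> \<mu> * cmod (y n)"
      using \<mu>(2) by (auto simp: z_def norm_mult intro!: mult_right_mono)
  qed
  also have "\<dots> \<le> \<mu> * 1" using y(2) \<mu>(2) by (rule mult_left_mono)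
  also have "nrm zcount (\<lambda>n. if n \<in> S then 0 else z n) \<le> 2 * nrm zcount (\<lambda>n. if n \<in> S then 0 else y n)"
    by (rule nrm_zcount_mono[OF sq_integrable_zcountI[OF y(1)]]) (use z2 in auto)
  finally show ?thesis by simp
qed

section \<open>First-order expansion of the overlap over one interval\<close>

context bounded_potential
begin

text \<open>The free wave with initial coefficients \<open>c\<close> restricted to \<open>S\<close>;
  after its phases are undone it is constant in time.\<close>

definition free :: "(real \<Rightarrow> int \<Rightarrow> real) \<Rightarrow> int set \<Rightarrow> (int \<Rightarrow> complex) \<Rightarrow> real \<Rightarrow> real \<Rightarrow> complex" where
  "free P S c s = (\<lambda>x. \<Sum>m\<in>S. (cis (- P s m) * c m) * ech m x)"

text \<open>The first Born term of Duhamel's formula without its factor \<open>-\<i>\<close>: the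
  force acts on the free wave instead of the solution.\<close>

definition first_order :: "(real \<Rightarrow> int \<Rightarrow> real) \<Rightarrow> int set \<Rightarrow> (int \<Rightarrow> complex) \<Rightarrow> int \<Rightarrow> complex" where
  "first_order P S c n = (LINT s|tm a b. cis (P s n) * fourier_coeff (Vmul V s (free P S c s)) n)"

lemma free_L2 [simp]: "sq_integrable torus (free P S c s)"
  unfolding free_def by (rule sq_integrable_trig)

lemma fourier_free: "finite S \<Longrightarrow> fourier_coeff (free P S c s) n = cis (- P s n) * (if n \<in> S then c n else 0)"
  unfolding free_def by (simp add: fourier_coeff_trig)

lemma nrm_free: "finite S \<Longrightarrow> nrm torus (free P S c s) = nrm zcount (\<lambda>n. if n \<in> S then c n else 0)"
  by (subst nrm_fourier[OF free_L2, symmetric]) (rule nrm_cong, simp add: fourier_free norm_mult)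

lemma free_force_measurable:
  assumes [measurable]: "\<And>n. (\<lambda>s. P s n) \<in> borel_measurable (tm a b)"
  shows "(\<lambda>s. cis (P s n) * fourier_coeff (Vmul V s (free P S c s)) n) \<in> borel_measurable (tm a b)"
proof -
  have [measurable]: "(\<lambda>s. fourier_coeff (\<lambda>x. of_real (V s x)) m) \<in> borel_measurable (tm a b)" for m
    by (rule measurable_tm[OF fourier_potential_measurable[OF V]])
  have "(\<lambda>s. cis (P s n) * (\<Sum>m\<in>S. (cis (- P s m) * c m) * fourier_coeff (\<lambda>x. of_real (V s x)) (n - m)))
    \<in> borel_measurable (tm a b)" by measurable
  also have "?this \<longleftrightarrow> ?thesis"
    by (rule measurable_cong) (simp add: free_def fourier_Vmul_trig[OF V vB])
  finally show ?thesis .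
qed

text \<open>With increments \<open>\<beta>\<close> of \<open>u\<close> and \<open>\<gamma>\<close>
  of \<open>g\<close>, the overlap changes by
  \<open><\<beta>, c> + <u a, \<gamma>> + <\<beta>, \<gamma>>\<close>. Symmetry of V carries the
  force in the first term from \<open>u\<close> to the free wave moving with the phases of
  \<open>u\<close>; the second contains the free wave moving with the phases of \<open>g\<close>,
  with the opposite sign. Thus the rough function \<open>u a\<close> meets only the difference of
  two first-order terms of the same low-frequency data. The three \<open>e^2\<close> are the product
  of the increments, the motion of \<open>u\<close> and the motion of \<open>g\<close> during the
  step; the two \<open>e * \<rho>\<close> come from cutting \<open>c\<close> to
  \<open>S\<close>.\<close>

lemma step_estimate:
  assumes ab: "a \<le> b" and u: "evol P V u a b" and g: "evol Q V g a b"
    and nu: "\<And>t. t \<in> {a..b} \<Longrightarrow> nrm torus (u t) \<le> 1" and ng: "\<And>t. t \<in> {a..b} \<Longrightarrow> nrm torus (g t) \<le> 1"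
    and P0: "\<And>n. P a n = 0" and Q0: "\<And>n. Q a n = 0"
    and Pm: "\<And>n. (\<lambda>s. P s n) \<in> borel_measurable (tm a b)" and Qm: "\<And>n. (\<lambda>s. Q s n) \<in> borel_measurable (tm a b)"
    and S: "finite S"
  defines "c \<equiv> fourier_coeff (g a)"
  defines "\<rho> \<equiv> nrm zcount (\<lambda>n. if n \<in> S then 0 else c n)"
  defines "e \<equiv> (b - a) * v"
  shows "cmod (ip zcount (\<lambda>n. cis (P b n) * fourier_coeff (u b) n) (\<lambda>n. cis (Q b n) * fourier_coeff (g b) n) - ip torus (u a) (g a))
    \<le> 3 * e\<^sup>2 + 2 * e * \<rho> + nrm zcount (\<lambda>n. first_order P S c n - first_order Q S c n)"
proof -
  interpret T: finite_measure "tm a b" by (rule finite_measure_tm)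
  have a: "a \<in> {a..b}" using ab by simp
  have e0: "0 \<le> e" using ab v0 by (simp add: e_def)
  define Y where "Y n = (if n \<in> S then c n else 0)" for n
  define \<zeta>u where "\<zeta>u t n = cis (P t n) * fourier_coeff (u t) n" for t n
  define \<zeta>g where "\<zeta>g t n = cis (Q t n) * fourier_coeff (g t) n" for t n
  define Fu where "Fu s n = cis (P s n) * fourier_coeff (Vmul V s (u s)) n" for s n
  define Fg where "Fg s n = cis (Q s n) * fourier_coeff (Vmul V s (g s)) n" for s n
  define FP where "FP s n = cis (P s n) * fourier_coeff (Vmul V s (free P S c s)) n" for s n
  define FQ where "FQ s n = cis (Q s n) * fourier_coeff (Vmul V s (free Q S c s)) n" for s n
  define \<beta> where "\<beta> n = \<zeta>u b n - \<zeta>u a n" for n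
  define \<gamma> where "\<gamma> n = \<zeta>g b n - \<zeta>g a n" for n
  have uL: "sq_integrable torus (u t)" and gL: "sq_integrable torus (g t)" if "t \<in> {a..b}" for t
    using u g that by (auto simp: evol_def)
  have \<zeta>uL: "sq_integrable zcount (\<zeta>u t)" "nrm zcount (\<zeta>u t) \<le> 1" if "t \<in> {a..b}" for t
    unfolding \<zeta>u_def using phased_L2[OF uL[OF that], of "P t"] nu[OF that] by auto
  have \<zeta>gL: "sq_integrable zcount (\<zeta>g t)" "nrm zcount (\<zeta>g t) \<le> 1" if "t \<in> {a..b}" for t
    unfolding \<zeta>g_def using phased_L2[OF gL[OF that], of "Q t"] ng[OF that] by auto
  have \<zeta>ua: "\<zeta>u a = fourier_coeff (u a)" and \<zeta>ga: "\<zeta>g a = c"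
    by (auto simp: \<zeta>u_def \<zeta>g_def P0 Q0 c_def fun_eq_iff)
  have cL: "sq_integrable zcount c" "nrm zcount c \<le> 1" using \<zeta>gL[OF a] by (auto simp: \<zeta>ga)
  have YL: "sq_integrable zcount Y" by (rule sq_integrable_zcountI[OF cL(1)]) (auto simp: Y_def)
  have Y1: "nrm zcount Y \<le> 1"
    using nrm_mono[OF cL(1), of Y] cL(2) by (force simp: Y_def)
  have cYL: "sq_integrable zcount (\<lambda>n. c n - Y n)" by (intro sq_integrable_diff cL YL)
  have cY: "nrm zcount (\<lambda>n. c n - Y n) = \<rho>"
    unfolding \<rho>_def by (rule nrm_cong) (auto simp: Y_def)
  have \<rho>0: "0 \<le> \<rho>" by (simp add: \<rho>_def)
  have fP: "nrm torus (free P S c s) \<le> 1" and fQ: "nrm torus (free Q S c s) \<le> 1" for s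
    using Y1 S by (simp_all add: nrm_free Y_def[abs_def])
  have incu: "sq_integrable zcount (\<lambda>n. \<zeta>u t n - \<zeta>u a n)" "nrm zcount (\<lambda>n. \<zeta>u t n - \<zeta>u a n) \<le> e"
    and incg: "sq_integrable zcount (\<lambda>n. \<zeta>g t n - \<zeta>g a n)" "nrm zcount (\<lambda>n. \<zeta>g t n - \<zeta>g a n) \<le> e"
    if t: "t \<in> {a..b}" for t
  proof -
    have le: "(t - a) * (v * 1) \<le> e" using t v0 by (auto simp: e_def intro!: mult_right_mono)
    have at: "a \<le> a" "a \<le> t" "t \<le> b" using t by auto
    show "sq_integrable zcount (\<lambda>n. \<zeta>u t n - \<zeta>u a n)" "sq_integrable zcount (\<lambda>n. \<zeta>g t n - \<zeta>g a n)"
      unfolding \<zeta>u_def \<zeta>g_def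
      by (rule evol_increment(1)[OF u nu zero_le_one at], assumption)
        (rule evol_increment(1)[OF g ng zero_le_one at])
    show "nrm zcount (\<lambda>n. \<zeta>u t n - \<zeta>u a n) \<le> e"
      unfolding \<zeta>u_def by (rule order_trans[OF evol_increment(2)[OF u nu zero_le_one at] le])
    show "nrm zcount (\<lambda>n. \<zeta>g t n - \<zeta>g a n) \<le> e"
      unfolding \<zeta>g_def by (rule order_trans[OF evol_increment(2)[OF g ng zero_le_one at] le])
  qed
  have b: "b \<in> {a..b}" using ab by simp
  have \<beta>L: "sq_integrable zcount \<beta>" "nrm zcount \<beta> \<le> e" and \<gamma>L: "sq_integrable zcount \<gamma>" "nrm zcount \<gamma> \<le> e"
    using incu[OF b] incg[OF b] by (auto simp: \<beta>_def[abs_def] \<gamma>_def[abs_def])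
  have FL: "sq_integrable zcount (\<lambda>n. cis (p n) * fourier_coeff (Vmul V s f) n)"
    "nrm zcount (\<lambda>n. cis (p n) * fourier_coeff (Vmul V s f) n) \<le> v * B"
    if "sq_integrable torus f" "nrm torus f \<le> B" "s \<in> {a..b}" for p s f B
    using phased_L2[OF Vmul_L2(1)[OF that], of p] Vmul_L2(2)[OF that] by auto
  have mFu: "(\<lambda>s. Fu s n) \<in> borel_measurable (tm a b)" for n using u by (auto simp: evol_def Fu_def)
  have mFg: "(\<lambda>s. Fg s n) \<in> borel_measurable (tm a b)" for n using g by (auto simp: evol_def Fg_def)
  have mFP: "(\<lambda>s. FP s n) \<in> borel_measurable (tm a b)" for n
    unfolding FP_def by (rule free_force_measurable[OF Pm])
  have mFQ: "(\<lambda>s. FQ s n) \<in> borel_measurable (tm a b)" for n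
    unfolding FQ_def by (rule free_force_measurable[OF Qm])
  have bFu: "\<forall>s\<in>space (tm a b). (\<integral>\<^sup>+n. ennreal ((cmod (Fu s n))\<^sup>2) \<partial>zcount) \<le> ennreal ((v * 1)\<^sup>2)"
    unfolding Fu_def using force_bound[OF uL nu] by simp
  have bFP: "\<forall>s\<in>space (tm a b). (\<integral>\<^sup>+n. ennreal ((cmod (FP s n))\<^sup>2) \<partial>zcount) \<le> ennreal ((v * 1)\<^sup>2)"
    unfolding FP_def using force_bound[OF free_L2 fP] by simp
  have bFg: "\<forall>s\<in>space (tm a b). (\<integral>\<^sup>+n. ennreal ((cmod (Fg s n))\<^sup>2) \<partial>zcount) \<le> ennreal ((v * 1)\<^sup>2)"
    unfolding Fg_def using force_bound[OF gL ng] by simp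
  have bFQ: "\<forall>s\<in>space (tm a b). (\<integral>\<^sup>+n. ennreal ((cmod (FQ s n))\<^sup>2) \<partial>zcount) \<le> ennreal ((v * 1)\<^sup>2)"
    unfolding FQ_def using force_bound[OF free_L2 fQ] by simp
  have v1: "0 \<le> v * 1" using v0 by simp
  have qP: "first_order P S c = (\<lambda>n. LINT s|tm a b. FP s n)" and qQ: "first_order Q S c = (\<lambda>n. LINT s|tm a b. FQ s n)"
    by (auto simp: first_order_def FP_def FQ_def fun_eq_iff)
  have qPL: "sq_integrable zcount (first_order P S c)"
    unfolding qP by (rule minkowski_zcount(2)[OF finite_measure_tm mFP bFP[rule_format] v1])
  have qQL: "sq_integrable zcount (first_order Q S c)"
    unfolding qQ by (rule minkowski_zcount(2)[OF finite_measure_tm mFQ bFQ[rule_format] v1])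
  have ipU: "integrable (tm a b) (\<lambda>s. ip zcount (\<zeta>u a) (FP s))"
    "ip zcount (\<zeta>u a) (first_order P S c) = (LINT s|tm a b. ip zcount (\<zeta>u a) (FP s))"
    unfolding qP
    by (rule ip_zcount_integral(1)[OF finite_measure_tm mFP bFP[rule_format] v1 \<zeta>uL(1)[OF a]], assumption)
      (rule ip_zcount_integral(2)[OF finite_measure_tm mFP bFP[rule_format] v1 \<zeta>uL(1)[OF a]])
  have ipY: "integrable (tm a b) (\<lambda>s. ip zcount Y (Fu s))"
    "ip zcount Y (\<lambda>n. LINT s|tm a b. Fu s n) = (LINT s|tm a b. ip zcount Y (Fu s))"
    by (rule ip_zcount_integral(1)[OF finite_measure_tm mFu bFu[rule_format] v1 YL], assumption)
      (rule ip_zcount_integral(2)[OF finite_measure_tm mFu bFu[rule_format] v1 YL])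
  have \<beta>eq: "\<beta> = (\<lambda>n. - \<i> * (LINT s|tm a b. Fu s n))"
    using u ab by (auto simp: evol_def \<beta>_def \<zeta>u_def Fu_def fun_eq_iff)
  have \<gamma>eq: "\<gamma> = (\<lambda>n. - \<i> * (LINT s|tm a b. Fg s n))"
    using g ab by (auto simp: evol_def \<gamma>_def \<zeta>g_def Fg_def fun_eq_iff)
  \<comment> \<open>\<open>Y\<close> is the free wave seen in the frame of \<open>P\<close>, so
    passing back to the torus allows V to be moved to the other factor.\<close>
  have Ysym: "ip zcount (Fu s) Y = ip zcount (\<zeta>u s) (FP s)" if s: "s \<in> {a..b}" for s
  proof -
    have y: "Y n = cis (P s n) * fourier_coeff (free P S c s) n" for n
      using S by (simp add: fourier_free Y_def cis_mult mult.assoc[symmetric])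
    have "ip zcount (Fu s) Y = ip zcount (fourier_coeff (Vmul V s (u s))) (fourier_coeff (free P S c s))"
      unfolding Fu_def y by (rule ip_phase)
    also have "\<dots> = ip torus (Vmul V s (u s)) (free P S c s)"
      by (rule parseval_ip[OF Vmul_L2(1)[OF uL[OF s] nu[OF s] s] free_L2])
    also have "\<dots> = ip torus (u s) (Vmul V s (free P S c s))" by (rule Vmul_symmetric)
    also have "\<dots> = ip zcount (fourier_coeff (u s)) (fourier_coeff (Vmul V s (free P S c s)))"
      by (rule parseval_ip[OF uL[OF s] Vmul_L2(1)[OF free_L2 fP s], symmetric])
    also have "\<dots> = ip zcount (\<zeta>u s) (FP s)"
      unfolding \<zeta>u_def FP_def by (rule ip_phase[symmetric])
    finally show ?thesis .
  qed
  have \<beta>Y: "ip zcount \<beta> Y = - \<i> * (LINT s|tm a b. ip zcount (\<zeta>u s) (FP s))"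
    and intY: "integrable (tm a b) (\<lambda>s. ip zcount (\<zeta>u s) (FP s))"
  proof -
    have c: "ip zcount (\<zeta>u s) (FP s) = cnj (ip zcount Y (Fu s))" if "s \<in> space (tm a b)" for s
      using Ysym[of s] that ip_commute[of zcount "Fu s" Y] by simp
    have "integrable (tm a b) (\<lambda>s. cnj (ip zcount Y (Fu s)))" using ipY(1) by (rule integrable_cnj)
    then show "integrable (tm a b) (\<lambda>s. ip zcount (\<zeta>u s) (FP s))"
      using c by (subst Bochner_Integration.integrable_cong[OF refl c])
    have "ip zcount \<beta> Y = - \<i> * cnj (ip zcount Y (\<lambda>n. LINT s|tm a b. Fu s n))"
      unfolding \<beta>eq ip_cmult_left by (subst ip_commute) (rule refl)
    also have "\<dots> = - \<i> * (LINT s|tm a b. cnj (ip zcount Y (Fu s)))"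
      unfolding ipY(2) Bochner_Integration.integral_cnj ..
    also have "(LINT s|tm a b. cnj (ip zcount Y (Fu s))) = (LINT s|tm a b. ip zcount (\<zeta>u s) (FP s))"
      by (rule Bochner_Integration.integral_cong[OF refl]) (simp add: c)
    finally show "ip zcount \<beta> Y = - \<i> * (LINT s|tm a b. ip zcount (\<zeta>u s) (FP s))" .
  qed
  \<comment> \<open>\<open>u\<close> is frozen at its initial value inside the time integral: its
    increment is at most \<open>e\<close> and the force at most \<open>v\<close>, over a length
    \<open>b - a\<close>.\<close>
  have E3: "cmod (ip zcount \<beta> Y + \<i> * ip zcount (\<zeta>u a) (first_order P S c)) \<le> e\<^sup>2"
  proof -
    have "ip zcount \<beta> Y + \<i> * ip zcount (\<zeta>u a) (first_order P S c)
      = - \<i> * (LINT s|tm a b. ip zcount (\<zeta>u s) (FP s) - ip zcount (\<zeta>u a) (FP s))"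
      unfolding \<beta>Y ipU(2) Bochner_Integration.integral_diff[OF intY ipU(1)] by (simp add: algebra_simps)
    then have "cmod (ip zcount \<beta> Y + \<i> * ip zcount (\<zeta>u a) (first_order P S c))
      = cmod (LINT s|tm a b. ip zcount (\<zeta>u s) (FP s) - ip zcount (\<zeta>u a) (FP s))" by (simp add: norm_mult)
    also have "\<dots> \<le> (LINT s|tm a b. cmod (ip zcount (\<zeta>u s) (FP s) - ip zcount (\<zeta>u a) (FP s)))"
      by (rule integral_norm_bound)
    also have "\<dots> \<le> (LINT s|tm a b. e * v)"
    proof (rule integral_mono)
      show "integrable (tm a b) (\<lambda>s. cmod (ip zcount (\<zeta>u s) (FP s) - ip zcount (\<zeta>u a) (FP s)))"
        by (intro integrable_norm Bochner_Integration.integrable_diff intY ipU(1))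
      fix s assume "s \<in> space (tm a b)"
      then have s: "s \<in> {a..b}" by simp
      note F = FL[OF free_L2 fP s, of "P s"]
      have "cmod (ip zcount (\<zeta>u s) (FP s) - ip zcount (\<zeta>u a) (FP s)) = cmod (ip zcount (\<lambda>n. \<zeta>u s n - \<zeta>u a n) (FP s))"
        using F(1) by (subst ip_diff_left[OF \<zeta>uL(1)[OF s] \<zeta>uL(1)[OF a]]) (simp_all add: FP_def[abs_def])
      also have "\<dots> \<le> nrm zcount (\<lambda>n. \<zeta>u s n - \<zeta>u a n) * nrm zcount (FP s)"
        using F(1) by (intro cauchy_schwarz_ip incu[OF s]) (simp add: FP_def[abs_def])
      also have "\<dots> \<le> e * v"
        using incu(2)[OF s] F(2) e0 by (intro mult_mono) (auto simp: FP_def[abs_def])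
      finally show "cmod (ip zcount (\<zeta>u s) (FP s) - ip zcount (\<zeta>u a) (FP s)) \<le> e * v" .
    qed simp
    also have "\<dots> = e\<^sup>2" using measure_tm[OF ab] by (simp add: e_def power2_eq_square)
    finally show ?thesis .
  qed
  \<comment> \<open>The error of replacing \<open>g\<close> in its own force by the free wave of its
    low part: the motion of \<open>g\<close> contributes \<open>e\<close>, the discarded frequencies
    \<rho>.\<close>
  define R where "R n = (LINT s|tm a b. Fg s n - FQ s n)" for n
  have bd: "(\<integral>\<^sup>+n. ennreal ((cmod (Fg s n - FQ s n))\<^sup>2) \<partial>zcount) \<le> ennreal ((v * (e + \<rho>))\<^sup>2)"
    if "s \<in> space (tm a b)" for s
  proof -
    have s: "s \<in> {a..b}" using that by simp
    let ?d = "\<lambda>x. g s x - free Q S c s x"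
    have dL: "sq_integrable torus ?d" by (intro sq_integrable_diff gL[OF s] free_L2)
    have "nrm torus ?d = nrm zcount (\<lambda>n. cis (Q s n) * fourier_coeff ?d n)"
      by (rule phased_L2(2)[OF dL, symmetric])
    also have "\<dots> = nrm zcount (\<lambda>n. (\<zeta>g s n - \<zeta>g a n) + (c n - Y n))"
    proof (rule nrm_cong)
      fix n
      have "cis (Q s n) * fourier_coeff ?d n = cis (Q s n) * fourier_coeff (g s) n - (cis (Q s n) * cis (- Q s n)) * Y n"
        using S by (simp add: fourier_coeff_diff[OF gL[OF s] free_L2] fourier_free right_diff_distrib Y_def mult.assoc)
      then show "cmod (cis (Q s n) * fourier_coeff ?d n) = cmod ((\<zeta>g s n - \<zeta>g a n) + (c n - Y n))"
        by (simp add: cis_mult \<zeta>ga) (simp add: \<zeta>g_def)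
    qed
    also have "\<dots> \<le> nrm zcount (\<lambda>n. \<zeta>g s n - \<zeta>g a n) + nrm zcount (\<lambda>n. c n - Y n)"
      by (rule nrm_triangle[OF incg(1)[OF s] cYL])
    also have "\<dots> \<le> e + \<rho>" using incg(2)[OF s] cY by simp
    finally have d: "nrm torus ?d \<le> e + \<rho>" .
    have V: "Vmul V s ?d = (\<lambda>x. Vmul V s (g s) x - Vmul V s (free Q S c s) x)"
      by (simp add: Vmul_def right_diff_distrib)
    have "Fg s n - FQ s n = cis (Q s n) * fourier_coeff (Vmul V s ?d) n" for n
      unfolding V using fourier_coeff_diff[OF Vmul_L2(1)[OF gL[OF s] ng[OF s] s] Vmul_L2(1)[OF free_L2 fQ s]]
      by (simp add: Fg_def FQ_def right_diff_distrib)
    then show ?thesis using force_bound[OF dL d s, of "Q s"] by simp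
  qed
  have v2: "0 \<le> v * (e + \<rho>)" using v0 e0 \<rho>0 by simp
  have mR: "(\<lambda>s. Fg s n - FQ s n) \<in> borel_measurable (tm a b)" for n using mFg mFQ by measurable
  have RL: "sq_integrable zcount R" unfolding R_def
    by (rule minkowski_zcount(2)[OF finite_measure_tm mR bd v2])
  have Rn: "nrm zcount R \<le> measure (tm a b) (space (tm a b)) * (v * (e + \<rho>))" unfolding R_def
    by (rule minkowski_zcount(3)[OF finite_measure_tm mR bd v2])
  have Rn': "nrm zcount R \<le> e * (e + \<rho>)"
    using Rn measure_tm[OF ab] by (simp add: e_def mult.assoc)
  have iFg: "integrable (tm a b) (\<lambda>s. Fg s n)" for n
    by (rule minkowski_zcount(1)[OF finite_measure_tm mFg bFg[rule_format] v1])
  have iFQ: "integrable (tm a b) (\<lambda>s. FQ s n)" for n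
    by (rule minkowski_zcount(1)[OF finite_measure_tm mFQ bFQ[rule_format] v1])
  have \<gamma>R: "\<gamma> = (\<lambda>n. - \<i> * (first_order Q S c n + R n))"
    unfolding \<gamma>eq qQ R_def using Bochner_Integration.integral_diff[OF iFg iFQ] by simp
  have U\<gamma>: "ip zcount (\<zeta>u a) \<gamma> = \<i> * ip zcount (\<zeta>u a) (first_order Q S c) + \<i> * ip zcount (\<zeta>u a) R"
    unfolding \<gamma>R ip_cmult_right by (simp add: ip_add_right[OF qQL RL \<zeta>uL(1)[OF a]] distrib_left)
  have E4: "cmod (ip zcount (\<zeta>u a) R) \<le> e * (e + \<rho>)"
  proof -
    have "cmod (ip zcount (\<zeta>u a) R) \<le> nrm zcount (\<zeta>u a) * nrm zcount R" by (rule cauchy_schwarz_ip[OF \<zeta>uL(1)[OF a] RL])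
    also have "\<dots> \<le> 1 * nrm zcount R" using \<zeta>uL(2)[OF a] by (intro mult_right_mono) auto
    finally show ?thesis using Rn' by simp
  qed
  define q where "q n = first_order P S c n - first_order Q S c n" for n
  have qL: "sq_integrable zcount q" unfolding q_def by (intro sq_integrable_diff qPL qQL)
  have E5: "cmod (ip zcount (\<zeta>u a) q) \<le> nrm zcount q"
  proof -
    have "cmod (ip zcount (\<zeta>u a) q) \<le> nrm zcount (\<zeta>u a) * nrm zcount q" by (rule cauchy_schwarz_ip[OF \<zeta>uL(1)[OF a] qL])
    also have "\<dots> \<le> 1 * nrm zcount q" using \<zeta>uL(2)[OF a] by (intro mult_right_mono) auto
    finally show ?thesis by simp
  qed
  have E1: "cmod (ip zcount \<beta> \<gamma>) \<le> e\<^sup>2"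
  proof -
    have "cmod (ip zcount \<beta> \<gamma>) \<le> nrm zcount \<beta> * nrm zcount \<gamma>" by (rule cauchy_schwarz_ip[OF \<beta>L(1) \<gamma>L(1)])
    also have "\<dots> \<le> e * e" using \<beta>L(2) \<gamma>L(2) e0 by (intro mult_mono) auto
    finally show ?thesis by (simp add: power2_eq_square)
  qed
  have E2: "cmod (ip zcount \<beta> (\<lambda>n. c n - Y n)) \<le> e * \<rho>"
  proof -
    have "cmod (ip zcount \<beta> (\<lambda>n. c n - Y n)) \<le> nrm zcount \<beta> * nrm zcount (\<lambda>n. c n - Y n)"
      by (rule cauchy_schwarz_ip[OF \<beta>L(1) cYL])
    also have "\<dots> \<le> e * \<rho>" unfolding cY using \<beta>L(2) \<rho>0 by (rule mult_right_mono)
    finally show ?thesis .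
  qed
  have "ip zcount (\<zeta>u b) (\<zeta>g b) = ip zcount (\<lambda>n. \<zeta>u a n + \<beta> n) (\<lambda>n. c n + \<gamma> n)"
    by (simp add: \<beta>_def \<gamma>_def \<zeta>ga)
  also have "\<dots> = ip zcount (\<zeta>u a) c + ip zcount (\<zeta>u a) \<gamma> + (ip zcount \<beta> c + ip zcount \<beta> \<gamma>)"
    by (simp add: ip_add_left ip_add_right sq_integrable_add \<zeta>uL(1)[OF a] \<beta>L(1) cL(1) \<gamma>L(1))
  also have "ip zcount \<beta> c = ip zcount \<beta> Y + ip zcount \<beta> (\<lambda>n. c n - Y n)"
    using ip_add_right[OF YL cYL \<beta>L(1)] by simp
  also have "ip zcount (\<zeta>u a) c = ip torus (u a) (g a)"
    unfolding \<zeta>ua c_def by (rule parseval_ip[OF uL[OF a] gL[OF a]])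
  finally have "ip zcount (\<zeta>u b) (\<zeta>g b) - ip torus (u a) (g a)
     = (ip zcount \<beta> Y + \<i> * ip zcount (\<zeta>u a) (first_order P S c)) + - \<i> * ip zcount (\<zeta>u a) q
       + \<i> * ip zcount (\<zeta>u a) R + ip zcount \<beta> (\<lambda>n. c n - Y n) + ip zcount \<beta> \<gamma>"
    unfolding U\<gamma> q_def ip_diff_right[OF qPL qQL \<zeta>uL(1)[OF a]] by (simp add: algebra_simps)
  then have "cmod (ip zcount (\<zeta>u b) (\<zeta>g b) - ip torus (u a) (g a))
     \<le> cmod (ip zcount \<beta> Y + \<i> * ip zcount (\<zeta>u a) (first_order P S c)) + cmod (- \<i> * ip zcount (\<zeta>u a) q)
       + cmod (\<i> * ip zcount (\<zeta>u a) R) + cmod (ip zcount \<beta> (\<lambda>n. c n - Y n)) + cmod (ip zcount \<beta> \<gamma>)"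
    by (metis (no_types, lifting) norm_triangle_le add_mono norm_triangle_ineq order_refl)
  also have "\<dots> \<le> e\<^sup>2 + nrm zcount q + e * (e + \<rho>) + e * \<rho> + e\<^sup>2"
    using E1 E2 E3 E4 E5 by (intro add_mono) (simp_all add: norm_mult)
  also have "\<dots> = 3 * e\<^sup>2 + 2 * e * \<rho> + nrm zcount q" by (simp add: power2_eq_square algebra_simps)
  finally show ?thesis unfolding \<zeta>u_def \<zeta>g_def q_def .
qed

lemma fourier_potential_bound:
  assumes "s \<in> {a..b}" shows "cmod (fourier_coeff (\<lambda>x. of_real (V s x)) n) \<le> v"
proof -
  have "sq_integrable torus (\<lambda>x. complex_of_real (V s x))" "nrm torus (\<lambda>x. complex_of_real (V s x)) \<le> v"
    using vB[OF assms] v0 potential_measurable[OF V, of s] by (intro nrm_le_const[OF prob_space_torus]; auto)+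
  moreover have "nrm torus (ech n) = 1" using torus.prob_space by (simp add: nrm_def)
  ultimately show ?thesis
    using cauchy_schwarz_ip[of torus "\<lambda>x. complex_of_real (V s x)" "ech n"] by (simp add: fourier_coeff_ip)
qed

text \<open>Outgoing frequencies in \<open>S'\<close> and incoming ones in \<open>S\<close>, a
  subset of \<open>S'\<close>, both have nearly equal phases, which costs \<mu> twice. Outside
  \<open>S'\<close> the phases of the two equations are unrelated and each first-order term must be
  small by itself.\<close>

lemma first_order_diff:
  assumes ab: "a \<le> b"
    and Pm: "\<And>n. (\<lambda>s. P s n) \<in> borel_measurable (tm a b)" and Qm: "\<And>n. (\<lambda>s. Q s n) \<in> borel_measurable (tm a b)"
    and S: "finite S" "S \<subseteq> S'" and c: "sq_integrable zcount c" "nrm zcount c \<le> 1"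
    and \<mu>: "\<And>n s. n \<in> S' \<Longrightarrow> s \<in> {a..b} \<Longrightarrow> \<bar>P s n - Q s n\<bar> \<le> \<mu>" "0 \<le> \<mu>"
  shows "nrm zcount (\<lambda>n. first_order P S c n - first_order Q S c n) \<le> 2 * ((b - a) * v) * \<mu>
    + nrm zcount (\<lambda>n. if n \<in> S' then 0 else first_order P S c n)
    + nrm zcount (\<lambda>n. if n \<in> S' then 0 else first_order Q S c n)"
proof -
  interpret T: finite_measure "tm a b" by (rule finite_measure_tm)
  define Y where "Y n = (if n \<in> S then c n else 0)" for n
  have YL: "sq_integrable zcount Y" by (rule sq_integrable_zcountI[OF c(1)]) (auto simp: Y_def)
  have Y1: "nrm zcount Y \<le> 1" using nrm_mono[OF c(1), of Y] c(2) by (force simp: Y_def)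
  define FP where "FP s n = cis (P s n) * fourier_coeff (Vmul V s (free P S c s)) n" for s n
  define FQ where "FQ s n = cis (Q s n) * fourier_coeff (Vmul V s (free Q S c s)) n" for s n
  have fP: "nrm torus (free P S c s) \<le> 1" and fQ: "nrm torus (free Q S c s) \<le> 1" for s
    using Y1 S by (simp_all add: nrm_free Y_def[abs_def])
  have mFP: "(\<lambda>s. FP s n) \<in> borel_measurable (tm a b)" for n
    unfolding FP_def by (rule free_force_measurable[OF Pm])
  have mFQ: "(\<lambda>s. FQ s n) \<in> borel_measurable (tm a b)" for n
    unfolding FQ_def by (rule free_force_measurable[OF Qm])
  have bFP: "\<forall>s\<in>space (tm a b). (\<integral>\<^sup>+n. ennreal ((cmod (FP s n))\<^sup>2) \<partial>zcount) \<le> ennreal ((v * 1)\<^sup>2)"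
    unfolding FP_def using force_bound[OF free_L2 fP] by simp
  have bFQ: "\<forall>s\<in>space (tm a b). (\<integral>\<^sup>+n. ennreal ((cmod (FQ s n))\<^sup>2) \<partial>zcount) \<le> ennreal ((v * 1)\<^sup>2)"
    unfolding FQ_def using force_bound[OF free_L2 fQ] by simp
  have v1: "0 \<le> v * 1" using v0 by simp
  have qP: "first_order P S c = (\<lambda>n. LINT s|tm a b. FP s n)" and qQ: "first_order Q S c = (\<lambda>n. LINT s|tm a b. FQ s n)"
    by (auto simp: first_order_def FP_def FQ_def fun_eq_iff)
  have qPL: "sq_integrable zcount (first_order P S c)"
    unfolding qP by (rule minkowski_zcount(2)[OF finite_measure_tm mFP bFP[rule_format] v1])
  have qQL: "sq_integrable zcount (first_order Q S c)"
    unfolding qQ by (rule minkowski_zcount(2)[OF finite_measure_tm mFQ bFQ[rule_format] v1])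
  have iFP: "integrable (tm a b) (\<lambda>s. FP s n)" for n
    by (rule minkowski_zcount(1)[OF finite_measure_tm mFP bFP[rule_format] v1])
  have iFQ: "integrable (tm a b) (\<lambda>s. FQ s n)" for n
    by (rule minkowski_zcount(1)[OF finite_measure_tm mFQ bFQ[rule_format] v1])
  define q where "q n = first_order P S c n - first_order Q S c n" for n
  have qL: "sq_integrable zcount q" unfolding q_def by (intro sq_integrable_diff qPL qQL)
  define D where "D s n = (if n \<in> S' then FP s n - FQ s n else 0)" for s n
  have qD: "(if n \<in> S' then q n else 0) = (LINT s|tm a b. D s n)" for n
    unfolding q_def qP qQ D_def using Bochner_Integration.integral_diff[OF iFP iFQ] by simp
  have mD: "(\<lambda>s. D s n) \<in> borel_measurable (tm a b)" for n
    unfolding D_def using mFP mFQ by measurable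
  have cc: "cmod (cis (P s n) - cis (Q s n)) \<le> \<mu>" if "n \<in> S'" "s \<in> {a..b}" for s n
    using cmod_cis_diff[of "P s n" "Q s n"] \<mu>(1)[OF that] by linarith
  have cc': "cmod (cis (- P s n) - cis (- Q s n)) \<le> \<mu>" if "n \<in> S'" "s \<in> {a..b}" for s n
    using cmod_cis_diff[of "- P s n" "- Q s n"] \<mu>(1)[OF that] by linarith
  have bD: "(\<integral>\<^sup>+n. ennreal ((cmod (D s n))\<^sup>2) \<partial>zcount) \<le> ennreal ((2 * v * \<mu>)\<^sup>2)" if "s \<in> space (tm a b)" for s
  proof -
    have s: "s \<in> {a..b}" using that by simp
    let ?d = "\<lambda>x. free P S c s x - free Q S c s x"
    have dL: "sq_integrable torus ?d" by (intro sq_integrable_diff free_L2)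
    have "nrm torus ?d = nrm zcount (\<lambda>n. (cis (- P s n) - cis (- Q s n)) * Y n)"
      unfolding nrm_fourier[OF dL, symmetric]
      by (rule nrm_cong) (simp add: fourier_coeff_diff[OF free_L2 free_L2] fourier_free[OF S(1)] Y_def left_diff_distrib)
    also have "\<dots> \<le> \<mu> * nrm zcount Y"
    proof (rule nrm_zcount_mono[OF YL _ \<mu>(2)])
      show "cmod ((cis (- P s n) - cis (- Q s n)) * Y n) \<le> \<mu> * cmod (Y n)" for n
      proof (cases "n \<in> S")
        case True
        then have "n \<in> S'" using S by auto
        then show ?thesis using cc'[OF _ s] by (simp add: norm_mult mult_right_mono)
      qed (simp add: Y_def)
    qed
    also have "\<dots> \<le> \<mu> * 1" using Y1 \<mu>(2) by (rule mult_left_mono)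
    finally have d: "nrm torus ?d \<le> \<mu>" by simp
    have V: "Vmul V s ?d = (\<lambda>x. Vmul V s (free P S c s) x - Vmul V s (free Q S c s) x)"
      by (simp add: Vmul_def right_diff_distrib)
    \<comment> \<open>\<open>D1\<close> exchanges the outgoing phase, \<open>D2\<close> the phases
      of the incoming free wave.\<close>
    define D1 where "D1 n = (if n \<in> S' then (cis (P s n) - cis (Q s n)) * fourier_coeff (Vmul V s (free P S c s)) n else 0)" for n
    define D2 where "D2 n = (if n \<in> S' then cis (Q s n) * fourier_coeff (Vmul V s ?d) n else 0)" for n
    have Deq: "D s = (\<lambda>n. D1 n + D2 n)"
      unfolding D_def D1_def D2_def FP_def FQ_def V
        fourier_coeff_diff[OF Vmul_L2(1)[OF free_L2 fP s] Vmul_L2(1)[OF free_L2 fQ s]]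
      by (rule ext) (simp add: left_diff_distrib right_diff_distrib)
    have f1: "sq_integrable zcount (fourier_coeff (Vmul V s (free P S c s)))"
      "nrm zcount (fourier_coeff (Vmul V s (free P S c s))) \<le> v"
      using sq_integrable_fourier[OF Vmul_L2(1)[OF free_L2 fP s]] nrm_fourier[OF Vmul_L2(1)[OF free_L2 fP s]]
        Vmul_L2(2)[OF free_L2 fP s] by auto
    have f2: "sq_integrable zcount (fourier_coeff (Vmul V s ?d))" "nrm zcount (fourier_coeff (Vmul V s ?d)) \<le> v * \<mu>"
      using sq_integrable_fourier[OF Vmul_L2(1)[OF dL d s]] nrm_fourier[OF Vmul_L2(1)[OF dL d s]]
        Vmul_L2(2)[OF dL d s] by auto
    have b1: "cmod (D1 n) \<le> \<mu> * cmod (fourier_coeff (Vmul V s (free P S c s)) n)" for n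
      using cc[OF _ s] \<mu>(2) by (auto simp: D1_def norm_mult intro!: mult_right_mono)
    have b2: "cmod (D2 n) \<le> 1 * cmod (fourier_coeff (Vmul V s ?d) n)" for n
      by (auto simp: D2_def norm_mult)
    have L1: "sq_integrable zcount D1" by (rule sq_integrable_bound[OF f1(1) _ AE_I2]) (auto intro: b1)
    have L2: "sq_integrable zcount D2" by (rule sq_integrable_bound[OF f2(1) _ AE_I2]) (auto intro: b2)
    have "nrm zcount D1 \<le> \<mu> * v"
      using nrm_zcount_mono[OF f1(1) b1 \<mu>(2)] mult_left_mono[OF f1(2) \<mu>(2)] by linarith
    moreover have "nrm zcount D2 \<le> v * \<mu>"
      using nrm_zcount_mono[OF f2(1) b2] f2(2) by simp
    ultimately have "nrm zcount (D s) \<le> 2 * v * \<mu>"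
      unfolding Deq using nrm_triangle[OF L1 L2] by (simp add: mult_ac)
    moreover have "sq_integrable zcount (D s)" unfolding Deq by (rule sq_integrable_add[OF L1 L2])
    ultimately show ?thesis by (rule ennreal_nrm_sq_le[rotated])
  qed
  have v2: "0 \<le> 2 * v * \<mu>" using v0 \<mu>(2) by simp
  have "nrm zcount (\<lambda>n. LINT s|tm a b. D s n) \<le> measure (tm a b) (space (tm a b)) * (2 * v * \<mu>)"
    by (rule minkowski_zcount(3)[OF finite_measure_tm mD bD v2])
  then have A: "nrm zcount (\<lambda>n. if n \<in> S' then q n else 0) \<le> 2 * ((b - a) * v) * \<mu>"
    unfolding qD measure_tm[OF ab] by (simp add: mult_ac)
  have "nrm zcount (\<lambda>n. if n \<in> S' then 0 else q n)
    = nrm zcount (\<lambda>n. (if n \<in> S' then 0 else first_order P S c n) - (if n \<in> S' then 0 else first_order Q S c n))"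
    by (rule nrm_cong) (simp add: q_def)
  also have "\<dots> \<le> nrm zcount (\<lambda>n. if n \<in> S' then 0 else first_order P S c n)
      + nrm zcount (\<lambda>n. if n \<in> S' then 0 else first_order Q S c n)"
    by (intro nrm_triangle_diff sq_integrable_zcountI[OF qPL] sq_integrable_zcountI[OF qQL]) auto
  finally have B: "nrm zcount (\<lambda>n. if n \<in> S' then 0 else q n) \<le> \<dots>" .
  have "nrm zcount q \<le> nrm zcount (\<lambda>n. if n \<in> S' then q n else 0) + nrm zcount (\<lambda>n. if n \<in> S' then 0 else q n)"
    by (rule nrm_split[OF qL])
  then show ?thesis using A B unfolding q_def by linarith
qed

text \<open>The matrix entry of the first-order operator from frequency m to frequency n; its phase
  difference is what oscillates in k.\<close>

definition interaction :: "(real \<Rightarrow> int \<Rightarrow> real) \<Rightarrow> int \<Rightarrow> int \<Rightarrow> complex" where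
  "interaction P n m = (LINT s|tm a b. fourier_coeff (\<lambda>x. of_real (V s x)) (n - m) * cis (P s n - P s m))"

text \<open>Cauchy-Schwarz over the incoming frequencies removes the coefficients \<open>c\<close>.
  They depend on k through the solution, while the matrix entries depend on k only through explicit
  phases and can therefore be averaged.\<close>

lemma first_order_tail:
  assumes Pm [measurable]: "\<And>n. (\<lambda>s. P s n) \<in> borel_measurable (tm a b)"
    and S: "finite S" and c: "sq_integrable zcount c" "nrm zcount c \<le> 1"
  shows "ennreal ((nrm zcount (\<lambda>n. if n \<in> S' then 0 else first_order P S c n))\<^sup>2)
    \<le> (\<integral>\<^sup>+n. (if n \<in> S' then 0 else \<Sum>m\<in>S. ennreal ((cmod (interaction P n m))\<^sup>2)) \<partial>zcount)"
proof -
  interpret T: finite_measure "tm a b" by (rule finite_measure_tm)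
  have vm [measurable]: "(\<lambda>s. fourier_coeff (\<lambda>x. of_real (V s x)) m) \<in> borel_measurable (tm a b)" for m
    by (rule measurable_tm[OF fourier_potential_measurable[OF V]])
  have int: "integrable (tm a b) (\<lambda>s. fourier_coeff (\<lambda>x. of_real (V s x)) (n - m) * cis (P s n - P s m))" for n m
    by (rule T.integrable_const_bound[where B=v]) (auto simp: norm_mult fourier_potential_bound)
  have c1: "(\<Sum>m\<in>S. (cmod (c m))\<^sup>2) \<le> 1"
  proof -
    have "ennreal (\<Sum>m\<in>S. (cmod (c m))\<^sup>2) = (\<Sum>m\<in>S. ennreal ((cmod (c m))\<^sup>2))" by (simp add: sum_ennreal)
    also have "\<dots> \<le> (\<integral>\<^sup>+m. ennreal ((cmod (c m))\<^sup>2) \<partial>zcount)" by (rule sum_le_nn_integral_zcount[OF S])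
    also have "\<dots> \<le> ennreal (1\<^sup>2)" by (rule ennreal_nrm_sq_le[OF c])
    finally show ?thesis by simp
  qed
  have eq: "first_order P S c n = (\<Sum>m\<in>S. c m * interaction P n m)" for n
  proof -
    have "first_order P S c n = (LINT s|tm a b. (\<Sum>m\<in>S. c m * (fourier_coeff (\<lambda>x. of_real (V s x)) (n - m) * cis (P s n - P s m))))"
      unfolding first_order_def
    proof (rule Bochner_Integration.integral_cong[OF refl])
      fix s assume "s \<in> space (tm a b)"
      then have s: "s \<in> {a..b}" by simp
      have e: "cis (P s n - P s m) = cis (P s n) * cis (- P s m)" for m by (simp add: cis_mult)
      show "cis (P s n) * fourier_coeff (Vmul V s (free P S c s)) n
        = (\<Sum>m\<in>S. c m * (fourier_coeff (\<lambda>x. of_real (V s x)) (n - m) * cis (P s n - P s m)))"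
        unfolding free_def fourier_Vmul_trig[OF V vB[OF s]] e sum_distrib_left
        by (rule sum.cong) (simp_all add: mult_ac)
    qed
    also have "\<dots> = (\<Sum>m\<in>S. LINT s|tm a b. c m * (fourier_coeff (\<lambda>x. of_real (V s x)) (n - m) * cis (P s n - P s m)))"
      by (rule Bochner_Integration.integral_sum) (intro integrable_mult_right int)
    finally show ?thesis unfolding interaction_def by simp
  qed
  have pt: "(cmod (first_order P S c n))\<^sup>2 \<le> (\<Sum>m\<in>S. (cmod (interaction P n m))\<^sup>2)" for n
  proof -
    have "cmod (first_order P S c n) \<le> (\<Sum>m\<in>S. cmod (c m) * cmod (interaction P n m))"
      unfolding eq by (rule order_trans[OF norm_sum]) (simp add: norm_mult)
    then have "(cmod (first_order P S c n))\<^sup>2 \<le> (\<Sum>m\<in>S. cmod (c m) * cmod (interaction P n m))\<^sup>2"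
      by (intro power_mono) auto
    also have "\<dots> \<le> (\<Sum>m\<in>S. (cmod (c m))\<^sup>2) * (\<Sum>m\<in>S. (cmod (interaction P n m))\<^sup>2)"
      by (rule Cauchy_Schwarz_ineq_sum)
    also have "\<dots> \<le> 1 * (\<Sum>m\<in>S. (cmod (interaction P n m))\<^sup>2)"
      using c1 by (intro mult_right_mono sum_nonneg) auto
    finally show ?thesis by simp
  qed
  show ?thesis
  \<comment> \<open>A finite right-hand side supplies the square integrability without which
    \<open>nrm\<close> would not be a true norm; an infinite one leaves nothing to show.\<close>
  proof (cases "(\<integral>\<^sup>+n. (if n \<in> S' then 0 else \<Sum>m\<in>S. ennreal ((cmod (interaction P n m))\<^sup>2)) \<partial>zcount) = \<infinity>")
    case False
    then obtain B where B: "(\<integral>\<^sup>+n. (if n \<in> S' then 0 else \<Sum>m\<in>S. ennreal ((cmod (interaction P n m))\<^sup>2)) \<partial>zcount) = ennreal B"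
      by (cases "\<integral>\<^sup>+n. (if n \<in> S' then 0 else \<Sum>m\<in>S. ennreal ((cmod (interaction P n m))\<^sup>2)) \<partial>zcount") auto
    have le: "(\<integral>\<^sup>+n. ennreal ((cmod (if n \<in> S' then 0 else first_order P S c n))\<^sup>2) \<partial>zcount) \<le> ennreal B"
      unfolding B[symmetric]
    proof (rule nn_integral_mono)
      fix n
      show "ennreal ((cmod (if n \<in> S' then 0 else first_order P S c n))\<^sup>2)
        \<le> (if n \<in> S' then 0 else \<Sum>m\<in>S. ennreal ((cmod (interaction P n m))\<^sup>2))"
        using ennreal_leI[OF pt[of n]] by (simp add: sum_ennreal)
    qed
    then have "sq_integrable zcount (\<lambda>n. if n \<in> S' then 0 else first_order P S c n)"
      by (rule sq_integrableI_nn[rotated]) simp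
    then show ?thesis unfolding B using le by (simp add: ennreal_nrm_sq)
  qed simp
qed

end

section \<open>Regularity of the transport equation\<close>

text \<open>Translation followed by reduction to the fundamental domain: a function on the torus is
  an arbitrary function on the line whose values count only there, so it need not be
  periodic.\<close>

definition rot :: "real \<Rightarrow> real \<Rightarrow> real" where
  "rot \<tau> x = x + \<tau> - 2 * pi * of_int \<lfloor>(x + \<tau>) / (2 * pi)\<rfloor>"

lemma rot_measurable [measurable]:
  fixes f g :: "'a \<Rightarrow> real"
  assumes [measurable]: "f \<in> borel_measurable M" "g \<in> borel_measurable M"
  shows "(\<lambda>x. rot (f x) (g x)) \<in> borel_measurable M"
proof -
  have [measurable]: "(\<lambda>x. real_of_int \<lfloor>(g x + f x) / (2 * pi)\<rfloor>) \<in> borel_measurable M"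
    by (rule measurable_compose[OF _ borel_measurable_real_floor]) measurable
  show ?thesis unfolding rot_def by measurable
qed

lemma rot_range: "0 \<le> rot \<tau> x" "rot \<tau> x < 2 * pi"
proof -
  have "rot \<tau> x = 2 * pi * ((x + \<tau>) / (2 * pi) - of_int \<lfloor>(x + \<tau>) / (2 * pi)\<rfloor>)"
    by (simp add: rot_def right_diff_distrib)
  moreover have "0 \<le> y - of_int \<lfloor>y\<rfloor>" "y - of_int \<lfloor>y\<rfloor> < 1" for y :: real by linarith+
  ultimately show "0 \<le> rot \<tau> x" "rot \<tau> x < 2 * pi"
    using pi_gt_zero by (simp_all only: mult_nonneg_nonneg mult_less_cancel_left_pos[of "2 * pi" _ 1, simplified] zero_le_mult_iff) auto
qed

lemma ech_rot: "ech n (rot \<tau> x) = cis (of_int n * \<tau>) * ech n x"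
proof -
  let ?j = "\<lfloor>(x + \<tau>) / (2 * pi)\<rfloor>"
  have "cis (of_int n * (x + \<tau>) - 2 * pi * of_int (n * ?j)) = cis (of_int n * (x + \<tau>)) / cis (2 * pi * of_int (n * ?j))"
    by (rule cis_divide[symmetric])
  also have "cis (2 * pi * of_int (n * ?j)) = 1" by (rule cis_multiple_2pi) simp
  finally show ?thesis
    unfolding ech_def rot_def by (simp add: cis_mult algebra_simps)
qed

lemma rot_eq: "0 \<le> x + \<tau> - 2 * pi * of_int j \<Longrightarrow> x + \<tau> - 2 * pi * of_int j < 2 * pi \<Longrightarrow> rot \<tau> x = x + \<tau> - 2 * pi * of_int j"
proof -
  assume "0 \<le> x + \<tau> - 2 * pi * of_int j" "x + \<tau> - 2 * pi * of_int j < 2 * pi"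
  then have "\<lfloor>(x + \<tau>) / (2 * pi)\<rfloor> = j"
    by (intro floor_unique) (simp_all add: field_simps)
  then show ?thesis by (simp add: rot_def)
qed

lemma nn_integral_rot:
  assumes f [measurable]: "f \<in> borel_measurable borel"
  shows "(\<integral>\<^sup>+x. f (rot \<tau> x) \<partial>torus) = (\<integral>\<^sup>+x. f x \<partial>torus)"
proof -
  define r where "r = rot \<tau> 0"
  have r: "0 \<le> r" "r < 2 * pi" unfolding r_def by (rule rot_range)+
  have "\<exists>j::int. r = \<tau> - 2 * pi * of_int j" unfolding r_def rot_def by auto
  then obtain j :: int where j: "\<tau> = r + 2 * pi * of_int j" by auto
  \<comment> \<open>The domain is cut where the translation wraps around, with \<open>j\<close>
    periods subtracted on one piece and \<open>j + 1\<close> on the other. The factor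
    \<open>1 * x\<close> fits the affine substitution rule used below.\<close>
  have split: "f (rot \<tau> x) * indicator {0..<2*pi} x
    = f (r + 1 * x) * indicator {r..<2*pi} (r + 1 * x) + f (r - 2 * pi + 1 * x) * indicator {0..<r} (r - 2 * pi + 1 * x)" for x
  proof (cases "x \<in> {0..<2*pi}")
    case True
    show ?thesis
    proof (cases "x + r < 2 * pi")
      case t: True
      have "rot \<tau> x = x + \<tau> - 2 * pi * of_int j" using True t r by (intro rot_eq) (auto simp: j)
      then show ?thesis using True t r by (simp add: j indicator_def add.commute)
    next
      case False
      have "rot \<tau> x = x + \<tau> - 2 * pi * of_int (j + 1)" using True False r by (intro rot_eq) (auto simp: j algebra_simps)
      then have "rot \<tau> x = r - 2 * pi + 1 * x" by (simp add: j algebra_simps)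
      then show ?thesis using True False r by (simp add: indicator_def)
    qed
  next
    case False
    then show ?thesis using r by (auto simp: indicator_def)
  qed
  have "(\<integral>\<^sup>+x. f (rot \<tau> x) * indicator {0..<2*pi} x \<partial>lborel)
    = (\<integral>\<^sup>+x. f (r + 1 * x) * indicator {r..<2*pi} (r + 1 * x) \<partial>lborel)
      + (\<integral>\<^sup>+x. f (r - 2 * pi + 1 * x) * indicator {0..<r} (r - 2 * pi + 1 * x) \<partial>lborel)"
    unfolding split by (rule nn_integral_add) measurable
  also have "(\<integral>\<^sup>+x. f (r + 1 * x) * indicator {r..<2*pi} (r + 1 * x) \<partial>lborel) = (\<integral>\<^sup>+x. f x * indicator {r..<2*pi} x \<partial>lborel)"
    using nn_integral_real_affine[of "\<lambda>x. f x * indicator {r..<2*pi} x" 1 r] by simp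
  also have "(\<integral>\<^sup>+x. f (r - 2 * pi + 1 * x) * indicator {0..<r} (r - 2 * pi + 1 * x) \<partial>lborel) = (\<integral>\<^sup>+x. f x * indicator {0..<r} x \<partial>lborel)"
    using nn_integral_real_affine[of "\<lambda>x. f x * indicator {0..<r} x" 1 "r - 2 * pi"] by simp
  also have "(\<integral>\<^sup>+x. f x * indicator {r..<2*pi} x \<partial>lborel) + (\<integral>\<^sup>+x. f x * indicator {0..<r} x \<partial>lborel)
     = (\<integral>\<^sup>+x. f x * indicator {r..<2*pi} x + f x * indicator {0..<r} x \<partial>lborel)"
    by (rule nn_integral_add[symmetric]) measurable
  also have "\<dots> = (\<integral>\<^sup>+x. f x * indicator {0..<2*pi} x \<partial>lborel)"
    using r by (intro nn_integral_cong) (auto simp: indicator_def)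
  finally show ?thesis by (simp add: nn_integral_torus)
qed

lemma distr_rot: "distr torus torus (rot \<tau>) = torus"
proof (rule measure_eqI)
  fix A assume "A \<in> sets (distr torus torus (rot \<tau>))"
  then have A [measurable]: "A \<in> sets borel" by simp
  have "emeasure (distr torus torus (rot \<tau>)) A = (\<integral>\<^sup>+x. indicator A x \<partial>distr torus torus (rot \<tau>))"
    by (subst nn_integral_indicator) auto
  also have "\<dots> = (\<integral>\<^sup>+x. indicator A (rot \<tau> x) \<partial>torus)"
    by (subst nn_integral_distr) auto
  also have "\<dots> = (\<integral>\<^sup>+x. indicator A x \<partial>torus)" by (rule nn_integral_rot) simp
  also have "\<dots> = emeasure torus A" by simp
  finally show "emeasure (distr torus torus (rot \<tau>)) A = emeasure torus A" .
qed simp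

lemma integral_rot:
  fixes f :: "real \<Rightarrow> 'b::{banach, second_countable_topology}"
  assumes [measurable]: "f \<in> borel_measurable borel"
  shows "(LINT x|torus. f (rot \<tau> x)) = (LINT x|torus. f x)"
proof -
  have "(LINT x|torus. f x) = (LINT x|distr torus torus (rot \<tau>). f x)" by (simp only: distr_rot)
  also have "\<dots> = (LINT x|torus. f (rot \<tau> x))" by (rule integral_distr) auto
  finally show ?thesis by simp
qed

lemma sq_integrable_rot:
  assumes f: "sq_integrable torus f" shows "sq_integrable torus (\<lambda>x. f (rot \<tau> x))"
proof -
  have m [measurable]: "f \<in> borel_measurable borel" using sq_integrable_measurable[OF f] by simp
  have "(\<integral>\<^sup>+x. ennreal ((cmod (f (rot \<tau> x)))\<^sup>2) \<partial>torus) = (\<integral>\<^sup>+x. ennreal ((cmod (f x))\<^sup>2) \<partial>torus)"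
    by (rule nn_integral_rot) measurable
  also have "\<dots> = ennreal ((nrm torus f)\<^sup>2)" by (rule ennreal_nrm_sq[OF f, symmetric])
  finally show ?thesis by (intro sq_integrableI_nn[where B="(nrm torus f)\<^sup>2"]) auto
qed

lemma nrm_rot: "f \<in> borel_measurable borel \<Longrightarrow> nrm torus (\<lambda>x. f (rot \<tau> x)) = nrm torus f"
  unfolding nrm_def by (subst integral_rot) auto

lemma fourier_rot:
  assumes [measurable]: "f \<in> borel_measurable borel"
  shows "fourier_coeff (\<lambda>x. f (rot \<tau> x)) n = cis (of_int n * \<tau>) * fourier_coeff f n"
proof -
  have e: "f (rot \<tau> x) * cnj (ech n x) = cis (of_int n * \<tau>) * (f (rot \<tau> x) * cnj (ech n (rot \<tau> x)))" for x
  proof -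
    have "cis (of_int n * \<tau>) * cnj (ech n (rot \<tau> x)) = (cis (of_int n * \<tau>) * cnj (cis (of_int n * \<tau>))) * cnj (ech n x)"
      by (simp add: ech_rot)
    also have "\<dots> = cnj (ech n x)" by (simp add: cis_cnj cis_mult)
    finally show ?thesis by (metis mult.left_commute)
  qed
  have "fourier_coeff (\<lambda>x. f (rot \<tau> x)) n = cis (of_int n * \<tau>) * (LINT x|torus. f (rot \<tau> x) * cnj (ech n (rot \<tau> x)))"
    unfolding fourier_coeff_ip ip_def e by (rule integral_mult_right_zero)
  also have "(LINT x|torus. f (rot \<tau> x) * cnj (ech n (rot \<tau> x))) = (LINT x|torus. f x * cnj (ech n x))"
    by (rule integral_rot[where f="\<lambda>x. f x * cnj (ech n x)"]) measurable
  finally show ?thesis by (simp add: fourier_coeff_ip ip_def)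
qed

section \<open>Solution of the transport equation along characteristics\<close>

lemma tm_split:
  fixes f :: "real \<Rightarrow> 'b::{banach, second_countable_topology}"
  assumes "a \<le> s" "s \<le> t" and f: "integrable (tm a t) f"
  shows "integrable (tm a s) f" "integrable (tm s t) f"
    and "(LINT r|tm a t. f r) = (LINT r|tm a s. f r) + (LINT r|tm s t. f r)"
proof -
  have I: "set_integrable lborel {a..t} f" using f by (simp add: integrable_tm)
  then have 1: "set_integrable lborel {a..s} f" and 2: "set_integrable lborel {s..t} f"
    using assms by (auto intro: set_integrable_subset)
  then show "integrable (tm a s) f" "integrable (tm s t) f" by (simp_all add: integrable_tm)
  have "(LINT r|lborel. indicator {a..t} r *\<^sub>R f r) = (LINT r|lborel. indicator {a..s} r *\<^sub>R f r + indicator {s..t} r *\<^sub>R f r)"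
  proof (rule integral_cong_AE)
    have "AE r in lborel. r \<noteq> s" by (rule AE_lborel_singleton)
    then show "AE r in lborel. indicator {a..t} r *\<^sub>R f r = indicator {a..s} r *\<^sub>R f r + indicator {s..t} r *\<^sub>R f r"
      by eventually_elim (use assms in \<open>auto simp: indicator_def\<close>)
  qed (use I 1 2 in \<open>auto simp: set_integrable_def\<close>)
  also have "\<dots> = (LINT r|lborel. indicator {a..s} r *\<^sub>R f r) + (LINT r|lborel. indicator {s..t} r *\<^sub>R f r)"
    using 1 2 by (intro Bochner_Integration.integral_add) (auto simp: set_integrable_def)
  finally show "(LINT r|tm a t. f r) = (LINT r|tm a s. f r) + (LINT r|tm s t. f r)"
    by (simp add: integral_tm set_lebesgue_integral_def)
qed

lemma integrable_tm_bounded: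
  fixes f :: "real \<Rightarrow> 'b::{banach, second_countable_topology}"
  assumes "f \<in> borel_measurable (tm a b)" "\<And>s. s \<in> {a..b} \<Longrightarrow> norm (f s) \<le> C"
  shows "integrable (tm a b) f"
proof -
  interpret finite_measure "tm a b" by (rule finite_measure_tm)
  show ?thesis using assms by (intro integrable_const_bound[where B=C]) auto
qed

lemma integral_tm_bound:
  fixes f :: "real \<Rightarrow> 'b::{banach, second_countable_topology}"
  assumes "a \<le> b" "f \<in> borel_measurable (tm a b)" "\<And>s. s \<in> {a..b} \<Longrightarrow> norm (f s) \<le> C"
  shows "norm (LINT s|tm a b. f s) \<le> C * (b - a)"
proof -
  interpret finite_measure "tm a b" by (rule finite_measure_tm)
  have "norm (LINT s|tm a b. f s) \<le> (LINT s|tm a b. norm (f s))" by (rule integral_norm_bound)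
  also have "\<dots> \<le> (LINT s|tm a b. C)"
    using integrable_tm_bounded[OF assms(2,3)] assms(3) by (intro integral_mono integrable_norm) auto
  also have "\<dots> = C * (b - a)" using measure_tm[OF assms(1)] by simp
  finally show ?thesis .
qed

lemma integral_tm_trivial [simp]:
  fixes f :: "real \<Rightarrow> 'b::{banach, second_countable_topology}"
  shows "(LINT r|tm a a. f r) = 0"
  unfolding integral_tm set_lebesgue_integral_def
proof (rule integral_eq_zero_AE)
  have "AE r in lborel. r \<noteq> a" by (rule AE_lborel_singleton)
  then show "AE r in lborel. indicator {a..a} r *\<^sub>R f r = 0" by eventually_elim (simp add: indicator_def)
qed

lemma cis_second_order: "cmod (cis (- y) - 1 + \<i> * of_real y) \<le> y\<^sup>2"
proof -
  have "cmod (iexp (- y) - (\<Sum>k\<le>1. (\<i> * of_real (- y)) ^ k / fact k)) \<le> \<bar>- y\<bar> ^ Suc 1 / fact (Suc 1)"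
    by (rule iexp_approx1)
  then have "cmod (cis (- y) - 1 + \<i> * of_real y) \<le> y\<^sup>2 / 2"
    by (simp add: cis_eq_iexp power2_eq_square algebra_simps)
  also have "\<dots> \<le> y\<^sup>2" by simp
  finally show ?thesis .
qed

text \<open>Since \<open>w\<close> is only measurable, \<open>cis (- F)\<close> has no derivative in
  the classical sense at every point. Instead the defect \<open>G\<close> of the integral equation
  is shown to have quadratic increments, from the second-order expansion of the exponential and the
  Lipschitz bound for \<open>F\<close>.\<close>

lemma exp_integral_equation:
  fixes w :: "real \<Rightarrow> real"
  assumes w [measurable]: "w \<in> borel_measurable borel" and C: "\<And>s. \<bar>w s\<bar> \<le> C"
    and F: "\<And>t. F t = (LINT r|tm 0 t. w r)" and Fm [measurable]: "F \<in> borel_measurable borel"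
    and st: "0 \<le> s" "s \<le> t"
  shows "cis (- F t) - cis (- F s) = - \<i> * (LINT r|tm s t. of_real (w r) * cis (- F r))"
proof -
  have C0: "0 \<le> C" using C[of 0] by linarith
  have iw: "integrable (tm a b) w" for a b by (rule integrable_tm_bounded[where C=C]) (use C in auto)
  have iwc: "integrable (tm a b) (\<lambda>r. of_real (w r) * cis (- F r))" for a b
    by (rule integrable_tm_bounded[where C=C]) (use C in \<open>auto simp: norm_mult\<close>)
  define G where "G x = cis (- F x) + \<i> * (LINT r|tm s x. of_real (w r) * cis (- F r))" for x
  have q: "cmod (G y - G x) \<le> 2 * C\<^sup>2 * (y - x)\<^sup>2" if xy: "s \<le> x" "x \<le> y" for x y
  proof -
    have x0: "0 \<le> x" using xy st by simp
    define d where "d = (LINT r|tm x y. w r)"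
    have Fy: "F z = F x + (LINT r|tm x z. w r)" if "x \<le> z" for z
      unfolding F using tm_split(3)[OF x0 that iw] by simp
    have db: "\<bar>d\<bar> \<le> C * (y - x)"
      using integral_tm_bound[OF xy(2), of w C] C by (auto simp: d_def)
    have ii: "integrable (tm x y) (\<lambda>r. of_real (w r) * (cis (- F r) - cis (- F x)))"
      by (rule integrable_tm_bounded[where C="C * 2"])
        (use C C0 in \<open>auto simp: norm_mult intro!: mult_mono order_trans[OF norm_triangle_ineq4]\<close>)
    have "(LINT r|tm x y. of_real (w r) * cis (- F r))
      = (LINT r|tm x y. of_real (w r) * cis (- F x) + of_real (w r) * (cis (- F r) - cis (- F x)))"
      by (simp add: algebra_simps)
    also have "\<dots> = (LINT r|tm x y. of_real (w r) * cis (- F x)) + (LINT r|tm x y. of_real (w r) * (cis (- F r) - cis (- F x)))"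
      by (rule Bochner_Integration.integral_add[OF _ ii]) (use iw in auto)
    also have "(LINT r|tm x y. of_real (w r) * cis (- F x)) = of_real d * cis (- F x)"
      unfolding d_def by simp
    finally have I: "(LINT r|tm x y. of_real (w r) * cis (- F r)) = of_real d * cis (- F x) + (LINT r|tm x y. of_real (w r) * (cis (- F r) - cis (- F x)))" .
    have Gyx: "G y - G x = cis (- F y) - cis (- F x) + \<i> * (LINT r|tm x y. of_real (w r) * cis (- F r))"
      unfolding G_def using tm_split(3)[OF xy iwc] by (simp add: algebra_simps)
    have "cis (- F y) = cis (- F x) * cis (- d)" using Fy[OF xy(2)] by (simp add: cis_mult d_def)
    then have "G y - G x = cis (- F x) * (cis (- d) - 1 + \<i> * of_real d) + \<i> * (LINT r|tm x y. of_real (w r) * (cis (- F r) - cis (- F x)))"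
      unfolding Gyx I by (simp add: algebra_simps)
    then have "cmod (G y - G x) \<le> cmod (cis (- d) - 1 + \<i> * of_real d) + cmod (LINT r|tm x y. of_real (w r) * (cis (- F r) - cis (- F x)))"
      by (metis (no_types, lifting) norm_triangle_ineq norm_mult norm_cis norm_ii mult_1)
    also have "cmod (LINT r|tm x y. of_real (w r) * (cis (- F r) - cis (- F x))) \<le> (C * (C * (y - x))) * (y - x)"
    proof (rule integral_tm_bound[OF xy(2)])
      fix r assume r: "r \<in> {x..y}"
      have "cmod (cis (- F r) - cis (- F x)) \<le> \<bar>F r - F x\<bar>" using cmod_cis_diff[of "- F r" "- F x"] by simp
      also have "\<dots> = norm (LINT q|tm x r. w q)" using Fy[of r] r by simp
      also have "\<dots> \<le> C * (r - x)" by (rule integral_tm_bound) (use r C in auto)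
      also have "\<dots> \<le> C * (y - x)" using r C0 by (intro mult_left_mono) auto
      finally show "norm (complex_of_real (w r) * (cis (- F r) - cis (- F x))) \<le> C * (C * (y - x))"
        using C[of r] C0 by (auto simp: norm_mult intro!: mult_mono)
    qed measurable
    also have "cmod (cis (- d) - 1 + \<i> * of_real d) \<le> d\<^sup>2" by (rule cis_second_order)
    also have "d\<^sup>2 \<le> (C * (y - x))\<^sup>2" using db by (rule power2_le_iff_abs_le[THEN iffD2, rotated]) (use C0 xy in auto)
    finally show ?thesis by (simp add: power2_eq_square algebra_simps)
  qed
  have "Re (G t) = Re (G s)"
  proof (rule constant_if_quadratic[where b=t and C="2 * C\<^sup>2" and g="\<lambda>x. Re (G x)"])
    show "\<bar>Re (G y) - Re (G x)\<bar> \<le> 2 * C\<^sup>2 * (y - x)\<^sup>2" if "s \<le> x" "x \<le> y" "y \<le> t" for x y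
      using abs_Re_le_cmod[of "G y - G x"] q[OF that(1,2)] by simp
  qed (use st in auto)
  moreover have "Im (G t) = Im (G s)"
  proof (rule constant_if_quadratic[where b=t and C="2 * C\<^sup>2" and g="\<lambda>x. Im (G x)"])
    show "\<bar>Im (G y) - Im (G x)\<bar> \<le> 2 * C\<^sup>2 * (y - x)\<^sup>2" if "s \<le> x" "x \<le> y" "y \<le> t" for x y
      using abs_Im_le_cmod[of "G y - G x"] q[OF that(1,2)] by simp
  qed (use st in auto)
  ultimately have "G t = G s" by (rule complex_eqI)
  then have "cis (- F t) + \<i> * (LINT r|tm s t. of_real (w r) * cis (- F r)) = cis (- F s)"
    unfolding G_def integral_tm_trivial by simp
  then show ?thesis by (metis add_diff_cancel_left' minus_diff_eq mult_minus_left)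
qed

lemma fourier_integral_tm:
  fixes W :: "real \<Rightarrow> real \<Rightarrow> complex"
  assumes W [measurable]: "(\<lambda>p. W (fst p) (snd p)) \<in> borel_measurable (borel \<Otimes>\<^sub>M borel)"
    and C: "\<And>s x. s \<in> {a..b} \<Longrightarrow> cmod (W s x) \<le> C"
  shows "fourier_coeff (\<lambda>x. LINT s|tm a b. W s x) n = (LINT s|tm a b. fourier_coeff (W s) n)"
proof -
  interpret T: finite_measure "tm a b" by (rule finite_measure_tm)
  interpret pair_sigma_finite "tm a b" torus ..
  interpret P: finite_measure "tm a b \<Otimes>\<^sub>M torus" by (rule finite_measure_pair_measure) unfold_locales
  have [measurable]: "(\<lambda>p. W (fst p) (snd p)) \<in> borel_measurable (tm a b \<Otimes>\<^sub>M torus)"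
  proof -
    have "fst \<in> borel_measurable (tm a b \<Otimes>\<^sub>M torus)"
      using measurable_fst by (rule measurable_compose[OF _ measurable_tm[of "\<lambda>x. x"], simplified])
    then have "(\<lambda>p. (fst p, snd p)) \<in> tm a b \<Otimes>\<^sub>M torus \<rightarrow>\<^sub>M borel \<Otimes>\<^sub>M borel" by measurable
    from measurable_compose[OF this W] show ?thesis by simp
  qed
  have int: "integrable (tm a b \<Otimes>\<^sub>M torus) (case_prod (\<lambda>s x. W s x * cnj (ech n x)))"
    unfolding case_prod_beta
    by (rule P.integrable_const_bound[where B=C]) (use C in \<open>auto simp: space_pair_measure norm_mult intro!: AE_I2\<close>)
  have "fourier_coeff (\<lambda>x. LINT s|tm a b. W s x) n = (LINT x|torus. LINT s|tm a b. W s x * cnj (ech n x))"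
    unfolding fourier_coeff_ip ip_def by simp
  also have "\<dots> = (LINT s|tm a b. LINT x|torus. W s x * cnj (ech n x))" by (rule Fubini_integral[OF int])
  finally show ?thesis by (simp add: fourier_coeff_ip ip_def)
qed

lemma cmod_fourier_le: "sq_integrable torus f \<Longrightarrow> cmod (fourier_coeff f n) \<le> nrm torus f"
  using bessel[of "{n}" f] by (simp add: power2_le_iff_abs_le)

text \<open>Together with \<open>evol_norm_conserved\<close> this gives uniqueness: the difference
  of two solutions with equal data has norm zero at all times.\<close>

lemma (in bounded_potential) evol_diff:
  assumes w1: "evol P V w1 a b" and w2: "evol P V w2 a b"
    and B1: "\<And>t. t \<in> {a..b} \<Longrightarrow> nrm torus (w1 t) \<le> B" and B2: "\<And>t. t \<in> {a..b} \<Longrightarrow> nrm torus (w2 t) \<le> B"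
  shows "evol P V (\<lambda>t x. w1 t x - w2 t x) a b"
  unfolding evol_def
proof (intro conjI allI impI ballI)
  have L: "sq_integrable torus (w1 t)" "sq_integrable torus (w2 t)" if "t \<in> {a..b}" for t
    using w1 w2 that by (auto simp: evol_def)
  show "sq_integrable torus (\<lambda>x. w1 t x - w2 t x)" if "t \<in> {a..b}" for t
    by (intro sq_integrable_diff L that)
  have F: "cis (P t n) * fourier_coeff (Vmul V t (\<lambda>x. w1 t x - w2 t x)) n
    = cis (P t n) * fourier_coeff (Vmul V t (w1 t)) n - cis (P t n) * fourier_coeff (Vmul V t (w2 t)) n"
    if t: "t \<in> {a..b}" for t n
  proof -
    have "Vmul V t (\<lambda>x. w1 t x - w2 t x) = (\<lambda>x. Vmul V t (w1 t) x - Vmul V t (w2 t) x)"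
      by (simp add: Vmul_def right_diff_distrib)
    then show ?thesis
      using fourier_coeff_diff[OF Vmul_L2(1)[OF L(1)[OF t] B1[OF t] t] Vmul_L2(1)[OF L(2)[OF t] B2[OF t] t]]
      by (simp add: right_diff_distrib)
  qed
  have m1: "(\<lambda>s. cis (P s n) * fourier_coeff (Vmul V s (w1 s)) n) \<in> borel_measurable (tm a b)"
    and m2: "(\<lambda>s. cis (P s n) * fourier_coeff (Vmul V s (w2 s)) n) \<in> borel_measurable (tm a b)" for n
    using w1 w2 by (auto simp: evol_def)
  show "(\<lambda>s. cis (P s n) * fourier_coeff (Vmul V s (\<lambda>x. w1 s x - w2 s x)) n) \<in> borel_measurable (tm a b)" for n
  proof -
    have "(\<lambda>s. cis (P s n) * fourier_coeff (Vmul V s (w1 s)) n - cis (P s n) * fourier_coeff (Vmul V s (w2 s)) n) \<in> borel_measurable (tm a b)"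
      using m1 m2 by (rule borel_measurable_diff)
    also have "?this \<longleftrightarrow> ?thesis" by (rule measurable_cong) (simp add: F)
    finally show ?thesis .
  qed
  fix n s t assume st: "a \<le> s" "s \<le> t" "t \<le> b"
  have i: "integrable (tm s t) (\<lambda>r. cis (P r n) * fourier_coeff (Vmul V r (w r)) n)"
    if "evol P V w a b" "\<And>t. t \<in> {a..b} \<Longrightarrow> nrm torus (w t) \<le> B" for w
  proof (rule integrable_tm_bounded)
    show "(\<lambda>r. cis (P r n) * fourier_coeff (Vmul V r (w r)) n) \<in> borel_measurable (tm s t)"
      by (rule measurable_tm_subset[of _ a b]) (use that st in \<open>auto simp: evol_def\<close>)
    fix r assume "r \<in> {s..t}"
    then have r: "r \<in> {a..b}" using st by auto
    have "sq_integrable torus (w r)" using that(1) r by (auto simp: evol_def)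
    note V = Vmul_L2[OF this that(2)[OF r] r]
    show "norm (cis (P r n) * fourier_coeff (Vmul V r (w r)) n) \<le> v * B"
      using cmod_fourier_le[OF V(1), of n] V(2) by (simp add: norm_mult)
  qed
  have "(LINT r|tm s t. cis (P r n) * fourier_coeff (Vmul V r (\<lambda>x. w1 r x - w2 r x)) n)
    = (LINT r|tm s t. cis (P r n) * fourier_coeff (Vmul V r (w1 r)) n - cis (P r n) * fourier_coeff (Vmul V r (w2 r)) n)"
    using st by (intro Bochner_Integration.integral_cong refl F) auto
  also have "\<dots> = (LINT r|tm s t. cis (P r n) * fourier_coeff (Vmul V r (w1 r)) n)
      - (LINT r|tm s t. cis (P r n) * fourier_coeff (Vmul V r (w2 r)) n)"
    by (rule Bochner_Integration.integral_diff) (intro i w1 w2 B1 B2; assumption)+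
  finally have I: "(LINT r|tm s t. cis (P r n) * fourier_coeff (Vmul V r (\<lambda>x. w1 r x - w2 r x)) n) = \<dots>" .
  have fc: "fourier_coeff (\<lambda>x. w1 t x - w2 t x) n = fourier_coeff (w1 t) n - fourier_coeff (w2 t) n" if "t \<in> {a..b}" for t
    by (rule fourier_coeff_diff[OF L[OF that]])
  have e: "cis (P t n) * fourier_coeff (w t) n - cis (P s n) * fourier_coeff (w s) n =
        - \<i> * (LINT r|tm s t. cis (P r n) * fourier_coeff (Vmul V r (w r)) n)" if "evol P V w a b" for w
    using that st by (auto simp: evol_def)
  show "cis (P t n) * fourier_coeff (\<lambda>x. w1 t x - w2 t x) n - cis (P s n) * fourier_coeff (\<lambda>x. w1 s x - w2 s x) n =
        - \<i> * (LINT r|tm s t. cis (P r n) * fourier_coeff (Vmul V r (\<lambda>x. w1 r x - w2 r x)) n)"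
    unfolding I right_diff_distrib[of "- \<i>"] e[OF w1, symmetric] e[OF w2, symmetric]
    using fc st by (simp add: right_diff_distrib)
qed

text \<open>Since \<open>|e\<^sup>i\<^sup>a - e\<^sup>i\<^sup>b| \<le> |a - b|\<close>, the Sobolev seminorm of order one half of \<open>e\<^sup>-\<^sup>i\<^sup>S\<close>, expressed
  through translations, is at most that of \<open>S\<close>; averaging over translations by at most \<open>2 / N\<close> bounds
  the mass of the frequencies above \<open>N\<close>.\<close>

lemma exp_phase_tail:
  fixes S :: "real \<Rightarrow> real"
  assumes S [measurable]: "S \<in> borel_measurable borel" and K: "\<And>x. \<bar>S x\<bar> \<le> K" and N: "0 < N"
  shows "(\<integral>\<^sup>+n. (if real_of_int \<bar>n\<bar> \<le> N then 0 else ennreal ((cmod (fourier_coeff (\<lambda>x. cis (- S x)) n))\<^sup>2)) \<partial>zcount)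
    \<le> (\<integral>\<^sup>+n. ennreal (4 * \<bar>of_int n\<bar> / N * (cmod (fourier_coeff (\<lambda>x. of_real (S x)) n))\<^sup>2) \<partial>zcount)" (is "_ \<le> ?B")
proof (cases "?B = \<infinity>")
  case False
  then obtain B where B: "?B = ennreal B" "0 \<le> B" by (cases ?B) auto
  let ?E = "\<lambda>x. cis (- S x)" and ?S = "\<lambda>x. complex_of_real (S x)"
  \<comment> \<open>For \<open>|n| > N\<close> the mean value over this window is at least one: the
    integral of \<open>2 - 2 cos (n h)\<close> is at least \<open>2 H - 2 / N = H\<close>.\<close>
  let ?H = "2 / N"
  have H: "0 < ?H" using N by simp
  have EL: "sq_integrable torus ?E" by (rule sq_integrable_torusI[where C=1]) auto
  have SL: "sq_integrable torus ?S" by (rule sq_integrable_torusI[where C=K]) (use K in auto)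
  have shift: "\<And>h. 0 \<le> h \<Longrightarrow> h \<le> ?H \<Longrightarrow> finite T \<Longrightarrow>
      (\<Sum>n\<in>T. (cmod (cis (of_int n * h) - 1))\<^sup>2 * (cmod (fourier_coeff ?E n))\<^sup>2) \<le> B" for T
  proof -
    fix h :: real assume h: "0 \<le> h" "h \<le> ?H" and T: "finite T"
    let ?DE = "\<lambda>x. ?E (rot h x) - ?E x" and ?DS = "\<lambda>x. ?S (rot h x) - ?S x"
    have DEL: "sq_integrable torus ?DE" by (rule sq_integrable_diff[OF sq_integrable_rot[OF EL] EL])
    have DSL: "sq_integrable torus ?DS" by (rule sq_integrable_diff[OF sq_integrable_rot[OF SL] SL])
    have fE: "fourier_coeff ?DE n = (cis (of_int n * h) - 1) * fourier_coeff ?E n" for n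
      using fourier_rot[of ?E h n] by (simp add: fourier_coeff_diff[OF sq_integrable_rot[OF EL] EL] left_diff_distrib)
    have fS: "fourier_coeff ?DS n = (cis (of_int n * h) - 1) * fourier_coeff ?S n" for n
      using fourier_rot[of ?S h n] by (simp add: fourier_coeff_diff[OF sq_integrable_rot[OF SL] SL] left_diff_distrib)
    have "(\<Sum>n\<in>T. (cmod (cis (of_int n * h) - 1))\<^sup>2 * (cmod (fourier_coeff ?E n))\<^sup>2) = (\<Sum>n\<in>T. (cmod (fourier_coeff ?DE n))\<^sup>2)"
      by (simp add: fE norm_mult power_mult_distrib)
    also have "\<dots> \<le> (nrm torus ?DE)\<^sup>2" by (rule bessel[OF T DEL])
    finally have 1: "(\<Sum>n\<in>T. (cmod (cis (of_int n * h) - 1))\<^sup>2 * (cmod (fourier_coeff ?E n))\<^sup>2) \<le> (nrm torus ?DE)\<^sup>2" .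
    have "nrm torus ?DE \<le> nrm torus ?DS"
    proof (rule nrm_mono[OF DSL])
      fix x
      have "cmod (?DE x) \<le> \<bar>- S (rot h x) - - S x\<bar>" by (rule cmod_cis_diff)
      also have "\<dots> = cmod (?DS x)" unfolding of_real_diff[symmetric] norm_of_real by simp
      finally show "cmod (?DE x) \<le> cmod (?DS x)" .
    qed
    then have "(nrm torus ?DE)\<^sup>2 \<le> (nrm torus ?DS)\<^sup>2" by (intro power_mono) auto
    moreover have "ennreal ((nrm torus ?DS)\<^sup>2) \<le> ennreal B"
      unfolding parseval_nn[OF DSL, symmetric] B(1)[symmetric]
    proof (intro nn_integral_mono ennreal_leI)
      fix n :: int
      have a: "cmod (cis (of_int n * h) - 1) \<le> \<bar>of_int n\<bar> * ?H"
      proof -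
        have "cmod (cis (of_int n * h) - cis 0) \<le> \<bar>of_int n * h - 0\<bar>" by (rule cmod_cis_diff)
        also have "\<dots> = \<bar>of_int n\<bar> * h" using h by (simp add: abs_mult)
        also have "\<dots> \<le> \<bar>of_int n\<bar> * ?H" using h by (intro mult_left_mono) auto
        finally show ?thesis by simp
      qed
      have b: "cmod (cis (of_int n * h) - 1) \<le> 2" using norm_triangle_ineq4[of "cis (of_int n * h)" 1] by simp
      \<comment> \<open>One factor is bounded by 2 and the other by \<open>|n| h\<close>; this
        interpolation produces the single power of \<open>|n|\<close>, that is, half a
        derivative.\<close>
      have "(cmod (cis (of_int n * h) - 1))\<^sup>2 \<le> 2 * (\<bar>of_int n\<bar> * ?H)"
        unfolding power2_eq_square by (intro mult_mono a b) auto
      also have "\<dots> = 4 * \<bar>of_int n\<bar> / N" by simp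
      finally show "(cmod (fourier_coeff ?DS n))\<^sup>2 \<le> 4 * \<bar>of_int n\<bar> / N * (cmod (fourier_coeff ?S n))\<^sup>2"
        unfolding fS norm_mult power_mult_distrib by (intro mult_right_mono) auto
    qed
    then have "(nrm torus ?DS)\<^sup>2 \<le> B" using B(2) by (simp only: ennreal_le_iff)
    ultimately have "(nrm torus ?DE)\<^sup>2 \<le> B" by (rule order_trans)
    then show "(\<Sum>n\<in>T. (cmod (cis (of_int n * h) - 1))\<^sup>2 * (cmod (fourier_coeff ?E n))\<^sup>2) \<le> B" using 1 by linarith
  qed
  have sqc: "(cmod (cis (of_int n * h) - 1))\<^sup>2 = 2 - 2 * cos (of_int n * h)" for n :: int and h
  proof -
    have "(cmod (cis (of_int n * h) - 1))\<^sup>2 = ((cos (of_int n * h))\<^sup>2 + (sin (of_int n * h))\<^sup>2) + 1 - 2 * cos (of_int n * h)"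
      by (simp add: cmod_power2 power2_diff)
    then show ?thesis by simp
  qed
  have avg: "?H \<le> (LINT h|tm 0 ?H. (cmod (cis (of_int n * h) - 1))\<^sup>2)" if n: "\<not> real_of_int \<bar>n\<bar> \<le> N" for n
  proof -
    have n0: "n \<noteq> 0" using n N by auto
    have "(LINT h|tm 0 ?H. (cmod (cis (of_int n * h) - 1))\<^sup>2) = (LINT h|lborel. (2 - 2 * cos (of_int n * h)) * indicator {0..?H} h)"
      unfolding integral_tm set_lebesgue_integral_def sqc by (simp add: mult.commute)
    also have "\<dots> = (2 * ?H - 2 * sin (of_int n * ?H) / of_int n) - (2 * 0 - 2 * sin (of_int n * 0) / of_int n)"
    proof (rule integral_FTC_Icc_nonneg)
      show "0 \<le> ?H" using H by simp
      show "0 \<le> 2 - 2 * cos (of_int n * x)" for x :: real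
        using cos_le_one[of "of_int n * x"] by linarith
      show "((\<lambda>x. 2 * x - 2 * sin (of_int n * x) / of_int n) has_real_derivative 2 - 2 * cos (of_int n * x)) (at x)" for x :: real
        using n0 by (auto intro!: derivative_eq_intros)
    qed measurable
    finally have e: "(LINT h|tm 0 ?H. (cmod (cis (of_int n * h) - 1))\<^sup>2) = 2 * ?H - 2 * (sin (of_int n * ?H) / of_int n)" by simp
    have "\<bar>sin (of_int n * ?H) / of_int n\<bar> \<le> 1 / \<bar>of_int n\<bar>" by (simp add: abs_divide divide_right_mono)
    also have "\<dots> \<le> 1 / N" using n N by (intro divide_left_mono) (auto simp: mult_pos_pos)
    finally have "sin (of_int n * ?H) / of_int n \<le> 1 / N" by linarith
    then show ?thesis unfolding e by simp
  qed
  have fin: "(\<Sum>n\<in>T. (if real_of_int \<bar>n\<bar> \<le> N then 0 else (cmod (fourier_coeff ?E n))\<^sup>2)) \<le> B" if T: "finite T" for T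
  proof -
    let ?T = "{n\<in>T. \<not> real_of_int \<bar>n\<bar> \<le> N}"
    have fT: "finite ?T" using T by simp
    have i: "integrable (tm 0 ?H) (\<lambda>h. (cmod (cis (of_int n * h) - 1))\<^sup>2)" for n :: int
    proof (rule integrable_tm_bounded[where C=4])
      fix h
      have "cmod (cis (of_int n * h) - 1) \<le> 2" using norm_triangle_ineq4[of "cis (of_int n * h)" 1] by simp
      then have "(cmod (cis (of_int n * h) - 1))\<^sup>2 \<le> 2\<^sup>2" by (intro power_mono) auto
      then show "norm ((cmod (cis (of_int n * h) - 1))\<^sup>2) \<le> 4" by simp
    qed measurable
    have "?H * (\<Sum>n\<in>?T. (cmod (fourier_coeff ?E n))\<^sup>2) \<le> (\<Sum>n\<in>?T. (LINT h|tm 0 ?H. (cmod (cis (of_int n * h) - 1))\<^sup>2) * (cmod (fourier_coeff ?E n))\<^sup>2)"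
      unfolding sum_distrib_left by (intro sum_mono mult_right_mono avg) auto
    also have "\<dots> = (LINT h|tm 0 ?H. (\<Sum>n\<in>?T. (cmod (cis (of_int n * h) - 1))\<^sup>2 * (cmod (fourier_coeff ?E n))\<^sup>2))"
      using i by (subst Bochner_Integration.integral_sum) auto
    also have "\<dots> \<le> (LINT h|tm 0 ?H. B)"
    proof (rule integral_mono)
      interpret finite_measure "tm 0 ?H" by (rule finite_measure_tm)
      show "integrable (tm 0 ?H) (\<lambda>h. B)" by simp
      show "integrable (tm 0 ?H) (\<lambda>h. \<Sum>n\<in>?T. (cmod (cis (of_int n * h) - 1))\<^sup>2 * (cmod (fourier_coeff ?E n))\<^sup>2)"
        using i by (intro Bochner_Integration.integrable_sum integrable_mult_left) auto
    qed (use shift fT in auto)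
    also have "\<dots> = ?H * B" using measure_tm[of 0 ?H] H by simp
    finally have "(\<Sum>n\<in>?T. (cmod (fourier_coeff ?E n))\<^sup>2) \<le> B" using H by (simp only: mult_le_cancel_left_pos)
    also have "(\<Sum>n\<in>?T. (cmod (fourier_coeff ?E n))\<^sup>2) = (\<Sum>n\<in>T. (if real_of_int \<bar>n\<bar> \<le> N then 0 else (cmod (fourier_coeff ?E n))\<^sup>2))"
      using T by (intro sum.mono_neutral_cong_left) auto
    finally show ?thesis .
  qed
  show ?thesis unfolding B(1)
  proof (rule nn_integral_zcount_le)
    fix T :: "int set" assume T: "finite T"
    have "(\<Sum>n\<in>T. (if real_of_int \<bar>n\<bar> \<le> N then 0 else ennreal ((cmod (fourier_coeff ?E n))\<^sup>2)))
      = (\<Sum>n\<in>T. ennreal (if real_of_int \<bar>n\<bar> \<le> N then 0 else (cmod (fourier_coeff ?E n))\<^sup>2))"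
      by (intro sum.cong) auto
    also have "\<dots> = ennreal (\<Sum>n\<in>T. (if real_of_int \<bar>n\<bar> \<le> N then 0 else (cmod (fourier_coeff ?E n))\<^sup>2))"
      by (rule sum_ennreal) auto
    also have "\<dots> \<le> ennreal B" by (rule ennreal_leI[OF fin[OF T]])
    finally show "(\<Sum>n\<in>T. (if real_of_int \<bar>n\<bar> \<le> N then 0 else ennreal ((cmod (fourier_coeff ?E n))\<^sup>2))) \<le> ennreal B" .
  qed
qed simp

text \<open>Along characteristics the transport equation is an ordinary differential equation at
  each point, solved by \<open>exp (- \<i> F)\<close> with \<open>F\<close> the integral of V along
  the characteristic. By uniqueness this is the mild solution; translations do not change absolute
  values of Fourier coefficients, so \<open>exp_phase_tail\<close> applies, and the coefficients of
  \<open>F\<close> are the oscillatory integrals on the right.\<close>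

lemma transport_regularity:
  fixes V :: "real \<Rightarrow> real \<Rightarrow> real" and k :: real
  defines "P \<equiv> \<lambda>t (n::int). of_int n * (- k * ln (1 + t))"
  assumes V: "meas_potential V" and C: "\<And>s x. \<bar>V s x\<bar> \<le> C"
    and g: "evol P V g 0 T" and B: "\<And>t. t \<in> {0..T} \<Longrightarrow> nrm torus (g t) \<le> B"
    and g0: "\<And>n. fourier_coeff (g 0) n = (if n = 0 then 1 else 0)"
    and T: "0 \<le> T" and N: "0 < N"
  shows "(\<integral>\<^sup>+n. (if real_of_int \<bar>n\<bar> \<le> N then 0 else ennreal ((cmod (fourier_coeff (g T) n))\<^sup>2)) \<partial>zcount)
    \<le> (\<integral>\<^sup>+n. ennreal (4 * \<bar>of_int n\<bar> / N *
          (cmod (LINT s|tm 0 T. fourier_coeff (\<lambda>x. of_real (V s x)) n * cis (P s n)))\<^sup>2) \<partial>zcount)"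
proof -
  have C0: "0 \<le> C" using C[of 0 0] by linarith
  define \<tau> where "\<tau> t = - k * ln (1 + t)" for t
  have [measurable]: "\<tau> \<in> borel_measurable borel" unfolding \<tau>_def[abs_def] by measurable
  \<comment> \<open>The potential seen from the moving frame.\<close>
  define W where "W s x = V s (rot (\<tau> s) x)" for s x
  have Vm [measurable]: "(\<lambda>p. V (fst p) (snd p)) \<in> borel_measurable (borel \<Otimes>\<^sub>M borel)" by (rule meas_potentialD[OF V])
  have Wm [measurable]: "(\<lambda>p. W (fst p) (snd p)) \<in> borel_measurable (borel \<Otimes>\<^sub>M borel)"
  proof -
    have "(\<lambda>p. (fst p, rot (\<tau> (fst p)) (snd p))) \<in> borel \<Otimes>\<^sub>M borel \<rightarrow>\<^sub>M borel \<Otimes>\<^sub>M borel" by measurable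
    from measurable_compose[OF this Vm] show ?thesis by (simp add: W_def)
  qed
  then have W: "meas_potential W" by (simp add: meas_potential_def)
  have CW: "\<bar>W s x\<bar> \<le> C" for s x by (simp add: W_def C)
  interpret W: bounded_potential W 0 T C by unfold_locales (use W CW C0 in auto)
  define gt where "gt s = (\<lambda>x. g s (rot (\<tau> s) x))" for s
  have gL: "sq_integrable torus (g t)" if "t \<in> {0..T}" for t using g that by (auto simp: evol_def)
  have gm: "g t \<in> borel_measurable borel" if "t \<in> {0..T}" for t using sq_integrable_measurable[OF gL[OF that]] by simp
  have Vgm: "Vmul V t (g t) \<in> borel_measurable borel" if "t \<in> {0..T}" for t
    using gm[OF that] potential_measurable[OF V, of t] unfolding Vmul_def by measurable
  have fg: "fourier_coeff (gt t) n = cis (P t n) * fourier_coeff (g t) n" if "t \<in> {0..T}" for t n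
    unfolding gt_def fourier_rot[OF gm[OF that]] by (simp add: P_def \<tau>_def)
  have fVg: "fourier_coeff (Vmul W t (gt t)) n = cis (P t n) * fourier_coeff (Vmul V t (g t)) n" if "t \<in> {0..T}" for t n
  proof -
    have "Vmul W t (gt t) = (\<lambda>x. Vmul V t (g t) (rot (\<tau> t) x))" by (simp add: Vmul_def W_def gt_def)
    then show ?thesis using fourier_rot[OF Vgm[OF that]] by (simp add: P_def \<tau>_def)
  qed
  \<comment> \<open>The moving frame absorbs the free evolution completely, so both competitors
    evolve with zero phase.\<close>
  let ?Z = "\<lambda>(t::real) (n::int). 0::real"
  have ev1: "evol ?Z W gt 0 T"
    unfolding evol_def
  proof (intro conjI allI impI ballI)
    show "sq_integrable torus (gt t)" if "t \<in> {0..T}" for t unfolding gt_def by (rule sq_integrable_rot[OF gL[OF that]])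
    show "(\<lambda>s. cis 0 * fourier_coeff (Vmul W s (gt s)) n) \<in> borel_measurable (tm 0 T)" for n
    proof -
      have "(\<lambda>s. cis (P s n) * fourier_coeff (Vmul V s (g s)) n) \<in> borel_measurable (tm 0 T)" using g by (auto simp: evol_def)
      also have "?this \<longleftrightarrow> ?thesis" by (rule measurable_cong) (simp add: fVg)
      finally show ?thesis .
    qed
    fix n s t assume st: "0 \<le> s" "s \<le> t" "t \<le> T"
    have "(LINT r|tm s t. cis 0 * fourier_coeff (Vmul W r (gt r)) n) = (LINT r|tm s t. cis (P r n) * fourier_coeff (Vmul V r (g r)) n)"
      using st by (intro Bochner_Integration.integral_cong refl) (simp add: fVg)
    then show "cis 0 * fourier_coeff (gt t) n - cis 0 * fourier_coeff (gt s) n =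
        - \<i> * (LINT r|tm s t. cis 0 * fourier_coeff (Vmul W r (gt r)) n)"
      using g st by (auto simp: evol_def fg)
  qed
  define F where "F t x = (LINT r|tm 0 t. W r x)" for t x
  have Fm [measurable]: "(\<lambda>p. F (fst p) (snd p)) \<in> borel_measurable (borel \<Otimes>\<^sub>M borel)"
  proof -
    have "(\<lambda>(p, r). (if 0 \<le> r \<and> r \<le> fst p then W r (snd p) else 0)) \<in> borel_measurable ((borel \<Otimes>\<^sub>M borel) \<Otimes>\<^sub>M lborel)"
    proof -
      have "(\<lambda>q. (snd q, snd (fst q))) \<in> (borel \<Otimes>\<^sub>M borel) \<Otimes>\<^sub>M lborel \<rightarrow>\<^sub>M borel \<Otimes>\<^sub>M borel" by measurable
      from measurable_compose[OF this Wm] have [measurable]: "(\<lambda>q. W (snd q) (snd (fst q))) \<in> borel_measurable ((borel \<Otimes>\<^sub>M borel) \<Otimes>\<^sub>M lborel)" by simp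
      show ?thesis unfolding case_prod_beta by measurable
    qed
    then have "(\<lambda>p. LINT r|lborel. (if 0 \<le> r \<and> r \<le> fst p then W r (snd p) else 0)) \<in> borel_measurable (borel \<Otimes>\<^sub>M borel)"
      by (rule lborel.borel_measurable_lebesgue_integral)
    moreover have "(LINT r|lborel. (if 0 \<le> r \<and> r \<le> fst p then W r (snd p) else 0)) = F (fst p) (snd p)" for p
      unfolding F_def integral_tm set_lebesgue_integral_def
      by (intro Bochner_Integration.integral_cong refl) (auto simp: indicator_def)
    ultimately show ?thesis by simp
  qed
  have Fm1: "F t \<in> borel_measurable borel" for t
    using measurable_compose[OF measurable_Pair1'[of t borel borel] Fm] by simp
  have Fm2: "(\<lambda>t. F t x) \<in> borel_measurable borel" for x
    using measurable_compose[OF measurable_Pair2'[of x borel borel] Fm] by simp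
  have Wm2: "(\<lambda>t. W t x) \<in> borel_measurable borel" for x
    using measurable_compose[OF measurable_Pair2'[of x borel borel] Wm] by simp
  define E where "E t x = cis (- F t x)" for t x
  have EL: "sq_integrable torus (E t)" for t
    unfolding E_def using Fm1[of t] by (intro sq_integrable_torusI[where C=1]) auto
  have E1: "nrm torus (E t) \<le> 1" for t
    using nrm_le_const(2)[OF prob_space_torus, of "E t" 1] EL[of t] by (auto simp: sq_integrable_def E_def)
  have Em: "(\<lambda>p. complex_of_real (W (fst p) (snd p)) * cis (- F (fst p) (snd p))) \<in> borel_measurable (borel \<Otimes>\<^sub>M borel)"
    by measurable
  have VE: "Vmul W r (E r) = (\<lambda>x. complex_of_real (W r x) * cis (- F r x))" for r
    by (simp add: Vmul_def E_def)
  have ev2: "evol ?Z W E 0 T"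
    unfolding evol_def
  proof (intro conjI allI impI ballI EL)
    show "(\<lambda>s. cis 0 * fourier_coeff (Vmul W s (E s)) n) \<in> borel_measurable (tm 0 T)" for n
    proof (rule measurable_tm)
      have "(\<lambda>p. complex_of_real (W (fst p) (snd p)) * cis (- F (fst p) (snd p))) \<in> borel_measurable (borel \<Otimes>\<^sub>M torus)"
        using Em measurable_cong_sets[OF sets_pair_measure_cong[OF refl sets_torus] refl] by blast
      then have "(\<lambda>p. complex_of_real (W (fst p) (snd p)) * cis (- F (fst p) (snd p)) * cnj (ech n (snd p))) \<in> borel_measurable (borel \<Otimes>\<^sub>M torus)"
        by measurable
      then have "(\<lambda>s. LINT x|torus. complex_of_real (W s x) * cis (- F s x) * cnj (ech n x)) \<in> borel_measurable borel"
        by (intro torus.borel_measurable_lebesgue_integral) (simp add: case_prod_beta)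
      then show "(\<lambda>s. cis 0 * fourier_coeff (Vmul W s (E s)) n) \<in> borel_measurable borel"
        unfolding VE fourier_coeff_ip ip_def by simp
    qed
    fix n s t assume st: "0 \<le> s" "s \<le> t" "t \<le> T"
    have "fourier_coeff (E t) n - fourier_coeff (E s) n = fourier_coeff (\<lambda>x. E t x - E s x) n"
      by (rule fourier_coeff_diff[OF EL EL, symmetric])
    also have "(\<lambda>x. E t x - E s x) = (\<lambda>x. - \<i> * (LINT r|tm s t. of_real (W r x) * cis (- F r x)))"
      unfolding E_def using exp_integral_equation[OF Wm2 CW F_def Fm2 st(1,2)] by simp
    also have "fourier_coeff \<dots> n = - \<i> * fourier_coeff (\<lambda>x. LINT r|tm s t. of_real (W r x) * cis (- F r x)) n"
      by (rule fourier_coeff_cmult)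
    also have "fourier_coeff (\<lambda>x. LINT r|tm s t. of_real (W r x) * cis (- F r x)) n
      = (LINT r|tm s t. fourier_coeff (\<lambda>x. of_real (W r x) * cis (- F r x)) n)"
      by (rule fourier_integral_tm[OF Em, where C=C]) (use CW in \<open>auto simp: norm_mult\<close>)
    finally show "cis 0 * fourier_coeff (E t) n - cis 0 * fourier_coeff (E s) n =
        - \<i> * (LINT r|tm s t. cis 0 * fourier_coeff (Vmul W r (E r)) n)"
      unfolding VE by simp
  qed
  define B' where "B' = max B 1"
  have gtB: "nrm torus (gt t) \<le> B'" if "t \<in> {0..T}" for t
    using nrm_rot[OF gm[OF that]] B[OF that] by (auto simp: gt_def B'_def)
  have EB: "nrm torus (E t) \<le> B'" for t using E1[of t] by (auto simp: B'_def)
  have ev: "evol ?Z W (\<lambda>t x. gt t x - E t x) 0 T" by (rule W.evol_diff[OF ev1 ev2 gtB EB])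
  have gtL: "sq_integrable torus (gt t)" if "t \<in> {0..T}" for t using ev1 that by (auto simp: evol_def)
  have zB: "nrm torus (\<lambda>x. gt t x - E t x) \<le> B' + B'" if "t \<in> {0..T}" for t
    using nrm_triangle_diff[OF gtL[OF that] EL[of t]] gtB[OF that] EB[of t] by linarith
  have T0: "0 \<in> {0..T}" and TT: "T \<in> {0..T}" using T by auto
  \<comment> \<open>Both start from the constant 1; only Fourier coefficients of \<open>g 0\<close>
    are given, so the equality is obtained in norm.\<close>
  have "nrm torus (\<lambda>x. gt 0 x - E 0 x) = nrm zcount (\<lambda>n. 0)"
  proof -
    have F0: "F 0 x = 0" for x unfolding F_def by (rule integral_tm_trivial)
    have "E 0 = (\<lambda>x. \<Sum>n\<in>{0}. 1 * ech n x)" by (simp add: E_def[abs_def] F0)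
    then have "fourier_coeff (E 0) n = (if n = 0 then 1 else 0)" for n
      using fourier_coeff_trig[of "{0}" "\<lambda>_. 1" n] by simp
    then have "fourier_coeff (\<lambda>x. gt 0 x - E 0 x) n = 0" for n
      by (simp add: fourier_coeff_diff[OF gtL[OF T0] EL] fg[OF T0] g0 P_def)
    then show ?thesis
      by (subst nrm_fourier[OF sq_integrable_diff[OF gtL[OF T0] EL], symmetric]) (intro nrm_cong, simp)
  qed
  also have "\<dots> = 0" by (simp add: nrm_def)
  finally have "nrm torus (\<lambda>x. gt T x - E T x) = 0"
    using W.evol_norm_conserved[OF ev zB _ TT] by (simp add: B'_def)
  then have "fourier_coeff (\<lambda>x. gt T x - E T x) n = 0" for n
    using cmod_fourier_le[OF sq_integrable_diff[OF gtL[OF TT] EL], of T n] by simp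
  then have "fourier_coeff (gt T) n = fourier_coeff (E T) n" for n
    by (simp add: fourier_coeff_diff[OF gtL[OF TT] EL])
  then have "cmod (fourier_coeff (g T) n) = cmod (fourier_coeff (E T) n)" for n
    using arg_cong[OF fg[OF TT, of n], of cmod] by (simp add: norm_mult)
  then have "(\<integral>\<^sup>+n. (if real_of_int \<bar>n\<bar> \<le> N then 0 else ennreal ((cmod (fourier_coeff (g T) n))\<^sup>2)) \<partial>zcount)
    = (\<integral>\<^sup>+n. (if real_of_int \<bar>n\<bar> \<le> N then 0 else ennreal ((cmod (fourier_coeff (\<lambda>x. cis (- F T x)) n))\<^sup>2)) \<partial>zcount)"
    by (intro nn_integral_cong) (simp add: E_def[abs_def])
  also have "\<dots> \<le> (\<integral>\<^sup>+n. ennreal (4 * \<bar>of_int n\<bar> / N * (cmod (fourier_coeff (\<lambda>x. of_real (F T x)) n))\<^sup>2) \<partial>zcount)"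
  proof (rule exp_phase_tail[OF Fm1 _ N])
    show "\<bar>F T x\<bar> \<le> C * (T - 0)" for x
      using integral_tm_bound[OF T, of "\<lambda>r. W r x" C] CW Wm2[of x] by (simp add: F_def)
  qed
  finally have bound: "(\<integral>\<^sup>+n. (if real_of_int \<bar>n\<bar> \<le> N then 0 else ennreal ((cmod (fourier_coeff (g T) n))\<^sup>2)) \<partial>zcount)
    \<le> (\<integral>\<^sup>+n. ennreal (4 * \<bar>of_int n\<bar> / N * (cmod (fourier_coeff (\<lambda>x. of_real (F T x)) n))\<^sup>2) \<partial>zcount)" .
  have FS: "fourier_coeff (\<lambda>x. of_real (F T x)) n = (LINT s|tm 0 T. fourier_coeff (\<lambda>x. of_real (V s x)) n * cis (P s n))" for n
  proof -
    have "(\<lambda>x. complex_of_real (F T x)) = (\<lambda>x. LINT s|tm 0 T. complex_of_real (W s x))"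
      unfolding F_def by (simp only: integral_complex_of_real)
    then have e: "fourier_coeff (\<lambda>x. of_real (F T x)) n = (LINT s|tm 0 T. fourier_coeff (\<lambda>x. of_real (W s x)) n)"
      using fourier_integral_tm[of "\<lambda>s x. of_real (W s x)" 0 T C n] CW by simp
    have "fourier_coeff (\<lambda>x. of_real (W s x)) n = fourier_coeff (\<lambda>x. of_real (V s x)) n * cis (P s n)" for s
      unfolding W_def using fourier_rot[of "\<lambda>x. complex_of_real (V s x)" "\<tau> s" n] potential_measurable[OF V, of s]
      by (simp add: P_def \<tau>_def mult_ac)
    then show ?thesis by (simp only: e)
  qed
  show ?thesis using bound unfolding FS .
qed

section \<open>Phases of the two equations\<close>

text \<open>At each time \<open>t >= 0\<close> this alters V on a null set only and turns the
  essential bound into a pointwise one. The value zero at negative times extends joint measurability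
  to the whole plane.\<close>

definition truncated :: "real \<Rightarrow> real \<Rightarrow> (real \<Rightarrow> real \<Rightarrow> real) \<Rightarrow> real \<Rightarrow> real \<Rightarrow> real" where
  "truncated \<gamma> c V t x = (if 0 \<le> t \<and> \<bar>V t x\<bar> \<le> c * (1 + t) powr (- \<gamma>) then V t x else 0)"

lemma truncated_bound: "0 \<le> c \<Longrightarrow> 0 \<le> t \<Longrightarrow> \<bar>truncated \<gamma> c V t x\<bar> \<le> c * (1 + t) powr (- \<gamma>)"
  by (simp add: truncated_def)

lemma truncated_bound_const: "0 \<le> c \<Longrightarrow> 0 \<le> \<gamma> \<Longrightarrow> \<bar>truncated \<gamma> c V t x\<bar> \<le> c"
proof (cases "0 \<le> t")
  case True
  assume c: "0 \<le> c" "0 \<le> \<gamma>"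
  have "(1 + t) powr (- \<gamma>) \<le> (1 + t) powr 0" using True c by (intro powr_mono) auto
  then have "c * (1 + t) powr (- \<gamma>) \<le> c * 1" using c True by (intro mult_left_mono) auto
  then show ?thesis using truncated_bound[OF c(1) True, of \<gamma> V x] by linarith
qed (simp add: truncated_def)

lemma meas_potential_truncated:
  assumes "admissible_potential \<gamma> c V" shows "meas_potential (truncated \<gamma> c V)"
proof -
  have V: "(\<lambda>(t, x). V t x) \<in> borel_measurable (restrict_space borel {0..} \<Otimes>\<^sub>M torus)"
    using assms by (simp add: admissible_potential_def)
  let ?\<Omega> = "{0..} \<times> (UNIV :: real set)"
  let ?B = "borel \<Otimes>\<^sub>M borel :: (real \<times> real) measure"
  have \<Omega>: "?\<Omega> \<inter> space ?B \<in> sets ?B" by (simp add: space_pair_measure)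
  have 1: "fst \<in> restrict_space ?B ?\<Omega> \<rightarrow>\<^sub>M restrict_space borel {0..}"
    by (intro measurable_restrict_space2 measurable_restrict_space1 measurable_fst) (auto simp: space_restrict_space)
  have 2: "snd \<in> restrict_space ?B ?\<Omega> \<rightarrow>\<^sub>M torus"
    using measurable_restrict_space1[OF measurable_snd[of borel borel], of ?\<Omega>] measurable_cong_sets[OF refl sets_torus] by blast
  have "(\<lambda>p. (fst p, snd p)) \<in> restrict_space ?B ?\<Omega> \<rightarrow>\<^sub>M restrict_space borel {0..} \<Otimes>\<^sub>M torus"
    using 1 2 by (rule measurable_Pair)
  from measurable_compose[OF this V] have "(\<lambda>p. V (fst p) (snd p)) \<in> borel_measurable (restrict_space ?B ?\<Omega>)"
    by (simp add: case_prod_beta)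
  then have "(\<lambda>p. if p \<in> ?\<Omega> then V (fst p) (snd p) else 0) \<in> borel_measurable ?B"
    using measurable_restrict_space_iff[OF \<Omega>, of 0 borel "\<lambda>p. V (fst p) (snd p)"] by simp
  moreover define F where "F p = (if p \<in> ?\<Omega> then V (fst p) (snd p) else 0)" for p
  ultimately have [measurable]: "F \<in> borel_measurable ?B" by (simp add: F_def[abs_def])
  have "truncated \<gamma> c V (fst p) (snd p) = (if \<bar>F p\<bar> \<le> c * (1 + fst p) powr (- \<gamma>) then F p else 0)" for p
    by (auto simp: truncated_def F_def mem_Times_iff)
  moreover have "(\<lambda>p. if \<bar>F p\<bar> \<le> c * (1 + fst p) powr (- \<gamma>) then F p else 0) \<in> borel_measurable ?B" by measurable
  ultimately show ?thesis by (simp add: meas_potential_def)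
qed

lemma truncated_AE:
  assumes "admissible_potential \<gamma> c V" "0 \<le> t"
  shows "AE x in torus. truncated \<gamma> c V t x = V t x"
proof -
  have le: "esssup torus (\<lambda>x. ereal \<bar>V t x\<bar>) \<le> ereal (c * (1 + t) powr (- \<gamma>))"
    using assms by (simp add: admissible_potential_def)
  have "AE x in torus. ereal \<bar>V t x\<bar> \<le> esssup torus (\<lambda>x. ereal \<bar>V t x\<bar>)" by (rule esssup_AE)
  then show ?thesis
  proof eventually_elim
    case (elim x)
    then have "ereal \<bar>V t x\<bar> \<le> ereal (c * (1 + t) powr (- \<gamma>))" using le by (rule order_trans)
    then show ?case using assms(2) by (simp add: truncated_def)
  qed
qed

lemma admissible_section_measurable:
  assumes "admissible_potential \<gamma> c V" "0 \<le> t" shows "V t \<in> borel_measurable borel"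
proof -
  have V: "(\<lambda>(t, x). V t x) \<in> borel_measurable (restrict_space borel {0..} \<Otimes>\<^sub>M torus)"
    using assms by (simp add: admissible_potential_def)
  have "Pair t \<in> torus \<rightarrow>\<^sub>M restrict_space borel {0..} \<Otimes>\<^sub>M torus"
    by (rule measurable_Pair1') (use assms(2) in \<open>simp add: space_restrict_space\<close>)
  from measurable_compose[OF this V] show ?thesis by simp
qed

section \<open>Mild solutions in the interaction picture\<close>

text \<open>The phase for \<open>k = 1\<close>: both free operators are multiples of k, so the
  actual phase is k times this one, which is the form that averaging in k requires.\<close>

definition phase :: "(real \<Rightarrow> int \<Rightarrow> real) \<Rightarrow> real \<Rightarrow> int \<Rightarrow> real" where
  "phase \<theta> t n = (LINT r|tm 0 t. \<theta> r n)"

lemma phase_0 [simp]: "phase \<theta> 0 n = 0"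
  unfolding phase_def by (rule integral_tm_trivial)

definition regular_symbol :: "(real \<Rightarrow> int \<Rightarrow> real) \<Rightarrow> bool" where
  "regular_symbol \<theta> \<longleftrightarrow> (\<forall>n. (\<lambda>r. \<theta> r n) \<in> borel_measurable borel \<and> (\<exists>C. \<forall>r\<ge>0. \<bar>\<theta> r n\<bar> \<le> C))"

lemma regular_symbol_integrable:
  assumes "regular_symbol \<theta>" "0 \<le> s" shows "integrable (tm s t) (\<lambda>r. \<theta> r n)"
proof -
  obtain C where C: "\<forall>r\<ge>0. \<bar>\<theta> r n\<bar> \<le> C" and m: "(\<lambda>r. \<theta> r n) \<in> borel_measurable borel"
    using assms(1) by (auto simp: regular_symbol_def)
  show ?thesis by (rule integrable_tm_bounded[where C=C]) (use C assms(2) measurable_tm[OF m] in auto)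
qed

lemma phase_diff:
  assumes "regular_symbol \<theta>" "0 \<le> s" "s \<le> t"
  shows "phase \<theta> t n - phase \<theta> s n = (LINT r|tm s t. \<theta> r n)"
  unfolding phase_def
  using tm_split(3)[OF assms(2,3) regular_symbol_integrable[OF assms(1) order_refl]] by simp

lemma phase_measurable:
  assumes "regular_symbol \<theta>" shows "(\<lambda>t. phase \<theta> t n) \<in> borel_measurable borel"
proof -
  have [measurable]: "(\<lambda>r. \<theta> r n) \<in> borel_measurable borel" using assms by (simp add: regular_symbol_def)
  have "(\<lambda>t. LINT r|lborel. (if 0 \<le> r \<and> r \<le> t then \<theta> r n else 0)) \<in> borel_measurable borel"
    by (rule lborel.borel_measurable_lebesgue_integral) measurable
  moreover have "(LINT r|lborel. (if 0 \<le> r \<and> r \<le> t then \<theta> r n else 0)) = phase \<theta> t n" for t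
    unfolding phase_def integral_tm set_lebesgue_integral_def
    by (intro Bochner_Integration.integral_cong refl) (auto simp: indicator_def)
  ultimately show ?thesis by simp
qed

lemma propagator_phase:
  assumes \<theta>: "regular_symbol \<theta>" and h: "\<And>r. 0 \<le> r \<Longrightarrow> h r n = of_real (k * \<theta> r n)" and st: "0 \<le> s" "s \<le> t"
  shows "propagator_mult h t s n = cis (- (k * phase \<theta> t n)) * cis (k * phase \<theta> s n)"
proof -
  have "(LBINT r:{s..t}. h r n) = (LINT r|tm s t. h r n)" by (rule integral_tm[symmetric])
  also have "\<dots> = (LINT r|tm s t. complex_of_real (k * \<theta> r n))"
    using st by (intro Bochner_Integration.integral_cong refl h) simp
  also have "\<dots> = complex_of_real (k * (phase \<theta> t n - phase \<theta> s n))"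
    unfolding phase_diff[OF \<theta> st] by (simp only: integral_complex_of_real integral_mult_right_zero)
  finally have "propagator_mult h t s n = exp (- \<i> * complex_of_real (k * (phase \<theta> t n - phase \<theta> s n)))"
    unfolding propagator_mult_def by (simp only:)
  also have "\<dots> = cis (- (k * phase \<theta> t n) + k * phase \<theta> s n)"
    by (simp add: cis_conv_exp algebra_simps)
  finally show ?thesis by (simp only: cis_mult)
qed

lemma fourier_coeff_one: "fourier_coeff (\<lambda>_. 1) n = (if n = 0 then 1 else 0)"
  using fourier_coeff_trig[of "{0}" "\<lambda>_. 1" n] by simp

text \<open>Multiplying Duhamel's formula by \<open>cis (P t n)\<close> removes the final time from
  the integrand; subtracting the formulas for two times then gives \<open>evol\<close>. Conservation
  of the norm requires some bound on the interval, which the assumed continuity in time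
  provides.\<close>

lemma mild_solution_evol:
  assumes \<theta>: "regular_symbol \<theta>" and h: "\<And>r n. 0 \<le> r \<Longrightarrow> h r n = of_real (k * \<theta> r n)"
    and V: "admissible_potential \<gamma> c V" and c: "0 \<le> c" "0 \<le> \<gamma>" and w: "mild_solution h V (\<lambda>_. 1) w"
  shows "evol (\<lambda>t n. k * phase \<theta> t n) (truncated \<gamma> c V) w 0 T"
    and "0 \<le> t \<Longrightarrow> nrm torus (w t) = 1"
    and "fourier_coeff (w 0) n = (if n = 0 then 1 else 0)"
proof -
  define P where "P t n = k * phase \<theta> t n" for t n
  define W where "W = truncated \<gamma> c V"
  have L: "sq_integrable torus (w t)" if "0 \<le> t" for t
    using w that by (simp add: mild_solution_def in_L2_sq_integrable)
  have W: "meas_potential W" unfolding W_def by (rule meas_potential_truncated[OF V])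
  have F: "fourier_coeff (\<lambda>x. of_real (V s x) * w s x) n = fourier_coeff (Vmul W s (w s)) n" if s: "0 \<le> s" for s n
    unfolding fourier_coeff_def
  proof (rule integral_cong_AE)
    have [measurable]: "w s \<in> borel_measurable borel" using sq_integrable_measurable[OF L[OF s]] by simp
    have [measurable]: "V s \<in> borel_measurable borel" by (rule admissible_section_measurable[OF V s])
    have [measurable]: "W s \<in> borel_measurable borel" by (rule potential_measurable[OF W])
    show "(\<lambda>x. of_real (V s x) * w s x * exp (- (\<i> * of_int n * of_real x))) \<in> borel_measurable torus" by measurable
    show "(\<lambda>x. Vmul W s (w s) x * exp (- (\<i> * of_int n * of_real x))) \<in> borel_measurable torus"
      unfolding Vmul_def by measurable
    show "AE x in torus. of_real (V s x) * w s x * exp (- (\<i> * of_int n * of_real x)) = Vmul W s (w s) x * exp (- (\<i> * of_int n * of_real x))"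
      using truncated_AE[OF V s] by eventually_elim (simp add: Vmul_def W_def)
  qed
  define K where "K s n = cis (P s n) * fourier_coeff (Vmul W s (w s)) n" for s n
  have prp: "propagator_mult h t s n = cis (- P t n) * cis (P s n)" if "0 \<le> s" "s \<le> t" for s t n
    unfolding P_def by (rule propagator_phase[OF \<theta> h that])
  have eq: "propagator_mult h t s n * fourier_coeff (\<lambda>x. of_real (V s x) * w s x) n = cis (- P t n) * K s n"
    if "s \<in> {0..t}" for s t n
    using that F[of s n] prp[of s t n] by (simp add: K_def mult.assoc)
  have cc: "cis (P t n) * (cis (- P t n) * z) = z" for t n z
    by (simp add: mult.assoc[symmetric] cis_mult)
  have Kint: "integrable (tm 0 t) (\<lambda>s. K s n)" if "0 \<le> t" for t n
  proof -
    have "set_integrable lborel {0..t} (\<lambda>s. propagator_mult h t s n * fourier_coeff (\<lambda>x. of_real (V s x) * w s x) n)"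
      using w that by (simp add: mild_solution_def)
    then have "integrable (tm 0 t) (\<lambda>s. propagator_mult h t s n * fourier_coeff (\<lambda>x. of_real (V s x) * w s x) n)"
      by (simp only: integrable_tm)
    then have "integrable (tm 0 t) (\<lambda>s. cis (- P t n) * K s n)"
      by (subst Bochner_Integration.integrable_cong[OF refl, of _ _ "\<lambda>s. propagator_mult h t s n * fourier_coeff (\<lambda>x. of_real (V s x) * w s x) n"])
        (simp_all add: eq)
    then have "integrable (tm 0 t) (\<lambda>s. cis (P t n) * (cis (- P t n) * K s n))" by (rule integrable_mult_right)
    then show ?thesis by (simp only: cc)
  qed
  have duh: "cis (P t n) * fourier_coeff (w t) n = (if n = 0 then 1 else 0) - \<i> * (LINT s|tm 0 t. K s n)"
    if t: "0 \<le> t" for t n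
  proof -
    have "(LBINT s:{0..t}. propagator_mult h t s n * fourier_coeff (\<lambda>x. of_real (V s x) * w s x) n)
      = (LINT s|tm 0 t. propagator_mult h t s n * fourier_coeff (\<lambda>x. of_real (V s x) * w s x) n)" by (rule integral_tm[symmetric])
    also have "\<dots> = (LINT s|tm 0 t. cis (- P t n) * K s n)"
      by (rule Bochner_Integration.integral_cong[OF refl]) (simp add: eq)
    also have "\<dots> = cis (- P t n) * (LINT s|tm 0 t. K s n)" by simp
    finally have I: "(LBINT s:{0..t}. propagator_mult h t s n * fourier_coeff (\<lambda>x. of_real (V s x) * w s x) n) = \<dots>" .
    have p0: "propagator_mult h t 0 n = cis (- P t n)" using prp[of 0 t n] t by (simp add: P_def)
    have "fourier_coeff (w t) n = propagator_mult h t 0 n * fourier_coeff (\<lambda>_. 1) n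
       - \<i> * (LBINT s:{0..t}. propagator_mult h t s n * fourier_coeff (\<lambda>x. of_real (V s x) * w s x) n)"
      using w t unfolding mild_solution_def by blast
    also have "\<dots> = cis (- P t n) * ((if n = 0 then 1 else 0) - \<i> * (LINT s|tm 0 t. K s n))"
      unfolding I p0 fourier_coeff_one by (simp add: algebra_simps)
    finally show ?thesis by (simp only: cc)
  qed
  have ev: "evol P W w 0 T" for T
    unfolding evol_def
  proof (intro conjI allI impI ballI)
    show "sq_integrable torus (w t)" if "t \<in> {0..T}" for t using L that by simp
    show "(\<lambda>s. cis (P s n) * fourier_coeff (Vmul W s (w s)) n) \<in> borel_measurable (tm 0 T)" for n
    \<comment> \<open>For negative T the time interval is empty and every function on it is
      measurable.\<close>
    proof (cases "0 \<le> T")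
      case True
      show ?thesis using borel_measurable_integrable[OF Kint[OF True, of n]] by (simp add: K_def)
    next
      case False
      then show ?thesis by (intro measurableI) simp_all
    qed
    fix n s t assume st: "0 \<le> s" "s \<le> t" "t \<le> T"
    then have t: "0 \<le> t" by simp
    show "cis (P t n) * fourier_coeff (w t) n - cis (P s n) * fourier_coeff (w s) n =
        - \<i> * (LINT r|tm s t. cis (P r n) * fourier_coeff (Vmul W r (w r)) n)"
      unfolding duh[OF st(1)] duh[OF t] tm_split(3)[OF st(1,2) Kint[OF t]] by (simp add: K_def algebra_simps)
  qed
  then show "evol (\<lambda>t n. k * phase \<theta> t n) (truncated \<gamma> c V) w 0 T" for T
    by (simp add: P_def[abs_def] W_def)
  show w0: "fourier_coeff (w 0) n = (if n = 0 then 1 else 0)" for n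
    using duh[of 0 n] unfolding integral_tm_trivial by (simp add: P_def)
  have nrm0: "nrm torus (w 0) = 1"
  proof -
    have "nrm torus (w 0) = nrm zcount (fourier_coeff (\<lambda>_. 1))"
      unfolding nrm_fourier[OF L[OF order_refl], symmetric] by (rule nrm_cong) (simp add: w0 fourier_coeff_one)
    also have "\<dots> = nrm torus (\<lambda>_. 1)" by (rule nrm_fourier) (simp add: sq_integrable_def)
    also have "\<dots> = 1" using torus.prob_space by (simp add: nrm_def)
    finally show ?thesis .
  qed
  assume t: "0 \<le> t"
  \<comment> \<open>Only used to bound the norm on a compact interval, as
    \<open>evol_norm_conserved\<close> asks.\<close>
  have "continuous_on {0..t} (\<lambda>s. nrm torus (w s))"
    unfolding continuous_on_def
  proof
    fix r assume r: "r \<in> {0..t}"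
    have "((\<lambda>s. nrm torus (\<lambda>x. w s x - w r x)) \<longlongrightarrow> 0) (at r within {0..})"
      using w r by (simp add: mild_solution_def L2_norm_nrm)
    then have "((\<lambda>s. nrm torus (\<lambda>x. w s x - w r x)) \<longlongrightarrow> 0) (at r within {0..t})"
      by (rule tendsto_within_subset) auto
    then have "((\<lambda>s. nrm torus (w s) - nrm torus (w r)) \<longlongrightarrow> 0) (at r within {0..t})"
    proof (rule Lim_null_comparison[rotated])
      have "norm (nrm torus (w s) - nrm torus (w r)) \<le> nrm torus (\<lambda>x. w s x - w r x)" if s: "s \<in> {0..t}" for s
      proof -
        have s0: "0 \<le> s" "0 \<le> r" using s r by auto
        have "nrm torus (w s) \<le> nrm torus (\<lambda>x. w s x - w r x) + nrm torus (w r)"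
          using nrm_triangle[OF sq_integrable_diff[OF L[OF s0(1)] L[OF s0(2)]] L[OF s0(2)]] by simp
        moreover have "nrm torus (w r) \<le> nrm torus (w s) + nrm torus (\<lambda>x. w s x - w r x)"
          using nrm_triangle_diff[OF L[OF s0(1)] sq_integrable_diff[OF L[OF s0(1)] L[OF s0(2)]]] by simp
        ultimately show ?thesis by (simp add: abs_le_iff)
      qed
      then show "\<forall>\<^sub>F s in at r within {0..t}. norm (nrm torus (w s) - nrm torus (w r)) \<le> nrm torus (\<lambda>x. w s x - w r x)"
        by (auto simp: eventually_at_filter)
    qed
    then show "((\<lambda>s. nrm torus (w s)) \<longlongrightarrow> nrm torus (w r)) (at r within {0..t})"
      by (simp add: LIM_zero_iff)
  qed
  then have "bounded ((\<lambda>s. nrm torus (w s)) ` {0..t})" by (intro compact_imp_bounded compact_continuous_image) auto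
  then obtain B where "\<forall>z\<in>(\<lambda>s. nrm torus (w s)) ` {0..t}. norm z \<le> B"
    unfolding bounded_iff by (elim exE)
  then have B: "nrm torus (w s) \<le> B" if "s \<in> {0..t}" for s using that by force
  have B0: "0 \<le> B" using B[of 0] t nrm_nonneg[of torus "w 0"] by (meson atLeastAtMost_iff order_refl order_trans)
  interpret bounded_potential W 0 t c
    by unfold_locales (use W truncated_bound_const[OF c] c in \<open>auto simp: W_def\<close>)
  show "nrm torus (w t) = 1"
    using evol_norm_conserved[OF ev B B0, of t] nrm0 t by simp
qed

section \<open>The two symbols and the separation of their phases\<close>

definition transport_symbol :: "real \<Rightarrow> int \<Rightarrow> real" where
  "transport_symbol r n = - of_int n / (1 + r)"

text \<open>The minus sign of the equation cancels the one in the square of the multiplier of the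
  derivative, so the quadratic term is nonnegative: it opposes the transport for positive
  frequencies and reinforces it for negative ones.\<close>

definition schroedinger_symbol :: "real \<Rightarrow> int \<Rightarrow> real" where
  "schroedinger_symbol r n = - of_int n / (1 + r) + (if \<bar>n\<bar> \<le> \<lfloor>r / 2\<rfloor> then (of_int n)\<^sup>2 / (1 + r)\<^sup>2 else 0)"

lemma transport_mult_symbol: "transport_mult k r n = of_real (k * transport_symbol r n)"
proof -
  have "transport_mult k r n = (\<i> * \<i>) * (of_real k * of_int n / of_real (1 + r))"
    unfolding transport_mult_def dx_mult_def by (simp only: mult_ac times_divide_eq_left times_divide_eq_right)
  then show ?thesis by (simp add: transport_symbol_def)
qed

lemma schroedinger_mult_symbol: "schroedinger_mult k r n = of_real (k * schroedinger_symbol r n)"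
proof -
  have e1: "\<i> * (\<i> * of_int n) = - complex_of_int n" by (simp add: mult.assoc[symmetric])
  have e2: "(\<i> * of_int n)\<^sup>2 = - (complex_of_int n)\<^sup>2" by (simp add: power_mult_distrib)
  show ?thesis
    unfolding schroedinger_mult_def dx_mult_def schroedinger_symbol_def proj_mult_def e1 e2
    by (simp add: add.commute[of r 1])
qed

lemma regular_transport_symbol: "regular_symbol transport_symbol"
  unfolding regular_symbol_def
proof (intro allI conjI exI impI)
  fix n :: int
  show "(\<lambda>r. transport_symbol r n) \<in> borel_measurable borel" unfolding transport_symbol_def by measurable
  show "\<bar>transport_symbol r n\<bar> \<le> \<bar>of_int n\<bar>" if "0 \<le> r" for r
    unfolding transport_symbol_def using that by (simp add: abs_divide divide_le_eq mult_le_cancel_left1)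
qed

lemma regular_schroedinger_symbol: "regular_symbol schroedinger_symbol"
  unfolding regular_symbol_def
proof (intro allI conjI exI impI)
  fix n :: int
  have [measurable]: "Measurable.pred borel (\<lambda>r::real. \<bar>n\<bar> \<le> \<lfloor>r / 2\<rfloor>)"
    unfolding le_floor_iff by measurable
  show "(\<lambda>r. schroedinger_symbol r n) \<in> borel_measurable borel" unfolding schroedinger_symbol_def by measurable
  show "\<bar>schroedinger_symbol r n\<bar> \<le> \<bar>of_int n\<bar> + (of_int n)\<^sup>2" if r: "0 \<le> r" for r
  proof -
    have 1: "\<bar>- of_int n / (1 + r)\<bar> \<le> \<bar>of_int n\<bar>" using r by (simp add: abs_divide divide_le_eq mult_le_cancel_left1)
    have "1 \<le> (1 + r)\<^sup>2" using r by (simp add: power2_eq_square algebra_simps)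
    then have "(of_int n)\<^sup>2 / (1 + r)\<^sup>2 \<le> (of_int n)\<^sup>2 / 1" by (intro divide_left_mono) auto
    then have 2: "\<bar>if \<bar>n\<bar> \<le> \<lfloor>r / 2\<rfloor> then (of_int n)\<^sup>2 / (1 + r)\<^sup>2 else 0\<bar> \<le> (of_int n)\<^sup>2" by simp
    show ?thesis unfolding schroedinger_symbol_def using 1 2 by linarith
  qed
qed

lemma integral_inverse_tm: "0 \<le> s \<Longrightarrow> s \<le> t \<Longrightarrow> (LINT r|tm s t. 1 / (1 + r)) = ln (1 + t) - ln (1 + s)"
proof -
  assume st: "0 \<le> s" "s \<le> t"
  have "(LINT r|tm s t. 1 / (1 + r)) = (LINT r|lborel. 1 / (1 + r) * indicator {s..t} r)"
    by (simp add: integral_tm set_lebesgue_integral_def mult.commute)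
  also have "\<dots> = ln (1 + t) - ln (1 + s)"
    by (rule integral_FTC_Icc_nonneg) (use st in \<open>auto intro!: derivative_eq_intros\<close>)
  finally show ?thesis .
qed

lemma phase_transport: "0 \<le> t \<Longrightarrow> phase transport_symbol t n = - of_int n * ln (1 + t)"
proof -
  assume t: "0 \<le> t"
  have "phase transport_symbol t n = (LINT r|tm 0 t. - of_int n * (1 / (1 + r)))"
    unfolding phase_def transport_symbol_def by simp
  also have "\<dots> = - of_int n * (LINT r|tm 0 t. 1 / (1 + r))" by (rule integral_mult_right_zero)
  finally show ?thesis using integral_inverse_tm[OF order_refl t] by simp
qed

text \<open>Where the projection vanishes the symbols coincide, so the full quadratic term dominates
  their gap at every frequency; its time factor is largest at the start of the interval.\<close>

lemma phase_mismatch_bound: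
  assumes a: "0 \<le> a" "a \<le> s"
  shows "\<bar>(phase schroedinger_symbol s n - phase schroedinger_symbol a n) - (phase transport_symbol s n - phase transport_symbol a n)\<bar>
    \<le> (of_int n)\<^sup>2 / (1 + a)\<^sup>2 * (s - a)"
proof -
  have "(phase schroedinger_symbol s n - phase schroedinger_symbol a n) - (phase transport_symbol s n - phase transport_symbol a n)
    = (LINT r|tm a s. schroedinger_symbol r n - transport_symbol r n)"
    unfolding phase_diff[OF regular_schroedinger_symbol a] phase_diff[OF regular_transport_symbol a]
    using regular_symbol_integrable[OF regular_schroedinger_symbol a(1)] regular_symbol_integrable[OF regular_transport_symbol a(1)]
    by (rule Bochner_Integration.integral_diff[symmetric])
  also have "norm \<dots> \<le> (of_int n)\<^sup>2 / (1 + a)\<^sup>2 * (s - a)"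
  proof (rule integral_tm_bound[OF a(2)])
    show "(\<lambda>r. schroedinger_symbol r n - transport_symbol r n) \<in> borel_measurable (tm a s)"
      using regular_schroedinger_symbol regular_transport_symbol
      by (intro borel_measurable_diff measurable_tm) (simp_all add: regular_symbol_def)
    fix r assume r: "r \<in> {a..s}"
    have "(1 + a)\<^sup>2 \<le> (1 + r)\<^sup>2" using r a by (intro power_mono) auto
    then have "(of_int n)\<^sup>2 / (1 + r)\<^sup>2 \<le> (of_int n)\<^sup>2 / (1 + a)\<^sup>2" using a r by (intro divide_left_mono mult_pos_pos) auto
    then show "norm (schroedinger_symbol r n - transport_symbol r n) \<le> (of_int n)\<^sup>2 / (1 + a)\<^sup>2"
      by (simp add: schroedinger_symbol_def transport_symbol_def)
  qed
  finally show ?thesis by simp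
qed

text \<open>On the support of the projection the quadratic term costs at most half of the transport
  speed, and it can only help for the low frequency \<open>m\<close>, up to a bounded amount.\<close>

lemma symbol_separation:
  fixes n m :: int
  assumes nm: "3 * \<bar>m\<bar> \<le> \<bar>n\<bar>" "(real_of_int m)\<^sup>2 \<le> 1 + r" "2 \<le> \<bar>n\<bar>" and r: "0 \<le> r"
    and \<theta>: "\<theta> = schroedinger_symbol \<or> \<theta> = transport_symbol"
  shows "0 < n \<Longrightarrow> \<bar>of_int (n - m)\<bar> / 4 * (1 / (1 + r)) \<le> - (\<theta> r n - \<theta> r m)"
    and "n < 0 \<Longrightarrow> \<bar>of_int (n - m)\<bar> / 4 * (1 / (1 + r)) \<le> \<theta> r n - \<theta> r m"
proof -
  \<comment> \<open>The quadratic part after multiplication by \<open>1 + r\<close>, a scaling that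
    makes the transport part equal to \<open>- j\<close>.\<close>
  let ?q = "\<lambda>j::int. if \<theta> = schroedinger_symbol \<and> \<bar>j\<bar> \<le> \<lfloor>r / 2\<rfloor> then (of_int j)\<^sup>2 / (1 + r) else (0::real)"
  have \<theta>q: "\<theta> r j = (- of_int j + ?q j) / (1 + r)" for j
  proof -
    have "transport_symbol \<noteq> schroedinger_symbol"
    proof
      assume "transport_symbol = schroedinger_symbol"
      \<comment> \<open>At time 2 the projection first admits frequency 1, so the two symbols differ
        at this point.\<close>
      from fun_cong[OF fun_cong[OF this, of 2], of 1] show False
        by (simp add: transport_symbol_def schroedinger_symbol_def)
    qed
    then show ?thesis using \<theta> r
      by (auto simp: schroedinger_symbol_def transport_symbol_def add_divide_distrib diff_divide_distrib power2_eq_square)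
  qed
  have q0: "0 \<le> ?q j" for j using r by simp
  have qn: "?q n \<le> \<bar>of_int n\<bar> / 2"
  proof (cases "\<bar>n\<bar> \<le> \<lfloor>r / 2\<rfloor>")
    case True
    then have "\<bar>of_int n\<bar> \<le> r / 2" by (simp add: le_floor_iff)
    then have "\<bar>of_int n\<bar> * \<bar>of_int n\<bar> \<le> \<bar>of_int n\<bar> * ((1 + r) / 2)" by (intro mult_left_mono) auto
    then have "(of_int n)\<^sup>2 / (1 + r) \<le> \<bar>of_int n\<bar> / 2" using r by (simp add: power2_eq_square divide_le_eq)
    then show ?thesis by simp
  qed simp
  have qm: "?q m \<le> 1" using nm(2) r by (auto simp: divide_le_eq)
  have m3: "3 * \<bar>real_of_int m\<bar> \<le> \<bar>real_of_int n\<bar>" using nm(1) by linarith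
  have n2: "2 \<le> \<bar>real_of_int n\<bar>" using nm(3) by linarith
  have r1: "0 < 1 + r" using r by simp
  show "\<bar>of_int (n - m)\<bar> / 4 * (1 / (1 + r)) \<le> - (\<theta> r n - \<theta> r m)" if "0 < n"
  proof -
    \<comment> \<open>By \<open>qn\<close> the right side is at least \<open>n/2 - m\<close>, which
      exceeds \<open>(n - m)/4\<close> by \<open>(n - 3 m)/4\<close>; this is the origin of the
      factor 3 in the hypothesis.\<close>
    have "\<bar>of_int (n - m)\<bar> / 4 \<le> of_int n - ?q n - of_int m + ?q m"
      using that qn q0[of m] m3 by simp
    then have "\<bar>of_int (n - m)\<bar> / 4 / (1 + r) \<le> (of_int n - ?q n - of_int m + ?q m) / (1 + r)" using r1 by (intro divide_right_mono) auto
    then show ?thesis unfolding \<theta>q using r1 by (simp add: diff_divide_distrib[symmetric] add_divide_distrib[symmetric] minus_divide_left algebra_simps)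
  qed
  show "\<bar>of_int (n - m)\<bar> / 4 * (1 / (1 + r)) \<le> \<theta> r n - \<theta> r m" if "n < 0"
  proof -
    \<comment> \<open>Here \<open>m - n\<close> is at least \<open>2 |n| / 3 >= 4/3\<close>, and
      three quarters of it cover the bound 1 for \<open>?q m\<close>; this uses
      \<open>2 <= |n|\<close>.\<close>
    have "\<bar>of_int (n - m)\<bar> / 4 \<le> - of_int n + ?q n + of_int m - ?q m"
      using that qm q0[of n] m3 n2 by simp
    then have "\<bar>of_int (n - m)\<bar> / 4 / (1 + r) \<le> (- of_int n + ?q n + of_int m - ?q m) / (1 + r)" using r1 by (intro divide_right_mono) auto
    then show ?thesis unfolding \<theta>q using r1 by (simp add: diff_divide_distrib[symmetric] add_divide_distrib[symmetric] algebra_simps)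
  qed
qed

text \<open>The derivative of the phase difference keeps one sign, determined by the sign of n, so
  the pointwise lower bound survives integration without cancellation.\<close>

lemma phase_separation:
  fixes n m :: int
  assumes nm: "3 * \<bar>m\<bar> \<le> \<bar>n\<bar>" "(real_of_int m)\<^sup>2 \<le> 1 + a" "2 \<le> \<bar>n\<bar>" and a: "0 \<le> a" "a \<le> s" "s \<le> s'"
    and \<theta>: "\<theta> = schroedinger_symbol \<or> \<theta> = transport_symbol"
  shows "\<bar>of_int (n - m)\<bar> / 4 * \<bar>ln (1 + s) - ln (1 + s')\<bar>
    \<le> \<bar>(phase \<theta> s n - phase \<theta> s m) - (phase \<theta> s' n - phase \<theta> s' m)\<bar>"
proof -
  have s0: "0 \<le> s" using a by simp
  have reg: "regular_symbol \<theta>" using \<theta> regular_schroedinger_symbol regular_transport_symbol by auto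
  let ?d = "\<bar>real_of_int (n - m)\<bar> / 4"
  have D: "(phase \<theta> s' n - phase \<theta> s' m) - (phase \<theta> s n - phase \<theta> s m) = (LINT r|tm s s'. \<theta> r n - \<theta> r m)"
    using phase_diff[OF reg s0 a(3), of n] phase_diff[OF reg s0 a(3), of m]
      Bochner_Integration.integral_diff[OF regular_symbol_integrable[OF reg s0] regular_symbol_integrable[OF reg s0]]
    by simp
  have i1: "integrable (tm s s') (\<lambda>r. 1 / (1 + r))"
  proof (rule integrable_tm_bounded[where C=1])
    show "(\<lambda>r. 1 / (1 + r)) \<in> borel_measurable (tm s s')" by (rule measurable_tm) measurable
  qed (use s0 in auto)
  have i2: "integrable (tm s s') (\<lambda>r. \<theta> r n - \<theta> r m)"
    by (intro Bochner_Integration.integrable_diff regular_symbol_integrable[OF reg s0])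
  have L: "?d * (ln (1 + s') - ln (1 + s)) = (LINT r|tm s s'. ?d * (1 / (1 + r)))"
    unfolding integral_inverse_tm[OF s0 a(3), symmetric] by (rule integral_mult_right_zero[symmetric])
  have sep: "3 * \<bar>m\<bar> \<le> \<bar>n\<bar>" "(real_of_int m)\<^sup>2 \<le> 1 + r" "2 \<le> \<bar>n\<bar>" "0 \<le> r" if "r \<in> {s..s'}" for r
    using nm that a by auto
  have lnle: "ln (1 + s) \<le> ln (1 + s')" using s0 a by simp
  have "?d * (ln (1 + s') - ln (1 + s)) \<le> \<bar>LINT r|tm s s'. \<theta> r n - \<theta> r m\<bar>"
  proof (cases "0 < n")
    case True
    have "?d * (ln (1 + s') - ln (1 + s)) \<le> (LINT r|tm s s'. - (\<theta> r n - \<theta> r m))"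
      unfolding L
      by (rule integral_mono[OF integrable_mult_right[OF i1] Bochner_Integration.integrable_minus[OF i2]])
        (use symbol_separation(1)[OF sep \<theta> True] in auto)
    also have "\<dots> = - (LINT r|tm s s'. \<theta> r n - \<theta> r m)" by (rule Bochner_Integration.integral_minus)
    finally show ?thesis by linarith
  next
    case False
    then have "n < 0" using nm(3) by auto
    have "?d * (ln (1 + s') - ln (1 + s)) \<le> (LINT r|tm s s'. (\<theta> r n - \<theta> r m))"
      unfolding L
      by (rule integral_mono[OF integrable_mult_right[OF i1] i2])
        (use symbol_separation(2)[OF sep \<theta> \<open>n < 0\<close>] in auto)
    then show ?thesis by linarith
  qed
  moreover have "\<bar>ln (1 + s) - ln (1 + s')\<bar> = ln (1 + s') - ln (1 + s)" using lnle by simp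
  moreover have "\<bar>(phase \<theta> s n - phase \<theta> s m) - (phase \<theta> s' n - phase \<theta> s' m)\<bar> = \<bar>LINT r|tm s s'. \<theta> r n - \<theta> r m\<bar>"
    unfolding D[symmetric] by (rule abs_minus_commute)
  ultimately show ?thesis by (simp only:)
qed

section \<open>Averages over the spectral parameter\<close>

lemma oscillation_integral_measurable [measurable]:
  assumes f [measurable]: "f \<in> borel_measurable (tm a b)" and \<psi> [measurable]: "\<psi> \<in> borel_measurable (tm a b)"
  shows "(\<lambda>k. ennreal ((cmod (LINT s|tm a b. f s * cis (k * \<psi> s)))\<^sup>2)) \<in> borel_measurable borel"
proof -
  interpret finite_measure "tm a b" by (rule finite_measure_tm)
  show ?thesis by measurable
qed

lemma nn_integral_zcount_measurable [measurable]:
  fixes f :: "int \<Rightarrow> real \<Rightarrow> ennreal"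
  assumes [measurable]: "\<And>n. f n \<in> borel_measurable M"
  shows "(\<lambda>k. \<integral>\<^sup>+n. f n k \<partial>zcount) \<in> borel_measurable M"
proof -
  interpret sigma_finite_measure zcount by (rule sigma_finite_measure_count_space)
  have "(\<lambda>x. f (snd x) (fst x)) \<in> borel_measurable (M \<Otimes>\<^sub>M zcount)"
    by (rule measurable_compose_countable'[where f="\<lambda>n x. f n (fst x)" and g=snd and I=UNIV]) auto
  then show ?thesis by (intro borel_measurable_nn_integral) (simp add: case_prod_beta)
qed

lemma potential_fourier_sum:
  assumes V: "meas_potential V" and v: "\<And>x. \<bar>V s x\<bar> \<le> v"
  shows "(\<integral>\<^sup>+n. ennreal ((cmod (fourier_coeff (\<lambda>x. of_real (V s x)) n))\<^sup>2) \<partial>zcount) \<le> ennreal (v\<^sup>2)"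
proof -
  have v0: "0 \<le> v" using v[of 0] by linarith
  have "sq_integrable torus (\<lambda>x. complex_of_real (V s x))" "nrm torus (\<lambda>x. complex_of_real (V s x)) \<le> v"
    using v v0 potential_measurable[OF V, of s] by (intro nrm_le_const[OF prob_space_torus]; auto)+
  then show ?thesis unfolding parseval_nn[OF \<open>sq_integrable torus _\<close>] by (intro ennreal_leI power_mono) auto
qed

text \<open>At frequency n the oscillation gains a factor \<open>1 / |n|\<close>, which compensates
  exactly the weight \<open>|n|\<close> of the half-order seminorm. What remains is summed over n by
  Parseval's identity for V at a fixed time.\<close>

lemma transport_tail_average:
  assumes V: "meas_potential V" and v: "\<And>s x. 0 \<le> s \<Longrightarrow> \<bar>V s x\<bar> \<le> v s" and C: "\<And>s. 0 \<le> s \<Longrightarrow> v s \<le> C"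
    and vm: "v \<in> borel_measurable borel" and T: "0 \<le> T" and N: "0 < N"
  shows "(\<integral>\<^sup>+k\<in>{-A..A}. (\<integral>\<^sup>+n. ennreal (4 * \<bar>of_int n\<bar> / N *
       (cmod (LINT s|tm 0 T. fourier_coeff (\<lambda>x. of_real (V s x)) n * cis (of_int n * (- k * ln (1 + s)))))\<^sup>2) \<partial>zcount) \<partial>lborel)
    \<le> ennreal (4 * osc_const A / N) * (\<integral>\<^sup>+s. ennreal ((v s)\<^sup>2 * (1 + s)) \<partial>tm 0 T)"
proof -
  define f where "f n s = fourier_coeff (\<lambda>x. of_real (V s x)) n" for n s
  define \<psi> where "\<psi> n s = - of_int n * ln (1 + s)" for n :: int and s :: real
  have fm [measurable]: "f n \<in> borel_measurable (tm 0 T)" for n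
    unfolding f_def[abs_def] by (rule measurable_tm[OF fourier_potential_measurable[OF V]])
  have \<psi>m [measurable]: "\<psi> n \<in> borel_measurable (tm 0 T)" for n
    unfolding \<psi>_def[abs_def] by (rule measurable_tm) measurable
  have vm' [measurable]: "v \<in> borel_measurable (tm 0 T)" by (rule measurable_tm[OF vm])
  have idm [measurable]: "(\<lambda>s. s) \<in> borel_measurable (tm 0 T)" by (rule measurable_tm) simp
  define J where "J n k = ennreal ((cmod (LINT s|tm 0 T. f n s * cis (k * \<psi> n s)))\<^sup>2)" for n k
  have Jm [measurable]: "J n \<in> borel_measurable borel" for n unfolding J_def[abs_def] by measurable
  have trm: "ennreal (4 * \<bar>of_int n\<bar> / N *
       (cmod (LINT s|tm 0 T. fourier_coeff (\<lambda>x. of_real (V s x)) n * cis (of_int n * (- k * ln (1 + s)))))\<^sup>2)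
     = ennreal (4 * \<bar>of_int n\<bar> / N) * J n k" for n k
    using N by (subst ennreal_mult) (auto simp: J_def f_def \<psi>_def mult_ac)
  have fb: "cmod (f n s) \<le> C" if s: "s \<in> {0..T}" for n s
  proof -
    have s0: "0 \<le> s" using s by simp
    have "ennreal ((cmod (f n s))\<^sup>2) \<le> (\<integral>\<^sup>+n. ennreal ((cmod (f n s))\<^sup>2) \<partial>zcount)"
      using sum_le_nn_integral_zcount[of "{n}" "\<lambda>n. ennreal ((cmod (f n s))\<^sup>2)"] by simp
    also have "\<dots> \<le> ennreal ((v s)\<^sup>2)" unfolding f_def by (rule potential_fourier_sum[OF V v[OF s0]])
    finally have "(cmod (f n s))\<^sup>2 \<le> (v s)\<^sup>2" by simp
    moreover have "0 \<le> v s" using v[OF s0, of 0] by linarith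
    ultimately have "cmod (f n s) \<le> v s" by (rule power2_le_imp_le)
    then show ?thesis using C[OF s0] by linarith
  qed
  have each: "(\<integral>\<^sup>+k\<in>{-A..A}. ennreal (4 * \<bar>of_int n\<bar> / N) * J n k \<partial>lborel)
    \<le> ennreal (4 * osc_const A / N) * (\<integral>\<^sup>+s. ennreal ((cmod (f n s))\<^sup>2 * (1 + s)) \<partial>tm 0 T)" for n
  \<comment> \<open>At frequency zero nothing oscillates, but the weight vanishes.\<close>
  proof (cases "n = 0")
    case False
    then have n: "0 < \<bar>real_of_int n\<bar>" by simp
    have "(\<integral>\<^sup>+k\<in>{-A..A}. ennreal (4 * \<bar>of_int n\<bar> / N) * J n k \<partial>lborel)
      = ennreal (4 * \<bar>of_int n\<bar> / N) * (\<integral>\<^sup>+k\<in>{-A..A}. J n k \<partial>lborel)"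
      by (subst nn_integral_cmult[symmetric]) (auto simp: mult.assoc)
    also have "\<dots> \<le> ennreal (4 * \<bar>of_int n\<bar> / N) * (ennreal (osc_const A / \<bar>of_int n\<bar>) * (\<integral>\<^sup>+s. ennreal ((cmod (f n s))\<^sup>2 * (1 + s)) \<partial>tm 0 T))"
      unfolding J_def
    proof (intro mult_left_mono oscillation_bound[OF order_refl T n fm fb \<psi>m])
      show "\<bar>real_of_int n\<bar> * \<bar>ln (1 + s) - ln (1 + s')\<bar> \<le> \<bar>\<psi> n s - \<psi> n s'\<bar>" for s s'
      proof -
        have "\<psi> n s - \<psi> n s' = - of_int n * (ln (1 + s) - ln (1 + s'))" by (simp add: \<psi>_def algebra_simps)
        then show ?thesis by (simp add: abs_mult)
      qed
    qed auto
    also have "\<dots> = ennreal (4 * osc_const A / N) * (\<integral>\<^sup>+s. ennreal ((cmod (f n s))\<^sup>2 * (1 + s)) \<partial>tm 0 T)"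
      using n N osc_const_pos[of A] by (subst mult.assoc[symmetric], subst ennreal_mult[symmetric]) auto
    finally show ?thesis .
  qed simp
  have "(\<integral>\<^sup>+k\<in>{-A..A}. (\<integral>\<^sup>+n. ennreal (4 * \<bar>of_int n\<bar> / N) * J n k \<partial>zcount) \<partial>lborel)
    = (\<integral>\<^sup>+k. (\<integral>\<^sup>+n. ennreal (4 * \<bar>of_int n\<bar> / N) * J n k * indicator {-A..A} k \<partial>zcount) \<partial>lborel)"
    by (subst nn_integral_multc) auto
  also have "\<dots> = (\<integral>\<^sup>+n. (\<integral>\<^sup>+k\<in>{-A..A}. ennreal (4 * \<bar>of_int n\<bar> / N) * J n k \<partial>lborel) \<partial>zcount)"
    by (rule nn_integral_count_space_nn_integral) auto
  also have "\<dots> \<le> (\<integral>\<^sup>+n. ennreal (4 * osc_const A / N) * (\<integral>\<^sup>+s. ennreal ((cmod (f n s))\<^sup>2 * (1 + s)) \<partial>tm 0 T) \<partial>zcount)"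
    by (intro nn_integral_mono each)
  also have "\<dots> = ennreal (4 * osc_const A / N) * (\<integral>\<^sup>+n. (\<integral>\<^sup>+s. ennreal ((cmod (f n s))\<^sup>2 * (1 + s)) \<partial>tm 0 T) \<partial>zcount)"
    by (rule nn_integral_cmult) simp
  also have "(\<integral>\<^sup>+n. (\<integral>\<^sup>+s. ennreal ((cmod (f n s))\<^sup>2 * (1 + s)) \<partial>tm 0 T) \<partial>zcount)
    = (\<integral>\<^sup>+s. (\<integral>\<^sup>+n. ennreal ((cmod (f n s))\<^sup>2 * (1 + s)) \<partial>zcount) \<partial>tm 0 T)"
    by (rule nn_integral_count_space_nn_integral[symmetric]) auto
  also have "ennreal (4 * osc_const A / N) * \<dots> \<le> ennreal (4 * osc_const A / N) * (\<integral>\<^sup>+s. ennreal ((v s)\<^sup>2 * (1 + s)) \<partial>tm 0 T)"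
  proof (intro mult_left_mono nn_integral_mono)
    fix s assume "s \<in> space (tm 0 T)"
    then have s0: "0 \<le> s" by simp
    have "(\<integral>\<^sup>+n. ennreal ((cmod (f n s))\<^sup>2 * (1 + s)) \<partial>zcount) = (\<integral>\<^sup>+n. ennreal ((cmod (f n s))\<^sup>2) * ennreal (1 + s) \<partial>zcount)"
      using s0 by (intro nn_integral_cong ennreal_mult) auto
    also have "\<dots> = (\<integral>\<^sup>+n. ennreal ((cmod (f n s))\<^sup>2) \<partial>zcount) * ennreal (1 + s)" by (rule nn_integral_multc) simp
    also have "\<dots> \<le> ennreal ((v s)\<^sup>2) * ennreal (1 + s)"
      unfolding f_def by (intro mult_right_mono potential_fourier_sum[OF V v[OF s0]]) simp
    also have "\<dots> = ennreal ((v s)\<^sup>2 * (1 + s))" using s0 by (intro ennreal_mult[symmetric]) auto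
    finally show "(\<integral>\<^sup>+n. ennreal ((cmod (f n s))\<^sup>2 * (1 + s)) \<partial>zcount) \<le> ennreal ((v s)\<^sup>2 * (1 + s))" .
  qed simp
  finally show ?thesis unfolding trm .
qed

lemma nn_integral_zcount_shift:
  fixes f :: "int \<Rightarrow> ennreal" shows "(\<integral>\<^sup>+n. f (n - m) \<partial>zcount) = (\<integral>\<^sup>+n. f n \<partial>zcount)"
  by (rule nn_integral_bij_count_space[where g="\<lambda>n. n - m"])
    (rule bij_betw_byWitness[where f'="\<lambda>n. n + m"], auto)

text \<open>The squared Hilbert-Schmidt norm of the first-order operator from frequencies at most N
  to frequencies above M.\<close>

definition (in bounded_potential) interaction_mass :: "(real \<Rightarrow> int \<Rightarrow> real) \<Rightarrow> nat \<Rightarrow> nat \<Rightarrow> real \<Rightarrow> ennreal" where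
  "interaction_mass \<theta> N M k = (\<integral>\<^sup>+n. (if n \<in> {- int M..int M} then 0
     else \<Sum>m\<in>{- int N..int N}. ennreal ((cmod (interaction (\<lambda>t n. k * (phase \<theta> t n - phase \<theta> a n)) n m))\<^sup>2)) \<partial>zcount)"

text \<open>The frequency gap of order M yields a factor \<open>1 / M\<close> in each entry; for
  fixed m the entries are summed over n by Parseval's identity after a shift, and the values of m
  are counted. The condition on \<open>N^2\<close> bounds the quadratic part of the symbol at low
  frequencies, as \<open>phase_separation\<close> requires.\<close>

lemma (in bounded_potential) interaction_mass_average:
  assumes ab: "0 \<le> a" "a \<le> b" and \<theta>: "\<theta> = schroedinger_symbol \<or> \<theta> = transport_symbol"
    and NM: "6 * N \<le> M" "1 \<le> M" "(real N)\<^sup>2 \<le> 1 + a"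
  shows "interaction_mass \<theta> N M \<in> borel_measurable borel"
    and "(\<integral>\<^sup>+k\<in>{-A..A}. interaction_mass \<theta> N M k \<partial>lborel)
      \<le> ennreal (8 * osc_const A / real M * (2 * real N + 1) * (v\<^sup>2 * (1 + b) * (b - a)))"
proof -
  interpret T: finite_measure "tm a b" by (rule finite_measure_tm)
  have reg: "regular_symbol \<theta>" using \<theta> regular_schroedinger_symbol regular_transport_symbol by auto
  define f where "f n s = fourier_coeff (\<lambda>x. of_real (V s x)) n" for n s
  define \<psi> where "\<psi> n m s = (phase \<theta> s n - phase \<theta> a n) - (phase \<theta> s m - phase \<theta> a m)" for n m :: int and s :: real
  have fm [measurable]: "f n \<in> borel_measurable (tm a b)" for n
    unfolding f_def[abs_def] by (rule measurable_tm[OF fourier_potential_measurable[OF V]])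
  have \<psi>m [measurable]: "\<psi> n m \<in> borel_measurable (tm a b)" for n m
    unfolding \<psi>_def[abs_def] by (intro measurable_tm borel_measurable_diff phase_measurable[OF reg] borel_measurable_const)
  have idm [measurable]: "(\<lambda>s. s) \<in> borel_measurable (tm a b)" by (rule measurable_tm) simp
  define J where "J n m k = ennreal ((cmod (LINT s|tm a b. f (n - m) s * cis (k * \<psi> n m s)))\<^sup>2)" for n m k
  have Jm [measurable]: "J n m \<in> borel_measurable borel" for n m unfolding J_def[abs_def] by measurable
  have iJ: "ennreal ((cmod (interaction (\<lambda>t n. k * (phase \<theta> t n - phase \<theta> a n)) n m))\<^sup>2) = J n m k" for n m k
    by (simp add: interaction_def J_def f_def \<psi>_def right_diff_distrib)
  let ?M = "{- int M..int M}" and ?N = "{- int N..int N}"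
  have eq: "interaction_mass \<theta> N M = (\<lambda>k. \<integral>\<^sup>+n. (if n \<in> ?M then 0 else \<Sum>m\<in>?N. J n m k) \<partial>zcount)"
    by (rule ext) (simp only: interaction_mass_def iJ)
  have tm: "(\<lambda>k. if n \<in> ?M then 0 else \<Sum>m\<in>?N. J n m k) \<in> borel_measurable borel" for n
    by (cases "n \<in> ?M") auto
  show "interaction_mass \<theta> N M \<in> borel_measurable borel" unfolding eq using tm by (rule nn_integral_zcount_measurable)
  let ?c = "ennreal (8 * osc_const A / real M)"
  let ?I = "\<lambda>n. \<integral>\<^sup>+s. ennreal ((cmod (f n s))\<^sup>2 * (1 + s)) \<partial>tm a b"
  have each: "(\<integral>\<^sup>+k\<in>{-A..A}. J n m k \<partial>lborel) \<le> ?c * ?I (n - m)" if n: "n \<notin> ?M" and m: "m \<in> ?N" for n m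
  proof -
    have nM: "int M < \<bar>n\<bar>" using n by auto
    have mN: "\<bar>m\<bar> \<le> int N" using m by auto
    have s1: "3 * \<bar>m\<bar> \<le> \<bar>n\<bar>" and s3: "2 \<le> \<bar>n\<bar>" using nM mN NM by linarith+
    have "\<bar>real_of_int m\<bar> \<le> real N" using mN by linarith
    then have "\<bar>real_of_int m\<bar>\<^sup>2 \<le> (real N)\<^sup>2" by (intro power_mono) auto
    then have s2: "(real_of_int m)\<^sup>2 \<le> 1 + a" using NM(3) by simp
    define \<rho> where "\<rho> = \<bar>real_of_int (n - m)\<bar> / 4"
    \<comment> \<open>The gap is in fact at least \<open>5 M / 6\<close>; half of M already gives
      \<open>\<rho> >= M / 8\<close>.\<close>
    have "6 * int N \<le> int M" using NM(1) by linarith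
    moreover have "\<bar>n\<bar> \<le> \<bar>n - m\<bar> + \<bar>m\<bar>" by linarith
    moreover have "M' \<le> 2 * q" if "6 * N' \<le> M'" "p \<le> q + r" "M' < p" "r \<le> N'" "0 \<le> M'" for M' N' p q r :: int
      using that by linarith
    ultimately have "int M \<le> 2 * \<bar>n - m\<bar>" using nM mN of_nat_0_le_iff by metis
    then have "real_of_int (int M) \<le> real_of_int (2 * \<bar>n - m\<bar>)" by (simp only: of_int_le_iff)
    then have \<rho>M: "real M / 8 \<le> \<rho>" unfolding \<rho>_def by simp
    then have \<rho>: "0 < \<rho>" using NM(2) by linarith
    have "(\<integral>\<^sup>+k\<in>{-A..A}. J n m k \<partial>lborel) \<le> ennreal (osc_const A / \<rho>) * ?I (n - m)"
      unfolding J_def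
    proof (rule oscillation_bound[OF ab \<rho> fm _ \<psi>m])
      show "cmod (f (n - m) s) \<le> v" if "s \<in> {a..b}" for s unfolding f_def by (rule fourier_potential_bound[OF that])
      have half: "\<rho> * \<bar>ln (1 + s) - ln (1 + s')\<bar> \<le> \<bar>\<psi> n m s - \<psi> n m s'\<bar>" if "s \<in> {a..b}" "s \<le> s'" for s s'
      proof -
        have "\<psi> n m s - \<psi> n m s' = (phase \<theta> s n - phase \<theta> s m) - (phase \<theta> s' n - phase \<theta> s' m)" by (simp add: \<psi>_def)
        then show ?thesis unfolding \<rho>_def using phase_separation[OF s1 s2 s3 ab(1) _ that(2) \<theta>] that(1) by simp
      qed
      show "\<rho> * \<bar>ln (1 + s) - ln (1 + s')\<bar> \<le> \<bar>\<psi> n m s - \<psi> n m s'\<bar>" if "s \<in> {a..b}" "s' \<in> {a..b}" for s s'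
        using half[of s s'] half[of s' s] that by (cases "s \<le> s'") (auto simp: abs_minus_commute)
    qed
    also have "ennreal (osc_const A / \<rho>) \<le> ?c"
    proof (rule ennreal_leI)
      have "osc_const A / \<rho> \<le> osc_const A / (real M / 8)"
        using \<rho>M \<rho> NM(2) osc_const_pos[of A] by (intro divide_left_mono mult_pos_pos) auto
      then show "osc_const A / \<rho> \<le> 8 * osc_const A / real M" by (simp add: mult.commute)
    qed
    finally show ?thesis by (simp add: mult_right_mono)
  qed
  have "(\<integral>\<^sup>+k\<in>{-A..A}. interaction_mass \<theta> N M k \<partial>lborel)
    = (\<integral>\<^sup>+k. (\<integral>\<^sup>+n. (if n \<in> ?M then 0 else \<Sum>m\<in>?N. J n m k) * indicator {-A..A} k \<partial>zcount) \<partial>lborel)"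
    unfolding eq by (subst nn_integral_multc) auto
  also have "\<dots> = (\<integral>\<^sup>+n. (\<integral>\<^sup>+k\<in>{-A..A}. (if n \<in> ?M then 0 else \<Sum>m\<in>?N. J n m k) \<partial>lborel) \<partial>zcount)"
    by (rule nn_integral_count_space_nn_integral) (use tm in auto)
  also have "\<dots> \<le> (\<integral>\<^sup>+n. (\<Sum>m\<in>?N. ?c * ?I (n - m)) \<partial>zcount)"
  proof (rule nn_integral_mono)
    fix n
    show "(\<integral>\<^sup>+k\<in>{-A..A}. (if n \<in> ?M then 0 else \<Sum>m\<in>?N. J n m k) \<partial>lborel) \<le> (\<Sum>m\<in>?N. ?c * ?I (n - m))"
    proof (cases "n \<in> ?M")
      case False
      have "(\<integral>\<^sup>+k\<in>{-A..A}. (\<Sum>m\<in>?N. J n m k) \<partial>lborel) = (\<Sum>m\<in>?N. \<integral>\<^sup>+k\<in>{-A..A}. J n m k \<partial>lborel)"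
        unfolding sum_distrib_right by (rule nn_integral_sum) auto
      also have "\<dots> \<le> (\<Sum>m\<in>?N. ?c * ?I (n - m))" using False by (intro sum_mono each)
      finally show ?thesis unfolding if_not_P[OF False] .
    qed simp
  qed
  also have "\<dots> = (\<Sum>m\<in>?N. \<integral>\<^sup>+n. ?c * ?I (n - m) \<partial>zcount)" by (rule nn_integral_sum) simp
  also have "\<dots> \<le> (\<Sum>m\<in>?N. ?c * ennreal (v\<^sup>2 * (1 + b) * (b - a)))"
  proof (rule sum_mono)
    fix m
    have "(\<integral>\<^sup>+n. ?c * ?I (n - m) \<partial>zcount) = ?c * (\<integral>\<^sup>+n. ?I (n - m) \<partial>zcount)" by (rule nn_integral_cmult) simp
    also have "(\<integral>\<^sup>+n. ?I (n - m) \<partial>zcount) = (\<integral>\<^sup>+n. ?I n \<partial>zcount)" by (rule nn_integral_zcount_shift)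
    also have "\<dots> = (\<integral>\<^sup>+s. (\<integral>\<^sup>+n. ennreal ((cmod (f n s))\<^sup>2 * (1 + s)) \<partial>zcount) \<partial>tm a b)"
      by (rule nn_integral_count_space_nn_integral[symmetric]) auto
    also have "\<dots> \<le> (\<integral>\<^sup>+s. ennreal (v\<^sup>2 * (1 + b)) \<partial>tm a b)"
    proof (rule nn_integral_mono)
      fix s assume "s \<in> space (tm a b)"
      then have s: "s \<in> {a..b}" by simp
      then have s0: "0 \<le> s" using ab by simp
      have "(\<integral>\<^sup>+n. ennreal ((cmod (f n s))\<^sup>2 * (1 + s)) \<partial>zcount) = (\<integral>\<^sup>+n. ennreal ((cmod (f n s))\<^sup>2) * ennreal (1 + s) \<partial>zcount)"
        using s0 by (intro nn_integral_cong ennreal_mult) auto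
      also have "\<dots> = (\<integral>\<^sup>+n. ennreal ((cmod (f n s))\<^sup>2) \<partial>zcount) * ennreal (1 + s)" by (rule nn_integral_multc) simp
      also have "\<dots> \<le> ennreal (v\<^sup>2) * ennreal (1 + b)"
        unfolding f_def using s by (intro mult_mono potential_fourier_sum[OF V vB[OF s]] ennreal_leI) auto
      also have "\<dots> = ennreal (v\<^sup>2 * (1 + b))" using ab by (intro ennreal_mult[symmetric]) auto
      finally show "(\<integral>\<^sup>+n. ennreal ((cmod (f n s))\<^sup>2 * (1 + s)) \<partial>zcount) \<le> ennreal (v\<^sup>2 * (1 + b))" .
    qed
    also have "\<dots> = ennreal (v\<^sup>2 * (1 + b) * (b - a))"
      using measure_tm[OF ab(2)] ab by (simp add: T.emeasure_eq_measure ennreal_mult[symmetric])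
    finally show "(\<integral>\<^sup>+n. ?c * ?I (n - m) \<partial>zcount) \<le> ?c * ennreal (v\<^sup>2 * (1 + b) * (b - a))"
      by (simp add: mult_left_mono)
  qed
  also have "\<dots> = of_nat (2 * N + 1) * (?c * ennreal (v\<^sup>2 * (1 + b) * (b - a)))"
  proof -
    have "card ?N = 2 * N + 1" by (simp add: nat_add_distrib nat_mult_distrib)
    then show ?thesis by (simp only: sum_constant)
  qed
  also have "\<dots> = ennreal (real (2 * N + 1) * (8 * osc_const A / real M * (v\<^sup>2 * (1 + b) * (b - a))))"
    using ab osc_const_pos[of A] by (simp add: ennreal_of_nat_eq_real_of_nat ennreal_mult[symmetric] del: of_nat_add of_nat_mult of_nat_Suc)
  also have "real (2 * N + 1) * (8 * osc_const A / real M * (v\<^sup>2 * (1 + b) * (b - a)))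
    = 8 * osc_const A / real M * (2 * real N + 1) * (v\<^sup>2 * (1 + b) * (b - a))" by (simp add: mult_ac)
  finally show "(\<integral>\<^sup>+k\<in>{-A..A}. interaction_mass \<theta> N M k \<partial>lborel)
      \<le> ennreal (8 * osc_const A / real M * (2 * real N + 1) * (v\<^sup>2 * (1 + b) * (b - a)))" .
qed

lemma evol_cong:
  assumes "evol P V w a b" "\<And>t n. t \<in> {a..b} \<Longrightarrow> P t n = Q t n" shows "evol Q V w a b"
  unfolding evol_def
proof (intro conjI allI impI ballI)
  show "sq_integrable torus (w t)" if "t \<in> {a..b}" for t using assms(1) that by (auto simp: evol_def)
  show "(\<lambda>s. cis (Q s n) * fourier_coeff (Vmul V s (w s)) n) \<in> borel_measurable (tm a b)" for n
  proof -
    have "(\<lambda>s. cis (P s n) * fourier_coeff (Vmul V s (w s)) n) \<in> borel_measurable (tm a b)" using assms(1) by (simp add: evol_def)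
    also have "?this \<longleftrightarrow> ?thesis" by (rule measurable_cong) (simp add: assms(2))
    finally show ?thesis .
  qed
  fix n s t assume st: "a \<le> s" "s \<le> t" "t \<le> b"
  have "(LINT r|tm s t. cis (Q r n) * fourier_coeff (Vmul V r (w r)) n) = (LINT r|tm s t. cis (P r n) * fourier_coeff (Vmul V r (w r)) n)"
    using st by (intro Bochner_Integration.integral_cong refl) (simp add: assms(2))
  moreover have "P t n = Q t n" "P s n = Q s n" using assms(2) st by auto
  moreover have E: "cis (P t n) * fourier_coeff (w t) n - cis (P s n) * fourier_coeff (w s) n =
        - \<i> * (LINT r|tm s t. cis (P r n) * fourier_coeff (Vmul V r (w r)) n)"
    using assms(1) st unfolding evol_def by blast
  ultimately show "cis (Q t n) * fourier_coeff (w t) n - cis (Q s n) * fourier_coeff (w s) n =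
        - \<i> * (LINT r|tm s t. cis (Q r n) * fourier_coeff (Vmul V r (w r)) n)"
    using E by (simp only:)
qed

text \<open>Averages over k are available for squares only. This inequality passes from a quantity
  to its square linearly, so no square root has to be taken of an average, and \<tau> is later set
  to the expected size.\<close>

lemma le_add_square_div: "0 < \<tau> \<Longrightarrow> x \<le> \<tau> + x\<^sup>2 / \<tau>" for x \<tau> :: real
proof -
  assume t: "0 < \<tau>"
  have "2 * \<tau> * x \<le> \<tau>\<^sup>2 + x\<^sup>2" by (rule sum_squares_bound)
  then have "\<tau> * (2 * x) \<le> \<tau> * (\<tau> + x\<^sup>2 / \<tau>)" using t by (simp add: algebra_simps power2_eq_square)
  then have "2 * x \<le> \<tau> + x\<^sup>2 / \<tau>" using t by (simp only: mult_le_cancel_left_pos)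
  moreover have "0 \<le> \<tau> + x\<^sup>2 / \<tau>" using t by simp
  ultimately show ?thesis by (cases "0 \<le> x") auto
qed

section \<open>One step for the pair of solutions\<close>

context bounded_potential
begin

context
  fixes u g :: "real \<Rightarrow> real \<Rightarrow> complex" and k A :: real and N M :: nat
  assumes ab: "0 \<le> a" "a \<le> b"
    and u: "evol (\<lambda>t n. k * phase schroedinger_symbol t n) V u a b" and g: "evol (\<lambda>t n. k * phase transport_symbol t n) V g a b"
    and nu: "\<And>t. t \<in> {a..b} \<Longrightarrow> nrm torus (u t) \<le> 1" and ng: "\<And>t. t \<in> {a..b} \<Longrightarrow> nrm torus (g t) \<le> 1"
    and k: "\<bar>k\<bar> \<le> A" and NM: "N \<le> M"
begin

abbreviation P where "P \<equiv> \<lambda>t n. k * (phase schroedinger_symbol t n - phase schroedinger_symbol a n)"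
abbreviation Q where "Q \<equiv> \<lambda>t n. k * (phase transport_symbol t n - phase transport_symbol a n)"
abbreviation high where "high t \<equiv> nrm zcount (\<lambda>n. if n \<in> {- int N..int N} then 0 else fourier_coeff (g t) n)"

lemma evolP: "evol P V u a b" and evolQ: "evol Q V g a b"
  using evol_shift[OF u, of "\<lambda>n. k * phase schroedinger_symbol a n"] evol_shift[OF g, of "\<lambda>n. k * phase transport_symbol a n"]
  by (simp_all add: right_diff_distrib)

lemma phase_gap:
  assumes "t \<in> {a..b}" "n \<in> {- int L..int L}"
  shows "\<bar>P t n - Q t n\<bar> \<le> A * (real L)\<^sup>2 / (1 + a)\<^sup>2 * (b - a)"
proof -
  have t: "a \<le> t" "t \<le> b" using assms by auto
  have "\<bar>real_of_int n\<bar> \<le> real L" using assms(2) by auto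
  then have "\<bar>real_of_int n\<bar>\<^sup>2 \<le> (real L)\<^sup>2" by (intro power_mono) auto
  then have nL: "(real_of_int n)\<^sup>2 \<le> (real L)\<^sup>2" by simp
  have "\<bar>P t n - Q t n\<bar> = \<bar>k\<bar> * \<bar>(phase schroedinger_symbol t n - phase schroedinger_symbol a n) - (phase transport_symbol t n - phase transport_symbol a n)\<bar>"
    by (simp only: right_diff_distrib[symmetric] abs_mult)
  also have "\<dots> \<le> A * ((of_int n)\<^sup>2 / (1 + a)\<^sup>2 * (t - a))"
    using k by (intro mult_mono phase_mismatch_bound ab t) auto
  also have "\<dots> \<le> A * ((real L)\<^sup>2 / (1 + a)\<^sup>2 * (b - a))"
    using k nL t ab by (intro mult_left_mono mult_mono divide_right_mono) auto
  finally show ?thesis by simp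
qed

lemma L2: "t \<in> {a..b} \<Longrightarrow> sq_integrable torus (u t)" "t \<in> {a..b} \<Longrightarrow> sq_integrable torus (g t)"
  using u g by (auto simp: evol_def)

text \<open>\<open>step_estimate\<close> compares overlaps in frames that coincide with the fixed
  one at time a but not at b. Returning to the plain overlap at b costs the last two terms, by
  \<open>phase_mismatch\<close> at the lower cutoff N.\<close>

lemma step_increment_real:
  defines "e \<equiv> (b - a) * v"
  shows "cmod (ip torus (u b) (g b) - ip torus (u a) (g a))
    \<le> 3 * e\<^sup>2 + 2 * e * high a + 2 * e * (A * (real M)\<^sup>2 / (1 + a)\<^sup>2 * (b - a))
      + nrm zcount (\<lambda>n. if n \<in> {- int M..int M} then 0 else first_order P {- int N..int N} (fourier_coeff (g a)) n)
      + nrm zcount (\<lambda>n. if n \<in> {- int M..int M} then 0 else first_order Q {- int N..int N} (fourier_coeff (g a)) n)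
      + (A * (real N)\<^sup>2 / (1 + a)\<^sup>2 * (b - a)) + 2 * high b"
proof -
  let ?S = "{- int N..int N}" and ?S' = "{- int M..int M}"
  let ?F = "\<lambda>t. ip zcount (\<lambda>n. cis (P t n) * fourier_coeff (u t) n) (\<lambda>n. cis (Q t n) * fourier_coeff (g t) n)"
  have a: "a \<in> {a..b}" and b: "b \<in> {a..b}" using ab by auto
  have Pm: "(\<lambda>s. P s n) \<in> borel_measurable (tm a b)" and Qm: "(\<lambda>s. Q s n) \<in> borel_measurable (tm a b)" for n
    by (intro measurable_tm borel_measurable_times borel_measurable_diff borel_measurable_const
        phase_measurable[OF regular_schroedinger_symbol] phase_measurable[OF regular_transport_symbol])+
  have A0: "0 \<le> A" using k by linarith
  have cL: "sq_integrable zcount (fourier_coeff (g a))" "nrm zcount (fourier_coeff (g a)) \<le> 1"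
    using sq_integrable_fourier[OF L2(2)[OF a]] nrm_fourier[OF L2(2)[OF a]] ng[OF a] by auto
  have 1: "cmod (?F b - ip torus (u a) (g a)) \<le> 3 * e\<^sup>2 + 2 * e * high a
    + nrm zcount (\<lambda>n. first_order P ?S (fourier_coeff (g a)) n - first_order Q ?S (fourier_coeff (g a)) n)"
    unfolding e_def by (rule step_estimate[OF ab(2) evolP evolQ nu ng _ _ Pm Qm]) auto
  have 2: "nrm zcount (\<lambda>n. first_order P ?S (fourier_coeff (g a)) n - first_order Q ?S (fourier_coeff (g a)) n)
     \<le> 2 * e * (A * (real M)\<^sup>2 / (1 + a)\<^sup>2 * (b - a))
      + nrm zcount (\<lambda>n. if n \<in> ?S' then 0 else first_order P ?S (fourier_coeff (g a)) n)
      + nrm zcount (\<lambda>n. if n \<in> ?S' then 0 else first_order Q ?S (fourier_coeff (g a)) n)"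
    unfolding e_def
    by (rule first_order_diff[OF ab(2) Pm Qm _ _ cL phase_gap]) (use NM ab A0 in auto)
  have 3: "cmod (?F b - ip torus (u b) (g b)) \<le> A * (real N)\<^sup>2 / (1 + a)\<^sup>2 * (b - a) + 2 * high b"
    unfolding parseval_ip[OF L2(1)[OF b] L2(2)[OF b], symmetric]
    by (rule phase_mismatch[OF sq_integrable_fourier[OF L2(1)[OF b]] _ sq_integrable_fourier[OF L2(2)[OF b]] _ phase_gap[OF b]])
      (use nrm_fourier[OF L2(1)[OF b]] nrm_fourier[OF L2(2)[OF b]] nu[OF b] ng[OF b] A0 ab in auto)
  have "cmod (ip torus (u b) (g b) - ip torus (u a) (g a)) \<le> cmod (?F b - ip torus (u a) (g a)) + cmod (?F b - ip torus (u b) (g b))"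
    using norm_triangle_ineq4[of "?F b - ip torus (u a) (g a)" "?F b - ip torus (u b) (g b)"] by simp
  then show ?thesis using 1 2 3 by linarith
qed

text \<open>For times within a step a zeroth-order bound suffices, and it uses the high part of
  \<open>g\<close> at the initial time only. Its cost \<open>2 (b - a) v\<close> is too large to be
  summed over the steps, but it is paid only once, in the step that contains t.\<close>

lemma step_inside_real:
  assumes t: "t \<in> {a..b}"
  shows "cmod (ip torus (u t) (g t) - ip torus (u a) (g a))
    \<le> 2 * ((b - a) * v) + (A * (real N)\<^sup>2 / (1 + a)\<^sup>2 * (b - a)) + 2 * high a"
proof -
  let ?e = "(b - a) * v"
  have a: "a \<in> {a..b}" using ab by auto
  have at: "a \<le> a" "a \<le> t" "t \<le> b" using t by auto
  have A0: "0 \<le> A" using k by linarith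
  define x where "x s n = cis (P s n) * fourier_coeff (u s) n" for s n
  define y where "y s n = cis (Q s n) * fourier_coeff (g s) n" for s n
  have xL: "sq_integrable zcount (x s)" "nrm zcount (x s) \<le> 1" if "s \<in> {a..b}" for s
    unfolding x_def using phased_L2[OF L2(1)[OF that], of "P s"] nu[OF that] by auto
  have yL: "sq_integrable zcount (y s)" "nrm zcount (y s) \<le> 1" if "s \<in> {a..b}" for s
    unfolding y_def using phased_L2[OF L2(2)[OF that], of "Q s"] ng[OF that] by auto
  have le: "(t - a) * (v * 1) \<le> ?e" using t v0 by (auto intro!: mult_right_mono)
  have dx: "sq_integrable zcount (\<lambda>n. x t n - x a n)" "nrm zcount (\<lambda>n. x t n - x a n) \<le> ?e"
    unfolding x_def by (rule evol_increment(1)[OF evolP nu zero_le_one at], assumption)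
      (rule order_trans[OF evol_increment(2)[OF evolP nu zero_le_one at] le])
  have dy: "sq_integrable zcount (\<lambda>n. y t n - y a n)" "nrm zcount (\<lambda>n. y t n - y a n) \<le> ?e"
    unfolding y_def by (rule evol_increment(1)[OF evolQ ng zero_le_one at], assumption)
      (rule order_trans[OF evol_increment(2)[OF evolQ ng zero_le_one at] le])
  have xa: "x a = fourier_coeff (u a)" and ya: "y a = fourier_coeff (g a)" by (auto simp: x_def y_def)
  have ph: "sq_integrable zcount (\<lambda>n. cis (p n) * f n)" "nrm zcount (\<lambda>n. cis (p n) * f n) = nrm zcount f"
    if "sq_integrable zcount f" for p f
    by (rule sq_integrable_zcountI[OF that], simp add: norm_mult) (rule nrm_cong, simp add: norm_mult)
  \<comment> \<open>The states at time s carried freely to time t; for \<open>s = t\<close> these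
    are the coefficients of the solutions themselves.\<close>
  let ?x = "\<lambda>s n. cis (- P t n) * x s n" and ?y = "\<lambda>s n. cis (- Q t n) * y s n"
  have xt: "?x t = fourier_coeff (u t)" and yt: "?y t = fourier_coeff (g t)"
    by (auto simp: x_def y_def mult.assoc[symmetric] cis_mult fun_eq_iff)
  have 1: "ip zcount (?x t) (?y t) - ip zcount (?x a) (?y a)
    = ip zcount (\<lambda>n. cis (- P t n) * (x t n - x a n)) (?y t) + ip zcount (?x a) (\<lambda>n. cis (- Q t n) * (y t n - y a n))"
    unfolding right_diff_distrib
    by (subst ip_diff_left ip_diff_right; (intro ph(1) xL yL t a)?)+ simp
  have 2: "cmod (ip zcount (\<lambda>n. cis (- P t n) * (x t n - x a n)) (?y t)) \<le> ?e * 1"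
    using cauchy_schwarz_ip[OF ph(1)[OF dx(1)] ph(1)[OF yL(1)[OF t]], of "\<lambda>n. - P t n" "\<lambda>n. - Q t n"]
      mult_mono[OF dx(2) yL(2)[OF t]] v0 ab by (simp add: ph(2)[OF dx(1)] ph(2)[OF yL(1)[OF t]])
  have 3: "cmod (ip zcount (?x a) (\<lambda>n. cis (- Q t n) * (y t n - y a n))) \<le> 1 * ?e"
    using cauchy_schwarz_ip[OF ph(1)[OF xL(1)[OF a]] ph(1)[OF dy(1)], of "\<lambda>n. - P t n" "\<lambda>n. - Q t n"]
      mult_mono[OF xL(2)[OF a] dy(2)] v0 ab by (simp add: ph(2)[OF dy(1)] ph(2)[OF xL(1)[OF a]])
  have 4: "cmod (ip zcount (?x a) (?y a) - ip zcount (x a) (y a)) \<le> A * (real N)\<^sup>2 / (1 + a)\<^sup>2 * (b - a) + 2 * high a"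
    unfolding ya[symmetric]
  proof (rule phase_mismatch[OF xL[OF a] yL[OF a]])
    show "\<bar>- P t n - - Q t n\<bar> \<le> A * (real N)\<^sup>2 / (1 + a)\<^sup>2 * (b - a)" if "n \<in> {- int N..int N}" for n
      using phase_gap[OF t that] by (simp add: abs_minus_commute)
  qed (use A0 ab in auto)
  have "ip torus (u t) (g t) - ip torus (u a) (g a) = (ip zcount (?x t) (?y t) - ip zcount (?x a) (?y a)) + (ip zcount (?x a) (?y a) - ip zcount (x a) (y a))"
    unfolding xt yt xa ya parseval_ip[OF L2(1)[OF t] L2(2)[OF t]] parseval_ip[OF L2(1)[OF a] L2(2)[OF a]] by simp
  then have "cmod (ip torus (u t) (g t) - ip torus (u a) (g a))
    \<le> cmod (ip zcount (?x t) (?y t) - ip zcount (?x a) (?y a)) + cmod (ip zcount (?x a) (?y a) - ip zcount (x a) (y a))"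
    by (simp only: norm_triangle_ineq)
  also have "cmod (ip zcount (?x t) (?y t) - ip zcount (?x a) (?y a)) \<le> ?e * 1 + 1 * ?e"
    unfolding 1 by (rule order_trans[OF norm_triangle_ineq add_mono[OF 2 3]])
  finally show ?thesis using 4 by linarith
qed

lemma interaction_bound:
  assumes \<theta>: "\<theta> = schroedinger_symbol \<or> \<theta> = transport_symbol"
  shows "ennreal ((nrm zcount (\<lambda>n. if n \<in> {- int M..int M} then 0
     else first_order (\<lambda>t n. k * (phase \<theta> t n - phase \<theta> a n)) {- int N..int N} (fourier_coeff (g a)) n))\<^sup>2) \<le> interaction_mass \<theta> N M k"
  unfolding interaction_mass_def
proof (rule first_order_tail)
  have reg: "regular_symbol \<theta>" using \<theta> regular_schroedinger_symbol regular_transport_symbol by auto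
  have a: "a \<in> {a..b}" using ab by auto
  show "(\<lambda>s. k * (phase \<theta> s n - phase \<theta> a n)) \<in> borel_measurable (tm a b)" for n
    by (intro measurable_tm borel_measurable_times borel_measurable_diff borel_measurable_const phase_measurable[OF reg])
  show "sq_integrable zcount (fourier_coeff (g a))" "nrm zcount (fourier_coeff (g a)) \<le> 1"
    using sq_integrable_fourier[OF L2(2)[OF a]] nrm_fourier[OF L2(2)[OF a]] ng[OF a] by auto
qed simp

text \<open>Each quantity to be averaged is replaced through \<open>le_add_square_div\<close>. In
  the increment \<open>4 * \<tau>\<close> arises from twice the high part at b and from the two
  transfer terms; the term \<open>2 * e * high a\<close> is split as a product instead and gives the
  fourth \<open>e^2\<close> and the 1 in \<open>1 + 2 / \<tau>\<close>. The remaining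
  \<open>2 / \<tau>\<close> serves the bound at intermediate times, so that one expression covers
  both estimates.\<close>

lemma step_estimates:
  assumes Ra: "ennreal ((high a)\<^sup>2) \<le> Ra" and Rb: "ennreal ((high b)\<^sup>2) \<le> Rb" and \<tau>: "0 < \<tau>"
  defines "e \<equiv> (b - a) * v"
  defines "X \<equiv> ennreal (4 * e\<^sup>2 + 2 * e * (A * (real M)\<^sup>2 / (1 + a)\<^sup>2 * (b - a)) + A * (real N)\<^sup>2 / (1 + a)\<^sup>2 * (b - a) + 4 * \<tau>)
     + (ennreal (1 + 2 / \<tau>) * Ra + ennreal (2 / \<tau>) * Rb
     + ennreal (1 / \<tau>) * (interaction_mass schroedinger_symbol N M k + interaction_mass transport_symbol N M k))"
  shows "ennreal (cmod (ip torus (u b) (g b) - ip torus (u a) (g a))) \<le> X"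
    and "t \<in> {a..b} \<Longrightarrow> ennreal (cmod (ip torus (u t) (g t) - ip torus (u a) (g a))) \<le> ennreal (2 * e) + X"
proof -
  let ?\<mu> = "\<lambda>L. A * (real L)\<^sup>2 / (1 + a)\<^sup>2 * (b - a)"
  have A0: "0 \<le> A" using k by linarith
  have e0: "0 \<le> e" using ab v0 by (simp add: e_def)
  have \<mu>0: "0 \<le> ?\<mu> L" for L using A0 ab by simp
  define KP where "KP = nrm zcount (\<lambda>n. if n \<in> {- int M..int M} then 0 else first_order P {- int N..int N} (fourier_coeff (g a)) n)"
  define KQ where "KQ = nrm zcount (\<lambda>n. if n \<in> {- int M..int M} then 0 else first_order Q {- int N..int N} (fourier_coeff (g a)) n)"
  define D where "D = 4 * e\<^sup>2 + 2 * e * ?\<mu> M + ?\<mu> N + 4 * \<tau>"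
  have e\<mu>: "0 \<le> 2 * e * ?\<mu> M" by (rule mult_nonneg_nonneg[OF _ \<mu>0]) (use e0 in simp)
  have e2: "0 \<le> 4 * e\<^sup>2" by simp
  have D0: "0 \<le> D" unfolding D_def using e2 e\<mu> \<mu>0[of N] \<tau> by linarith
  have IP: "ennreal (KP\<^sup>2) \<le> interaction_mass schroedinger_symbol N M k" and IQ: "ennreal (KQ\<^sup>2) \<le> interaction_mass transport_symbol N M k"
    unfolding KP_def KQ_def by (rule interaction_bound, simp)+
  let ?r = "(1 + 2 / \<tau>) * (high a)\<^sup>2 + 2 / \<tau> * (high b)\<^sup>2 + 1 / \<tau> * (KP\<^sup>2 + KQ\<^sup>2)"
  have r0: "0 \<le> ?r" using \<tau> by simp
  have X: "ennreal (D + ?r) \<le> X"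
  proof -
    have "ennreal (D + ?r) = ennreal D + (ennreal (1 + 2 / \<tau>) * ennreal ((high a)\<^sup>2) + ennreal (2 / \<tau>) * ennreal ((high b)\<^sup>2)
       + ennreal (1 / \<tau>) * (ennreal (KP\<^sup>2) + ennreal (KQ\<^sup>2)))"
      using D0 \<tau> by (simp add: ennreal_mult[symmetric] ennreal_plus[symmetric] del: ennreal_plus)
    also have "\<dots> \<le> X"
      unfolding X_def D_def by (intro add_mono mult_left_mono Ra Rb IP IQ order_refl) simp_all
    finally show ?thesis .
  qed
  have ha: "high a \<le> \<tau> + (high a)\<^sup>2 / \<tau>" and hb: "high b \<le> \<tau> + (high b)\<^sup>2 / \<tau>" and kP: "KP \<le> \<tau> + KP\<^sup>2 / \<tau>" and kQ: "KQ \<le> \<tau> + KQ\<^sup>2 / \<tau>"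
    by (rule le_add_square_div[OF \<tau>])+
  have ea: "2 * e * high a \<le> e\<^sup>2 + (high a)\<^sup>2" by (rule sum_squares_bound)
  have p: "0 \<le> (high a)\<^sup>2 / \<tau>" "0 \<le> (high b)\<^sup>2 / \<tau>" "0 \<le> KP\<^sup>2 / \<tau>" "0 \<le> KQ\<^sup>2 / \<tau>" "0 \<le> (high a)\<^sup>2" "0 \<le> e\<^sup>2"
    using \<tau> by simp_all
  have r: "?r = (high a)\<^sup>2 + 2 * ((high a)\<^sup>2 / \<tau>) + 2 * ((high b)\<^sup>2 / \<tau>) + KP\<^sup>2 / \<tau> + KQ\<^sup>2 / \<tau>"
    by (simp add: distrib_right add_divide_distrib)
  have "cmod (ip torus (u b) (g b) - ip torus (u a) (g a)) \<le> D + ?r"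
    unfolding r D_def
    using step_increment_real[folded e_def KP_def KQ_def] ha hb kP kQ ea p e\<mu> \<mu>0[of N] by linarith
  then show "ennreal (cmod (ip torus (u b) (g b) - ip torus (u a) (g a))) \<le> X"
    using X ennreal_leI order_trans by blast
  assume t: "t \<in> {a..b}"
  have "cmod (ip torus (u t) (g t) - ip torus (u a) (g a)) \<le> 2 * e + (D + ?r)"
    unfolding r D_def
    using step_inside_real[OF t, folded e_def] ha p \<tau> e\<mu> \<mu>0[of N] by linarith
  then have "ennreal (cmod (ip torus (u t) (g t) - ip torus (u a) (g a))) \<le> ennreal (2 * e + (D + ?r))" by (rule ennreal_leI)
  also have "\<dots> = ennreal (2 * e) + ennreal (D + ?r)" using e0 D0 r0 by (intro ennreal_plus) auto
  also have "\<dots> \<le> ennreal (2 * e) + X" by (intro add_left_mono X)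
  finally show "ennreal (cmod (ip torus (u t) (g t) - ip torus (u a) (g a))) \<le> ennreal (2 * e) + X" .
qed

end

end

section \<open>Summation over the time steps\<close>

text \<open>The majorant from \<open>transport_regularity\<close> for the high part of
  \<open>G\<close> at time T. It involves V and k but not the solution, and is thereby measurable in
  k.\<close>

definition tail_mass :: "(real \<Rightarrow> real \<Rightarrow> real) \<Rightarrow> nat \<Rightarrow> real \<Rightarrow> real \<Rightarrow> ennreal" where
  "tail_mass V N T k = (\<integral>\<^sup>+n. ennreal (4 * \<bar>of_int n\<bar> / real N *
     (cmod (LINT s|tm 0 T. fourier_coeff (\<lambda>x. of_real (V s x)) n * cis (of_int n * (- k * ln (1 + s)))))\<^sup>2) \<partial>zcount)"

lemma transport_tail_bound:
  assumes V: "meas_potential V" and C: "\<And>s x. \<bar>V s x\<bar> \<le> C"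
    and g: "evol (\<lambda>t n. k * phase transport_symbol t n) V g 0 T" and B: "\<And>t. t \<in> {0..T} \<Longrightarrow> nrm torus (g t) \<le> B"
    and g0: "\<And>n. fourier_coeff (g 0) n = (if n = 0 then 1 else 0)" and T: "0 \<le> T" and N: "1 \<le> N"
  shows "ennreal ((nrm zcount (\<lambda>n. if n \<in> {- int N..int N} then 0 else fourier_coeff (g T) n))\<^sup>2) \<le> tail_mass V N T k"
proof -
  have g': "evol (\<lambda>t n. of_int n * (- k * ln (1 + t))) V g 0 T"
    by (rule evol_cong[OF g]) (simp add: phase_transport)
  have gL: "sq_integrable torus (g T)" using g T by (auto simp: evol_def)
  have "sq_integrable zcount (\<lambda>n. if n \<in> {- int N..int N} then 0 else fourier_coeff (g T) n)"
    by (rule sq_integrable_zcountI[OF sq_integrable_fourier[OF gL]]) auto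
  then have "ennreal ((nrm zcount (\<lambda>n. if n \<in> {- int N..int N} then 0 else fourier_coeff (g T) n))\<^sup>2)
    = (\<integral>\<^sup>+n. ennreal ((cmod (if n \<in> {- int N..int N} then 0 else fourier_coeff (g T) n))\<^sup>2) \<partial>zcount)"
    by (rule ennreal_nrm_sq)
  also have "\<dots> = (\<integral>\<^sup>+n. (if real_of_int \<bar>n\<bar> \<le> real N then 0 else ennreal ((cmod (fourier_coeff (g T) n))\<^sup>2)) \<partial>zcount)"
  proof (rule nn_integral_cong)
    fix n
    have "n \<in> {- int N..int N} \<longleftrightarrow> real_of_int \<bar>n\<bar> \<le> real N" by auto
    then show "ennreal ((cmod (if n \<in> {- int N..int N} then 0 else fourier_coeff (g T) n))\<^sup>2)
      = (if real_of_int \<bar>n\<bar> \<le> real N then 0 else ennreal ((cmod (fourier_coeff (g T) n))\<^sup>2))" by simp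
  qed
  also have "\<dots> \<le> tail_mass V N T k"
    unfolding tail_mass_def by (rule transport_regularity[OF V C g' B g0 T]) (use N in auto)
  finally show ?thesis .
qed

lemma tail_mass_measurable:
  assumes V: "meas_potential V" shows "tail_mass V N T \<in> borel_measurable borel"
proof -
  have [measurable]: "(\<lambda>s. fourier_coeff (\<lambda>x. of_real (V s x)) n) \<in> borel_measurable (tm 0 T)" for n
    by (rule measurable_tm[OF fourier_potential_measurable[OF V]])
  have [measurable]: "(\<lambda>s. - of_int n * ln (1 + s)) \<in> borel_measurable (tm 0 T)" for n :: int
    by (rule measurable_tm) measurable
  have "ennreal (4 * \<bar>of_int n\<bar> / real N *
     (cmod (LINT s|tm 0 T. fourier_coeff (\<lambda>x. of_real (V s x)) n * cis (of_int n * (- k * ln (1 + s)))))\<^sup>2)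
    = ennreal (4 * \<bar>of_int n\<bar> / real N) *
      ennreal ((cmod (LINT s|tm 0 T. fourier_coeff (\<lambda>x. of_real (V s x)) n * cis (k * (- of_int n * ln (1 + s)))))\<^sup>2)" for n k
    by (subst ennreal_mult[symmetric]) (auto simp: mult_ac)
  then have "tail_mass V N T = (\<lambda>k. \<integral>\<^sup>+n. ennreal (4 * \<bar>of_int n\<bar> / real N) *
      ennreal ((cmod (LINT s|tm 0 T. fourier_coeff (\<lambda>x. of_real (V s x)) n * cis (k * (- of_int n * ln (1 + s)))))\<^sup>2) \<partial>zcount)"
    by (simp add: tail_mass_def fun_eq_iff)
  also have "\<dots> \<in> borel_measurable borel" by (intro nn_integral_zcount_measurable) measurable
  finally show ?thesis .
qed

lemma weight_integral:
  assumes \<gamma>: "\<gamma> < 1" and T: "0 \<le> T"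
  shows "(\<integral>\<^sup>+s. ennreal ((c * (1 + s) powr (- \<gamma>))\<^sup>2 * (1 + s)) \<partial>tm 0 T) \<le> ennreal (c\<^sup>2 * ((1 + T) powr (2 - 2 * \<gamma>) / (2 - 2 * \<gamma>)))"
proof -
  let ?F = "\<lambda>s. c\<^sup>2 * ((1 + s) powr (2 - 2 * \<gamma>) / (2 - 2 * \<gamma>))"
  have "(\<integral>\<^sup>+s. ennreal ((c * (1 + s) powr (- \<gamma>))\<^sup>2 * (1 + s)) \<partial>tm 0 T)
    = (\<integral>\<^sup>+s. ennreal ((c * (1 + s) powr (- \<gamma>))\<^sup>2 * (1 + s)) * indicator {0..T} s \<partial>lborel)" by (rule nn_integral_tm)
  also have "\<dots> = ennreal (?F T - ?F 0)"
  proof (rule nn_integral_FTC_Icc)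
    fix s assume s: "s \<in> {0..T}"
    then have s1: "0 < 1 + s" by simp
    have "(c * (1 + s) powr (- \<gamma>))\<^sup>2 * (1 + s) = c\<^sup>2 * ((1 + s) powr (- \<gamma>) * (1 + s) powr (- \<gamma>) * (1 + s) powr 1)"
      using s1 by (simp add: power2_eq_square)
    also have "\<dots> = c\<^sup>2 * (1 + s) powr (1 - 2 * \<gamma>)" using s1 by (simp only: powr_add[symmetric]) simp
    finally have e: "(c * (1 + s) powr (- \<gamma>))\<^sup>2 * (1 + s) = c\<^sup>2 * (1 + s) powr (1 - 2 * \<gamma>)" .
    have "DERIV (\<lambda>s. 1 + s) s :> 1" by (auto intro!: derivative_eq_intros)
    then have "DERIV (\<lambda>s. (1 + s) powr (2 - 2 * \<gamma>)) s :> (2 - 2 * \<gamma>) * (1 + s) powr (2 - 2 * \<gamma> - of_nat 1) * 1"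
      using s1 by (rule DERIV_fun_powr)
    then have "DERIV ?F s :> c\<^sup>2 * ((2 - 2 * \<gamma>) * (1 + s) powr (2 - 2 * \<gamma> - of_nat 1) * 1 / (2 - 2 * \<gamma>))"
      by (intro DERIV_cmult DERIV_cdivide)
    then show "DERIV ?F s :> (c * (1 + s) powr (- \<gamma>))\<^sup>2 * (1 + s)"
      unfolding e by (rule DERIV_cong) (use \<gamma> in \<open>simp add: diff_diff_eq2\<close>)
    show "0 \<le> (c * (1 + s) powr (- \<gamma>))\<^sup>2 * (1 + s)" using s1 by simp
  qed (use T in auto)
  also have "\<dots> \<le> ennreal (?F T)" using \<gamma> by (intro ennreal_leI) simp
  finally show ?thesis .
qed

section \<open>Powers of j in the errors of a step\<close>

text \<open>The binomial coefficients other than the leading one sum to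
  \<open>2 ^ Suc n - 1\<close>, and all lower powers are at most \<open>J ^ n\<close>. For the tenth
  power this is the constant 1023.\<close>

lemma power_Suc_diff_bound:
  fixes J :: real assumes "1 \<le> J" shows "(J + 1) ^ Suc n \<le> J ^ Suc n + (2 ^ Suc n - 1) * J ^ n"
proof (induction n)
  case (Suc n)
  have "(J + 1) ^ Suc (Suc n) \<le> (J + 1) * (J ^ Suc n + (2 ^ Suc n - 1) * J ^ n)"
    using Suc assms by (simp only: power_Suc[of _ "Suc n"]) (intro mult_left_mono, auto)
  also have "\<dots> = J ^ Suc (Suc n) + J ^ Suc n + (2 ^ Suc n - 1) * J ^ Suc n + (2 ^ Suc n - 1) * J ^ n"
    by (simp add: algebra_simps)
  also have "(2 ^ Suc n - 1) * J ^ n \<le> (2 ^ Suc n - 1) * J ^ Suc n"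
    using assms one_le_power[of "2::real" "Suc n"] by (intro mult_left_mono power_increasing) auto
  also have "J ^ Suc (Suc n) + J ^ Suc n + (2 ^ Suc n - 1) * J ^ Suc n + (2 ^ Suc n - 1) * J ^ Suc n
    = J ^ Suc (Suc n) + (2 ^ Suc (Suc n) - 1) * J ^ Suc n" by (simp add: algebra_simps)
  finally show ?case by simp
qed (use assms in simp)

context
  fixes J \<gamma> c :: real
  assumes J: "1 \<le> J" and \<gamma>: "19 / 20 \<le> \<gamma>" "\<gamma> < 1" and c: "0 < c" "c \<le> 1"
begin

abbreviation "growth \<equiv> J powr (10 * (1 - \<gamma>))"
text \<open>The square root of \<open>growth^2 / J^3\<close>, the mean-square size of the tail and
  transfer errors; with this value the two terms of \<open>le_add_square_div\<close>
  balance.\<close>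

abbreviation "tol \<equiv> J powr (10 * (1 - \<gamma>) - 3 / 2)"

lemma step_length_le: "(J + 1) ^ 10 - J ^ 10 \<le> 1023 * J ^ 9"
  using power_Suc_diff_bound[OF J, of 9] by simp

lemma step_end_le: "1 + (J + 1) ^ 10 \<le> 1025 * J ^ 10"
proof -
  have "J ^ 9 \<le> J ^ 10" "1 \<le> J ^ 10" using J by (auto intro: power_increasing one_le_power)
  then show ?thesis using step_length_le by linarith
qed

lemma step_potential_le: "c * (1 + J ^ 10) powr (- \<gamma>) \<le> growth / J ^ 10"
proof -
  have J0: "0 < J" using J by simp
  have "c * (1 + J ^ 10) powr (- \<gamma>) \<le> 1 * (1 + J ^ 10) powr (- \<gamma>)" using c by (intro mult_right_mono) auto
  also have "\<dots> \<le> 1 * (J ^ 10) powr (- \<gamma>)" using J0 \<gamma> by (intro mult_left_mono powr_mono2') auto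
  also have "\<dots> = (J powr 10) powr (- \<gamma>)" using J0 by simp
  also have "\<dots> = J powr (10 * (1 - \<gamma>) - 10)" by (simp only: powr_powr) (simp add: algebra_simps)
  also have "\<dots> = growth / J powr 10" by (rule powr_diff)
  finally show ?thesis using J0 by simp
qed

lemma step_force_growth: "((J + 1) ^ 10 - J ^ 10) * (c * (1 + J ^ 10) powr (- \<gamma>)) \<le> 1023 * (growth / J)"
proof -
  have J0: "0 < J" using J by simp
  have "((J + 1) ^ 10 - J ^ 10) * (c * (1 + J ^ 10) powr (- \<gamma>)) \<le> (1023 * J ^ 9) * (growth / J ^ 10)"
    using step_length_le step_potential_le c J by (intro mult_mono) auto
  also have "\<dots> = 1023 * (growth / J)" using J0 by (simp add: field_simps eval_nat_numeral)
  finally show ?thesis .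
qed

lemma phase_gap_le: "0 \<le> A \<Longrightarrow> A * (J ^ p)\<^sup>2 / (1 + J ^ 10)\<^sup>2 * ((J + 1) ^ 10 - J ^ 10) \<le> 1023 * A * (J ^ (2 * p) / J ^ 11)"
proof -
  assume A: "0 \<le> A"
  have J0: "0 < J" using J by simp
  have "(J + 1) ^ 10 - J ^ 10 \<ge> 0" using J by (simp add: power_mono)
  have "0 < 1 + J ^ 10" using J0 by (intro add_pos_pos zero_less_power) auto
  then have pos: "0 < (1 + J ^ 10)\<^sup>2 * (J ^ 10)\<^sup>2" using J0 by (intro mult_pos_pos zero_less_power)
  have "A * (J ^ p)\<^sup>2 / (1 + J ^ 10)\<^sup>2 * ((J + 1) ^ 10 - J ^ 10) \<le> A * (J ^ p)\<^sup>2 / (J ^ 10)\<^sup>2 * (1023 * J ^ 9)"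
    using A J0 step_length_le \<open>(J + 1) ^ 10 - J ^ 10 \<ge> 0\<close> pos by (intro mult_mono divide_left_mono power_mono) auto
  also have "\<dots> = 1023 * A * (J ^ (2 * p) * (J ^ 9 / (J ^ 10)\<^sup>2))" by (simp add: power_mult[symmetric] mult.commute[of p 2])
  also have "J ^ 9 / (J ^ 10)\<^sup>2 = 1 / J ^ 11" using J0 by (simp add: field_simps power_mult[symmetric] power_add[symmetric])
  finally show ?thesis by simp
qed

lemma powr_div_power: "J powr r / J ^ n = J powr (r - real n)"
  using J by (simp add: powr_diff powr_realpow)

lemma growth_sq: "growth\<^sup>2 = J powr (20 * (1 - \<gamma>))"
  by (simp add: power2_eq_square powr_add[symmetric])

text \<open>The quadratic error of a step. Comparing the exponents
  \<open>20 (1 - \<gamma>) - 2\<close> and \<open>10 (1 - \<gamma>) - 3/2\<close> gives exactly the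
  condition \<gamma> >= 19/20.\<close>

lemma growth_sq_div_tol: "growth\<^sup>2 / J\<^sup>2 \<le> tol" unfolding growth_sq powr_div_power using J \<gamma> by (intro powr_mono) auto
lemma growth_div_tol: "growth / J\<^sup>2 \<le> tol" unfolding powr_div_power using J \<gamma> by (intro powr_mono) auto
lemma inverse_power_tol: "1 / J ^ 5 \<le> tol"
proof -
  have "1 / J ^ 5 = J powr 0 / J ^ 5" using J by simp
  also have "\<dots> \<le> tol" unfolding powr_div_power using J \<gamma> by (intro powr_mono) auto
  finally show ?thesis .
qed
lemma growth_sq_div_cube_tol: "growth\<^sup>2 / J ^ 3 \<le> tol" unfolding growth_sq powr_div_power using J \<gamma> by (intro powr_mono) auto
lemma growth_sq_div_cube_div_tol: "growth\<^sup>2 / J ^ 3 / tol = tol"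
  unfolding growth_sq powr_div_power powr_diff[symmetric] by (rule arg_cong[where f="\<lambda>e. J powr e"]) simp

lemma step_end_powr_le: "T \<le> (J + 1) ^ 10 \<Longrightarrow> 0 \<le> T \<Longrightarrow> (1 + T) powr (2 - 2 * \<gamma>) \<le> 1025 * growth\<^sup>2"
proof -
  assume T: "T \<le> (J + 1) ^ 10" "0 \<le> T"
  have J0: "0 < J" using J by simp
  have "(1 + T) powr (2 - 2 * \<gamma>) \<le> (1025 * J ^ 10) powr (2 - 2 * \<gamma>)"
    using T step_end_le \<gamma> by (intro powr_mono2) auto
  also have "\<dots> = 1025 powr (2 - 2 * \<gamma>) * (J powr 10) powr (2 - 2 * \<gamma>)"
    using J0 by (simp add: powr_mult)
  also have "(J powr 10) powr (2 - 2 * \<gamma>) = growth\<^sup>2" unfolding growth_sq powr_powr by (simp add: algebra_simps)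
  also have "1025 powr (2 - 2 * \<gamma>) \<le> (1025::real) powr 1" using \<gamma> by (intro powr_mono) auto
  finally show ?thesis by (simp add: mult_right_mono)
qed

end

definition step_time :: "nat \<Rightarrow> real" where "step_time j = real j ^ 10"

definition step_tol :: "real \<Rightarrow> nat \<Rightarrow> real" where
  "step_tol \<gamma> j = real j powr (10 * (1 - \<gamma>) - 3 / 2)"

definition step_force :: "real \<Rightarrow> real \<Rightarrow> nat \<Rightarrow> real" where
  "step_force \<gamma> c j = (step_time (Suc j) - step_time j) * (c * (1 + step_time j) powr (- \<gamma>))"

text \<open>The \<open>j\<close>-th step lasts from \<open>j\<^sup>1\<^sup>0\<close> to \<open>(j+1)\<^sup>1\<^sup>0\<close> and separates low frequencies at \<open>j\<^sup>3\<close> and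
  \<open>j\<^sup>5\<close>; with these exponents every error is \<open>O(j powr (10 (1 - \<gamma>) - 3/2))\<close>, which is summable
  precisely because \<open>\<gamma> > 19/20\<close>.\<close>

definition step_error :: "(real \<Rightarrow> real \<Rightarrow> real) \<Rightarrow> real \<Rightarrow> real \<Rightarrow> real \<Rightarrow> nat \<Rightarrow> real \<Rightarrow> ennreal" where
  "step_error V \<gamma> c A j k =
     ennreal (4 * (step_force \<gamma> c j)\<^sup>2
       + 2 * step_force \<gamma> c j * (A * (real (j ^ 5))\<^sup>2 / (1 + step_time j)\<^sup>2 * (step_time (Suc j) - step_time j))
       + A * (real (j ^ 3))\<^sup>2 / (1 + step_time j)\<^sup>2 * (step_time (Suc j) - step_time j) + 4 * step_tol \<gamma> j)
     + (ennreal (1 + 2 / step_tol \<gamma> j) * tail_mass V (j ^ 3) (step_time j) k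
     + ennreal (2 / step_tol \<gamma> j) * tail_mass V (j ^ 3) (step_time (Suc j)) k
     + ennreal (1 / step_tol \<gamma> j) *
        (bounded_potential.interaction_mass V (step_time j) (step_time (Suc j)) schroedinger_symbol (j ^ 3) (j ^ 5) k
         + bounded_potential.interaction_mass V (step_time j) (step_time (Suc j)) transport_symbol (j ^ 3) (j ^ 5) k))"

lemma step_time_mono: "i \<le> j \<Longrightarrow> step_time i \<le> step_time j"
  by (simp add: step_time_def power_mono)

lemma step_time_nonneg [simp]: "0 \<le> step_time j" by (simp add: step_time_def)

lemma step_time_Suc: "step_time (Suc j) = (real j + 1) ^ 10"
  by (simp add: step_time_def add.commute)

text \<open>The first summand is the deterministic error times the length of the range of k. The
  factor 5 counts one tail mass with coefficient 1 and two with coefficient 2 divided by the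
  tolerance; the factor 2 counts the transfer terms of the two equations.\<close>

definition error_const :: "real \<Rightarrow> real \<Rightarrow> real" where
  "error_const \<gamma> A = 2 * A * (4 * 1023\<^sup>2 + 2 * 1023\<^sup>2 * A + 1023 * A + 4)
     + 5 * (4100 * osc_const A / (2 - 2 * \<gamma>)) + 2 * (8 * osc_const A * 3 * 1025 * 1023)"

lemma nn_set_integral_add:
  "f \<in> borel_measurable borel \<Longrightarrow> g \<in> borel_measurable borel \<Longrightarrow>
   (\<integral>\<^sup>+k\<in>{-A..A::real}. (f k + g k) \<partial>lborel) = (\<integral>\<^sup>+k\<in>{-A..A}. f k \<partial>lborel) + (\<integral>\<^sup>+k\<in>{-A..A}. g k \<partial>lborel)"
  unfolding distrib_right by (rule nn_integral_add) auto

lemma nn_set_integral_cmult: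
  "f \<in> borel_measurable borel \<Longrightarrow>
   (\<integral>\<^sup>+k\<in>{-A..A::real}. c * f k \<partial>lborel) = c * (\<integral>\<^sup>+k\<in>{-A..A}. f k \<partial>lborel)"
  unfolding mult.assoc by (rule nn_integral_cmult) auto

lemma nn_set_integral_const:
  "0 \<le> A \<Longrightarrow> (\<integral>\<^sup>+k\<in>{-A..A::real}. c \<partial>lborel) = c * ennreal (2 * A)"
  by (subst nn_integral_cmult_indicator) auto

lemma nn_set_integral_combination:
  assumes [measurable]: "f1 \<in> borel_measurable borel" "f2 \<in> borel_measurable borel"
      "f3 \<in> borel_measurable borel" "f4 \<in> borel_measurable borel" and A: "0 \<le> A"
  shows "(\<integral>\<^sup>+k\<in>{-A..A::real}. (d + (a * f1 k + b * f2 k + e * (f3 k + f4 k))) \<partial>lborel)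
    = d * ennreal (2 * A) + (a * (\<integral>\<^sup>+k\<in>{-A..A}. f1 k \<partial>lborel) + b * (\<integral>\<^sup>+k\<in>{-A..A}. f2 k \<partial>lborel)
      + e * ((\<integral>\<^sup>+k\<in>{-A..A}. f3 k \<partial>lborel) + (\<integral>\<^sup>+k\<in>{-A..A}. f4 k \<partial>lborel)))"
  apply (subst nn_set_integral_add, measurable)
  apply (subst nn_set_integral_add, measurable)
  apply (subst nn_set_integral_add, measurable)
  apply (subst nn_set_integral_cmult, measurable)
  apply (subst nn_set_integral_cmult, measurable)
  apply (subst nn_set_integral_cmult, measurable)
  apply (subst nn_set_integral_add, measurable)
  apply (subst nn_set_integral_const[OF A])
  apply simp
  done

section \<open>Average error of a single step\<close>

locale decaying_potential =
  fixes V :: "real \<Rightarrow> real \<Rightarrow> real" and \<gamma> c A :: real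
  assumes Vm: "meas_potential V" and Vdecay: "\<And>s x. 0 \<le> s \<Longrightarrow> \<bar>V s x\<bar> \<le> c * (1 + s) powr (- \<gamma>)"
    and Vb: "\<And>s x. \<bar>V s x\<bar> \<le> c" and \<gamma>: "19 / 20 < \<gamma>" "\<gamma> < 1" and c: "0 < c" "c \<le> 1" and A: "0 < A"
begin

lemma bounded_potential_step:
  "bounded_potential V (step_time j) (step_time (Suc j)) (c * (1 + step_time j) powr (- \<gamma>))"
proof unfold_locales
  fix s x assume s: "s \<in> {step_time j..step_time (Suc j)}"
  then have s0: "0 \<le> s" using step_time_nonneg[of j] by (meson atLeastAtMost_iff order_trans)
  have "(1 + s) powr (- \<gamma>) \<le> (1 + step_time j) powr (- \<gamma>)"
    using s \<gamma> add_pos_nonneg[OF zero_less_one step_time_nonneg[of j]] by (intro powr_mono2') auto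
  then have "c * (1 + s) powr (- \<gamma>) \<le> c * (1 + step_time j) powr (- \<gamma>)" using c by (intro mult_left_mono) auto
  then show "\<bar>V s x\<bar> \<le> c * (1 + step_time j) powr (- \<gamma>)" using Vdecay[OF s0, of x] by linarith
qed (use Vm c in auto)

text \<open>The high frequencies of \<open>G\<close> accumulate from time zero, so the whole history
  enters; its weight integral grows only like \<open>T^(2 - 2 \<gamma>)\<close>, and the cutoff
  \<open>j^3\<close> supplies the decay.\<close>

lemma tail_mass_average:
  assumes j: "1 \<le> j" and T: "0 \<le> T" "T \<le> step_time (Suc j)"
  shows "(\<integral>\<^sup>+k\<in>{-A..A}. tail_mass V (j ^ 3) T k \<partial>lborel)
    \<le> ennreal (4100 * osc_const A / (2 - 2 * \<gamma>) * ((real j powr (10 * (1 - \<gamma>)))\<^sup>2 / real j ^ 3))"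
proof -
  let ?J = "real j" and ?y = "real j powr (10 * (1 - \<gamma>))"
  have J: "1 \<le> ?J" using j by simp
  have "(\<integral>\<^sup>+k\<in>{-A..A}. tail_mass V (j ^ 3) T k \<partial>lborel)
    \<le> ennreal (4 * osc_const A / real (j ^ 3)) * (\<integral>\<^sup>+s. ennreal ((c * (1 + s) powr (- \<gamma>))\<^sup>2 * (1 + s)) \<partial>tm 0 T)"
    unfolding tail_mass_def
  proof (rule transport_tail_average[OF Vm Vdecay _ _ T(1)])
    show "c * (1 + s) powr (- \<gamma>) \<le> c" if "0 \<le> s" for s
    proof -
      have "(1 + s) powr (- \<gamma>) \<le> (1 + s) powr 0" using that \<gamma> by (intro powr_mono) auto
      then show ?thesis using c that by (simp add: mult_left_le)
    qed
  qed (use j in auto)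
  also have "\<dots> \<le> ennreal (4 * osc_const A / real (j ^ 3)) * ennreal (c\<^sup>2 * ((1 + T) powr (2 - 2 * \<gamma>) / (2 - 2 * \<gamma>)))"
    by (intro mult_left_mono weight_integral \<gamma> T) auto
  also have "\<dots> = ennreal (4 * osc_const A / real (j ^ 3) * (c\<^sup>2 * ((1 + T) powr (2 - 2 * \<gamma>) / (2 - 2 * \<gamma>))))"
    using osc_const_pos[of A] \<gamma> by (intro ennreal_mult[symmetric]) auto
  also have "\<dots> \<le> ennreal (4 * osc_const A / real (j ^ 3) * (1 * (1025 * ?y\<^sup>2 / (2 - 2 * \<gamma>))))"
  proof (intro ennreal_leI mult_left_mono mult_mono divide_right_mono)
    show "c\<^sup>2 \<le> 1" using c by (simp add: power_le_one)
    show "(1 + T) powr (2 - 2 * \<gamma>) \<le> 1025 * ?y\<^sup>2"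
      by (rule step_end_powr_le[OF J _ \<gamma>(2) c]) (use T \<gamma> in \<open>auto simp: step_time_Suc\<close>)
  qed (use \<gamma> osc_const_pos[of A] in auto)
  also have "4 * osc_const A / real (j ^ 3) * (1 * (1025 * ?y\<^sup>2 / (2 - 2 * \<gamma>))) = 4100 * osc_const A / (2 - 2 * \<gamma>) * (?y\<^sup>2 / ?J ^ 3)"
    by (simp add: field_simps)
  finally show ?thesis .
qed

lemma interaction_average:
  assumes j: "3 \<le> j" and \<theta>: "\<theta> = schroedinger_symbol \<or> \<theta> = transport_symbol"
  defines "I \<equiv> bounded_potential.interaction_mass V (step_time j) (step_time (Suc j)) \<theta> (j ^ 3) (j ^ 5)"
  shows "I \<in> borel_measurable borel"
    and "(\<integral>\<^sup>+k\<in>{-A..A}. I k \<partial>lborel)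
      \<le> ennreal (8 * osc_const A * 3 * 1025 * 1023 * ((real j powr (10 * (1 - \<gamma>)))\<^sup>2 / real j ^ 3))"
proof -
  let ?J = "real j" and ?y = "real j powr (10 * (1 - \<gamma>))"
  have J: "1 \<le> ?J" using j by simp
  let ?v = "c * (1 + step_time j) powr (- \<gamma>)"
  interpret B: bounded_potential V "step_time j" "step_time (Suc j)" ?v by (rule bounded_potential_step)
  \<comment> \<open>The requirement \<open>6 <= j^2\<close> is why the steps start at 3.\<close>
  have NM: "6 * j ^ 3 \<le> j ^ 5"
  proof -
    have "6 * j ^ 3 \<le> j\<^sup>2 * j ^ 3" using power_mono[OF j, of 2] by (intro mult_right_mono) auto
    also have "\<dots> = j ^ 5" by (simp add: power_add[symmetric])
    finally show ?thesis .
  qed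
  have N2: "(real (j ^ 3))\<^sup>2 \<le> 1 + step_time j"
    using power_increasing[of 6 10 ?J] J by (simp add: step_time_def power_mult[symmetric])
  have ab: "0 \<le> step_time j" "step_time j \<le> step_time (Suc j)" by (auto intro: step_time_mono)
  note avg = B.interaction_mass_average[OF ab \<theta> NM _ N2]
  show "I \<in> borel_measurable borel" unfolding I_def by (rule avg(1)) (use j in simp)
  have "(\<integral>\<^sup>+k\<in>{-A..A}. I k \<partial>lborel)
    \<le> ennreal (8 * osc_const A / real (j ^ 5) * (2 * real (j ^ 3) + 1) * (?v\<^sup>2 * (1 + step_time (Suc j)) * (step_time (Suc j) - step_time j)))"
    unfolding I_def by (rule avg(2)) (use j in simp)
  also have "\<dots> \<le> ennreal (8 * osc_const A / real (j ^ 5) * (3 * ?J ^ 3) * ((?y / ?J ^ 10)\<^sup>2 * (1025 * ?J ^ 10) * (1023 * ?J ^ 9)))"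
  proof (intro ennreal_leI mult_mono mult_left_mono)
    show "?v\<^sup>2 \<le> (?y / ?J ^ 10)\<^sup>2"
      using step_potential_le[OF J _ \<gamma>(2) c] \<gamma> c unfolding step_time_def by (intro power_mono) auto
    show "1 + step_time (Suc j) \<le> 1025 * ?J ^ 10"
      unfolding step_time_Suc by (rule step_end_le[OF J _ \<gamma>(2) c]) (use \<gamma> in simp)
    show "step_time (Suc j) - step_time j \<le> 1023 * ?J ^ 9"
      unfolding step_time_Suc unfolding step_time_def by (rule step_length_le[OF J _ \<gamma>(2) c]) (use \<gamma> in simp)
    show "2 * real (j ^ 3) + 1 \<le> 3 * ?J ^ 3" using J by simp
  qed (use osc_const_pos[of A] ab J in auto)
  also have "8 * osc_const A / real (j ^ 5) * (3 * ?J ^ 3) * ((?y / ?J ^ 10)\<^sup>2 * (1025 * ?J ^ 10) * (1023 * ?J ^ 9))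
    = 8 * osc_const A * 3 * 1025 * 1023 * (?y\<^sup>2 / ?J ^ 3)"
  proof -
    have "?J ^ 3 / ?J ^ 5 * (?J ^ 10 * ?J ^ 9 / (?J ^ 10)\<^sup>2) = 1 / ?J ^ 3"
      using J by (simp add: field_simps power_mult[symmetric] power_add[symmetric])
    moreover have "8 * osc_const A / real (j ^ 5) * (3 * ?J ^ 3) * ((?y / ?J ^ 10)\<^sup>2 * (1025 * ?J ^ 10) * (1023 * ?J ^ 9))
      = 8 * osc_const A * 3 * 1025 * 1023 * (?y\<^sup>2 * (?J ^ 3 / ?J ^ 5 * (?J ^ 10 * ?J ^ 9 / (?J ^ 10)\<^sup>2)))"
      by (simp add: power_divide)
    ultimately show ?thesis by simp
  qed
  finally show "(\<integral>\<^sup>+k\<in>{-A..A}. I k \<partial>lborel)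
      \<le> ennreal (8 * osc_const A * 3 * 1025 * 1023 * (?y\<^sup>2 / ?J ^ 3))" .
qed

lemma step_error_measurable:
  assumes j: "3 \<le> j" shows "step_error V \<gamma> c A j \<in> borel_measurable borel"
proof -
  have [measurable]: "tail_mass V N T \<in> borel_measurable borel" for N T by (rule tail_mass_measurable[OF Vm])
  have [measurable]: "bounded_potential.interaction_mass V (step_time j) (step_time (Suc j)) schroedinger_symbol (j ^ 3) (j ^ 5) \<in> borel_measurable borel"
    "bounded_potential.interaction_mass V (step_time j) (step_time (Suc j)) transport_symbol (j ^ 3) (j ^ 5) \<in> borel_measurable borel"
    by (rule interaction_average[OF j], simp)+
  show ?thesis unfolding step_error_def[abs_def] by measurable
qed

text \<open>The averaged tail and transfer masses are of size \<open>?w = ?z^2\<close>, so division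
  by the tolerance \<open>?z\<close> leaves \<open>?z\<close>; the deterministic part is of this
  order by the exponent comparisons.\<close>

lemma step_error_average:
  assumes j: "3 \<le> j"
  shows "(\<integral>\<^sup>+k\<in>{-A..A}. step_error V \<gamma> c A j k \<partial>lborel) \<le> ennreal (error_const \<gamma> A * step_tol \<gamma> j)"
proof -
  let ?J = "real j" and ?y = "real j powr (10 * (1 - \<gamma>))" and ?z = "step_tol \<gamma> j"
  let ?I = "\<lambda>\<theta>. bounded_potential.interaction_mass V (step_time j) (step_time (Suc j)) \<theta> (j ^ 3) (j ^ 5)"
  have J: "1 \<le> ?J" and J0: "0 < ?J" using j by auto
  have \<gamma>': "19 / 20 \<le> \<gamma>" using \<gamma> by simp
  note num = growth_sq_div_tol[OF J \<gamma>' \<gamma>(2) c] growth_div_tol[OF J \<gamma>' \<gamma>(2) c] inverse_power_tol[OF J \<gamma>' \<gamma>(2) c] growth_sq_div_cube_tol[OF J \<gamma>' \<gamma>(2) c] growth_sq_div_cube_div_tol[OF J \<gamma>' \<gamma>(2) c]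
  note num = num[folded step_tol_def]
  have z: "0 < ?z" using J0 by (simp add: step_tol_def)
  let ?w = "?y\<^sup>2 / ?J ^ 3"
  define K1 where "K1 = 4100 * osc_const A / (2 - 2 * \<gamma>)"
  define K2 where "K2 = 8 * osc_const A * 3 * 1025 * 1023"
  have K: "0 \<le> K1" "0 \<le> K2" using osc_const_pos[of A] \<gamma> by (auto simp: K1_def K2_def)
  let ?\<mu> = "\<lambda>L. A * (real L)\<^sup>2 / (1 + step_time j)\<^sup>2 * (step_time (Suc j) - step_time j)"
  define D where "D = 4 * (step_force \<gamma> c j)\<^sup>2 + 2 * step_force \<gamma> c j * ?\<mu> (j ^ 5) + ?\<mu> (j ^ 3) + 4 * ?z"
  have dt: "0 \<le> step_time (Suc j) - step_time j" using step_time_mono[of j "Suc j"] by simp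
  have D: "D \<le> (4 * 1023\<^sup>2 + 2 * 1023\<^sup>2 * A + 1023 * A + 4) * ?z"
  proof -
    have e: "step_force \<gamma> c j \<le> 1023 * (?y / ?J)"
      unfolding step_force_def step_time_Suc unfolding step_time_def by (rule step_force_growth[OF J \<gamma>' \<gamma>(2) c])
    have e0: "0 \<le> step_force \<gamma> c j" unfolding step_force_def using dt c by (intro mult_nonneg_nonneg) auto
    have m5: "?\<mu> (j ^ 5) \<le> 1023 * A / ?J"
    proof -
      have "?J ^ 10 / ?J ^ 11 = 1 / ?J" using J0 power_Suc[of ?J 10] by (simp add: field_simps)
      then show ?thesis using phase_gap_le[OF J \<gamma>' \<gamma>(2) c, of A 5] A unfolding step_time_Suc unfolding step_time_def by simp
    qed
    have m3: "?\<mu> (j ^ 3) \<le> 1023 * A * (1 / ?J ^ 5)"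
    proof -
      have "?J ^ 6 / ?J ^ 11 = 1 / ?J ^ 5" using J0 by (simp add: field_simps power_add[symmetric])
      then show ?thesis using phase_gap_le[OF J \<gamma>' \<gamma>(2) c, of A 3] A unfolding step_time_Suc unfolding step_time_def by simp
    qed
    have "(step_force \<gamma> c j)\<^sup>2 \<le> (1023 * (?y / ?J))\<^sup>2" using e e0 by (intro power_mono)
    also have "\<dots> = 1023\<^sup>2 * (?y\<^sup>2 / ?J\<^sup>2)" by (simp add: power_divide power_mult_distrib)
    also have "\<dots> \<le> 1023\<^sup>2 * ?z" by (intro mult_left_mono num) simp
    finally have 1: "(step_force \<gamma> c j)\<^sup>2 \<le> 1023\<^sup>2 * ?z" .
    have "step_force \<gamma> c j * ?\<mu> (j ^ 5) \<le> (1023 * (?y / ?J)) * (1023 * A / ?J)"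
      using e m5 e0 A J0 dt by (intro mult_mono) auto
    also have "\<dots> = 1023\<^sup>2 * A * (?y / ?J\<^sup>2)" by (simp add: power2_eq_square)
    also have "\<dots> \<le> 1023\<^sup>2 * A * ?z" using A by (intro mult_left_mono num) simp
    finally have 2: "step_force \<gamma> c j * ?\<mu> (j ^ 5) \<le> 1023\<^sup>2 * A * ?z" .
    have "1023 * A * (1 / ?J ^ 5) \<le> 1023 * A * ?z" using A by (intro mult_left_mono num) simp
    then have 3: "?\<mu> (j ^ 3) \<le> 1023 * A * ?z" using m3 by linarith
    have "D = 4 * (step_force \<gamma> c j)\<^sup>2 + 2 * (step_force \<gamma> c j * ?\<mu> (j ^ 5)) + ?\<mu> (j ^ 3) + 4 * ?z" by (simp add: D_def)
    also have "\<dots> \<le> 4 * (1023\<^sup>2 * ?z) + 2 * (1023\<^sup>2 * A * ?z) + 1023 * A * ?z + 4 * ?z"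
      by (intro add_mono mult_left_mono 1 2 3) auto
    finally show ?thesis by (simp add: algebra_simps)
  qed
  have m [measurable]: "tail_mass V N T \<in> borel_measurable borel" for N T by (rule tail_mass_measurable[OF Vm])
  have mI [measurable]: "?I schroedinger_symbol \<in> borel_measurable borel" "?I transport_symbol \<in> borel_measurable borel"
    by (rule interaction_average[OF j], simp)+
  have "(\<integral>\<^sup>+k\<in>{-A..A}. step_error V \<gamma> c A j k \<partial>lborel) = ennreal D * ennreal (2 * A)
    + (ennreal (1 + 2 / ?z) * (\<integral>\<^sup>+k\<in>{-A..A}. tail_mass V (j ^ 3) (step_time j) k \<partial>lborel)
     + ennreal (2 / ?z) * (\<integral>\<^sup>+k\<in>{-A..A}. tail_mass V (j ^ 3) (step_time (Suc j)) k \<partial>lborel)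
     + ennreal (1 / ?z) * ((\<integral>\<^sup>+k\<in>{-A..A}. ?I schroedinger_symbol k \<partial>lborel) + (\<integral>\<^sup>+k\<in>{-A..A}. ?I transport_symbol k \<partial>lborel)))"
    unfolding step_error_def D_def[symmetric]
    by (rule nn_set_integral_combination[OF m m mI less_imp_le[OF A]])
  also have "\<dots> \<le> ennreal ((4 * 1023\<^sup>2 + 2 * 1023\<^sup>2 * A + 1023 * A + 4) * ?z) * ennreal (2 * A)
    + (ennreal (1 + 2 / ?z) * ennreal (K1 * ?w) + ennreal (2 / ?z) * ennreal (K1 * ?w)
     + ennreal (1 / ?z) * (ennreal (K2 * ?w) + ennreal (K2 * ?w)))"
    using tail_mass_average[of j "step_time j"] tail_mass_average[of j "step_time (Suc j)"] j
      interaction_average(2)[OF j, of schroedinger_symbol] interaction_average(2)[OF j, of transport_symbol]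
    unfolding K1_def[symmetric] K2_def[symmetric]
    by (intro add_mono mult_left_mono mult_right_mono ennreal_leI D) (auto simp: step_time_mono)
  also have "\<dots> = ennreal ((4 * 1023\<^sup>2 + 2 * 1023\<^sup>2 * A + 1023 * A + 4) * ?z * (2 * A)
    + ((1 + 2 / ?z) * (K1 * ?w) + 2 / ?z * (K1 * ?w) + 1 / ?z * (K2 * ?w + K2 * ?w)))"
    using A K z by (simp add: ennreal_mult[symmetric] ennreal_plus[symmetric] del: ennreal_plus)
  also have "\<dots> \<le> ennreal (error_const \<gamma> A * ?z)"
  proof (rule ennreal_leI)
    \<comment> \<open>The tolerance was chosen as the square root of \<open>?w\<close>.\<close>
    have wz: "?w / ?z = ?z" and w: "?w \<le> ?z" using num by simp_all
    have "(1 + 2 / z) * (K1 * w) + 2 / z * (K1 * w) + 1 / z * (K2 * w + K2 * w) = K1 * w + 4 * K1 * (w / z) + 2 * K2 * (w / z)" for w z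
      by (simp add: distrib_right add_divide_distrib)
    then have "(1 + 2 / ?z) * (K1 * ?w) + 2 / ?z * (K1 * ?w) + 1 / ?z * (K2 * ?w + K2 * ?w) = K1 * ?w + 4 * K1 * (?w / ?z) + 2 * K2 * (?w / ?z)" .
    also have "\<dots> \<le> K1 * ?z + 4 * K1 * ?z + 2 * K2 * ?z" unfolding wz using mult_left_mono[OF w K(1)] by linarith
    finally show "(4 * 1023\<^sup>2 + 2 * 1023\<^sup>2 * A + 1023 * A + 4) * ?z * (2 * A)
      + ((1 + 2 / ?z) * (K1 * ?w) + 2 / ?z * (K1 * ?w) + 1 / ?z * (K2 * ?w + K2 * ?w)) \<le> error_const \<gamma> A * ?z"
      unfolding error_const_def K1_def[symmetric] K2_def[symmetric] by (simp add: algebra_simps)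
  qed
  finally show ?thesis .
qed

end

section \<open>Proof of the theorem\<close>

text \<open>Frequency zero has zero phase, so the constant 1 is stationary for the free equation and
  the solution leaves it at rate at most \<open>c\<close>.\<close>

lemma evol_drift:
  assumes V: "meas_potential V" "\<And>s x. \<bar>V s x\<bar> \<le> c" and c: "0 \<le> c" and w: "evol P V w 0 t" and t: "0 \<le> t"
    and P: "\<And>n. P 0 n = 0" "P t 0 = 0" and B: "\<And>s. s \<in> {0..t} \<Longrightarrow> nrm torus (w s) \<le> 1"
    and w0: "\<And>n. fourier_coeff (w 0) n = (if n = 0 then 1 else 0)"
  shows "sq_integrable zcount (\<lambda>n. fourier_coeff (w t) n - (if n = 0 then 1 else 0))"
    and "nrm zcount (\<lambda>n. fourier_coeff (w t) n - (if n = 0 then 1 else 0)) \<le> c * t"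
proof -
  interpret bounded_potential V 0 t c by unfold_locales (use V c in auto)
  let ?d = "\<lambda>n::int. if n = 0 then 1 else 0 :: complex"
  have e: "cis (P t n) * fourier_coeff (w t) n - cis (P 0 n) * fourier_coeff (w 0) n = cis (P t n) * (fourier_coeff (w t) n - ?d n)" for n
    using w0[of n] P by (simp add: right_diff_distrib)
  have inc: "sq_integrable zcount (\<lambda>n. cis (P t n) * (fourier_coeff (w t) n - ?d n))"
      "nrm zcount (\<lambda>n. cis (P t n) * (fourier_coeff (w t) n - ?d n)) \<le> (t - 0) * (c * 1)"
    using evol_increment[OF w B, of 0 t] t unfolding e by auto
  show "sq_integrable zcount (\<lambda>n. fourier_coeff (w t) n - ?d n)"
    by (rule sq_integrable_zcountI[OF inc(1)]) (simp add: norm_mult)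
  have "nrm zcount (\<lambda>n. fourier_coeff (w t) n - ?d n) = nrm zcount (\<lambda>n. cis (P t n) * (fourier_coeff (w t) n - ?d n))"
    by (rule nrm_cong) (simp add: norm_mult)
  then show "nrm zcount (\<lambda>n. fourier_coeff (w t) n - ?d n) \<le> c * t" using inc(2) by (simp add: mult.commute)
qed

lemma phase_zero_frequency: "phase schroedinger_symbol t 0 = 0" "phase transport_symbol t 0 = 0"
  by (simp_all add: phase_def schroedinger_symbol_def transport_symbol_def cong: if_cong)

lemma step_tol_summable: "19 / 20 < \<gamma> \<Longrightarrow> summable (step_tol \<gamma>)"
  unfolding step_tol_def[abs_def] summable_real_powr_iff by simp

lemma step_force_le:
  assumes "1 \<le> j" "19 / 20 \<le> \<gamma>" "\<gamma> < 1" "0 < c" "c \<le> 1"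
  shows "step_force \<gamma> c j \<le> 1023 * real j powr (9 - 10 * \<gamma>)"
proof -
  have J: "1 \<le> real j" using assms(1) by simp
  have "step_force \<gamma> c j \<le> 1023 * (real j powr (10 * (1 - \<gamma>)) / real j)"
    unfolding step_force_def step_time_Suc unfolding step_time_def by (rule step_force_growth[OF J assms(2-5)])
  also have "real j powr (10 * (1 - \<gamma>)) / real j = real j powr (10 * (1 - \<gamma>) - 1)"
    using J powr_diff[of "real j" "10 * (1 - \<gamma>)" 1] by (simp only: powr_one)
  also have "10 * (1 - \<gamma>) - 1 = 9 - 10 * \<gamma>" by simp
  finally show ?thesis .
qed

section \<open>Accumulation of the overlap over all steps\<close>

context decaying_potential
begin

context
  fixes u g :: "real \<Rightarrow> real \<Rightarrow> complex" and k :: real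
  assumes u: "\<And>T. evol (\<lambda>t n. k * phase schroedinger_symbol t n) V u 0 T"
    and g: "\<And>T. evol (\<lambda>t n. k * phase transport_symbol t n) V g 0 T"
    and nu: "\<And>t. 0 \<le> t \<Longrightarrow> nrm torus (u t) = 1" and ng: "\<And>t. 0 \<le> t \<Longrightarrow> nrm torus (g t) = 1"
    and u0: "\<And>n. fourier_coeff (u 0) n = (if n = 0 then 1 else 0)"
    and g0: "\<And>n. fourier_coeff (g 0) n = (if n = 0 then 1 else 0)"
    and k: "\<bar>k\<bar> \<le> A"
begin

abbreviation "overlap t \<equiv> ip torus (u t) (g t)"

lemma sq_integrable_solutions:
  assumes "0 \<le> t" shows "sq_integrable torus (u t)" "sq_integrable torus (g t)"
  using u[of t] g[of t] assms by (auto simp: evol_def)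

lemma deviation_overlap:
  assumes "0 \<le> t" shows "(nrm torus (\<lambda>x. u t x - g t x))\<^sup>2 = 2 - 2 * Re (overlap t)"
  using nrm_diff_sq[OF sq_integrable_solutions[OF assms]] nu[OF assms] ng[OF assms] by simp

lemma deviation_early:
  assumes t: "0 \<le> t" shows "nrm torus (\<lambda>x. u t x - g t x) \<le> 2 * c * t"
proof -
  let ?d = "\<lambda>n::int. if n = 0 then 1 else 0 :: complex"
  note L = sq_integrable_solutions[OF t]
  have c0: "0 \<le> c" using c by simp
  have u': "sq_integrable zcount (\<lambda>n. fourier_coeff (u t) n - ?d n)" "nrm zcount (\<lambda>n. fourier_coeff (u t) n - ?d n) \<le> c * t"
    by (rule evol_drift[OF Vm Vb c0 u t]; simp add: u0 nu phase_zero_frequency)+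
  have g': "sq_integrable zcount (\<lambda>n. fourier_coeff (g t) n - ?d n)" "nrm zcount (\<lambda>n. fourier_coeff (g t) n - ?d n) \<le> c * t"
    by (rule evol_drift[OF Vm Vb c0 g t]; simp add: g0 ng phase_zero_frequency)+
  have "nrm torus (\<lambda>x. u t x - g t x) = nrm zcount (fourier_coeff (\<lambda>x. u t x - g t x))"
    by (rule nrm_fourier[symmetric]) (rule sq_integrable_diff[OF L])
  also have "\<dots> = nrm zcount (\<lambda>n. (fourier_coeff (u t) n - ?d n) - (fourier_coeff (g t) n - ?d n))"
    by (rule nrm_cong) (simp add: fourier_coeff_diff[OF L])
  also have "\<dots> \<le> c * t + c * t" using nrm_triangle_diff[OF u'(1) g'(1)] u'(2) g'(2) by linarith
  finally show ?thesis by simp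
qed

lemma overlap_step:
  assumes j: "3 \<le> j"
  shows "ennreal (cmod (overlap (step_time (Suc j)) - overlap (step_time j))) \<le> step_error V \<gamma> c A j k" (is ?one)
    and "t \<in> {step_time j..step_time (Suc j)} \<Longrightarrow>
      ennreal (cmod (overlap t - overlap (step_time j))) \<le> ennreal (2 * step_force \<gamma> c j) + step_error V \<gamma> c A j k" (is "_ \<Longrightarrow> ?two")
proof -
  have ab: "0 \<le> step_time j" "step_time j \<le> step_time (Suc j)" by (auto intro: step_time_mono)
  have nonneg: "0 \<le> s" if "s \<in> {step_time j..step_time (Suc j)}" for s using that order_trans[OF ab(1), of s] by simp
  have tail: "ennreal ((nrm zcount (\<lambda>n. if n \<in> {- int (j ^ 3)..int (j ^ 3)} then 0 else fourier_coeff (g T) n))\<^sup>2) \<le> tail_mass V (j ^ 3) T k"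
    if T: "0 \<le> T" for T
    by (rule transport_tail_bound[OF Vm Vb g _ g0 T, where B = 1]) (use ng j in auto)
  have u': "evol (\<lambda>t n. k * phase schroedinger_symbol t n) V u (step_time j) (step_time (Suc j))"
    by (rule evol_subset[OF u[of "step_time (Suc j)"] ab(1)]) simp
  have g': "evol (\<lambda>t n. k * phase transport_symbol t n) V g (step_time j) (step_time (Suc j))"
    by (rule evol_subset[OF g[of "step_time (Suc j)"] ab(1)]) simp
  have nu': "nrm torus (u s) \<le> 1" if "s \<in> {step_time j..step_time (Suc j)}" for s using nu[OF nonneg[OF that]] by simp
  have ng': "nrm torus (g s) \<le> 1" if "s \<in> {step_time j..step_time (Suc j)}" for s using ng[OF nonneg[OF that]] by simp
  have NM: "j ^ 3 \<le> j ^ 5" using j by (intro power_increasing) auto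
  have \<tau>: "0 < step_tol \<gamma> j" using j by (simp add: step_tol_def)
  note est = bounded_potential.step_estimates[OF bounded_potential_step ab u' g' nu' ng' k NM tail[OF ab(1)] tail[OF order_trans[OF ab]] \<tau>]
  show ?one unfolding step_error_def step_force_def by (rule est(1))
  show ?two if "t \<in> {step_time j..step_time (Suc j)}"
    unfolding step_error_def step_force_def by (rule est(2)[OF _ _ that])
qed

lemma overlap_telescope:
  assumes J: "3 \<le> J"
  shows "ennreal (cmod (overlap (step_time (J + m)) - overlap (step_time J))) \<le> (\<Sum>j<m. step_error V \<gamma> c A (j + J) k)"
proof (induction m)
  case (Suc m)
  let ?D = "\<lambda>a b. overlap (step_time a) - overlap (step_time b)"
  have "ennreal (cmod (?D (J + Suc m) J)) \<le> ennreal (cmod (?D (Suc (J + m)) (J + m)) + cmod (?D (J + m) J))"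
    using norm_triangle_ineq[of "?D (Suc (J + m)) (J + m)" "?D (J + m) J"] by (intro ennreal_leI) simp
  also have "\<dots> = ennreal (cmod (?D (Suc (J + m)) (J + m))) + ennreal (cmod (?D (J + m) J))" by simp
  also have "\<dots> \<le> step_error V \<gamma> c A (J + m) k + (\<Sum>j<m. step_error V \<gamma> c A (j + J) k)"
    by (intro add_mono Suc overlap_step(1)) (use J in simp)
  finally show ?case by (simp add: add.commute)
qed simp

text \<open>Complete steps telescope with summable errors; the intermediate estimate is applied in
  the last, incomplete step alone, so its force term appears once and needs only the uniform bound
  \<open>E\<close>.\<close>

lemma overlap_late:
  assumes J: "3 \<le> J" and E: "\<And>j. J \<le> j \<Longrightarrow> step_force \<gamma> c j \<le> E" and t: "step_time J < t"
  shows "ennreal (cmod (overlap t - overlap (step_time J))) \<le> ennreal (2 * E) + (\<Sum>j. step_error V \<gamma> c A (j + J) k)"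
proof -
  define n where "n = (LEAST n. t \<le> step_time (J + n))"
  obtain m where m: "t \<le> real m" using real_arch_simple by blast
  have "t \<le> step_time (J + Suc m)"
  proof -
    have "real m \<le> real (J + Suc m) ^ 1" by simp
    also have "\<dots> \<le> real (J + Suc m) ^ 10" by (rule power_increasing) auto
    finally show ?thesis using m by (simp add: step_time_def)
  qed
  then have n: "t \<le> step_time (J + n)" unfolding n_def by (rule LeastI)
  then have "n \<noteq> 0" using t by (cases n) auto
  then obtain i where i: "n = Suc i" by (cases n) auto
  have "\<not> t \<le> step_time (J + i)" using not_less_Least[of i "\<lambda>n. t \<le> step_time (J + n)"] i n_def by simp
  then have ti: "t \<in> {step_time (J + i)..step_time (Suc (J + i))}" using n i by simp
  have "ennreal (cmod (overlap t - overlap (step_time J)))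
    \<le> ennreal (cmod (overlap t - overlap (step_time (J + i))) + cmod (overlap (step_time (J + i)) - overlap (step_time J)))"
    using norm_triangle_ineq[of "overlap t - overlap (step_time (J + i))" "overlap (step_time (J + i)) - overlap (step_time J)"]
    by (intro ennreal_leI) simp
  also have "\<dots> = ennreal (cmod (overlap t - overlap (step_time (J + i)))) + ennreal (cmod (overlap (step_time (J + i)) - overlap (step_time J)))"
    by simp
  also have "\<dots> \<le> (ennreal (2 * step_force \<gamma> c (J + i)) + step_error V \<gamma> c A (J + i) k) + (\<Sum>j<i. step_error V \<gamma> c A (j + J) k)"
    by (intro add_mono overlap_step(2) overlap_telescope J ti) (use J in simp)
  \<comment> \<open>The error of the incomplete step becomes the last term of the partial
    sum.\<close>
  also have "\<dots> = ennreal (2 * step_force \<gamma> c (J + i)) + (\<Sum>j<Suc i. step_error V \<gamma> c A (j + J) k)"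
    by (simp add: ac_simps)
  also have "\<dots> \<le> ennreal (2 * E) + (\<Sum>j. step_error V \<gamma> c A (j + J) k)"
    using E[of "J + i"] by (intro add_mono ennreal_leI sum_le_suminf) auto
  finally show ?thesis .
qed

text \<open>Up to \<open>step_time J\<close> the drift from the constant 1 is used. Afterwards, by
  conservation of both norms, the squared deviation grows by at most twice the change of the
  overlap.\<close>

lemma deviation_sq_bound:
  assumes J: "3 \<le> J" and E: "\<And>j. J \<le> j \<Longrightarrow> step_force \<gamma> c j \<le> E" and t: "0 \<le> t"
  shows "ennreal ((nrm torus (\<lambda>x. u t x - g t x))\<^sup>2)
    \<le> ennreal ((2 * c * step_time J)\<^sup>2) + 2 * (ennreal (2 * E) + (\<Sum>j. step_error V \<gamma> c A (j + J) k))"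
proof -
  let ?D = "\<lambda>t. nrm torus (\<lambda>x. u t x - g t x)" and ?T = "step_time J"
  have early: "(?D s)\<^sup>2 \<le> (2 * c * ?T)\<^sup>2" if s: "0 \<le> s" "s \<le> ?T" for s
  proof (rule power_mono)
    have "2 * c * s \<le> 2 * c * ?T" using s c by (intro mult_left_mono) auto
    then show "?D s \<le> 2 * c * ?T" using deviation_early[OF s(1)] by linarith
  qed (rule nrm_nonneg)
  show ?thesis
  proof (cases "t \<le> ?T")
    case True
    then have "ennreal ((?D t)\<^sup>2) \<le> ennreal ((2 * c * ?T)\<^sup>2)" by (intro ennreal_leI early t)
    then show ?thesis by (rule order_trans) simp
  next
    case False
    have "(?D t)\<^sup>2 \<le> (?D ?T)\<^sup>2 + 2 * cmod (overlap t - overlap ?T)"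
      using deviation_overlap[OF t] deviation_overlap[OF step_time_nonneg[of J]]
        abs_Re_le_cmod[of "overlap t - overlap ?T"] by simp
    also have "\<dots> \<le> (2 * c * ?T)\<^sup>2 + 2 * cmod (overlap t - overlap ?T)" using early[of ?T] by simp
    finally have "ennreal ((?D t)\<^sup>2) \<le> ennreal ((2 * c * ?T)\<^sup>2 + 2 * cmod (overlap t - overlap ?T))" by (rule ennreal_leI)
    also have "\<dots> = ennreal ((2 * c * ?T)\<^sup>2) + 2 * ennreal (cmod (overlap t - overlap ?T))"
      by (simp add: ennreal_mult)
    also have "\<dots> \<le> ennreal ((2 * c * ?T)\<^sup>2) + 2 * (ennreal (2 * E) + (\<Sum>j. step_error V \<gamma> c A (j + J) k))"
      by (intro add_mono mult_left_mono overlap_late J E) (use False in auto)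
    finally show ?thesis .
  qed
qed

text \<open>Passes from the squared norm to the norm by \<open>le_add_square_div\<close> again. The
  bound is independent of t, which controls the supremum, and linear in the step errors, which
  allows integration over k.\<close>

lemma deviation_sup_bound:
  assumes J: "3 \<le> J" and E: "\<And>j. J \<le> j \<Longrightarrow> step_force \<gamma> c j \<le> E" "0 \<le> E" and \<kappa>: "0 < \<kappa>"
  shows "(SUP t\<in>{0<..}. ennreal (nrm torus (\<lambda>x. u t x - g t x)))
    \<le> ennreal (\<kappa> + ((2 * c * step_time J)\<^sup>2 + 4 * E) / \<kappa>) + ennreal (2 / \<kappa>) * (\<Sum>j. step_error V \<gamma> c A (j + J) k)"
proof (rule SUP_least)
  fix t :: real assume "t \<in> {0<..}"
  then have t: "0 \<le> t" by simp
  let ?D = "nrm torus (\<lambda>x. u t x - g t x)" and ?S = "\<Sum>j. step_error V \<gamma> c A (j + J) k" and ?a = "(2 * c * step_time J)\<^sup>2"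
  have a: "0 \<le> ?a" by (rule zero_le_power2)
  have i: "0 \<le> 1 / \<kappa>" using \<kappa> by simp
  have "ennreal ?D \<le> ennreal (\<kappa> + 1 / \<kappa> * ?D\<^sup>2)" using le_add_square_div[OF \<kappa>, of ?D] by (intro ennreal_leI) simp
  also have "\<dots> = ennreal \<kappa> + ennreal (1 / \<kappa>) * ennreal (?D\<^sup>2)" using \<kappa> by (simp add: ennreal_mult[symmetric] ennreal_plus[symmetric] del: ennreal_plus)
  also have "\<dots> \<le> ennreal \<kappa> + ennreal (1 / \<kappa>) * (ennreal ?a + 2 * (ennreal (2 * E) + ?S))"
    by (intro add_left_mono mult_left_mono deviation_sq_bound J E t) auto
  also have "\<dots> = (ennreal \<kappa> + (ennreal (1 / \<kappa>) * ennreal ?a + ennreal (1 / \<kappa>) * (2 * ennreal (2 * E)))) + ennreal (1 / \<kappa>) * 2 * ?S"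
    by (simp only: distrib_left add.assoc mult.assoc)
  also have "2 * ennreal (2 * E) = ennreal (4 * E)" using E(2) ennreal_mult[of 2 "2 * E"] by simp
  also have "ennreal (1 / \<kappa>) * 2 = ennreal (2 / \<kappa>)" using ennreal_mult[OF i, of 2] by simp
  also have "ennreal \<kappa> + (ennreal (1 / \<kappa>) * ennreal ?a + ennreal (1 / \<kappa>) * ennreal (4 * E)) = ennreal (\<kappa> + (1 / \<kappa> * ?a + 1 / \<kappa> * (4 * E)))"
  proof -
    have "0 \<le> 1 / \<kappa> * ?a" "0 \<le> 1 / \<kappa> * (4 * E)" using i a E(2) by (intro mult_nonneg_nonneg; simp)+
    then show ?thesis using \<kappa> a E(2) i by (simp only: ennreal_mult ennreal_plus add_nonneg_nonneg mult_nonneg_nonneg less_imp_le zero_le_numeral)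
  qed
  also have "\<kappa> + (1 / \<kappa> * ?a + 1 / \<kappa> * (4 * E)) = \<kappa> + (?a + 4 * E) / \<kappa>" by (simp add: add_divide_distrib)
  finally show "ennreal ?D \<le> ennreal (\<kappa> + (?a + 4 * E) / \<kappa>) + ennreal (2 / \<kappa>) * ?S" .
qed

end

lemma total_error_average:
  assumes J: "3 \<le> J" and d: "0 \<le> d" and e: "0 \<le> e"
  shows "(\<integral>\<^sup>+k\<in>{-A..A}. (ennreal d + ennreal e * (\<Sum>j. step_error V \<gamma> c A (j + J) k)) \<partial>lborel)
    \<le> ennreal (2 * A * d + e * (error_const \<gamma> A * (\<Sum>j. step_tol \<gamma> (j + J))))"
proof -
  have m: "step_error V \<gamma> c A (j + J) \<in> borel_measurable borel" for j by (rule step_error_measurable) (use J in simp)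
  note [measurable] = m
  have K: "0 \<le> error_const \<gamma> A" using A osc_const_pos[of A] \<gamma> by (simp add: error_const_def)
  have st: "summable (\<lambda>j. step_tol \<gamma> (j + J))" using step_tol_summable \<gamma> by (simp add: summable_iff_shift)
  have z0: "0 \<le> step_tol \<gamma> j" for j by (simp add: step_tol_def)
  have "(\<integral>\<^sup>+k\<in>{-A..A}. (ennreal d + ennreal e * (\<Sum>j. step_error V \<gamma> c A (j + J) k)) \<partial>lborel)
    = ennreal d * ennreal (2 * A) + ennreal e * (\<integral>\<^sup>+k\<in>{-A..A}. (\<Sum>j. step_error V \<gamma> c A (j + J) k) \<partial>lborel)"
    using A by (simp add: nn_set_integral_add nn_set_integral_cmult nn_set_integral_const)
  also have "(\<integral>\<^sup>+k\<in>{-A..A}. (\<Sum>j. step_error V \<gamma> c A (j + J) k) \<partial>lborel) = (\<Sum>j. \<integral>\<^sup>+k\<in>{-A..A}. step_error V \<gamma> c A (j + J) k \<partial>lborel)"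
    unfolding ennreal_suminf_multc[symmetric] by (rule nn_integral_suminf) measurable
  also have "\<dots> \<le> (\<Sum>j. ennreal (error_const \<gamma> A * step_tol \<gamma> (j + J)))"
    by (intro suminf_le summableI step_error_average) (use J in simp)
  also have "\<dots> = ennreal (\<Sum>j. error_const \<gamma> A * step_tol \<gamma> (j + J))"
    by (rule suminf_ennreal2) (use K z0 st in \<open>auto intro: summable_mult\<close>)
  also have "(\<Sum>j. error_const \<gamma> A * step_tol \<gamma> (j + J)) = error_const \<gamma> A * (\<Sum>j. step_tol \<gamma> (j + J))"
    by (rule suminf_mult[OF st])
  also have "ennreal d * ennreal (2 * A) + ennreal e * ennreal (error_const \<gamma> A * (\<Sum>j. step_tol \<gamma> (j + J)))
    = ennreal (2 * A * d + e * (error_const \<gamma> A * (\<Sum>j. step_tol \<gamma> (j + J))))"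
    using A d e K suminf_nonneg[OF st z0] by (simp add: ennreal_mult[symmetric] ennreal_plus[symmetric] mult_ac del: ennreal_plus)
  finally show ?thesis by (simp add: mult_left_mono)
qed

end

theorem theorem4p3:
  fixes \<gamma> A :: real
  assumes "83 / 87 \<le> \<gamma>" and "\<gamma> < 1" and "A > 0"
  shows "\<forall>\<epsilon>>0. \<exists>c\<^sub>0>0. \<forall>c::real. 0 < c \<and> c \<le> c\<^sub>0 \<longrightarrow>
    (\<forall>(V :: real \<Rightarrow> real \<Rightarrow> real)
       (u :: real \<Rightarrow> real \<Rightarrow> real \<Rightarrow> complex) (G :: real \<Rightarrow> real \<Rightarrow> real \<Rightarrow> complex).
       admissible_potential \<gamma> c V \<longrightarrow>
       (\<forall>k. mild_solution (schroedinger_mult k) V (\<lambda>_. 1) (u k)) \<longrightarrow>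
       (\<forall>k. mild_solution (transport_mult k) V (\<lambda>_. 1) (G k)) \<longrightarrow>
       (\<integral>\<^sup>+ k\<in>{-A..A}. (SUP t\<in>{0<..}. ennreal (L2_norm (\<lambda>x. u k t x - G k t x))) \<partial>lborel)
         < ennreal \<epsilon>)"
proof (intro allI impI)
  fix \<epsilon> :: real assume \<epsilon>: "0 < \<epsilon>"
  \<comment> \<open>\<open>83 * 20 = 1660\<close> exceeds \<open>87 * 19 = 1653\<close>, so the
    given range lies inside the summable one.\<close>
  have \<gamma>_bounds: "19 / 20 < \<gamma>" "0 \<le> \<gamma>" using assms(1) by simp_all
  \<comment> \<open>After integration over k the contribution of \<kappa> is
    \<open>\<epsilon>/4\<close> and that of \<open>E\<close> is \<open>\<epsilon>/8\<close>; the
    early drift and the tail of the errors get at most \<open>\<epsilon>/4\<close> each.\<close>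
  define \<kappa> where "\<kappa> = \<epsilon> / (8 * A)"
  define E where "E = \<epsilon> * \<kappa> / (64 * A)"
  define K where "K = error_const \<gamma> A"
  have \<kappa>: "0 < \<kappa>" and E: "0 < E" using \<epsilon> \<open>A > 0\<close> by (simp_all add: \<kappa>_def E_def)
  have K: "0 < K"
    unfolding K_def error_const_def using \<open>A > 0\<close> osc_const_pos[of A] \<open>\<gamma> < 1\<close> by (intro add_pos_pos) auto
  have "(\<lambda>j. 1023 * real j powr (9 - 10 * \<gamma>)) \<longlonglongrightarrow> 1023 * 0"
    by (intro tendsto_mult tendsto_const tendsto_neg_powr filterlim_real_sequentially) (use \<gamma>_bounds in simp)
  then have "eventually (\<lambda>j. 1023 * real j powr (9 - 10 * \<gamma>) < E) sequentially"
    using E order_tendstoD(2) by (metis mult_zero_right)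
  then obtain J1 where J1: "\<And>j. J1 \<le> j \<Longrightarrow> 1023 * real j powr (9 - 10 * \<gamma>) < E"
    by (auto simp: eventually_sequentially)
  obtain J2 where J2: "\<And>n. J2 \<le> n \<Longrightarrow> norm (\<Sum>i. step_tol \<gamma> (i + n)) < \<epsilon> * \<kappa> / (8 * K)"
    using suminf_exist_split[OF _ step_tol_summable[OF \<gamma>_bounds(1)], of "\<epsilon> * \<kappa> / (8 * K)"] \<epsilon> \<kappa> K by auto
  \<comment> \<open>\<open>J\<close> depends on \<gamma>, A and \<epsilon> only, so the size of the
    potential may be chosen after it: the step bounds hold uniformly for
    \<open>c <= 1\<close>.\<close>
  define J where "J = max 3 (max J1 J2)"
  have J: "3 \<le> J" "J1 \<le> J" "J2 \<le> J" by (simp_all add: J_def)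
  define T where "T = step_time J"
  have T: "0 < T" using J by (simp add: T_def step_time_def)
  \<comment> \<open>The bound 1 gives \<open>c^2 <= c\<close>; the other bound then makes
    \<open>2 A (2 c T)^2 / \<kappa>\<close> at most \<open>\<epsilon>/4\<close>.\<close>
  define c\<^sub>0 where "c\<^sub>0 = min 1 (\<epsilon> * \<kappa> / (32 * A * T\<^sup>2))"
  have "0 < c\<^sub>0" using \<epsilon> \<kappa> T \<open>A > 0\<close> by (simp add: c\<^sub>0_def)
  show "\<exists>c\<^sub>0>0. \<forall>c::real. 0 < c \<and> c \<le> c\<^sub>0 \<longrightarrow>
    (\<forall>(V :: real \<Rightarrow> real \<Rightarrow> real)
       (u :: real \<Rightarrow> real \<Rightarrow> real \<Rightarrow> complex) (G :: real \<Rightarrow> real \<Rightarrow> real \<Rightarrow> complex).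
       admissible_potential \<gamma> c V \<longrightarrow>
       (\<forall>k. mild_solution (schroedinger_mult k) V (\<lambda>_. 1) (u k)) \<longrightarrow>
       (\<forall>k. mild_solution (transport_mult k) V (\<lambda>_. 1) (G k)) \<longrightarrow>
       (\<integral>\<^sup>+ k\<in>{-A..A}. (SUP t\<in>{0<..}. ennreal (L2_norm (\<lambda>x. u k t x - G k t x))) \<partial>lborel)
         < ennreal \<epsilon>)"
  proof (rule exI[of _ c\<^sub>0], intro conjI allI impI)
    show "0 < c\<^sub>0" by fact
    fix c :: real and V :: "real \<Rightarrow> real \<Rightarrow> real" and u G :: "real \<Rightarrow> real \<Rightarrow> real \<Rightarrow> complex"
    assume c: "0 < c \<and> c \<le> c\<^sub>0" and V: "admissible_potential \<gamma> c V"
      and u: "\<forall>k. mild_solution (schroedinger_mult k) V (\<lambda>_. 1) (u k)"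
      and G: "\<forall>k. mild_solution (transport_mult k) V (\<lambda>_. 1) (G k)"
    have c1: "0 < c" "0 \<le> c" "c \<le> 1" "c \<le> \<epsilon> * \<kappa> / (32 * A * T\<^sup>2)" using c by (auto simp: c\<^sub>0_def)
    define W where "W = truncated \<gamma> c V"
    interpret decaying_potential W \<gamma> c A
      unfolding W_def using \<gamma>_bounds c1 assms
      by unfold_locales (auto intro: meas_potential_truncated[OF V] truncated_bound truncated_bound_const)
    let ?d = "\<kappa> + ((2 * c * T)\<^sup>2 + 4 * E) / \<kappa>"
    have E': "step_force \<gamma> c j \<le> E" if "J \<le> j" for j
      using step_force_le[of j \<gamma> c] J1[of j] that J \<gamma>_bounds c1 assms by simp
    have sup: "(SUP t\<in>{0<..}. ennreal (L2_norm (\<lambda>x. u k t x - G k t x)))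
      \<le> ennreal ?d + ennreal (2 / \<kappa>) * (\<Sum>j. step_error W \<gamma> c A (j + J) k)" if k: "k \<in> {-A..A}" for k
      unfolding L2_norm_nrm T_def
    proof (rule deviation_sup_bound[OF _ _ _ _ _ _ _ J(1) E' less_imp_le[OF E] \<kappa>])
      note Su = mild_solution_evol[OF regular_schroedinger_symbol schroedinger_mult_symbol V c1(2) \<gamma>_bounds(2) u[rule_format]]
      note SG = mild_solution_evol[OF regular_transport_symbol transport_mult_symbol V c1(2) \<gamma>_bounds(2) G[rule_format]]
      show "evol (\<lambda>t n. k * phase schroedinger_symbol t n) W (u k) 0 T" for T unfolding W_def by (rule Su(1))
      show "evol (\<lambda>t n. k * phase transport_symbol t n) W (G k) 0 T" for T unfolding W_def by (rule SG(1))
      show "nrm torus (u k t) = 1" if "0 \<le> t" for t by (rule Su(2)[OF that])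
      show "nrm torus (G k t) = 1" if "0 \<le> t" for t by (rule SG(2)[OF that])
      show "fourier_coeff (u k 0) n = (if n = 0 then 1 else 0)" for n by (rule Su(3))
      show "fourier_coeff (G k 0) n = (if n = 0 then 1 else 0)" for n by (rule SG(3))
      show "\<bar>k\<bar> \<le> A" using k by auto
    qed
    \<comment> \<open>The supremum may fail to be measurable in k; monotonicity moves the integral
      to the measurable majorant, on which additivity is then used.\<close>
    have "(\<integral>\<^sup>+ k\<in>{-A..A}. (SUP t\<in>{0<..}. ennreal (L2_norm (\<lambda>x. u k t x - G k t x))) \<partial>lborel)
      \<le> (\<integral>\<^sup>+k\<in>{-A..A}. (ennreal ?d + ennreal (2 / \<kappa>) * (\<Sum>j. step_error W \<gamma> c A (j + J) k)) \<partial>lborel)"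
      by (rule nn_integral_mono) (auto split: split_indicator intro: sup)
    also have "\<dots> \<le> ennreal (2 * A * ?d + 2 / \<kappa> * (error_const \<gamma> A * (\<Sum>j. step_tol \<gamma> (j + J))))"
      by (rule total_error_average[OF J(1)]) (use \<kappa> E in auto)
    also have "\<dots> < ennreal \<epsilon>"
    proof (rule ennreal_lessI[OF \<epsilon>])
      have "c\<^sup>2 \<le> \<epsilon> * \<kappa> / (32 * A * T\<^sup>2)" using mult_left_le[OF c1(3,2)] c1(4) unfolding power2_eq_square by linarith
      then have "c\<^sup>2 * (32 * A * T\<^sup>2) \<le> \<epsilon> * \<kappa>" using T \<open>A > 0\<close> by (simp add: pos_le_divide_eq)
      then have "(2 * A * (2 * c * T)\<^sup>2) * 4 \<le> \<epsilon> * \<kappa>" by (simp add: power_mult_distrib mult_ac)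
      then have 1: "2 * A * (2 * c * T)\<^sup>2 / \<kappa> \<le> \<epsilon> / 4" using \<kappa> by (simp add: pos_divide_le_eq)
      have 2: "2 * A * \<kappa> = \<epsilon> / 4" using \<open>A > 0\<close> by (simp add: \<kappa>_def)
      have 3: "2 * A * (4 * E) / \<kappa> = \<epsilon> / 8" using \<open>A > 0\<close> \<kappa> by (simp add: E_def)
      have "(\<Sum>j. step_tol \<gamma> (j + J)) < \<epsilon> * \<kappa> / (8 * K)" using J2[OF J(3)] by (simp add: abs_if split: if_splits)
      then have "2 / \<kappa> * (K * (\<Sum>j. step_tol \<gamma> (j + J))) < 2 / \<kappa> * (K * (\<epsilon> * \<kappa> / (8 * K)))"
        using \<kappa> K by (intro mult_strict_left_mono) auto
      also have "\<dots> = \<epsilon> / 4" using \<kappa> K by simp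
      finally have 4: "2 / \<kappa> * (K * (\<Sum>j. step_tol \<gamma> (j + J))) < \<epsilon> / 4" .
      have "2 * A * ?d = 2 * A * \<kappa> + 2 * A * (2 * c * T)\<^sup>2 / \<kappa> + 2 * A * (4 * E) / \<kappa>"
        by (simp add: distrib_left add_divide_distrib)
      then show "2 * A * ?d + 2 / \<kappa> * (error_const \<gamma> A * (\<Sum>j. step_tol \<gamma> (j + J))) < \<epsilon>"
        using 1 2 3 4 \<epsilon> unfolding K_def[symmetric] by linarith
    qed
    finally show "(\<integral>\<^sup>+ k\<in>{-A..A}. (SUP t\<in>{0<..}. ennreal (L2_norm (\<lambda>x. u k t x - G k t x))) \<partial>lborel) < ennreal \<epsilon>" .
  qed
qed

end
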